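(* Let $\mathscr{D},\omega,\varphi,V,P_N,D_N,\Omega,X_j$ be as in the context. Let $G$ be a bounded $C^\infty$-smooth function on $\mathbb{C}$, decomposed as $G=G_++G_-+G_0$ where $G_+,G_-,G_0$ are bounded and $C^\infty$-smooth on $\mathbb{C}$, $G_+$ is holomorphic on $\mathbb{C}\setminus\overline{\mathscr{D}}$, $G_-$ is conjugate-holomorphic on $\mathbb{C}\setminus\overline{\mathscr{D}}$, and $G_0$ vanishes along $\partial\mathscr{D}$. Then for any given positive integer $\varkappa$, as $N\to\infty$, $$\int_{\mathscr{D}}G\,|P_N|^2\,\omega\,\mathrm{dA}=G_+(\infty)+G_-(\infty)+D_N^2\sum_{(\nu,j,k)\in I_\varkappa}\frac{1}{N^{\nu+j+k}}\int_0^{2\pi}\big[(-\tfrac r2\partial_r)^{\nu}g_0\big](\mathrm{e}^{\mathrm{i}t})\;\mathbf{W}_{N,\nu,\varkappa}[X_j\overline{X_k}](\mathrm{e}^{\mathrm{i}t})\,\frac{\mathrm{d}t}{2\pi}+\mathrm{O}(N^{-\varkappa-1}),$$ where $g_0=G_0\circ\varphi^{-1}$, $I_\varkappa=\{(\nu,j,k)\in\mathbb{N}^3:\nu\ge1,\ \nu+j+k\le\varkappa\}$, and $$\mathbf{W}_{N,\nu,\varkappa}=\mathbf{R}\sum_{\mu=0}^{\varkappa-\nu}N^{-\mu}\binom{\nu+\mu}{\nu}\big(-\tfrac r2\partial_r-\mathbf{I}\big)^{\mu}\,\mathbf{M}_\Omega .$$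
   Context: $\mathscr{D}\subset\mathbb{C}$ is a bounded Jordan domain with real-analytic boundary, and $\omega\ge 0$ is a continuous weight function on $\mathscr{D}$ such that $\log\omega$ extends to a real-analytic function in a neighborhood of $\partial\mathscr{D}$ (so $\omega$ is defined and strictly positive near $\partial\mathscr{D}$). $\mathbb{N}=\{0,1,2,\ldots\}$, $\mathbb{T}$ is the unit circle, $\mathbb{D}_{\mathrm e}=\{|z|>1\}$, $\mathrm{dA}=\pi^{-1}\mathrm{d}x\,\mathrm{d}y$. $\varphi$ is the conformal mapping of $\mathbb{C}\setminus\overline{\mathscr{D}}$ onto $\mathbb{D}_{\mathrm e}$ with $\varphi(\infty)=\infty$ and $\varphi'(\infty)>0$; it extends to a univalent holomorphic function in a neighborhood of $\mathbb{C}\setminus\mathscr{D}$. $V$ is the Szegő function of $\omega$ relative to $\mathscr{D}$: the unique bounded holomorphic function on $\mathbb{C}\setminus\overline{\mathscr{D}}$ (including at $\infty$) with $2\,\mathrm{Re}\,V=-\log\omega$ on $\partial\mathscr{D}$ and $V(\infty)\in\mathbb{R}$; it extends holomorphically across $\partial\mathscr{D}$. $P_N$ is the normalized orthogonal polynomial of degree $N$ for $L^2(\mathscr{D},\omega\,\mathrm{dA})$: it has degree $N$, positive leading coefficient $\kappa_N$, unit norm, and is orthogonal to all polynomials of degree $\le N-1$. $C_N=(\varphi'(\infty))^{-N-1}\mathrm{e}^{-V(\infty)}$, and $D_N>0$ is defined by $\kappa_N=N^{\frac12}C_N^{-1}D_N$. The modified weight is $\Omega=\mathrm{e}^{2\mathrm{Re}\,V\circ\varphi^{-1}}\,\omega\circ\varphi^{-1}$,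 real-analytic and positive near $\mathbb{T}$ with $\Omega|_{\mathbb{T}}=1$. $\mathbf{M}_\Omega$ is multiplication by $\Omega$, $\mathbf{I}$ the identity, $\mathbf{R}$ restriction to $\mathbb{T}$; $r\partial_r$ is the radial derivative in polar coordinates $z=r\mathrm{e}^{\mathrm{i}t}$. For $f$ real-analytic near $\mathbb{T}$, $\mathbf{T}f=\Omega^{-1}(z\partial_z+\mathbf{I})(f\Omega)$ with $\partial_z=\frac12(\partial_x-\mathrm{i}\partial_y)$. $\mathbf{P}$ is the orthogonal projection of $L^2(\mathbb{T})$ onto the space $H^2_{-,0}$ of functions with Fourier coefficients supported on $n\le-1$, and $\mathbf{Q}=\mathbf{P}\mathbf{R}$, where for $f$ real-analytic near $\mathbb{T}$, $\mathbf{Q}f$ is regarded as a holomorphic function in a neighborhood of $\overline{\mathbb{D}}_{\mathrm e}$. The functions $X_j$ are $X_0\equiv1$ and $X_j=\mathbf{Q}\mathbf{T}[(\mathbf{Q}-\mathbf{I})\mathbf{T}]^{j-1}X_0$ for $j\ge1$. *)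

theory Defs
  imports "HOL-Complex_Analysis.Complex_Analysis" "HOL-Library.Landau_Symbols"
begin

definition real_analytic_at :: "(real \<Rightarrow> 'b::real_normed_vector) \<Rightarrow> real \<Rightarrow> bool" where
  "real_analytic_at c t0 \<longleftrightarrow>
     (\<exists>a. \<exists>\<rho>>0. \<forall>t. \<bar>t - t0\<bar> < \<rho> \<longrightarrow> (\<lambda>n. (t - t0) ^ n *\<^sub>R a n) sums c t)"

definition real_analytic2_at :: "(complex \<Rightarrow> 'b::real_normed_vector) \<Rightarrow> complex \<Rightarrow> bool" where
  "real_analytic2_at f z0 \<longleftrightarrow>
     (\<exists>a. \<exists>\<rho>>0. \<forall>z. \<bar>Re (z - z0)\<bar> < \<rho> \<and> \<bar>Im (z - z0)\<bar> < \<rho> \<longrightarrow>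
        ((\<lambda>(m, n). (Re (z - z0) ^ m * Im (z - z0) ^ n) *\<^sub>R a m n) has_sum f z) UNIV)"

primrec times_differentiable ::
  "nat \<Rightarrow> ('a::real_normed_vector \<Rightarrow> 'b::real_normed_vector) \<Rightarrow> bool" where
  "times_differentiable 0 f \<longleftrightarrow> continuous_on UNIV f"
| "times_differentiable (Suc k) f \<longleftrightarrow>
     (\<forall>x. f differentiable (at x)) \<and>
     (\<forall>v. times_differentiable k (\<lambda>x. frechet_derivative f (at x) v))"

definition smooth_fun :: "('a::real_normed_vector \<Rightarrow> 'b::real_normed_vector) \<Rightarrow> bool" where
  "smooth_fun f \<longleftrightarrow> (\<forall>k. times_differentiable k f)"

definition analytic_jordan_domain :: "complex set \<Rightarrow> bool" where
  "analytic_jordan_domain D \<longleftrightarrow>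
     (\<exists>c :: real \<Rightarrow> complex.
        (\<forall>t. real_analytic_at c t) \<and>
        (\<forall>t. vector_derivative c (at t) \<noteq> 0) \<and>
        (\<forall>t. c (t + 2 * pi) = c t) \<and> inj_on c {0..<2 * pi} \<and>
        D = inside (range c))"

text \<open>
  The total function \<open>\<omega>\<close> stands for the weight on \<open>D\<close> together with its extension to a
  neighbourhood of the boundary; its values elsewhere are irrelevant.
\<close>
definition admissible_weight :: "complex set \<Rightarrow> (complex \<Rightarrow> real) \<Rightarrow> bool" where
  "admissible_weight D \<omega> \<longleftrightarrow>
     (\<forall>z\<in>D. 0 \<le> \<omega> z) \<and> continuous_on D \<omega> \<and>
     (\<exists>U. open U \<and> frontier D \<subseteq> U \<and>
        (\<forall>z\<in>U. 0 < \<omega> z \<and> real_analytic2_at (\<lambda>w. ln (\<omega> w)) z))"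

text \<open>
  The map \<open>\<phi>\<close> is already the univalent extension to an open set \<open>W\<close> containing the complement
  of \<open>D\<close>; recording \<open>W\<close> makes the inverse \<open>the_inv_into W \<phi>\<close> available on both sides of the
  unit circle.
\<close>
definition exterior_conformal_map ::
  "complex set \<Rightarrow> complex set \<Rightarrow> (complex \<Rightarrow> complex) \<Rightarrow> bool" where
  "exterior_conformal_map D W \<phi> \<longleftrightarrow>
     open W \<and> - D \<subseteq> W \<and> \<phi> holomorphic_on W \<and> inj_on \<phi> W \<and>
     \<phi> ` (- closure D) = {z. 1 < norm z} \<and>
     filterlim \<phi> at_infinity at_infinity \<and>
     (\<exists>c>0. ((\<lambda>z. \<phi> z / z) \<longlongrightarrow> complex_of_real c) at_infinity)"

definition deriv_at_infinity :: "(complex \<Rightarrow> complex) \<Rightarrow> real" where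
  "deriv_at_infinity \<phi> = Re (Lim at_infinity (\<lambda>z. \<phi> z / z))"

text \<open>
  Analyticity on the closed set \<open>- D\<close> means holomorphy on an open neighbourhood of it, so that
  \<open>V\<close> includes its extension across the boundary.
\<close>
definition szego_function ::
  "complex set \<Rightarrow> (complex \<Rightarrow> real) \<Rightarrow> (complex \<Rightarrow> complex) \<Rightarrow> bool" where
  "szego_function D \<omega> V \<longleftrightarrow>
     V analytic_on (- D) \<and> bounded (V ` (- closure D)) \<and>
     (\<forall>z\<in>frontier D. 2 * Re (V z) = - ln (\<omega> z)) \<and>
     (\<exists>v::real. (V \<longlongrightarrow> complex_of_real v) at_infinity)"

definition area_integral :: "complex set \<Rightarrow> (complex \<Rightarrow> complex) \<Rightarrow> complex" where
  "area_integral S f = (LINT z:S|lborel. f z) / complex_of_real pi"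

definition normalized_orthogonal_poly ::
  "complex set \<Rightarrow> (complex \<Rightarrow> real) \<Rightarrow> nat \<Rightarrow> complex poly \<Rightarrow> bool" where
  "normalized_orthogonal_poly D \<omega> N p \<longleftrightarrow>
     degree p = N \<and>
     (\<exists>c>0. lead_coeff p = complex_of_real c) \<and>
     area_integral D (\<lambda>z. complex_of_real ((norm (poly p z))\<^sup>2 * \<omega> z)) = 1 \<and>
     (\<forall>q. degree q < N \<longrightarrow>
        area_integral D (\<lambda>z. poly p z * cnj (poly q z) * complex_of_real (\<omega> z)) = 0)"

definition C_const :: "(complex \<Rightarrow> complex) \<Rightarrow> (complex \<Rightarrow> complex) \<Rightarrow> nat \<Rightarrow> real" where
  "C_const \<phi> V N = exp (- Re (Lim at_infinity V)) / deriv_at_infinity \<phi> ^ (N + 1)"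

text \<open>
  The defining relation is \<open>c = N\<^bsup>1/2\<^esup> C\<^sub>N\<inverse> D\<^sub>N\<close>, solved here for \<open>D\<^sub>N\<close>, with \<open>c\<close> the (positive)
  leading coefficient of \<open>p\<close>.
\<close>
definition D_const ::
  "(complex \<Rightarrow> complex) \<Rightarrow> (complex \<Rightarrow> complex) \<Rightarrow> nat \<Rightarrow> complex poly \<Rightarrow> real" where
  "D_const \<phi> V N p = Re (lead_coeff p) * C_const \<phi> V N / sqrt (real N)"

text \<open>
  Elements of \<open>L\<^sup>2\<close> of the circle are represented by functions on the plane, of which only the
  values on the circle matter.
\<close>
definition circle_mean :: "(complex \<Rightarrow> complex) \<Rightarrow> complex" where
  "circle_mean f = (LINT t:{0..2 * pi}|lborel. f (cis t)) / complex_of_real (2 * pi)"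

definition circle_inner :: "(complex \<Rightarrow> complex) \<Rightarrow> (complex \<Rightarrow> complex) \<Rightarrow> complex" where
  "circle_inner f g = circle_mean (\<lambda>z. f z * cnj (g z))"

definition L2_circle :: "(complex \<Rightarrow> complex) set" where
  "L2_circle = {f. (\<lambda>t. f (cis t)) \<in> borel_measurable lborel \<and>
                   set_integrable lborel {0..2 * pi} (\<lambda>t. (norm (f (cis t)))\<^sup>2)}"

definition fourier_coeff :: "(complex \<Rightarrow> complex) \<Rightarrow> int \<Rightarrow> complex" where
  "fourier_coeff f n = circle_inner f (\<lambda>z. z powi n)"

definition H2_minus0 :: "(complex \<Rightarrow> complex) set" where
  "H2_minus0 = {f \<in> L2_circle. \<forall>n\<ge>0. fourier_coeff f n = 0}"

definition is_orthogonal_projection_H2_minus0 ::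
  "(complex \<Rightarrow> complex) \<Rightarrow> (complex \<Rightarrow> complex) \<Rightarrow> bool" where
  "is_orthogonal_projection_H2_minus0 f h \<longleftrightarrow>
     h \<in> H2_minus0 \<and> (\<forall>k\<in>H2_minus0. circle_inner (\<lambda>z. f z - h z) k = 0)"

text \<open>
  For \<open>f\<close> real-analytic near the circle the projection of its restriction has a representative
  \<open>h\<close> holomorphic in a neighbourhood of the closed exterior disk.  Any two choices agree on the
  circle, hence on a neighbourhood of the closed exterior disk, so the choice operator is
  harmless: all uses of \<open>Q_op f\<close> below depend only on its values near the circle.
\<close>
definition Q_op :: "(complex \<Rightarrow> complex) \<Rightarrow> (complex \<Rightarrow> complex)" where
  "Q_op f = (SOME h. h analytic_on {z. 1 \<le> norm z} \<and> is_orthogonal_projection_H2_minus0 f h)"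

definition wirtinger_dz :: "(complex \<Rightarrow> complex) \<Rightarrow> (complex \<Rightarrow> complex)" where
  "wirtinger_dz f z =
     (frechet_derivative f (at z) 1 - \<i> * frechet_derivative f (at z) \<i>) / 2"

text \<open>The operator \<open>r\<partial>\<^sub>r\<close>; for \<open>z = r e\<^bsup>it\<^esup>\<close> with \<open>r > 0\<close>, \<open>sgn z = e\<^bsup>it\<^esup>\<close>.\<close>
definition r_dr :: "(complex \<Rightarrow> complex) \<Rightarrow> (complex \<Rightarrow> complex)" where
  "r_dr f z = complex_of_real (norm z) *
     vector_derivative (\<lambda>r. f (complex_of_real r * sgn z)) (at (norm z))"

text \<open>\<open>\<psi>\<close> is the inverse of the exterior map.\<close>
definition modified_weight ::
  "(complex \<Rightarrow> real) \<Rightarrow> (complex \<Rightarrow> complex) \<Rightarrow> (complex \<Rightarrow> complex) \<Rightarrow> (complex \<Rightarrow> complex)" where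
  "modified_weight \<omega> V \<psi> z = complex_of_real (exp (2 * Re (V (\<psi> z))) * \<omega> (\<psi> z))"

definition T_op :: "(complex \<Rightarrow> complex) \<Rightarrow> (complex \<Rightarrow> complex) \<Rightarrow> (complex \<Rightarrow> complex)" where
  "T_op \<Omega> f z =
     (z * wirtinger_dz (\<lambda>w. f w * \<Omega> w) z + f z * \<Omega> z) / \<Omega> z"

definition X_fun :: "(complex \<Rightarrow> complex) \<Rightarrow> nat \<Rightarrow> (complex \<Rightarrow> complex)" where
  "X_fun \<Omega> j =
     (if j = 0 then (\<lambda>_. 1)
      else Q_op (T_op \<Omega>
             (((\<lambda>f z. Q_op (T_op \<Omega> f) z - T_op \<Omega> f z) ^^ (j - 1)) (\<lambda>_. 1))))"

text \<open>The final restriction to the circle is left to the points at which the result is evaluated.\<close>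
definition W_op ::
  "(complex \<Rightarrow> complex) \<Rightarrow> nat \<Rightarrow> nat \<Rightarrow> nat \<Rightarrow> (complex \<Rightarrow> complex) \<Rightarrow> (complex \<Rightarrow> complex)" where
  "W_op \<Omega> N \<nu> \<kappa> f z =
     (\<Sum>\<mu> = 0..\<kappa> - \<nu>. of_nat ((\<nu> + \<mu>) choose \<nu>) / of_nat N ^ \<mu> *
        ((\<lambda>h w. - (1/2) * r_dr h w - h w) ^^ \<mu>) (\<lambda>w. \<Omega> w * f w) z)"

definition I_set :: "nat \<Rightarrow> (nat \<times> nat \<times> nat) set" where
  "I_set \<kappa> = {(\<nu>, j, k). 1 \<le> \<nu> \<and> \<nu> + j + k \<le> \<kappa>}"

end

theory Submission
  imports Defs
begin

text \<open>
  In the coordinate \<open>\<zeta> = \<phi>(z)\<close> the inner product of \<open>L\<^sup>2(D, \<omega> dA)\<close> becomes, up to the part of \<open>D\<close> away from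
  the boundary, \<open>R f = N \<integral> |\<zeta>|\<^bsup>2N\<^esup> f dA\<close> over a thin ring inside the unit circle, applied to functions
  weighted by \<open>\<Omega>\<close>. Put \<open>Z\<^sub>j = [(Q - I) T]\<^bsup>j\<^esup> 1\<close> and \<open>Y = \<Sum> N\<^bsup>-j\<^esup> X\<^sub>j\<close>, \<open>j \<le> \<kappa>\<close>. Since \<open>X\<^sub>j\<^sub>+\<^sub>1 = Z\<^sub>j\<^sub>+\<^sub>1 + T Z\<^sub>j\<close> and
  the \<open>Z\<^sub>j\<close> are orthogonal to \<open>H\<^sup>2\<^sub>-\<^sub>,\<^sub>0\<close> on the circle, one radial integration by parts shows that \<open>Y\<close> is
  orthogonal under \<open>R\<close>, up to \<open>O(N\<^bsup>-\<kappa>-1\<^esup>)\<close>, to all functions holomorphic outside the ring that vanish at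
  infinity. The polynomial part at infinity of \<open>N\<^bsup>1/2\<^esup> \<phi>' \<phi>\<^bsup>N\<^esup> e\<^bsup>V\<^esup> Y(\<phi>)\<close> differs from this function by an
  exponentially small amount (Cauchy's formula on a smaller circle, and the maximum principle further
  inside), so \<open>P\<^sub>N\<close> is \<open>D\<^sub>N\<close> times it up to an error of relative order \<open>N\<^bsup>-\<kappa>-1\<^esup>\<close> in norm.

  Hence the integral equals \<open>D\<^sub>N\<^sup>2 R[g |Y|\<^sup>2 \<Omega>]\<close> up to \<open>O(N\<^bsup>-\<kappa>-1\<^esup>)\<close>. The same integration by parts disposes of
  \<open>g\<^sub>\<plusminus> - g\<^sub>\<plusminus>(\<infinity>)\<close>, because the antiholomorphic derivative of \<open>g\<^sub>+\<close> is flat along the circle; the case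
  \<open>G = 1\<close> gives \<open>D\<^sub>N\<^sup>2 R[|Y|\<^sup>2 \<Omega>] = 1 + O(N\<^bsup>-\<kappa>-1\<^esup>)\<close>; and Laplace's method, iterated integration by parts in
  the radius, gives the sum for \<open>g\<^sub>0\<close>.
\<close>

section \<open>Circles, annuli and boundary values\<close>

text \<open>What can be controlled, and where, shapes the argument. The annulus on which
  \<open>X_fun\<close> is known to be holomorphic shrinks with \<open>j\<close>, so
  \<open>\<kappa>\<close> is fixed throughout and a single annulus serves the finitely many
  functions involved. The test functions in the orthogonality estimate are arbitrary: only their
  norm over the ring is available, not their values on its inner circle, where integration by parts
  leaves a boundary term. That term is removed by a radial factor equal to zero on the inner circle
  and constant on the unit circle, tuned so that its derivative cancels against the growth of the
  weight. The functions \<open>G_+\<close> and \<open>G_-\<close> cause another difficulty: on the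
  ring itself they are merely smooth. Their defect from holomorphy vanishes identically outside the
  disk, hence to every order on the circle, and the weight concentrates at the circle on the scale
  \<open>1 / N\<close>. Finally nothing is known about \<open>D_N\<close> beforehand; it is bounded
  by comparing norms, and it is never expanded: the unit norm of \<open>P_N\<close> evaluates the
  only combination in which it has to be eliminated.\<close>

definition annulus :: "real \<Rightarrow> complex set" where
  "annulus \<rho> = {z. \<rho> < norm z \<and> norm z < 1 / \<rho>}"

lemma open_norm_gt: "open {z::complex. a < norm z}"
  by (intro open_Collect_less continuous_intros)

lemma open_annulus: "open (annulus \<rho>)"
proof -
  have "annulus \<rho> = {z. \<rho> < norm z} \<inter> {z. norm z < 1 / \<rho>}" by (auto simp: annulus_def)
  thus ?thesis by (simp add: open_norm_gt open_Collect_less continuous_on_norm_id open_Int)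
qed

lemma annulus_mono: "0 < \<rho> \<Longrightarrow> \<rho> \<le> \<rho>' \<Longrightarrow> annulus \<rho>' \<subseteq> annulus \<rho>"
proof
  fix z assume "0 < \<rho>" "\<rho> \<le> \<rho>'" "z \<in> annulus \<rho>'"
  moreover have "1 / \<rho>' \<le> 1 / \<rho>" using calculation by (simp add: frac_le)
  ultimately show "z \<in> annulus \<rho>" by (auto simp: annulus_def)
qed

lemma sphere_subset_annulus: "0 < \<rho> \<Longrightarrow> \<rho> < 1 \<Longrightarrow> sphere 0 1 \<subseteq> annulus \<rho>"
  by (auto simp: annulus_def)

lemma annulus_nonzero: "0 < \<rho> \<Longrightarrow> z \<in> annulus \<rho> \<Longrightarrow> z \<noteq> 0"
  by (auto simp: annulus_def)

lemma open_contains_annulus: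
  assumes "open S" "sphere 0 1 \<subseteq> S"
  obtains \<rho> where "0 < \<rho>" "\<rho> < 1" "annulus \<rho> \<subseteq> S"
proof -
  obtain e where e: "e > 0" "(\<Union>x\<in>sphere 0 1. cball x e) \<subseteq> S"
    using compact_subset_open_imp_cball_epsilon_subset[of "sphere 0 1 :: complex set" S] assms by auto
  \<comment> \<open>This makes the outer radius \<open>1 / \<rho>\<close> exactly
    \<open>1 + e\<close>, while \<open>1 - \<rho> \<le> e\<close> on the inner side.\<close>
  define \<rho> where "\<rho> = 1 / (1 + e)"
  have \<rho>: "0 < \<rho>" "\<rho> < 1" "1 / \<rho> = 1 + e" "1 - \<rho> \<le> e"
    using e(1) by (auto simp: \<rho>_def field_simps)
  have "annulus \<rho> \<subseteq> S"
  proof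
    fix z assume z: "z \<in> annulus \<rho>"
    hence z0: "z \<noteq> 0" using \<rho> by (auto simp: annulus_def)
    have "dist (sgn z) z = norm (sgn z - of_real (norm z) * sgn z)"
      using z0 by (simp add: dist_norm sgn_div_norm scaleR_conv_of_real mult.assoc[symmetric])
    also have "\<dots> = norm (of_real (1 - norm z) * sgn z)" by (simp add: algebra_simps)
    also have "\<dots> = \<bar>1 - norm z\<bar>" using z0 by (simp only: norm_mult norm_sgn norm_of_real) simp
    also have "\<dots> \<le> e" using z \<rho> by (auto simp: annulus_def)
    finally have "z \<in> cball (sgn z) e" by simp
    moreover have "sgn z \<in> sphere 0 1" using z0 by (simp add: norm_sgn)
    ultimately show "z \<in> S" using e(2) by blast
  qed
  with \<rho> that show thesis by blast
qed

lemma open_contains_exterior: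
  assumes "open S" "{z::complex. 1 \<le> norm z} \<subseteq> S"
  obtains \<rho> where "0 < \<rho>" "\<rho> < 1" "{z. \<rho> < norm z} \<subseteq> S"
proof -
  have "sphere 0 1 \<subseteq> S" using assms(2) by auto
  then obtain \<rho> where \<rho>: "0 < \<rho>" "\<rho> < 1" "annulus \<rho> \<subseteq> S"
    using open_contains_annulus assms(1) by blast
  have "1 < 1 / \<rho>" using \<rho> by simp
  hence "{z. \<rho> < norm z} \<subseteq> annulus \<rho> \<union> {z. 1 \<le> norm z}"
    by (auto simp: annulus_def)
  with \<rho> assms that show thesis by blast
qed

lemma circle_mean_eq_integral:
  assumes "continuous_on (sphere 0 1) f"
  shows "circle_mean f = integral {0..2 * pi} (\<lambda>t. f (cis t)) / complex_of_real (2 * pi)"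
proof -
  have "continuous_on {0..2 * pi} (\<lambda>t. f (cis t))"
    by (rule continuous_on_compose2[OF assms]) (auto intro!: continuous_intros)
  hence "set_integrable lborel {0..2 * pi} (\<lambda>t. f (cis t))"
    by (rule borel_integrable_atLeastAtMost')
  thus ?thesis unfolding circle_mean_def by (simp add: set_borel_integral_eq_integral)
qed

lemma continuous_on_cis_comp:
  assumes "continuous_on (sphere 0 1) f"
  shows "continuous_on S (\<lambda>t. f (cis t))"
  by (rule continuous_on_compose2[OF assms]) (auto intro!: continuous_intros)

lemma circle_mean_cong:
  assumes "\<And>z. norm z = 1 \<Longrightarrow> f z = g z"
  shows "circle_mean f = circle_mean g"
  unfolding circle_mean_def using assms by simp

lemma circle_mean_bound:
  assumes "continuous_on (sphere 0 1) f" "\<And>z. norm z = 1 \<Longrightarrow> norm (f z) \<le> B"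
  shows "norm (circle_mean f) \<le> B"
proof -
  have "norm (integral {0..2 * pi} (\<lambda>t. f (cis t))) \<le> B * (2 * pi - 0)"
    by (rule integral_bound) (use assms continuous_on_cis_comp in auto)
  thus ?thesis by (simp add: circle_mean_eq_integral[OF assms(1)] norm_divide field_simps)
qed

lemma circle_mean_const [simp]: "circle_mean (\<lambda>_. c) = c"
  by (subst circle_mean_eq_integral) (auto intro!: continuous_intros simp: scaleR_conv_of_real)

lemma circle_mean_add:
  assumes "continuous_on (sphere 0 1) f" "continuous_on (sphere 0 1) g"
  shows "circle_mean (\<lambda>z. f z + g z) = circle_mean f + circle_mean g"
  using assms
  by (simp add: circle_mean_eq_integral continuous_on_add add_divide_distrib
        Henstock_Kurzweil_Integration.integral_add integrable_continuous_real continuous_on_cis_comp)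

lemma circle_mean_cmult: "circle_mean (\<lambda>z. c * f z) = c * circle_mean f"
  unfolding circle_mean_def by simp

lemma circle_mean_sum:
  assumes "\<And>i. i \<in> I \<Longrightarrow> continuous_on (sphere 0 1) (f i)"
  shows "circle_mean (\<lambda>z. \<Sum>i\<in>I. f i z) = (\<Sum>i\<in>I. circle_mean (f i))"
proof (cases "finite I")
  case True thus ?thesis using assms
  proof (induction I rule: finite_induct)
    case (insert i I)
    thus ?case by (simp add: circle_mean_add continuous_on_sum)
  qed simp
qed simp

lemma circle_mean_cnj: "circle_mean (\<lambda>z. cnj (f z)) = cnj (circle_mean f)"
proof -
  have "(LINT t:{0..2 * pi}|lborel. cnj (f (cis t))) = cnj (LINT t:{0..2 * pi}|lborel. f (cis t))"
    unfolding set_lebesgue_integral_def by (subst Bochner_Integration.integral_cnj [symmetric]) simp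
  thus ?thesis unfolding circle_mean_def by simp
qed

section \<open>Cauchy integrals over circles and the projection onto the Hardy space\<close>

lemma contour_integral_circlepath_mean:
  assumes "r > 0" "continuous_on (sphere 0 r) f"
  shows "contour_integral (circlepath 0 r) f
           = 2 * pi * \<i> * circle_mean (\<lambda>z. of_real r * z * f (of_real r * z))"
proof -
  define g where "g = (\<lambda>z. of_real r * z * f (of_real r * z))"
  have c: "continuous_on (sphere 0 1) g" unfolding g_def
    by (intro continuous_intros continuous_on_compose2[OF assms(2)]) (use assms(1) in \<open>auto simp: norm_mult\<close>)
  have "((\<lambda>t. g (cis t)) has_integral integral {0..2*pi} (\<lambda>t. g (cis t))) {0..2*pi}"
    by (intro integrable_integral integrable_continuous_real continuous_on_cis_comp c)
  from has_integral_mult_right[OF this, of \<i>]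
  have "((\<lambda>t. f (0 + r * cis t) * r * \<i> * cis t) has_integral
           \<i> * integral {0..2*pi} (\<lambda>t. g (cis t))) {0..2*pi}"
    by (simp add: g_def mult_ac)
  hence "(f has_contour_integral \<i> * integral {0..2*pi} (\<lambda>t. g (cis t))) (part_circlepath 0 r 0 (2*pi))"
    by (subst has_contour_integral_part_circlepath_iff) auto
  hence "contour_integral (circlepath 0 r) f = \<i> * integral {0..2*pi} (\<lambda>t. g (cis t))"
    unfolding circlepath_def by (rule contour_integral_unique)
  also have "integral {0..2*pi} (\<lambda>t. g (cis t)) = 2 * pi * circle_mean g"
    by (simp add: circle_mean_eq_integral[OF c])
  finally show ?thesis by (simp add: g_def mult_ac)
qed

text \<open>The straight-line homotopy between the two circles moves every point along its own ray,
  so it never leaves the annulus.\<close>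

lemma contour_integral_circlepath_radius:
  assumes f: "f holomorphic_on {w. a < norm w \<and> norm w < b}"
    and r: "0 \<le> a" "a < r" "r \<le> R" "R < b"
  shows "contour_integral (circlepath 0 r) f = contour_integral (circlepath 0 R) f"
proof (rule Cauchy_theorem_homotopic_loops[of "{w. a < norm w \<and> norm w < b}"])
  show "homotopic_loops {w. a < norm w \<and> norm w < b} (circlepath 0 r) (circlepath 0 R)"
  proof (rule homotopic_loops_linear)
    fix t x :: real assume "t \<in> {0..1}"
    show "closed_segment (circlepath 0 r t) (circlepath 0 R t) \<subseteq> {w. a < norm w \<and> norm w < b}"
    proof
      fix w assume "w \<in> closed_segment (circlepath 0 r t) (circlepath 0 R t)"
      then obtain u where u: "0 \<le> u" "u \<le> 1"
        and w: "w = (1 - u) *\<^sub>R circlepath 0 r t + u *\<^sub>R circlepath 0 R t"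
        by (auto simp: closed_segment_def)
      have "w = of_real ((1 - u) * r + u * R) * exp (2 * of_real pi * \<i> * of_real t)"
        unfolding w circlepath by (simp add: scaleR_conv_of_real algebra_simps)
      moreover have "2 * of_real pi * \<i> * of_real t = \<i> * complex_of_real (2 * pi * t)" by simp
      ultimately have nw: "norm w = \<bar>(1 - u) * r + u * R\<bar>"
        by (metis norm_exp_i_times norm_mult norm_of_real mult.right_neutral)
      have e: "(1 - u) * r + u * R = r + u * (R - r)" by (simp add: algebra_simps)
      have "0 \<le> u * (R - r)" "u * (R - r) \<le> 1 * (R - r)" using u r by (auto intro!: mult_right_mono mult_left_le_one_le)
      thus "w \<in> {w. a < norm w \<and> norm w < b}" using nw e r by auto
    qed
  qed auto
  show "open {w::complex. a < norm w \<and> norm w < b}"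
    by (intro open_Collect_conj open_Collect_less continuous_intros)
qed (use f in auto)

text \<open>The difference quotient of \<open>f\<close> at \<open>z\<close> extends holomorphically
  across \<open>z\<close>, so its integrals over both circles agree. Splitting it into
  \<open>f w / (w - z)\<close> and \<open>f z / (w - z)\<close>, the second part is decided by the
  winding numbers: 1 for the outer circle, 0 for the inner one.\<close>

lemma annulus_Cauchy_formula:
  assumes f: "f holomorphic_on {w. a < norm w \<and> norm w < b}"
    and r: "0 \<le> a" "a < r" "r < norm z" "norm z < R" "R < b"
  shows "2 * pi * \<i> * f z = contour_integral (circlepath 0 R) (\<lambda>w. f w / (w - z))
                            - contour_integral (circlepath 0 r) (\<lambda>w. f w / (w - z))"
proof -
  let ?A = "{w. a < norm w \<and> norm w < b}"
  define g where "g = (\<lambda>w. if w = z then deriv f z else (f w - f z) / (w - z))"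
  have op: "open ?A" by (intro open_Collect_conj open_Collect_less continuous_intros)
  have g: "g holomorphic_on ?A" unfolding g_def by (rule pole_lemma_open[OF f op])
  have eq: "contour_integral (circlepath 0 r) g = contour_integral (circlepath 0 R) g"
    by (rule contour_integral_circlepath_radius[OF g]) (use r in auto)
  have *: "contour_integral (circlepath 0 s) (\<lambda>w. f w / (w - z))
            = contour_integral (circlepath 0 s) g + 2 * pi * \<i> * winding_number (circlepath 0 s) z * f z"
    if s: "a < s" "s < b" "s \<noteq> norm z" for s
  proof -
    have s0: "s > 0" using s r by auto
    have cf: "continuous_on (sphere 0 s) f"
      by (rule holomorphic_on_imp_continuous_on[OF holomorphic_on_subset[OF f]]) (use s in auto)
    have zi: "z \<notin> path_image (circlepath 0 s)" using s s0 by auto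
    have 1: "((\<lambda>w. 1 / (w - z)) has_contour_integral 2 * pi * \<i> * winding_number (circlepath 0 s) z) (circlepath 0 s)"
      by (rule has_contour_integral_winding_number) (use zi in auto)
    have 2: "(\<lambda>w. f w / (w - z)) contour_integrable_on circlepath 0 s"
      by (rule contour_integrable_continuous_circlepath)
         (use s s0 zi in \<open>auto intro!: continuous_intros cf\<close>)
    have "((\<lambda>w. f w / (w - z) - f z * (1 / (w - z))) has_contour_integral
            contour_integral (circlepath 0 s) (\<lambda>w. f w / (w - z)) - f z * (2 * pi * \<i> * winding_number (circlepath 0 s) z)) (circlepath 0 s)"
      by (intro has_contour_integral_diff has_contour_integral_lmul has_contour_integral_integral 1 2)
    hence "(g has_contour_integral
            contour_integral (circlepath 0 s) (\<lambda>w. f w / (w - z)) - f z * (2 * pi * \<i> * winding_number (circlepath 0 s) z)) (circlepath 0 s)"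
      by (rule has_contour_integral_eq) (use zi in \<open>auto simp: g_def diff_divide_distrib\<close>)
    from contour_integral_unique[OF this] show ?thesis by (simp add: algebra_simps)
  qed
  have "winding_number (circlepath 0 R) z = 1" by (rule winding_number_circlepath) (use r in auto)
  moreover have "winding_number (circlepath 0 r) z = 0"
    by (rule winding_number_zero_outside[of _ "cball 0 r"]) (use r in auto)
  ultimately show ?thesis using *[of r] *[of R] eq r by auto
qed

lemma continuous_on_sphere_bounded:
  assumes "continuous_on (sphere 0 r) (g :: complex \<Rightarrow> complex)"
  obtains B where "B \<ge> 0" "\<And>w. norm w = r \<Longrightarrow> norm (g w) \<le> B"
proof -
  have "bounded (g ` sphere 0 r)"
    by (intro compact_imp_bounded compact_continuous_image assms compact_sphere)
  then obtain B where "B > 0" "\<forall>w\<in>sphere 0 r. norm (g w) \<le> B" unfolding bounded_pos by blast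
  thus thesis using that[of B] by auto
qed

text \<open>Expand \<open>1 / (w - z)\<close> in powers of \<open>z / w\<close>. On the circle the
  modulus of this ratio is the constant \<open>norm z / r\<close>, so the geometric series converges
  uniformly and is integrated term by term.\<close>

lemma Cauchy_integral_sums:
  assumes f: "continuous_on (sphere 0 r) f" and r: "norm z < r"
  shows "(\<lambda>n. z ^ n * contour_integral (circlepath 0 r) (\<lambda>w. f w / w ^ Suc n)) sums
            contour_integral (circlepath 0 r) (\<lambda>w. f w / (w - z))"
proof -
  have r0: "r > 0" using r le_less_trans norm_ge_zero by blast
  obtain B where B0: "B \<ge> 0" and B: "\<And>w. norm w = r \<Longrightarrow> norm (f w) \<le> B"
    using continuous_on_sphere_bounded[OF f] by blast
  have ci: "(\<lambda>w. f w / w ^ Suc n) contour_integrable_on circlepath 0 r" for n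
    by (rule contour_integrable_continuous_circlepath)
       (use r0 in \<open>auto intro!: continuous_intros f\<close>)
  have ul: "uniform_limit (sphere 0 r) (\<lambda>N w. \<Sum>n<N. z ^ n * (f w / w ^ Suc n))
               (\<lambda>w. \<Sum>n. z ^ n * (f w / w ^ Suc n)) sequentially"
  proof (rule Weierstrass_m_test)
    show "norm (z ^ n * (f w / w ^ Suc n)) \<le> B / r * (norm z / r) ^ n" if "w \<in> sphere 0 r" for n w
    proof -
      have "norm (z ^ n * (f w / w ^ Suc n)) = norm (f w) / r * (norm z / r) ^ n"
        using that by (simp add: norm_mult norm_divide norm_power power_divide)
      also have "\<dots> \<le> B / r * (norm z / r) ^ n"
        using B that r0 by (intro mult_right_mono divide_right_mono) auto
      finally show ?thesis .
    qed
    show "summable (\<lambda>n. B / r * (norm z / r) ^ n)"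
      using r r0 by (intro summable_mult summable_geometric) auto
  qed
  have s: "(\<Sum>n. z ^ n * (f w / w ^ Suc n)) = f w / (w - z)" if w: "norm w = r" for w
  proof -
    have wz: "w \<noteq> 0" "w \<noteq> z" using r w r0 by auto
    have "norm (z / w) < 1" using r w r0 by (simp add: norm_divide)
    from sums_mult[OF geometric_sums[OF this], of "f w / w"]
    have "(\<lambda>n. z ^ n * (f w / w ^ Suc n)) sums (f w / w * (1 / (1 - z / w)))"
      by (simp add: power_divide mult_ac)
    also have "f w / w * (1 / (1 - z / w)) = f w / (w - z)" using wz by (simp add: field_simps)
    finally show ?thesis by (rule sums_unique[symmetric])
  qed
  have "(\<lambda>N. contour_integral (circlepath 0 r) (\<lambda>w. \<Sum>n<N. z ^ n * (f w / w ^ Suc n)))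
          \<longlonglongrightarrow> contour_integral (circlepath 0 r) (\<lambda>w. \<Sum>n. z ^ n * (f w / w ^ Suc n))"
    by (rule contour_integral_uniform_limit_circlepath(2)[OF _ ul])
       (use r0 in \<open>auto simp del: power_Suc times_divide_eq_right intro!: always_eventually contour_integrable_sum contour_integrable_lmul ci\<close>)
  also have "contour_integral (circlepath 0 r) (\<lambda>w. \<Sum>n. z ^ n * (f w / w ^ Suc n))
      = contour_integral (circlepath 0 r) (\<lambda>w. f w / (w - z))"
    by (rule contour_integral_eq) (use r0 s in \<open>auto simp del: power_Suc\<close>)
  also have "(\<lambda>N. contour_integral (circlepath 0 r) (\<lambda>w. \<Sum>n<N. z ^ n * (f w / w ^ Suc n)))
     = (\<lambda>N. \<Sum>n<N. z ^ n * contour_integral (circlepath 0 r) (\<lambda>w. f w / w ^ Suc n))"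
    by (subst contour_integral_sum) (auto simp: contour_integral_lmul ci simp del: power_Suc times_divide_eq_right intro!: contour_integrable_lmul ci)
  finally show ?thesis by (simp add: sums_def)
qed

lemma circle_inner_eq_mean: "circle_inner f g = circle_mean (\<lambda>z. f z * cnj (g z))"
  by (simp add: circle_inner_def)

lemma circle_inner_commute: "circle_inner g f = cnj (circle_inner f g)"
  unfolding circle_inner_eq_mean by (subst circle_mean_cnj [symmetric]) (simp add: mult.commute)

lemma cnj_unit: "norm z = 1 \<Longrightarrow> cnj z = inverse z"
proof -
  assume "norm z = 1"
  hence "z * cnj z = 1" by (simp add: complex_norm_square[symmetric])
  thus ?thesis using inverse_unique by metis
qed

lemma fourier_coeff_contour_integral:
  assumes "continuous_on (sphere 0 1) f"
  shows "contour_integral (circlepath 0 1) (\<lambda>w. f w / w ^ Suc n) = 2 * pi * \<i> * fourier_coeff f (int n)"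
proof -
  have "contour_integral (circlepath 0 1) (\<lambda>w. f w / w ^ Suc n)
      = 2 * pi * \<i> * circle_mean (\<lambda>z. of_real 1 * z * (f (of_real 1 * z) / (of_real 1 * z) ^ Suc n))"
    by (rule contour_integral_circlepath_mean) (use assms in \<open>auto intro!: continuous_intros\<close>)
  also have "circle_mean (\<lambda>z. of_real 1 * z * (f (of_real 1 * z) / (of_real 1 * z) ^ Suc n)) = fourier_coeff f (int n)"
    unfolding fourier_coeff_def circle_inner_eq_mean
    by (rule circle_mean_cong) (auto simp: cnj_unit power_inverse field_simps)
  finally show ?thesis .
qed

lemma L2_circle_continuous:
  assumes "continuous_on (sphere 0 1) f"
  shows "f \<in> L2_circle"
proof -
  have c: "continuous_on UNIV (\<lambda>t. f (cis t))" by (rule continuous_on_cis_comp[OF assms])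
  have "(\<lambda>t. f (cis t)) \<in> borel_measurable lborel"
    using borel_measurable_continuous_onI[OF c] by simp
  moreover have "set_integrable lborel {0..2 * pi} (\<lambda>t. (norm (f (cis t)))\<^sup>2)"
    by (rule borel_integrable_atLeastAtMost') (intro continuous_intros continuous_on_subset[OF c] subset_UNIV)
  ultimately show ?thesis by (simp add: L2_circle_def)
qed

text \<open>Boundedness of \<open>h\<close> at infinity only excludes \<open>n > 0\<close>; decay also excludes the mean.\<close>

lemma fourier_coeff_exterior_zero:
  assumes h: "h holomorphic_on {z. a < norm z}" "0 \<le> a" "a < 1" and lim: "(h \<longlongrightarrow> 0) at_infinity"
    and n: "0 \<le> n"
  shows "fourier_coeff h n = 0"
proof -
  obtain m where m: "n = int m" using n by (metis nonneg_int_cases)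
  let ?I = "\<lambda>R. contour_integral (circlepath 0 R) (\<lambda>w. h w / w ^ Suc m)"
  have hol: "(\<lambda>w. h w / w ^ Suc m) holomorphic_on {z. a < norm z}"
    by (intro holomorphic_intros h(1)) (use h in auto)
  have eq: "?I R = ?I 1" if "R \<ge> 1" for R
    by (rule contour_integral_circlepath_radius[where a=a and b="R+1", symmetric])
       (use that h(2,3) in \<open>auto simp del: power_Suc intro: holomorphic_on_subset[OF hol]\<close>)
  have "norm (?I 1) \<le> e * (2 * pi)" if e: "e > 0" for e
  proof -
    obtain B where B: "\<And>z. norm z \<ge> B \<Longrightarrow> norm (h z) < e"
      using tendstoD[OF lim e] unfolding eventually_at_infinity by auto
    define R where "R = max B 1"
    have R: "R \<ge> 1" "R \<ge> B" by (auto simp: R_def)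
    have hi: "((\<lambda>w. h w / w ^ Suc m) has_contour_integral ?I R) (circlepath 0 R)"
      by (intro has_contour_integral_integral contour_integrable_continuous_circlepath
          holomorphic_on_imp_continuous_on holomorphic_on_subset[OF hol]) (use R h in auto)
    \<comment> \<open>The denominator \<open>w ^ Suc m\<close> supplies at least one factor
      \<open>1 / R\<close>, which cancels the length of the circle; the smallness is that of
      \<open>h\<close>.\<close>
    have "norm (?I R) \<le> e / R * (2 * pi * R)"
    proof (rule has_contour_integral_bound_circlepath[OF hi])
      fix x :: complex assume x: "norm (x - 0) = R"
      have "norm (h x / x ^ Suc m) = norm (h x) / R ^ Suc m" using x by (simp add: norm_divide norm_mult norm_power)
      also have "\<dots> \<le> e / R"
        using B[of x] x R e by (intro frac_le) (auto intro: self_le_power simp del: power_Suc)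
      finally show "norm (h x / x ^ Suc m) \<le> e / R" .
    qed (use e R in auto)
    also have "\<dots> = e * (2 * pi)" using R by simp
    finally show ?thesis using eq[of R] R by simp
  qed
  note * = this
  have "norm (?I 1) \<le> 0"
  proof (rule field_le_epsilon)
    fix e :: real assume "e > 0"
    with *[of "e / (2 * pi)"] show "norm (?I 1) \<le> 0 + e" by simp
  qed
  hence "?I 1 = 0" by simp
  moreover have "continuous_on (sphere 0 1) h"
    by (rule holomorphic_on_imp_continuous_on[OF holomorphic_on_subset[OF h(1)]]) (use h in auto)
  ultimately show ?thesis using fourier_coeff_contour_integral[of h m] m by simp
qed

text \<open>Off the circle the Cauchy integral of a continuous density may be differentiated under
  the integral sign; the distance from \<open>z\<close> to the circle is at least
  \<open>norm z - r\<close>, which gives the decay.\<close>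

lemma circle_Cauchy_integral_exterior:
  assumes g: "continuous_on (sphere 0 r) g" and r: "r > 0"
  defines "h \<equiv> \<lambda>z. contour_integral (circlepath 0 r) (\<lambda>w. g w / (w - z))"
  shows "h holomorphic_on {z. r < norm z}" and "(h \<longlongrightarrow> 0) at_infinity"
proof -
  have int: "((\<lambda>u. g u / (u - w) ^ 1) has_contour_integral h w) (circlepath 0 r)"
    if "w \<in> UNIV - path_image (circlepath 0 r)" for w
    unfolding h_def power_one_right
    by (rule has_contour_integral_integral, rule contour_integrable_continuous_circlepath)
       (use that r in \<open>auto intro!: continuous_intros g\<close>)
  have "(h has_field_derivative (of_nat 1 * contour_integral (circlepath 0 r) (\<lambda>u. g u / (u - w) ^ Suc 1))) (at w)"
    if "r < norm w" for w
    by (rule Cauchy_next_derivative(2)[where S=UNIV and B="2 * pi * r", OF _ _ int])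
       (use that r g in \<open>auto simp: vector_derivative_circlepath norm_mult\<close>)
  thus "h holomorphic_on {z. r < norm z}"
    by (auto simp: holomorphic_on_def field_differentiable_def intro: has_field_derivative_at_within)
  obtain B where B0: "B \<ge> 0" and B: "\<And>w. norm w = r \<Longrightarrow> norm (g w) \<le> B"
    using continuous_on_sphere_bounded[OF g] by blast
  have bd: "norm (h z) \<le> B / (norm z - r) * (2 * pi * r)" if z: "norm z > r" for z
  proof (rule has_contour_integral_bound_circlepath)
    show "((\<lambda>u. g u / (u - z)) has_contour_integral h z) (circlepath 0 r)" using int[of z] z r by simp
    fix x :: complex assume x: "norm (x - 0) = r"
    have "norm z - r \<le> norm (x - z)" using x norm_triangle_ineq2[of z x] by (simp add: norm_minus_commute)
    thus "norm (g x / (x - z)) \<le> B / (norm z - r)"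
      unfolding norm_divide using B[of x] x z B0 by (intro frac_le) auto
  qed (use z B0 r in auto)
  have "((\<lambda>z::complex. B / (norm z - r) * (2 * pi * r)) \<longlongrightarrow> 0) at_infinity"
  proof -
    have "filterlim (\<lambda>z::complex. - r + norm z) at_top at_infinity"
      by (intro filterlim_tendsto_add_at_top[OF tendsto_const] filterlim_norm_at_top)
    hence "((\<lambda>z::complex. B / (- r + norm z)) \<longlongrightarrow> 0) at_infinity"
      by (rule real_tendsto_divide_at_top[OF tendsto_const])
    from tendsto_mult_left_zero[OF this, of "2 * pi * r"] show ?thesis by simp
  qed
  moreover have "\<forall>\<^sub>F z in at_infinity. norm (h z) \<le> B / (norm z - r) * (2 * pi * r)"
    unfolding eventually_at_infinity by (rule exI[of _ "r + 1"]) (use bd in auto)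
  ultimately show "(h \<longlongrightarrow> 0) at_infinity" by (rule Lim_null_comparison[rotated])
qed

text \<open>Each power \<open>z ^ n\<close> with \<open>n \<ge> 0\<close> is orthogonal to
  \<open>k\<close>; the work lies in the interchange of sum and integral. As \<open>k\<close> is a
  general square integrable function, the interchange rests on absolute summability of the
  coefficients and on integrability of \<open>norm k\<close> over the bounded interval.\<close>

lemma circle_inner_power_series:
  assumes s: "\<And>z. norm z = 1 \<Longrightarrow> (\<lambda>n. a n * z ^ n) sums u z" and a: "summable (\<lambda>n. norm (a n))"
    and k: "k \<in> L2_circle" "\<And>n. 0 \<le> n \<Longrightarrow> fourier_coeff k n = 0"
  shows "circle_inner u k = 0"
proof -
  have m: "(\<lambda>t. k (cis t)) \<in> borel_measurable lborel"
    and k2: "set_integrable lborel {0..2 * pi} (\<lambda>t. (norm (k (cis t)))\<^sup>2)"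
    using k(1) by (auto simp: L2_circle_def)
  have k1: "set_integrable lborel {0..2 * pi} (\<lambda>t. norm (k (cis t)))"
  proof (rule set_integrable_bound)
    show "set_integrable lborel {0..2 * pi} (\<lambda>t. 1 + (norm (k (cis t)))\<^sup>2)"
      by (intro set_integral_add k2) (simp add: set_integrable_def)
    show "set_borel_measurable lborel {0..2 * pi} (\<lambda>t. norm (k (cis t)))"
      using m unfolding set_borel_measurable_def by measurable
    have "x \<le> 1 + x\<^sup>2" if "x \<ge> 0" for x :: real
      using zero_le_power2[of "x - 1/2"] by (simp add: power2_eq_square algebra_simps)
    thus "AE t in lborel. t \<in> {0..2 * pi} \<longrightarrow> norm (norm (k (cis t))) \<le> norm (1 + (norm (k (cis t)))\<^sup>2)"
      by auto
  qed
  define F where "F n t = indicator {0..2 * pi} t *\<^sub>R (a n * cis t ^ n * cnj (k (cis t)))" for n t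
  have Fi: "integrable lborel (F n)" for n
  proof -
    have "set_integrable lborel {0..2 * pi} (\<lambda>t. a n * cis t ^ n * cnj (k (cis t)))"
    proof (rule set_integrable_bound)
      show "set_integrable lborel {0..2 * pi} (\<lambda>t. norm (a n) * norm (k (cis t)))"
        using k1 by simp
      have c: "(\<lambda>t. a n * cis t ^ n) \<in> borel_measurable lborel"
        by (simp, intro borel_measurable_continuous_onI continuous_intros)
      have "(\<lambda>t. cnj (k (cis t))) \<in> borel_measurable lborel"
        by (rule borel_measurable_continuous_on[OF _ m]) (intro continuous_intros)
      hence "(\<lambda>t. a n * cis t ^ n * cnj (k (cis t))) \<in> borel_measurable lborel"
        by (rule borel_measurable_times[OF c])
      thus "set_borel_measurable lborel {0..2 * pi} (\<lambda>t. a n * cis t ^ n * cnj (k (cis t)))"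
        unfolding set_borel_measurable_def by measurable
    qed (auto simp: norm_mult norm_power)
    thus ?thesis by (simp add: F_def[abs_def] set_integrable_def)
  qed
  have nF: "norm (F n t) = norm (a n) * (indicator {0..2 * pi} t * norm (k (cis t)))" for n t
    by (simp add: F_def norm_mult norm_power)
  have "(\<lambda>n. integral\<^sup>L lborel (F n)) sums (\<integral>t. (\<Sum>n. F n t) \<partial>lborel)"
  proof (rule sums_integral)
    show "AE t in lborel. summable (\<lambda>n. norm (F n t))"
      unfolding nF using a by (intro AE_I2 summable_mult2)
    show "summable (\<lambda>n. \<integral>t. norm (F n t) \<partial>lborel)"
      unfolding nF using a by (simp add: summable_mult2)
  qed (rule Fi)
  moreover have "integral\<^sup>L lborel (F n) = 0" for n
  proof -
    have "integral\<^sup>L lborel (F n) = a n * (LINT t:{0..2*pi}|lborel. cis t ^ n * cnj (k (cis t)))"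
      unfolding F_def set_lebesgue_integral_def
      by (subst integral_mult_right_zero [symmetric]) (auto intro!: Bochner_Integration.integral_cong)
    also have "(LINT t:{0..2*pi}|lborel. cis t ^ n * cnj (k (cis t))) = 2 * pi * circle_inner (\<lambda>z. z powi int n) k"
      by (simp add: circle_inner_def circle_mean_def)
    also have "circle_inner (\<lambda>z. z powi int n) k = cnj (fourier_coeff k (int n))"
      unfolding fourier_coeff_def by (rule circle_inner_commute)
    finally show ?thesis using k(2)[of "int n"] by simp
  qed
  moreover have "(\<Sum>n. F n t) = indicator {0..2 * pi} t *\<^sub>R (u (cis t) * cnj (k (cis t)))" for t
  proof -
    have "(\<lambda>n. a n * cis t ^ n) sums u (cis t)" by (rule s) simp
    from sums_scaleR_right[OF sums_mult2[OF this]] show ?thesis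
      unfolding F_def by (rule sums_unique[symmetric])
  qed
  ultimately have "(\<integral>t. indicator {0..2 * pi} t *\<^sub>R (u (cis t) * cnj (k (cis t))) \<partial>lborel) = 0"
    by (simp add: sums_iff)
  thus ?thesis by (simp add: circle_inner_def circle_mean_def set_lebesgue_integral_def)
qed

text \<open>Laurent splitting. The Cauchy integral over a radius below 1 is the part holomorphic
  outside and zero at infinity. The one over a radius \<open>R > 1\<close> is a power series with
  coefficients of order \<open>(1 / R) ^ n\<close>, so it converges absolutely on the unit circle
  and is orthogonal to \<open>H2_minus0\<close>.\<close>

lemma projection_H2_minus0_exists:
  assumes g: "g holomorphic_on annulus \<rho>" "0 < \<rho>" "\<rho> < 1" and fg: "\<And>z. norm z = 1 \<Longrightarrow> f z = g z"
  shows "\<exists>h. h analytic_on {z. 1 \<le> norm z} \<and> is_orthogonal_projection_H2_minus0 f h"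
proof -
  define r where "r = (\<rho> + 1) / 2"
  define R where "R = (1 / \<rho> + 1) / 2"
  have r: "\<rho> < r" "r < 1" "0 < r" using g by (auto simp: r_def)
  have R: "1 < R" "R < 1 / \<rho>" using g by (auto simp: R_def field_simps)
  have gc: "continuous_on (sphere 0 s) g" if "\<rho> < s" "s < 1 / \<rho>" for s
    by (rule holomorphic_on_imp_continuous_on[OF holomorphic_on_subset[OF g(1)]])
       (use that in \<open>auto simp: annulus_def\<close>)
  have cr: "continuous_on (sphere 0 r) g" by (rule gc) (use r R in auto)
  have cR: "continuous_on (sphere 0 R) g" by (rule gc) (use r R in auto)
  define h where "h = (\<lambda>z. - 1 / (2 * pi * \<i>) * contour_integral (circlepath 0 r) (\<lambda>w. g w / (w - z)))"
  define a where "a = (\<lambda>n. contour_integral (circlepath 0 R) (\<lambda>w. g w / w ^ Suc n) / (2 * pi * \<i>))"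
  have hh: "h holomorphic_on {z. r < norm z}"
    unfolding h_def by (intro holomorphic_intros circle_Cauchy_integral_exterior(1)[OF cr r(3)])
  have h0: "(h \<longlongrightarrow> 0) at_infinity"
    unfolding h_def by (intro tendsto_mult_right_zero circle_Cauchy_integral_exterior(2)[OF cr r(3)])
  have ha: "h analytic_on {z. 1 \<le> norm z}"
    unfolding analytic_on_holomorphic using hh r open_norm_gt by (intro exI[of _ "{z. r < norm z}"]) auto
  have hc: "continuous_on (sphere 0 1) h"
    by (rule holomorphic_on_imp_continuous_on[OF holomorphic_on_subset[OF hh]]) (use r in auto)
  have hH: "h \<in> H2_minus0"
    using L2_circle_continuous[OF hc] fourier_coeff_exterior_zero[OF hh _ r(2) h0] r by (auto simp: H2_minus0_def)
  have sums: "(\<lambda>n. a n * z ^ n) sums (f z - h z)" if z: "norm z = 1" for z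
  proof -
    have "(\<lambda>n. z ^ n * contour_integral (circlepath 0 R) (\<lambda>w. g w / w ^ Suc n) / (2 * pi * \<i>)) sums
            (contour_integral (circlepath 0 R) (\<lambda>w. g w / (w - z)) / (2 * pi * \<i>))"
      by (intro sums_divide Cauchy_integral_sums cR) (use z R in auto)
    also have "contour_integral (circlepath 0 R) (\<lambda>w. g w / (w - z)) / (2 * pi * \<i>) = f z - h z"
      using annulus_Cauchy_formula[of g \<rho> "1 / \<rho>" r z R] g z r R fg
      by (simp add: annulus_def h_def field_simps)
    finally show ?thesis by (simp add: a_def mult_ac)
  qed
  have "summable (\<lambda>n. norm (a n))"
  proof -
    obtain B where B0: "B \<ge> 0" and B: "\<And>w. norm w = R \<Longrightarrow> norm (g w) \<le> B"
      using continuous_on_sphere_bounded[OF cR] by blast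
    have "norm (a n) \<le> B * (1 / R) ^ n" for n
    proof -
      have "((\<lambda>w. g w / w ^ Suc n) has_contour_integral a n * (2 * pi * \<i>)) (circlepath 0 R)"
        unfolding a_def using R
        by (auto intro!: has_contour_integral_integral contour_integrable_continuous_circlepath continuous_intros cR)
      hence "norm (a n * (2 * pi * \<i>)) \<le> B / R ^ Suc n * (2 * pi * R)"
        by (rule has_contour_integral_bound_circlepath)
           (use R B B0 in \<open>auto simp: norm_divide norm_mult norm_power intro!: divide_right_mono\<close>)
      thus ?thesis using R by (simp add: norm_mult field_simps power_divide)
    qed
    hence "norm (norm (a n)) \<le> B * (1 / R) ^ n" for n by simp
    moreover have "summable (\<lambda>n. B * (1 / R) ^ n)" using R by (intro summable_mult summable_geometric) auto
    ultimately show ?thesis using summable_comparison_test'[of "\<lambda>n. B * (1 / R) ^ n" 0 "\<lambda>n. norm (a n)"] by blast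
  qed
  from circle_inner_power_series[of a "\<lambda>z. f z - h z", OF sums this]
  have "is_orthogonal_projection_H2_minus0 f h"
    using hH by (auto simp: is_orthogonal_projection_H2_minus0_def H2_minus0_def)
  with ha show ?thesis by blast
qed

lemma analytic_exterior_holomorphic:
  assumes "h analytic_on {z. 1 \<le> norm z}"
  obtains a where "0 < a" "a < 1" "h holomorphic_on {z. a < norm z}"
proof -
  from assms obtain S where S: "open S" "{z. 1 \<le> norm z} \<subseteq> S" "h holomorphic_on S"
    unfolding analytic_on_holomorphic by blast
  from open_contains_exterior[OF S(1,2)] obtain a where "0 < a" "a < 1" "{z. a < norm z} \<subseteq> S" by blast
  thus thesis using that S(3) holomorphic_on_subset by blast
qed

text \<open>\<open>Q_op\<close> is specified by values on the circle only, so decay at infinity has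
  to be recovered from them: the vanishing Fourier coefficients kill the outer Cauchy integral, and
  the remaining inner one decays.\<close>

lemma H2_minus0_exterior_tendsto_0:
  assumes h: "h holomorphic_on {z. a < norm z}" "0 < a" "a < 1" and H: "h \<in> H2_minus0"
  shows "(h \<longlongrightarrow> 0) at_infinity"
proof -
  define r where "r = (a + 1) / 2"
  have r: "a < r" "r < 1" "0 < r" using h by (auto simp: r_def)
  have hc: "continuous_on (sphere 0 s) h" if "a < s" for s
    by (rule holomorphic_on_imp_continuous_on[OF holomorphic_on_subset[OF h(1)]]) (use that in auto)
  have *: "h z = - 1 / (2 * pi * \<i>) * contour_integral (circlepath 0 r) (\<lambda>w. h w / (w - z))"
    if z: "norm z > 1" for z
  proof -
    define R where "R = norm z + 1"
    have "contour_integral (circlepath 0 R) (\<lambda>w. h w / w ^ Suc n) = 0" for n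
    proof -
      have "(\<lambda>w. h w / w ^ Suc n) holomorphic_on {z. a < norm z}"
        by (intro holomorphic_intros h(1)) (use h in auto)
      hence "contour_integral (circlepath 0 1) (\<lambda>w. h w / w ^ Suc n) = contour_integral (circlepath 0 R) (\<lambda>w. h w / w ^ Suc n)"
        by (intro contour_integral_circlepath_radius[where a=a and b="R+1"])
           (use h z in \<open>auto simp: R_def simp del: power_Suc intro: holomorphic_on_subset\<close>)
      moreover have "fourier_coeff h (int n) = 0" using H by (simp add: H2_minus0_def)
      ultimately show ?thesis using fourier_coeff_contour_integral[OF hc[OF h(3)], of n] by simp
    qed
    with Cauchy_integral_sums[of R h z] hc[of R] z h(3)
    have "contour_integral (circlepath 0 R) (\<lambda>w. h w / (w - z)) = 0"
      by (simp add: R_def sums_iff)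
    moreover have "h holomorphic_on {w. a < norm w \<and> norm w < R + 1}"
      by (rule holomorphic_on_subset[OF h(1)]) auto
    ultimately show ?thesis
      using annulus_Cauchy_formula[of h a "R + 1" r z R] z h r
      by (simp add: R_def divide_simps mult_ac)
  qed
  have "((\<lambda>z. - 1 / (2 * pi * \<i>) * contour_integral (circlepath 0 r) (\<lambda>w. h w / (w - z))) \<longlongrightarrow> 0) at_infinity"
    by (intro tendsto_mult_right_zero circle_Cauchy_integral_exterior(2) hc r)
  moreover have "\<forall>\<^sub>F z in at_infinity. - 1 / (2 * pi * \<i>) * contour_integral (circlepath 0 r) (\<lambda>w. h w / (w - z)) = h z"
    unfolding eventually_at_infinity by (rule exI[of _ 2]) (auto simp: *)
  ultimately show ?thesis by (rule Lim_transform_eventually)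
qed

section \<open>Logarithmic derivatives and smoothness on annuli\<close>

text \<open>The operator \<open>z d/dz\<close>; \<open>ldb\<close> is its counterpart for
  \<open>cnj z\<close>. In the coordinate \<open>log z = x + i t\<close> the two are the Wirtinger
  derivatives, so \<open>d/dx\<close>, which is \<open>r_dr\<close>, is \<open>ld + ldb\<close>, and
  \<open>d/dt\<close> is \<open>\<i> (ld - ldb)\<close>.\<close>

definition ld :: "(complex \<Rightarrow> complex) \<Rightarrow> (complex \<Rightarrow> complex)" where
  "ld f z = z * wirtinger_dz f z"

definition ldb :: "(complex \<Rightarrow> complex) \<Rightarrow> (complex \<Rightarrow> complex)" where
  "ldb f z = cnj z *
     ((frechet_derivative f (at z) 1 + \<i> * frechet_derivative f (at z) \<i>) / 2)"

text \<open>The differential of \<open>f\<close> is \<open>a dz/z\<close> plus \<open>b\<close>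
  times the conjugate of \<open>dz/z\<close>. Carrying both coefficients in one predicate yields
  product, conjugation and exponential rules with explicit values, from which \<open>ld\<close> and
  \<open>ldb\<close> are read off by uniqueness.\<close>

definition has_log_deriv :: "(complex \<Rightarrow> complex) \<Rightarrow> complex \<Rightarrow> complex \<Rightarrow> complex \<Rightarrow> bool" where
  "has_log_deriv f a b z \<longleftrightarrow>
     z \<noteq> 0 \<and> (f has_derivative (\<lambda>h. h / z * a + cnj (h / z) * b)) (at z)"

lemma has_log_deriv_unique:
  assumes "has_log_deriv f a b z"
  shows "ld f z = a" "ldb f z = b"
proof -
  have z: "z \<noteq> 0" and d: "(f has_derivative (\<lambda>h. h / z * a + cnj (h / z) * b)) (at z)"
    using assms by (auto simp: has_log_deriv_def)
  have e: "frechet_derivative f (at z) = (\<lambda>h. h / z * a + cnj (h / z) * b)"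
    using frechet_derivative_at[OF d] by simp
  show "ld f z = a" "ldb f z = b"
    using z by (simp_all add: ld_def ldb_def wirtinger_dz_def e divide_simps) (simp_all add: algebra_simps)
qed

lemma differentiable_has_log_deriv:
  assumes "f differentiable (at z)" "z \<noteq> 0"
  shows "has_log_deriv f (ld f z) (ldb f z) z"
proof -
  let ?f' = "frechet_derivative f (at z)"
  have d: "(f has_derivative ?f') (at z)" using assms frechet_derivative_works by blast
  have "?f' h = h / z * ld f z + cnj (h / z) * ldb f z" for h
  proof -
    have l: "linear ?f'" by (rule has_derivative_linear[OF d])
    have "?f' h = ?f' (Re h *\<^sub>R 1 + Im h *\<^sub>R \<i>)"
      by (rule arg_cong[of _ _ ?f']) (simp add: complex_eq_iff)
    also have "\<dots> = Re h * ?f' 1 + Im h * ?f' \<i>"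
      by (simp only: linear_add[OF l] linear_cmul[OF l]) (simp add: scaleR_conv_of_real)
    also have "\<dots> = h / z * ld f z + cnj (h / z) * ldb f z"
    proof -
      have "h / z * ld f z = h * (?f' 1 - \<i> * ?f' \<i>) / 2"
        "cnj (h / z) * ldb f z = cnj h * (?f' 1 + \<i> * ?f' \<i>) / 2"
        using assms(2) by (simp_all add: ld_def ldb_def wirtinger_dz_def)
      moreover have "Re h * ?f' 1 + Im h * ?f' \<i> = h * (?f' 1 - \<i> * ?f' \<i>) / 2 + cnj h * (?f' 1 + \<i> * ?f' \<i>) / 2"
        unfolding complex_eq_iff by (simp add: field_simps)
      ultimately show ?thesis by (simp only:)
    qed
    finally show ?thesis .
  qed
  hence "?f' = (\<lambda>h. h / z * ld f z + cnj (h / z) * ldb f z)" by (rule ext)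
  with d have "(f has_derivative (\<lambda>h. h / z * ld f z + cnj (h / z) * ldb f z)) (at z)" by (simp only:)
  thus ?thesis using assms by (simp add: has_log_deriv_def)
qed

lemma has_log_deriv_differentiable: "has_log_deriv f a b z \<Longrightarrow> f differentiable (at z)"
  by (auto simp: has_log_deriv_def differentiable_def)

lemma has_log_deriv_add:
  "has_log_deriv f a b z \<Longrightarrow> has_log_deriv g c d z \<Longrightarrow> has_log_deriv (\<lambda>z. f z + g z) (a + c) (b + d) z"
  unfolding has_log_deriv_def
  by (auto intro!: derivative_eq_intros simp: algebra_simps add_divide_distrib)

lemma has_log_deriv_mult:
  "has_log_deriv f a b z \<Longrightarrow> has_log_deriv g c d z \<Longrightarrow>
     has_log_deriv (\<lambda>z. f z * g z) (a * g z + f z * c) (b * g z + f z * d) z"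
  unfolding has_log_deriv_def
  by (auto intro!: derivative_eq_intros simp: algebra_simps add_divide_distrib)

lemma has_log_deriv_cnj: "has_log_deriv f a b z \<Longrightarrow> has_log_deriv (\<lambda>z. cnj (f z)) (cnj b) (cnj a) z"
  unfolding has_log_deriv_def
  by (auto intro!: derivative_eq_intros simp: algebra_simps)

lemma has_log_deriv_holomorphic:
  assumes "(f has_field_derivative f') (at z)" "z \<noteq> 0"
  shows "has_log_deriv f (z * f') 0 z"
proof -
  have "(f has_derivative (\<lambda>h. f' * h)) (at z)"
    using assms(1) by (simp add: has_field_derivative_def)
  thus ?thesis using assms(2) by (simp add: has_log_deriv_def mult.commute)
qed

lemma has_log_deriv_exp:
  assumes "has_log_deriv f a b z"
  shows "has_log_deriv (\<lambda>z. exp (f z)) (a * exp (f z)) (b * exp (f z)) z"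
proof -
  have "(exp has_derivative (\<lambda>h. exp (f z) * h)) (at (f z))"
    using DERIV_exp[of "f z"] by (simp add: has_field_derivative_def)
  from has_derivative_compose[of f "\<lambda>h. h / z * a + cnj (h / z) * b" z UNIV, OF _ this] assms show ?thesis
    unfolding has_log_deriv_def by (simp add: algebra_simps)
qed

lemma has_log_deriv_transform:
  assumes "has_log_deriv f a b z" "open S" "z \<in> S" "\<And>w. w \<in> S \<Longrightarrow> f w = g w"
  shows "has_log_deriv g a b z"
  using assms has_derivative_transform_within_open[of f _ z UNIV S g]
  by (auto simp: has_log_deriv_def)

lemma r_dr_eq_log_deriv:
  assumes "f differentiable (at z)" "z \<noteq> 0"
  shows "r_dr f z = ld f z + ldb f z"
proof -
  have d: "(f has_derivative (\<lambda>h. h / z * ld f z + cnj (h / z) * ldb f z)) (at z)"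
    using differentiable_has_log_deriv[OF assms] by (simp add: has_log_deriv_def)
  have zz: "complex_of_real (norm z) * sgn z = z" using assms(2) by (simp add: sgn_div_norm scaleR_conv_of_real mult.assoc[symmetric])
  have "((\<lambda>r. complex_of_real r * sgn z) has_vector_derivative sgn z) (at (norm z))"
    by (auto intro!: derivative_eq_intros)
  hence "((\<lambda>r. complex_of_real r * sgn z) has_derivative (\<lambda>h. h *\<^sub>R sgn z)) (at (norm z))"
    by (simp add: has_vector_derivative_def)
  from has_derivative_compose[OF this, of f "\<lambda>h. h / z * ld f z + cnj (h / z) * ldb f z"] d
  have "((\<lambda>r. f (complex_of_real r * sgn z)) has_derivative
         (\<lambda>h. (h *\<^sub>R sgn z) / z * ld f z + cnj ((h *\<^sub>R sgn z) / z) * ldb f z)) (at (norm z))"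
    unfolding zz by blast
  also have "(\<lambda>h. (h *\<^sub>R sgn z) / z * ld f z + cnj ((h *\<^sub>R sgn z) / z) * ldb f z)
       = (\<lambda>h. h *\<^sub>R ((ld f z + ldb f z) / norm z))"
    using assms(2) by (auto simp: sgn_div_norm scaleR_conv_of_real field_simps)
  finally have "vector_derivative (\<lambda>r. f (complex_of_real r * sgn z)) (at (norm z)) = (ld f z + ldb f z) / norm z"
    by (intro vector_derivative_at) (simp add: has_vector_derivative_def)
  thus ?thesis using assms(2) by (simp add: r_dr_def)
qed

section \<open>Functions with logarithmic derivatives of all orders on an annulus\<close>

text \<open>Real-analyticity of the restriction to the circle, expressed as a holomorphic extension.
  The radius is existentially quantified because the extension may live on a thinner annulus than
  the function itself.\<close>

definition circle_ext :: "(complex \<Rightarrow> complex) \<Rightarrow> bool" where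
  "circle_ext f \<longleftrightarrow>
     (\<exists>\<rho> g. 0 < \<rho> \<and> \<rho> < 1 \<and> g holomorphic_on annulus \<rho> \<and> (\<forall>z. norm z = 1 \<longrightarrow> f z = g z))"

lemma circle_extI:
  "0 < \<rho> \<Longrightarrow> \<rho> < 1 \<Longrightarrow> g holomorphic_on annulus \<rho> \<Longrightarrow> (\<And>z. norm z = 1 \<Longrightarrow> f z = g z) \<Longrightarrow> circle_ext f"
  unfolding circle_ext_def by blast

lemma circle_ext_cong: "circle_ext f \<Longrightarrow> (\<And>z. norm z = 1 \<Longrightarrow> f z = g z) \<Longrightarrow> circle_ext g"
  unfolding circle_ext_def by metis

lemma circle_ext_const: "circle_ext (\<lambda>_. c)"
  by (rule circle_extI[of "1/2" "\<lambda>_. c"]) (auto intro: holomorphic_intros)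

lemma circle_ext2:
  assumes "circle_ext f" "circle_ext g"
  obtains \<rho> f' g' where "0 < \<rho>" "\<rho> < 1" "f' holomorphic_on annulus \<rho>" "g' holomorphic_on annulus \<rho>"
    "\<And>z. norm z = 1 \<Longrightarrow> f z = f' z" "\<And>z. norm z = 1 \<Longrightarrow> g z = g' z"
proof -
  from assms obtain \<rho>1 f' \<rho>2 g' where 1: "0 < \<rho>1" "\<rho>1 < 1" "f' holomorphic_on annulus \<rho>1" "\<And>z. norm z = 1 \<Longrightarrow> f z = f' z"
    and 2: "0 < \<rho>2" "\<rho>2 < 1" "g' holomorphic_on annulus \<rho>2" "\<And>z. norm z = 1 \<Longrightarrow> g z = g' z"
    unfolding circle_ext_def by metis
  have "annulus (max \<rho>1 \<rho>2) \<subseteq> annulus \<rho>1" "annulus (max \<rho>1 \<rho>2) \<subseteq> annulus \<rho>2"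
    using 1 2 by (intro annulus_mono; simp)+
  thus thesis using that[of "max \<rho>1 \<rho>2" f' g'] 1 2 holomorphic_on_subset by (metis less_max_iff_disj max_less_iff_conj)
qed

lemma circle_ext_add:
  assumes "circle_ext f" "circle_ext g" shows "circle_ext (\<lambda>z. f z + g z)"
  by (rule circle_ext2[OF assms], rule circle_extI) (auto intro!: holomorphic_intros)

lemma circle_ext_mult:
  assumes "circle_ext f" "circle_ext g" shows "circle_ext (\<lambda>z. f z * g z)"
  by (rule circle_ext2[OF assms], rule circle_extI) (auto intro!: holomorphic_intros)

text \<open>On the unit circle \<open>z = 1 / cnj z\<close>, so the Schwarz reflection extends the conjugate.\<close>

lemma circle_ext_cnj:
  assumes "circle_ext f" shows "circle_ext (\<lambda>z. cnj (f z))"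
proof -
  from assms obtain \<rho> g where g: "0 < \<rho>" "\<rho> < 1" "g holomorphic_on annulus \<rho>" "\<And>z. norm z = 1 \<Longrightarrow> f z = g z"
    unfolding circle_ext_def by metis
  have im: "cnj ` annulus \<rho> = annulus \<rho>"
    by (auto simp: annulus_def image_iff) (metis complex_cnj_cnj complex_mod_cnj)
  have 1: "(cnj \<circ> g \<circ> cnj) holomorphic_on annulus \<rho>"
    by (rule holomorphic_on_compose_cnj_cnj) (use im g open_annulus in auto)
  have inv: "inverse holomorphic_on annulus \<rho>"
    by (rule holomorphic_intros) (use g annulus_nonzero in \<open>auto intro: holomorphic_intros\<close>)
  \<comment> \<open>The annulus is symmetric under inversion, which is why its outer radius was
    defined as \<open>1 / \<rho>\<close>; reflection therefore costs no width.\<close>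
  have "inverse ` annulus \<rho> \<subseteq> annulus \<rho>"
  proof
    fix w assume "w \<in> inverse ` annulus \<rho>"
    then obtain z where z: "w = inverse z" "\<rho> < norm z" "norm z < 1 / \<rho>" by (auto simp: annulus_def)
    have "0 < norm z" using z g by linarith
    moreover have "norm w = 1 / norm z" unfolding z(1) norm_inverse by (simp add: inverse_eq_divide)
    moreover have "\<rho> < 1 / norm z" "1 / norm z < 1 / \<rho>"
      using z g calculation(1) by (simp_all add: field_simps)
    ultimately show "w \<in> annulus \<rho>" by (simp add: annulus_def)
  qed
  hence "((cnj \<circ> g \<circ> cnj) \<circ> inverse) holomorphic_on annulus \<rho>"
    by (intro holomorphic_on_compose inv holomorphic_on_subset[OF 1])
  moreover have "cnj (f z) = ((cnj \<circ> g \<circ> cnj) \<circ> inverse) z" if "norm z = 1" for z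
    using g(4)[OF that] cnj_unit[OF that] by (simp flip: cnj_unit[OF that])
  ultimately show ?thesis using g by (intro circle_extI)
qed

text \<open>The flag \<open>b\<close> switches on the requirement that the restrictions to the unit circle of the function
  and of its derivatives be real-analytic. This is all that \<open>Q_op\<close> needs.\<close>

primrec log_smooth_k :: "bool \<Rightarrow> real \<Rightarrow> nat \<Rightarrow> (complex \<Rightarrow> complex) \<Rightarrow> bool" where
  "log_smooth_k b \<rho> 0 f \<longleftrightarrow> continuous_on (annulus \<rho>) f \<and> (b \<longrightarrow> circle_ext f)"
| "log_smooth_k b \<rho> (Suc k) f \<longleftrightarrow> (b \<longrightarrow> circle_ext f) \<and>
     (\<forall>z\<in>annulus \<rho>. f differentiable (at z)) \<and> log_smooth_k b \<rho> k (ld f) \<and> log_smooth_k b \<rho> k (ldb f)"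

definition log_smooth :: "bool \<Rightarrow> real \<Rightarrow> (complex \<Rightarrow> complex) \<Rightarrow> bool" where
  "log_smooth b \<rho> f \<longleftrightarrow> (\<forall>k. log_smooth_k b \<rho> k f)"

lemma log_smooth_k_cong:
  assumes "0 < \<rho>" "\<rho> < 1" "log_smooth_k b \<rho> k f" "\<And>z. z \<in> annulus \<rho> \<Longrightarrow> f z = g z"
  shows "log_smooth_k b \<rho> k g"
  using assms(3,4)
proof (induction k arbitrary: f g)
  case 0
  have "continuous_on (annulus \<rho>) g" using 0 continuous_on_cong by force
  thus ?case using 0 sphere_subset_annulus[OF assms(1,2)] by (auto intro!: circle_ext_cong[of f g])
next
  case (Suc k)
  have hd: "has_log_deriv g (ld f z) (ldb f z) z" if "z \<in> annulus \<rho>" for z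
    by (rule has_log_deriv_transform[OF differentiable_has_log_deriv[of f] open_annulus[of \<rho>]])
       (use that Suc.prems annulus_nonzero[OF assms(1)] in auto)
  have "log_smooth_k b \<rho> k (ld g)" "log_smooth_k b \<rho> k (ldb g)"
    using Suc.IH[of "ld f" "ld g"] Suc.IH[of "ldb f" "ldb g"] Suc.prems(1) has_log_deriv_unique[OF hd] by auto
  moreover have "b \<longrightarrow> circle_ext g"
    using Suc.prems sphere_subset_annulus[OF assms(1,2)] by (auto intro!: circle_ext_cong[of f g])
  ultimately show ?case using has_log_deriv_differentiable[OF hd] by auto
qed

text \<open>Lets each closure lemma name its derivatives as explicit functions instead of rewriting
  \<open>ld\<close> and \<open>ldb\<close> of compound terms.\<close>

lemma log_smooth_k_SucI:
  assumes \<rho>: "0 < \<rho>" "\<rho> < 1" and "\<And>z. z \<in> annulus \<rho> \<Longrightarrow> has_log_deriv f (f1 z) (f2 z) z"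
    and "log_smooth_k b \<rho> k f1" "log_smooth_k b \<rho> k f2" "b \<Longrightarrow> circle_ext f"
  shows "log_smooth_k b \<rho> (Suc k) f"
proof -
  have "log_smooth_k b \<rho> k (ld f)"
    by (rule log_smooth_k_cong[OF \<rho> assms(4)]) (use has_log_deriv_unique(1)[OF assms(3)] in simp)
  moreover have "log_smooth_k b \<rho> k (ldb f)"
    by (rule log_smooth_k_cong[OF \<rho> assms(5)]) (use has_log_deriv_unique(2)[OF assms(3)] in simp)
  ultimately show ?thesis using assms(6) has_log_deriv_differentiable[OF assms(3)] by simp
qed

lemma log_smooth_k_ext: "log_smooth_k b \<rho> k f \<Longrightarrow> b \<Longrightarrow> circle_ext f"
  by (cases k) auto

lemma log_smooth_k_continuous: "log_smooth_k b \<rho> k f \<Longrightarrow> continuous_on (annulus \<rho>) f"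
  by (cases k) (auto intro!: continuous_at_imp_continuous_on differentiable_imp_continuous_within)

lemma log_smooth_k_log_deriv:
  "0 < \<rho> \<Longrightarrow> log_smooth_k b \<rho> (Suc k) f \<Longrightarrow> z \<in> annulus \<rho> \<Longrightarrow> has_log_deriv f (ld f z) (ldb f z) z"
  using annulus_nonzero by (auto intro!: differentiable_has_log_deriv)

lemma log_smooth_k_Suc: "log_smooth_k b \<rho> (Suc k) f \<Longrightarrow> log_smooth_k b \<rho> k f"
proof (induction k arbitrary: f)
  case 0
  thus ?case using log_smooth_k_continuous[OF 0] by auto
next
  case (Suc k)
  have "log_smooth_k b \<rho> (Suc k) (ld f)" "log_smooth_k b \<rho> (Suc k) (ldb f)" using Suc.prems by auto
  with Suc.IH[of "ld f"] Suc.IH[of "ldb f"] Suc.prems show ?case by auto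
qed

lemma log_smooth_k_add:
  assumes "0 < \<rho>" "\<rho> < 1" "log_smooth_k b \<rho> k f" "log_smooth_k b \<rho> k g"
  shows "log_smooth_k b \<rho> k (\<lambda>z. f z + g z)"
  using assms(3,4)
proof (induction k arbitrary: f g)
  case 0 thus ?case by (auto intro!: continuous_intros circle_ext_add)
next
  case (Suc k)
  show ?case
  proof (rule log_smooth_k_SucI[OF assms(1,2)])
    show "has_log_deriv (\<lambda>z. f z + g z) (ld f z + ld g z) (ldb f z + ldb g z) z" if "z \<in> annulus \<rho>" for z
      using that Suc.prems by (intro has_log_deriv_add log_smooth_k_log_deriv[OF assms(1)])
  qed (use Suc log_smooth_k_ext circle_ext_add in auto)
qed

lemma log_smooth_k_mult:
  assumes "0 < \<rho>" "\<rho> < 1" "log_smooth_k b \<rho> k f" "log_smooth_k b \<rho> k g"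
  shows "log_smooth_k b \<rho> k (\<lambda>z. f z * g z)"
  using assms(3,4)
proof (induction k arbitrary: f g)
  case 0 thus ?case by (auto intro!: continuous_intros circle_ext_mult)
next
  case (Suc k)
  have s: "log_smooth_k b \<rho> k f" "log_smooth_k b \<rho> k g" using log_smooth_k_Suc[OF Suc.prems(1)] log_smooth_k_Suc[OF Suc.prems(2)] .
  show ?case
  proof (rule log_smooth_k_SucI[OF assms(1,2)])
    show "has_log_deriv (\<lambda>z. f z * g z) (ld f z * g z + f z * ld g z) (ldb f z * g z + f z * ldb g z) z"
      if "z \<in> annulus \<rho>" for z
      using that Suc.prems by (intro has_log_deriv_mult log_smooth_k_log_deriv[OF assms(1)])
    show "log_smooth_k b \<rho> k (\<lambda>z. ld f z * g z + f z * ld g z)" "log_smooth_k b \<rho> k (\<lambda>z. ldb f z * g z + f z * ldb g z)"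
      using Suc s by (auto intro!: log_smooth_k_add[OF assms(1,2)])
  qed (use Suc.prems log_smooth_k_ext circle_ext_mult in blast)
qed

lemma log_smooth_k_cnj:
  assumes "0 < \<rho>" "\<rho> < 1" "log_smooth_k b \<rho> k f"
  shows "log_smooth_k b \<rho> k (\<lambda>z. cnj (f z))"
  using assms(3)
proof (induction k arbitrary: f)
  case 0 thus ?case by (auto intro!: continuous_intros circle_ext_cnj)
next
  case (Suc k)
  show ?case
  proof (rule log_smooth_k_SucI[OF assms(1,2)])
    show "has_log_deriv (\<lambda>z. cnj (f z)) (cnj (ldb f z)) (cnj (ld f z)) z" if "z \<in> annulus \<rho>" for z
      using that Suc.prems by (intro has_log_deriv_cnj log_smooth_k_log_deriv[OF assms(1)])
  qed (use Suc log_smooth_k_ext circle_ext_cnj in auto)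
qed

lemma log_smooth_k_holomorphic:
  assumes "0 < \<rho>" "\<rho> < 1" "f holomorphic_on annulus \<rho>"
  shows "log_smooth_k b \<rho> k f"
  using assms(3)
proof (induction k arbitrary: f)
  case 0 thus ?case using assms by (auto intro: holomorphic_on_imp_continuous_on circle_extI)
next
  case (Suc k)
  show ?case
  proof (rule log_smooth_k_SucI[OF assms(1,2)])
    show "has_log_deriv f (z * deriv f z) ((\<lambda>_. 0) z) z" if "z \<in> annulus \<rho>" for z
      using that Suc.prems annulus_nonzero[OF assms(1)] open_annulus
      by (auto intro!: has_log_deriv_holomorphic holomorphic_derivI)
    show "log_smooth_k b \<rho> k (\<lambda>z. z * deriv f z)"
      by (intro Suc.IH holomorphic_intros holomorphic_deriv Suc.prems open_annulus)
  qed (use Suc assms in \<open>auto intro: circle_extI\<close>)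
qed

lemma log_smooth_k_exp:
  assumes "0 < \<rho>" "\<rho> < 1" "log_smooth_k b \<rho> k f" "b \<Longrightarrow> (\<And>z. norm z = 1 \<Longrightarrow> f z = 0)"
  shows "log_smooth_k b \<rho> k (\<lambda>z. exp (f z))"
  using assms(3)
proof (induction k)
  case 0 thus ?case using assms(4) circle_ext_cong[OF circle_ext_const[of 1], of "\<lambda>z. exp (f z)"]
    by (auto intro!: continuous_intros)
next
  case (Suc k)
  have s: "log_smooth_k b \<rho> k f" by (rule log_smooth_k_Suc[OF Suc.prems])
  show ?case
  proof (rule log_smooth_k_SucI[OF assms(1,2)])
    show "has_log_deriv (\<lambda>z. exp (f z)) (ld f z * exp (f z)) (ldb f z * exp (f z)) z" if "z \<in> annulus \<rho>" for z
      using that Suc.prems by (intro has_log_deriv_exp log_smooth_k_log_deriv[OF assms(1)])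
    show "log_smooth_k b \<rho> k (\<lambda>z. ld f z * exp (f z))" "log_smooth_k b \<rho> k (\<lambda>z. ldb f z * exp (f z))"
      using Suc s by (auto intro!: log_smooth_k_mult[OF assms(1,2)])
    show "circle_ext (\<lambda>z. exp (f z))" if b
      using assms(4)[OF that] circle_ext_cong[OF circle_ext_const[of 1], of "\<lambda>z. exp (f z)"] by auto
  qed
qed

lemma log_smooth_k_weaken: "log_smooth_k b \<rho> k f \<Longrightarrow> log_smooth_k False \<rho> k f"
  by (induction k arbitrary: f) auto

lemma log_smooth_k_mono:
  assumes "0 < \<rho>" "\<rho> \<le> \<rho>'" "log_smooth_k b \<rho> k f"
  shows "log_smooth_k b \<rho>' k f"
  using assms(3)
  by (induction k arbitrary: f) (use annulus_mono[OF assms(1,2)] continuous_on_subset in auto)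

text \<open>Let a family be closed under partial derivatives. By the chain rule the logarithmic
  derivatives of a member composed with \<open>\<psi>\<close> are again members composed with
  \<open>\<psi>\<close>, multiplied by \<open>z \<psi>'\<close> or its conjugate, so the induction
  closes. The family is later taken to be the functions real-analytic on an open set, and then all
  smooth functions.\<close>

lemma log_smooth_k_comp:
  fixes \<G> :: "(complex \<Rightarrow> complex) set"
  assumes \<rho>: "0 < \<rho>" "\<rho> < 1" and \<psi>: "\<psi> holomorphic_on annulus \<rho>" "\<psi> ` annulus \<rho> \<subseteq> U"
    and \<G>: "\<And>g. g \<in> \<G> \<Longrightarrow> \<exists>gu gv :: complex \<Rightarrow> complex. gu \<in> \<G> \<and> gv \<in> \<G> \<and>
              (\<forall>w\<in>U. (g has_derivative (\<lambda>h. of_real (Re h) * gu w + of_real (Im h) * gv w)) (at w))"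
    and ext: "\<And>g. g \<in> \<G> \<Longrightarrow> b \<Longrightarrow> circle_ext (\<lambda>z. g (\<psi> z))"
    and g: "g \<in> \<G>"
  shows "log_smooth_k b \<rho> k (\<lambda>z. g (\<psi> z))"
  using g
proof (induction k arbitrary: g)
  case 0
  from \<G>[OF 0] have "continuous_on U g"
    by (metis continuous_at_imp_continuous_on has_derivative_continuous)
  moreover have "continuous_on (annulus \<rho>) \<psi>" using \<psi>(1) by (rule holomorphic_on_imp_continuous_on)
  ultimately show ?case using ext[OF 0] \<psi>(2) by (auto intro: continuous_on_compose2[of U g])
next
  case (Suc k)
  from \<G>[OF Suc.prems] obtain gu gv where G: "gu \<in> \<G>" "gv \<in> \<G>"
    "\<And>w. w \<in> U \<Longrightarrow> (g has_derivative (\<lambda>h. of_real (Re h) * gu w + of_real (Im h) * gv w)) (at w)" by blast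
  define p where "p = (\<lambda>z. z * deriv \<psi> z)"
  have p: "p holomorphic_on annulus \<rho>"
    unfolding p_def by (intro holomorphic_intros holomorphic_deriv \<psi> open_annulus)
  have P: "log_smooth_k b \<rho> k p" "log_smooth_k b \<rho> k (\<lambda>z. cnj (p z))"
    and C: "log_smooth_k b \<rho> k (\<lambda>z. c)" for c
    by (intro log_smooth_k_holomorphic log_smooth_k_cnj \<rho> p holomorphic_intros)+
  show ?case
  proof (rule log_smooth_k_SucI[OF \<rho>])
    fix z assume z: "z \<in> annulus \<rho>"
    have z0: "z \<noteq> 0" using z annulus_nonzero \<rho> by auto
    have "(\<psi> has_derivative (\<lambda>h. deriv \<psi> z * h)) (at z)"
      using holomorphic_derivI[OF \<psi>(1) open_annulus z] by (simp add: has_field_derivative_def)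
    from has_derivative_compose[OF this G(3)[of "\<psi> z"]] z \<psi>(2)
    have "((\<lambda>z. g (\<psi> z)) has_derivative (\<lambda>h. of_real (Re (deriv \<psi> z * h)) * gu (\<psi> z) + of_real (Im (deriv \<psi> z * h)) * gv (\<psi> z))) (at z)"
      by blast
    also have "(\<lambda>h. of_real (Re (deriv \<psi> z * h)) * gu (\<psi> z) + of_real (Im (deriv \<psi> z * h)) * gv (\<psi> z)) =
       (\<lambda>h. h / z * (p z * ((1/2) * gu (\<psi> z) + (-\<i>/2) * gv (\<psi> z)))
            + cnj (h / z) * (cnj (p z) * ((1/2) * gu (\<psi> z) + (\<i>/2) * gv (\<psi> z))))"
    proof
      fix h
      \<comment> \<open>The increment of \<open>\<psi>\<close>. Expressing its real and imaginary
        parts through \<open>q\<close> and \<open>cnj q\<close> separates the two logarithmic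
        derivatives.\<close>
      define q where "q = deriv \<psi> z * h"
      have e: "h / z * p z = q" "cnj (h / z) * cnj (p z) = cnj q" using z0 by (auto simp: p_def q_def)
      have r: "complex_of_real (Re q) = (q + cnj q) / 2" "complex_of_real (Im q) = - \<i> * (q - cnj q) / 2"
        by (auto simp: complex_eq_iff)
      show "of_real (Re (deriv \<psi> z * h)) * gu (\<psi> z) + of_real (Im (deriv \<psi> z * h)) * gv (\<psi> z)
        = h / z * (p z * ((1/2) * gu (\<psi> z) + (-\<i>/2) * gv (\<psi> z)))
            + cnj (h / z) * (cnj (p z) * ((1/2) * gu (\<psi> z) + (\<i>/2) * gv (\<psi> z)))"
        unfolding mult.assoc[symmetric] e unfolding q_def[symmetric] r by (simp add: field_simps)
    qed
    finally show "has_log_deriv (\<lambda>z. g (\<psi> z)) (p z * ((1/2) * gu (\<psi> z) + (-\<i>/2) * gv (\<psi> z)))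
        (cnj (p z) * ((1/2) * gu (\<psi> z) + (\<i>/2) * gv (\<psi> z))) z"
      using z0 by (simp add: has_log_deriv_def)
  next
    show "log_smooth_k b \<rho> k (\<lambda>z. p z * ((1/2) * gu (\<psi> z) + (-\<i>/2) * gv (\<psi> z)))"
      "log_smooth_k b \<rho> k (\<lambda>z. cnj (p z) * ((1/2) * gu (\<psi> z) + (\<i>/2) * gv (\<psi> z)))"
      using Suc.IH[OF G(1)] Suc.IH[OF G(2)] P C
      by (intro log_smooth_k_mult[OF \<rho>] log_smooth_k_add[OF \<rho>]; simp)+
  qed (use ext[OF Suc.prems] in auto)
qed

lemma log_smooth_cong:
  "0 < \<rho> \<Longrightarrow> \<rho> < 1 \<Longrightarrow> log_smooth b \<rho> f \<Longrightarrow> (\<And>z. z \<in> annulus \<rho> \<Longrightarrow> f z = g z) \<Longrightarrow> log_smooth b \<rho> g"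
  unfolding log_smooth_def by (blast intro: log_smooth_k_cong)

lemma log_smooth_add:
  "0 < \<rho> \<Longrightarrow> \<rho> < 1 \<Longrightarrow> log_smooth b \<rho> f \<Longrightarrow> log_smooth b \<rho> g \<Longrightarrow> log_smooth b \<rho> (\<lambda>z. f z + g z)"
  unfolding log_smooth_def by (blast intro: log_smooth_k_add)

lemma log_smooth_mult:
  "0 < \<rho> \<Longrightarrow> \<rho> < 1 \<Longrightarrow> log_smooth b \<rho> f \<Longrightarrow> log_smooth b \<rho> g \<Longrightarrow> log_smooth b \<rho> (\<lambda>z. f z * g z)"
  unfolding log_smooth_def by (blast intro: log_smooth_k_mult)

lemma log_smooth_cnj:
  "0 < \<rho> \<Longrightarrow> \<rho> < 1 \<Longrightarrow> log_smooth b \<rho> f \<Longrightarrow> log_smooth b \<rho> (\<lambda>z. cnj (f z))"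
  unfolding log_smooth_def by (blast intro: log_smooth_k_cnj)

lemma log_smooth_holomorphic:
  "0 < \<rho> \<Longrightarrow> \<rho> < 1 \<Longrightarrow> f holomorphic_on annulus \<rho> \<Longrightarrow> log_smooth b \<rho> f"
  unfolding log_smooth_def by (blast intro: log_smooth_k_holomorphic)

lemma log_smooth_const: "0 < \<rho> \<Longrightarrow> \<rho> < 1 \<Longrightarrow> log_smooth b \<rho> (\<lambda>_. c)"
  by (rule log_smooth_holomorphic) (auto intro: holomorphic_intros)

lemma log_smooth_exp:
  "0 < \<rho> \<Longrightarrow> \<rho> < 1 \<Longrightarrow> log_smooth b \<rho> f \<Longrightarrow> (\<And>z. norm z = 1 \<Longrightarrow> f z = 0) \<Longrightarrow> log_smooth b \<rho> (\<lambda>z. exp (f z))"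
  unfolding log_smooth_def by (blast intro: log_smooth_k_exp)

lemma log_smooth_weaken: "log_smooth b \<rho> f \<Longrightarrow> log_smooth False \<rho> f"
  unfolding log_smooth_def by (blast intro: log_smooth_k_weaken)

lemma log_smooth_mono: "0 < \<rho> \<Longrightarrow> \<rho> \<le> \<rho>' \<Longrightarrow> log_smooth b \<rho> f \<Longrightarrow> log_smooth b \<rho>' f"
  unfolding log_smooth_def by (blast intro: log_smooth_k_mono)

lemma log_smooth_ld: "log_smooth b \<rho> f \<Longrightarrow> log_smooth b \<rho> (ld f)"
  and log_smooth_ldb: "log_smooth b \<rho> f \<Longrightarrow> log_smooth b \<rho> (ldb f)"
  unfolding log_smooth_def by (meson log_smooth_k.simps(2))+

lemma log_smooth_differentiable: "log_smooth b \<rho> f \<Longrightarrow> z \<in> annulus \<rho> \<Longrightarrow> f differentiable (at z)"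
  unfolding log_smooth_def by (meson log_smooth_k.simps(2))

lemma log_smooth_log_deriv:
  "0 < \<rho> \<Longrightarrow> log_smooth b \<rho> f \<Longrightarrow> z \<in> annulus \<rho> \<Longrightarrow> has_log_deriv f (ld f z) (ldb f z) z"
  using log_smooth_differentiable annulus_nonzero differentiable_has_log_deriv by blast

lemma log_smooth_continuous: "log_smooth b \<rho> f \<Longrightarrow> continuous_on (annulus \<rho>) f"
  unfolding log_smooth_def by (blast intro: log_smooth_k_continuous)

lemma log_smooth_circle_ext: "log_smooth True \<rho> f \<Longrightarrow> circle_ext f"
  unfolding log_smooth_def by (blast intro: log_smooth_k_ext)

lemma log_smooth_continuous_circle:
  "0 < \<rho> \<Longrightarrow> \<rho> < 1 \<Longrightarrow> log_smooth b \<rho> f \<Longrightarrow> continuous_on (sphere 0 1) f"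
  using log_smooth_continuous sphere_subset_annulus continuous_on_subset by blast

section \<open>Integrals over rings\<close>

text \<open>Log-polar coordinates: with the logarithm of the radius as variable the radial
  derivative is simply \<open>d/dx\<close> and the unit circle is \<open>x = 0\<close>.\<close>

definition polar :: "real \<Rightarrow> real \<Rightarrow> complex" where
  "polar x t = of_real (exp x) * cis t"

definition radial_mean :: "(complex \<Rightarrow> complex) \<Rightarrow> real \<Rightarrow> complex" where
  "radial_mean F x = circle_mean (\<lambda>z. F (of_real (exp x) * z))"

lemma norm_polar [simp]: "norm (polar x t) = exp x"
  by (simp add: polar_def norm_mult)

lemma polar_nonzero [simp]: "polar x t \<noteq> 0"
  by (simp add: polar_def)

lemma polar_0: "polar 0 t = cis t"
  by (simp add: polar_def)

lemma continuous_on_polar: "continuous_on S (\<lambda>p. polar (fst p) (snd p))"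
  unfolding polar_def by (intro continuous_intros)

lemma polar_has_vector_derivative_radius:
  "((\<lambda>x. polar x t) has_vector_derivative polar x t) (at x within S)"
  unfolding polar_def by (auto intro!: derivative_eq_intros)

lemma polar_has_vector_derivative_angle:
  "((\<lambda>t. polar x t) has_vector_derivative \<i> * polar x t) (at t within S)"
proof -
  have "((\<lambda>t. cis t) has_vector_derivative \<i> * cis t) (at t within S)"
    unfolding has_vector_derivative_def using has_derivative_cis[OF has_derivative_ident] by simp
  hence "((\<lambda>t. of_real (exp x) * cis t) has_vector_derivative of_real (exp x) * (\<i> * cis t)) (at t within S)"
    by (intro derivative_intros)
  thus ?thesis unfolding polar_def by (simp add: mult_ac)
qed

lemma has_log_deriv_polar_radius:
  assumes "has_log_deriv F a b (polar x t)"
  shows "((\<lambda>x. F (polar x t)) has_vector_derivative (a + b)) (at x within S)"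
proof -
  have 1: "((\<lambda>x. polar x t) has_derivative (\<lambda>h. h *\<^sub>R polar x t)) (at x within S)"
    using polar_has_vector_derivative_radius[of t x S] by (simp add: has_vector_derivative_def)
  have 2: "(F has_derivative (\<lambda>h. h / polar x t * a + cnj (h / polar x t) * b)) (at (polar x t))"
    using assms by (simp add: has_log_deriv_def)
  from has_derivative_compose[OF 1 2]
  show ?thesis by (simp add: has_vector_derivative_def scaleR_conv_of_real algebra_simps)
qed

lemma has_log_deriv_polar_angle:
  assumes "has_log_deriv F a b (polar x t)"
  shows "((\<lambda>t. F (polar x t)) has_vector_derivative \<i> * (a - b)) (at t within S)"
proof -
  have 1: "((\<lambda>t. polar x t) has_derivative (\<lambda>h. h *\<^sub>R (\<i> * polar x t))) (at t within S)"
    using polar_has_vector_derivative_angle[of x t S] by (simp add: has_vector_derivative_def)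
  have 2: "(F has_derivative (\<lambda>h. h / polar x t * a + cnj (h / polar x t) * b)) (at (polar x t))"
    using assms by (simp add: has_log_deriv_def)
  from has_derivative_compose[OF 1 2]
  show ?thesis by (simp add: has_vector_derivative_def scaleR_conv_of_real algebra_simps)
qed

lemma radial_mean_eq_integral:
  assumes "continuous_on (sphere 0 (exp x)) F"
  shows "radial_mean F x = integral {0..2 * pi} (\<lambda>t. F (polar x t)) / (2 * pi)"
proof -
  have "continuous_on (sphere 0 1) (\<lambda>z. F (of_real (exp x) * z))"
    by (rule continuous_on_compose2[OF assms]) (auto intro!: continuous_intros simp: norm_mult)
  thus ?thesis unfolding radial_mean_def by (simp add: circle_mean_eq_integral polar_def)
qed

lemma radial_mean_0: "radial_mean F 0 = circle_mean F"
  by (simp add: radial_mean_def)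

lemma radial_mean_cong: "(\<And>z. norm z = exp x \<Longrightarrow> F z = G z) \<Longrightarrow> radial_mean F x = radial_mean G x"
  unfolding radial_mean_def by (rule circle_mean_cong) (simp add: norm_mult)

lemma radial_mean_bound:
  assumes "continuous_on (sphere 0 (exp x)) F" "\<And>z. norm z = exp x \<Longrightarrow> norm (F z) \<le> B"
  shows "norm (radial_mean F x) \<le> B"
  unfolding radial_mean_def
  by (rule circle_mean_bound) (use assms in \<open>auto intro!: continuous_on_compose2[OF assms(1)] continuous_intros simp: norm_mult\<close>)

lemma radial_mean_add:
  assumes "continuous_on (sphere 0 (exp x)) F" "continuous_on (sphere 0 (exp x)) G"
  shows "radial_mean (\<lambda>z. F z + G z) x = radial_mean F x + radial_mean G x"
  unfolding radial_mean_def
  by (rule circle_mean_add)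
     (auto intro!: continuous_on_compose2[OF assms(1)] continuous_on_compose2[OF assms(2)] continuous_intros simp: norm_mult)

lemma continuous_on_polar_comp:
  assumes "continuous_on {z. exp a < norm z \<and> norm z < exp b} F"
  shows "continuous_on ({a<..<b} \<times> cbox 0 (2 * pi)) (\<lambda>(x, t). F (polar x t))"
proof -
  have "continuous_on ({a<..<b} \<times> cbox 0 (2 * pi)) (\<lambda>p. F (polar (fst p) (snd p)))"
    by (rule continuous_on_compose2[OF assms continuous_on_polar]) auto
  thus ?thesis by (simp add: case_prod_unfold)
qed

text \<open>Differentiation under the integral gives the derivative. The angular derivative
  \<open>\<i> (F1 - F2)\<close> integrates to zero over a full period, so the means of
  \<open>F1\<close> and \<open>F2\<close> agree; hence the derivative of the mean is twice the mean
  of either one.\<close>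

lemma radial_mean_has_derivative:
  assumes d: "\<And>z. exp a < norm z \<Longrightarrow> norm z < exp b \<Longrightarrow> has_log_deriv F (F1 z) (F2 z) z"
    and c: "continuous_on {z. exp a < norm z \<and> norm z < exp b} F1"
           "continuous_on {z. exp a < norm z \<and> norm z < exp b} F2"
    and x: "a < x" "x < b"
  shows "(radial_mean F has_vector_derivative radial_mean (\<lambda>z. F1 z + F2 z) x) (at x)"
    and "radial_mean F1 x = radial_mean F2 x"
proof -
  have cF: "continuous_on {z. exp a < norm z \<and> norm z < exp b} F"
    by (intro continuous_at_imp_continuous_on ballI) (use d in \<open>auto simp: has_log_deriv_def intro: has_derivative_continuous\<close>)
  have sub: "sphere 0 (exp y) \<subseteq> {z. exp a < norm z \<and> norm z < exp b}" if "a < y" "y < b" for y using that by auto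
  have s: "continuous_on (sphere 0 (exp y)) G" if "a < y" "y < b" "continuous_on {z. exp a < norm z \<and> norm z < exp b} G" for y G
    by (rule continuous_on_subset[OF that(3) sub[OF that(1,2)]])
  have pc: "(\<lambda>t. G (polar y t)) integrable_on {0..2*pi}"
    if "a < y" "y < b" "continuous_on {z. exp a < norm z \<and> norm z < exp b} G" for y and G :: "complex \<Rightarrow> complex"
    by (rule integrable_continuous_real, rule continuous_on_compose2[OF s[OF that]])
       (auto simp: polar_def norm_mult intro!: continuous_intros)
  have "((\<lambda>y. integral (cbox 0 (2 * pi)) (\<lambda>t. F (polar y t))) has_vector_derivative
          integral (cbox 0 (2 * pi)) (\<lambda>t. F1 (polar x t) + F2 (polar x t))) (at x within {a<..<b})"
  proof (rule leibniz_rule_vector_derivative)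
    show "((\<lambda>x. F (polar x t)) has_vector_derivative F1 (polar y t) + F2 (polar y t)) (at y within {a<..<b})"
      if "y \<in> {a<..<b}" for y t
      by (rule has_log_deriv_polar_radius, rule d) (use that in auto)
    show "(\<lambda>t. F (polar y t)) integrable_on cbox 0 (2 * pi)" if "y \<in> {a<..<b}" for y
      using pc[OF _ _ cF, of y] that by simp
    show "continuous_on ({a<..<b} \<times> cbox 0 (2 * pi)) (\<lambda>(x, t). F1 (polar x t) + F2 (polar x t))"
      using continuous_on_add[OF continuous_on_polar_comp[OF c(1)] continuous_on_polar_comp[OF c(2)]]
      by (simp add: case_prod_unfold)
  qed (use x in auto)
  hence "((\<lambda>y. integral {0..2*pi} (\<lambda>t. F (polar y t))) has_vector_derivative
          integral {0..2*pi} (\<lambda>t. F1 (polar x t) + F2 (polar x t))) (at x)"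
    using x by (simp add: at_within_open[of x "{a<..<b}"])
  from has_vector_derivative_divide[OF this, of "of_real (2*pi)"]
  have "((\<lambda>y. integral {0..2*pi} (\<lambda>t. F (polar y t)) / (2*pi)) has_vector_derivative radial_mean (\<lambda>z. F1 z + F2 z) x) (at x)"
    using x c by (subst radial_mean_eq_integral) (auto intro!: continuous_on_add s)
  moreover have "integral {0..2*pi} (\<lambda>t. F (polar y t)) / (2*pi) = radial_mean F y" if "y \<in> {a<..<b}" for y
    using that by (subst radial_mean_eq_integral) (auto intro!: s cF)
  ultimately show "(radial_mean F has_vector_derivative radial_mean (\<lambda>z. F1 z + F2 z) x) (at x)"
    using has_vector_derivative_transform_within_open[of _ _ x "{a<..<b}" "radial_mean F"] x
    by (metis (no_types, lifting) greaterThanLessThan_iff open_greaterThanLessThan)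
  have "((\<lambda>t. \<i> * (F1 (polar x t) - F2 (polar x t))) has_integral F (polar x (2*pi)) - F (polar x 0)) {0..2*pi}"
    by (rule fundamental_theorem_of_calculus) (use x in \<open>auto intro!: has_log_deriv_polar_angle d\<close>)
  moreover have "polar x (2*pi) = polar x 0" by (simp add: polar_def)
  ultimately have "((\<lambda>t. \<i> * (F1 (polar x t) - F2 (polar x t))) has_integral 0) {0..2*pi}" by simp
  from integral_unique[OF this]
  have "integral {0..2*pi} (\<lambda>t. \<i> * (F1 (polar x t) - F2 (polar x t))) = 0" .
  hence "integral {0..2*pi} (\<lambda>t. F1 (polar x t) - F2 (polar x t)) = 0" by simp
  hence "integral {0..2*pi} (\<lambda>t. F1 (polar x t)) = integral {0..2*pi} (\<lambda>t. F2 (polar x t))"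
    using Henstock_Kurzweil_Integration.integral_diff[OF pc[OF x c(1)] pc[OF x c(2)]] by simp
  thus "radial_mean F1 x = radial_mean F2 x"
    using x by (subst (1 2) radial_mean_eq_integral) (auto intro!: s c)
qed

section \<open>The weighted ring integral\<close>

text \<open>This is \<open>N\<close> times the integral of \<open>|z|^(2N) F\<close> against
  \<open>dA\<close> over the ring, in log-polar coordinates: the summand 1 in \<open>N + 1\<close>
  comes from the Jacobian \<open>exp (2 x)\<close>. The codomain is left general so that norms are
  integrated by the same operator.\<close>

definition ring_integral :: "real \<Rightarrow> nat \<Rightarrow> (complex \<Rightarrow> 'a::euclidean_space) \<Rightarrow> 'a" where
  "ring_integral x0 N F = (real N / pi) *\<^sub>R
     integral (cbox (x0, 0) (0, 2 * pi)) (\<lambda>(x, t). exp (2 * (real N + 1) * x) *\<^sub>R F (polar x t))"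

definition closed_ring :: "real \<Rightarrow> complex set" where
  "closed_ring x0 = {z. exp x0 \<le> norm z \<and> norm z \<le> 1}"

lemma continuous_on_ring_integrand:
  fixes F :: "complex \<Rightarrow> 'a::euclidean_space"
  assumes "continuous_on (closed_ring x0) F"
  shows "continuous_on (cbox (x0, 0) (0, 2 * pi)) (\<lambda>(x, t). exp (a * x) *\<^sub>R F (polar x t))"
proof -
  have "continuous_on (cbox (x0, 0) (0, 2 * pi)) (\<lambda>p. F (polar (fst p) (snd p)))"
    by (rule continuous_on_compose2[OF assms continuous_on_polar]) (auto simp: closed_ring_def cbox_Pair_eq)
  thus ?thesis unfolding case_prod_unfold by (intro continuous_intros) auto
qed

lemma ring_integrable:
  fixes F :: "complex \<Rightarrow> 'a::euclidean_space"
  assumes "continuous_on (closed_ring x0) F"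
  shows "(\<lambda>(x, t). exp (a * x) *\<^sub>R F (polar x t)) integrable_on cbox (x0, 0) (0, 2 * pi)"
  by (intro integrable_continuous continuous_on_ring_integrand assms)

lemma ring_integral_add:
  assumes "continuous_on (closed_ring x0) F" "continuous_on (closed_ring x0) G"
  shows "ring_integral x0 N (\<lambda>z. F z + G z) = ring_integral x0 N F + ring_integral x0 N G"
  using Henstock_Kurzweil_Integration.integral_add[OF ring_integrable[OF assms(1), of "2 * (real N + 1)"]
       ring_integrable[OF assms(2), of "2 * (real N + 1)"]]
  by (simp add: ring_integral_def case_prod_unfold scaleR_add_right)

lemma ring_integral_diff:
  assumes "continuous_on (closed_ring x0) F" "continuous_on (closed_ring x0) G"
  shows "ring_integral x0 N (\<lambda>z. F z - G z) = ring_integral x0 N F - ring_integral x0 N G"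
  using Henstock_Kurzweil_Integration.integral_diff[OF ring_integrable[OF assms(1), of "2 * (real N + 1)"]
       ring_integrable[OF assms(2), of "2 * (real N + 1)"]]
  by (simp add: ring_integral_def case_prod_unfold scaleR_diff_right)

lemma ring_integral_cmult:
  fixes F :: "complex \<Rightarrow> 'a::{euclidean_space, real_normed_field}"
  shows "ring_integral x0 N (\<lambda>z. c * F z) = c * ring_integral x0 N F"
proof -
  have "(\<lambda>(x, t). exp (2 * (real N + 1) * x) *\<^sub>R (c * F (polar x t)))
      = (\<lambda>p. c * (case p of (x, t) \<Rightarrow> exp (2 * (real N + 1) * x) *\<^sub>R F (polar x t)))"
    by auto
  thus ?thesis by (simp add: ring_integral_def integral_mult_right)
qed

lemma ring_integral_sum:
  assumes "\<And>i. i \<in> I \<Longrightarrow> continuous_on (closed_ring x0) (F i)"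
  shows "ring_integral x0 N (\<lambda>z. \<Sum>i\<in>I. F i z) = (\<Sum>i\<in>I. ring_integral x0 N (F i))"
proof (cases "finite I")
  case True thus ?thesis using assms
  proof (induction I rule: finite_induct)
    case empty thus ?case by (simp add: ring_integral_def case_prod_unfold)
  next
    case (insert i I)
    thus ?case by (simp add: ring_integral_add continuous_on_sum)
  qed
qed (simp add: ring_integral_def case_prod_unfold)

lemma ring_integral_cong:
  assumes "\<And>z. z \<in> closed_ring x0 \<Longrightarrow> F z = G z"
  shows "ring_integral x0 N F = ring_integral x0 N G"
proof -
  have "integral (cbox (x0, 0) (0, 2 * pi)) (\<lambda>(x, t). exp (2 * (real N + 1) * x) *\<^sub>R F (polar x t))
      = integral (cbox (x0, 0) (0, 2 * pi)) (\<lambda>(x, t). exp (2 * (real N + 1) * x) *\<^sub>R G (polar x t))"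
    by (rule Henstock_Kurzweil_Integration.integral_cong) (auto simp: cbox_Pair_eq closed_ring_def intro!: assms)
  thus ?thesis by (simp add: ring_integral_def)
qed

lemma ring_integral_mono:
  fixes F G :: "complex \<Rightarrow> real"
  assumes "continuous_on (closed_ring x0) F" "continuous_on (closed_ring x0) G"
    "\<And>z. z \<in> closed_ring x0 \<Longrightarrow> F z \<le> G z"
  shows "ring_integral x0 N F \<le> ring_integral x0 N G"
  unfolding ring_integral_def
  by (intro scaleR_left_mono integral_le ring_integrable assms(1,2))
     (auto simp: cbox_Pair_eq closed_ring_def intro!: assms(3))

lemma ring_integral_norm_le:
  fixes F :: "complex \<Rightarrow> complex"
  assumes "continuous_on (closed_ring x0) F"
  shows "norm (ring_integral x0 N F) \<le> ring_integral x0 N (\<lambda>z. norm (F z))"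
proof -
  have c: "continuous_on (closed_ring x0) (\<lambda>z. norm (F z))" by (intro continuous_intros assms)
  have "norm (integral (cbox (x0, 0) (0, 2 * pi)) (\<lambda>(x, t). exp (2 * (real N + 1) * x) *\<^sub>R F (polar x t)))
     \<le> integral (cbox (x0, 0) (0, 2 * pi)) (\<lambda>(x, t). exp (2 * (real N + 1) * x) *\<^sub>R norm (F (polar x t)))"
    by (rule Henstock_Kurzweil_Integration.integral_norm_bound_integral[OF ring_integrable[OF assms] ring_integrable[OF c]]) auto
  thus ?thesis by (simp add: ring_integral_def mult_left_mono divide_right_mono)
qed

lemma ring_integral_of_real:
  assumes "continuous_on (closed_ring x0) F"
  shows "ring_integral x0 N (\<lambda>z. complex_of_real (F z)) = of_real (ring_integral x0 N F)"
proof -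
  have "((\<lambda>(x, t). exp (2 * (real N + 1) * x) *\<^sub>R F (polar x t)) has_integral
    integral (cbox (x0, 0) (0, 2 * pi)) (\<lambda>(x, t). exp (2 * (real N + 1) * x) *\<^sub>R F (polar x t))) (cbox (x0, 0) (0, 2 * pi))"
    by (intro integrable_integral ring_integrable assms)
  from has_integral_linear[OF this bounded_linear_of_real[where 'a=complex]]
  have "((\<lambda>(x, t). exp (2 * (real N + 1) * x) *\<^sub>R complex_of_real (F (polar x t))) has_integral
    of_real (integral (cbox (x0, 0) (0, 2 * pi)) (\<lambda>(x, t). exp (2 * (real N + 1) * x) *\<^sub>R F (polar x t)))) (cbox (x0, 0) (0, 2 * pi))"
    by (simp add: o_def case_prod_unfold scaleR_conv_of_real)
  from integral_unique[OF this] show ?thesis by (simp add: ring_integral_def scaleR_conv_of_real)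
qed

lemma ring_integral_cnj:
  assumes "continuous_on (closed_ring x0) F"
  shows "ring_integral x0 N (\<lambda>z. cnj (F z)) = cnj (ring_integral x0 N F)"
proof -
  have "((\<lambda>(x, t). exp (2 * (real N + 1) * x) *\<^sub>R F (polar x t)) has_integral
    integral (cbox (x0, 0) (0, 2 * pi)) (\<lambda>(x, t). exp (2 * (real N + 1) * x) *\<^sub>R F (polar x t))) (cbox (x0, 0) (0, 2 * pi))"
    by (intro integrable_integral ring_integrable assms)
  from has_integral_linear[OF this bounded_linear_cnj]
  have "((\<lambda>(x, t). exp (2 * (real N + 1) * x) *\<^sub>R cnj (F (polar x t))) has_integral
    cnj (integral (cbox (x0, 0) (0, 2 * pi)) (\<lambda>(x, t). exp (2 * (real N + 1) * x) *\<^sub>R F (polar x t)))) (cbox (x0, 0) (0, 2 * pi))"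
    by (simp add: o_def case_prod_unfold)
  from integral_unique[OF this] show ?thesis by (simp add: ring_integral_def)
qed

lemma integral_exp_interval:
  assumes "(x0::real) \<le> 0" "a > 0"
  shows "((\<lambda>x. exp (a * x)) has_integral (1 - exp (a * x0)) / a) {x0..0}"
proof -
  have "((\<lambda>x. exp (a * x)) has_integral exp (a * 0) / a - exp (a * x0) / a) {x0..0}"
    by (rule fundamental_theorem_of_calculus)
       (use assms in \<open>auto intro!: derivative_eq_intros simp flip: has_real_derivative_iff_has_vector_derivative\<close>)
  thus ?thesis by (simp add: diff_divide_distrib)
qed

text \<open>The prefactor \<open>N\<close> normalises the weight: its total mass is
  \<open>N / (N + 1)\<close> up to an exponentially small amount. Sup bounds therefore pass through
  uniformly in \<open>N\<close>.\<close>

lemma ring_integral_const_le: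
  fixes B :: real
  assumes "x0 \<le> 0" "B \<ge> 0"
  shows "ring_integral x0 N (\<lambda>_. B) \<le> B"
proof -
  have "continuous_on (cbox (x0, 0) (0, 2 * pi)) (\<lambda>(x, t::real). exp (2 * (real N + 1) * x) *\<^sub>R B)"
    by (auto simp: case_prod_unfold intro!: continuous_intros)
  from integral_prod_continuous[OF this]
  have "ring_integral x0 N (\<lambda>_. B) = real N / pi * integral {x0..0} (\<lambda>x. 2 * pi * B * exp (2 * (real N + 1) * x))"
    by (simp add: ring_integral_def mult_ac)
  also have "\<dots> = real N / pi * (2 * pi * B * ((1 - exp (2 * (real N + 1) * x0)) / (2 * (real N + 1))))"
    using integral_exp_interval[of x0 "2 * (real N + 1)"] assms by (simp add: integral_unique)
  also have "\<dots> = B * (real N / (real N + 1)) * (1 - exp (2 * (real N + 1) * x0))"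
    by (simp add: divide_simps)
  also have "\<dots> \<le> B * 1 * 1"
    using assms by (intro mult_mono mult_left_mono) (auto simp: mult_nonneg_nonpos)
  finally show ?thesis by simp
qed

lemma ring_integral_bound:
  fixes F :: "complex \<Rightarrow> complex"
  assumes "continuous_on (closed_ring x0) F" "x0 \<le> 0" "\<And>z. z \<in> closed_ring x0 \<Longrightarrow> norm (F z) \<le> B"
  shows "norm (ring_integral x0 N F) \<le> B"
proof -
  have "norm (F 1) \<le> B" using assms(2) by (intro assms(3)) (simp add: closed_ring_def)
  hence B: "B \<ge> 0" using norm_ge_zero order_trans by blast
  have "norm (ring_integral x0 N F) \<le> ring_integral x0 N (\<lambda>z. norm (F z))" by (rule ring_integral_norm_le[OF assms(1)])
  also have "\<dots> \<le> ring_integral x0 N (\<lambda>_. B)" by (rule ring_integral_mono) (use assms in \<open>auto intro!: continuous_intros\<close>)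
  also have "\<dots> \<le> B" by (rule ring_integral_const_le[OF assms(2) B])
  finally show ?thesis .
qed

lemma ring_integral_eq_iterated:
  fixes F :: "complex \<Rightarrow> complex"
  assumes "continuous_on (closed_ring x0) F" "x0 \<le> 0"
  shows "ring_integral x0 N F
     = of_nat N * integral {x0..0} (\<lambda>x. of_real (2 * exp (2 * (real N + 1) * x)) * radial_mean F x)"
proof -
  have "integral (cbox (x0, 0) (0, 2 * pi)) (\<lambda>(x, t). exp (2 * (real N + 1) * x) *\<^sub>R F (polar x t))
     = integral {x0..0} (\<lambda>x. integral {0..2*pi} (\<lambda>t. exp (2 * (real N + 1) * x) *\<^sub>R F (polar x t)))"
    using integral_prod_continuous[OF continuous_on_ring_integrand[OF assms(1)]] by simp
  also have "\<dots> = integral {x0..0} (\<lambda>x. pi * (of_real (2 * exp (2 * (real N + 1) * x)) * radial_mean F x))"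
  proof (rule Henstock_Kurzweil_Integration.integral_cong)
    fix x assume "x \<in> {x0..0}"
    hence "continuous_on (sphere 0 (exp x)) F"
      by (intro continuous_on_subset[OF assms(1)]) (auto simp: closed_ring_def)
    thus "integral {0..2*pi} (\<lambda>t. exp (2 * (real N + 1) * x) *\<^sub>R F (polar x t))
        = pi * (of_real (2 * exp (2 * (real N + 1) * x)) * radial_mean F x)"
      by (simp add: radial_mean_eq_integral scaleR_conv_of_real)
  qed
  also have "\<dots> = pi * integral {x0..0} (\<lambda>x. of_real (2 * exp (2 * (real N + 1) * x)) * radial_mean F x)"
    by (rule integral_mult_right)
  finally show ?thesis by (simp add: ring_integral_def scaleR_conv_of_real)
qed

text \<open>Differentiate \<open>exp (2 (N + 1) x)\<close> times the radial mean. The factor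
  \<open>2 (N + 1)\<close> is split as \<open>2 N + 2\<close>, and the derivative of the mean is
  twice the mean of \<open>F1\<close>; so only the holomorphic derivative appears, in the
  combination \<open>F1 + F\<close>.\<close>

lemma ring_integral_by_parts:
  fixes F :: "complex \<Rightarrow> complex"
  assumes ab: "a < x0" "x0 \<le> 0" "0 < b"
    and d: "\<And>z. exp a < norm z \<Longrightarrow> norm z < exp b \<Longrightarrow> has_log_deriv F (F1 z) (F2 z) z"
    and c: "continuous_on {z. exp a < norm z \<and> norm z < exp b} F1"
           "continuous_on {z. exp a < norm z \<and> norm z < exp b} F2"
    and N: "N \<ge> 1"
  shows "ring_integral x0 N F = circle_mean F - of_real (exp (2 * (real N + 1) * x0)) * radial_mean F x0
           - ring_integral x0 N (\<lambda>z. F1 z + F z) / of_nat N"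
proof -
  let ?R = "{z. exp a < norm z \<and> norm z < exp b}"
  have sub: "closed_ring x0 \<subseteq> ?R"
  proof
    fix z assume "z \<in> closed_ring x0"
    hence z: "exp x0 \<le> norm z" "norm z \<le> 1" by (auto simp: closed_ring_def)
    have e: "exp a < exp x0" "1 < exp b" using ab by auto
    show "z \<in> ?R" using less_le_trans[OF e(1) z(1)] le_less_trans[OF z(2) e(2)] by simp
  qed
  have cF: "continuous_on ?R F"
    by (intro continuous_at_imp_continuous_on ballI) (use d in \<open>auto simp: has_log_deriv_def intro: has_derivative_continuous\<close>)
  have cont: "continuous_on (closed_ring x0) F" "continuous_on (closed_ring x0) F1" "continuous_on (closed_ring x0) F2"
    using continuous_on_subset[OF _ sub] cF c by blast+
  have sph: "continuous_on (sphere 0 (exp x)) G" if "continuous_on ?R G" "x \<in> {x0..0}" for x G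
    by (rule continuous_on_subset[OF that(1)]) (use that ab in auto)
  define k where "k = 2 * (real N + 1)"
  have D: "((\<lambda>x. of_real (exp (k * x)) * radial_mean F x) has_vector_derivative
        of_real N * (of_real (2 * exp (k * x)) * radial_mean F x) + of_real (2 * exp (k * x)) * radial_mean (\<lambda>z. F1 z + F z) x) (at x within {x0..0})"
    if x: "x \<in> {x0..0}" for x
  proof -
    have xab: "a < x" "x < b" using x ab by auto
    have m: "(radial_mean F has_vector_derivative radial_mean (\<lambda>z. F1 z + F2 z) x) (at x within {x0..0})"
      by (rule has_vector_derivative_at_within[OF radial_mean_has_derivative(1)[OF d c xab]])
    have e: "((\<lambda>x. complex_of_real (exp (k * x))) has_vector_derivative of_real (k * exp (k * x))) (at x within {x0..0})"
    proof (rule bounded_linear.has_vector_derivative[OF bounded_linear_of_real])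
      show "((\<lambda>x. exp (k * x)) has_vector_derivative k * exp (k * x)) (at x within {x0..0})"
        by (auto intro!: derivative_eq_intros simp flip: has_real_derivative_iff_has_vector_derivative)
    qed
    have "radial_mean (\<lambda>z. F1 z + F2 z) x = radial_mean F1 x + radial_mean F2 x"
      by (rule radial_mean_add) (use x c in \<open>auto intro!: sph\<close>)
    also have "\<dots> = 2 * radial_mean F1 x" using radial_mean_has_derivative(2)[OF d c xab] by simp
    finally have m2: "radial_mean (\<lambda>z. F1 z + F2 z) x = 2 * radial_mean F1 x" .
    have m3: "radial_mean (\<lambda>z. F1 z + F z) x = radial_mean F1 x + radial_mean F x"
      by (rule radial_mean_add) (use x c cF in \<open>auto intro!: sph\<close>)
    show ?thesis
      by (rule has_vector_derivative_eq_rhs[OF has_vector_derivative_mult[OF e m]])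
         (simp only: m2 m3, simp add: k_def algebra_simps)
  qed
  have I: "integral {x0..0} (\<lambda>x. of_real N * (of_real (2 * exp (k * x)) * radial_mean F x)
            + of_real (2 * exp (k * x)) * radial_mean (\<lambda>z. F1 z + F z) x)
        = circle_mean F - of_real (exp (k * x0)) * radial_mean F x0"
    using integral_unique[OF fundamental_theorem_of_calculus[OF _ D]] ab by (simp add: radial_mean_0)
  have cm: "continuous_on {x0..0} (radial_mean G)" if "continuous_on (closed_ring x0) G" for G :: "complex \<Rightarrow> complex"
  proof -
    have "continuous_on {x0..0} (\<lambda>x. integral (cbox 0 (2*pi)) (\<lambda>t. G (polar x t)) / (2*pi))"
    proof (intro continuous_intros integral_continuous_on_param)
      have "continuous_on ({x0..0} \<times> cbox 0 (2 * pi)) (\<lambda>p. G (polar (fst p) (snd p)))"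
        by (rule continuous_on_compose2[OF that continuous_on_polar]) (auto simp: closed_ring_def)
      thus "continuous_on ({x0..0} \<times> cbox 0 (2 * pi)) (\<lambda>(x, t). G (polar x t))" by (simp add: case_prod_unfold)
    qed auto
    moreover have "integral (cbox 0 (2*pi)) (\<lambda>t. G (polar x t)) / (2*pi) = radial_mean G x" if x: "x \<in> {x0..0}" for x
    proof -
      have "continuous_on (sphere 0 (exp x)) G"
        by (rule continuous_on_subset[OF \<open>continuous_on (closed_ring x0) G\<close>]) (use x in \<open>auto simp: closed_ring_def\<close>)
      thus ?thesis by (simp add: radial_mean_eq_integral)
    qed
    ultimately show ?thesis by (subst continuous_on_cong[OF refl, of _ _ "\<lambda>x. integral (cbox 0 (2*pi)) (\<lambda>t. G (polar x t)) / (2*pi)"]) auto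
  qed
  have "continuous_on (closed_ring x0) (\<lambda>z. F1 z + F z)" by (intro continuous_intros cont)
  note cm2 = cm[OF this] and it2 = ring_integral_eq_iterated[OF this ab(2), of N]
  have "integral {x0..0} (\<lambda>x. of_real N * (of_real (2 * exp (k * x)) * radial_mean F x)
            + of_real (2 * exp (k * x)) * radial_mean (\<lambda>z. F1 z + F z) x)
     = integral {x0..0} (\<lambda>x. of_real N * (of_real (2 * exp (k * x)) * radial_mean F x))
       + integral {x0..0} (\<lambda>x. of_real (2 * exp (k * x)) * radial_mean (\<lambda>z. F1 z + F z) x)"
    by (intro Henstock_Kurzweil_Integration.integral_add integrable_continuous_real continuous_intros cm cm2 cont)
  also have "integral {x0..0} (\<lambda>x. of_real N * (of_real (2 * exp (k * x)) * radial_mean F x)) = ring_integral x0 N F"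
    using ring_integral_eq_iterated[OF cont(1) ab(2), of N] by (simp add: k_def)
  also have "integral {x0..0} (\<lambda>x. of_real (2 * exp (k * x)) * radial_mean (\<lambda>z. F1 z + F z) x)
      = ring_integral x0 N (\<lambda>z. F1 z + F z) / of_nat N"
    using it2 N by (simp add: k_def)
  finally show ?thesis using I by (simp add: k_def algebra_simps)
qed

lemma ring_integral_log_deriv_eq:
  assumes ab: "a < x0" "x0 \<le> 0" "0 < b"
    and d: "\<And>z. exp a < norm z \<Longrightarrow> norm z < exp b \<Longrightarrow> has_log_deriv F (F1 z) (F2 z) z"
    and c: "continuous_on {z. exp a < norm z \<and> norm z < exp b} F1"
           "continuous_on {z. exp a < norm z \<and> norm z < exp b} F2"
  shows "ring_integral x0 N F1 = ring_integral x0 N F2"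
proof -
  have "closed_ring x0 \<subseteq> {z. exp a < norm z \<and> norm z < exp b}"
  proof
    fix z assume "z \<in> closed_ring x0"
    hence z: "exp x0 \<le> norm z" "norm z \<le> 1" by (auto simp: closed_ring_def)
    have e: "exp a < exp x0" "1 < exp b" using ab by auto
    show "z \<in> {z. exp a < norm z \<and> norm z < exp b}"
      using less_le_trans[OF e(1) z(1)] le_less_trans[OF z(2) e(2)] by simp
  qed
  hence cont: "continuous_on (closed_ring x0) F1" "continuous_on (closed_ring x0) F2"
    using continuous_on_subset c by blast+
  show ?thesis
    unfolding ring_integral_eq_iterated[OF cont(1) ab(2)] ring_integral_eq_iterated[OF cont(2) ab(2)]
    using radial_mean_has_derivative(2)[OF d c] ab
    by (intro arg_cong[of _ _ "\<lambda>x. of_nat N * x"] Henstock_Kurzweil_Integration.integral_cong) auto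
qed

text \<open>Discriminant argument for the form obtained by integrating
  \<open>(u |F| - v |G|)^2\<close>, which uses only linearity and monotonicity of the ring
  integral.\<close>

lemma ring_integral_Cauchy_Schwarz:
  fixes F G :: "complex \<Rightarrow> complex"
  assumes cF: "continuous_on (closed_ring x0) F" and cG: "continuous_on (closed_ring x0) G"
  shows "ring_integral x0 N (\<lambda>z. norm (F z) * norm (G z))
    \<le> sqrt (ring_integral x0 N (\<lambda>z. (norm (F z))\<^sup>2)) * sqrt (ring_integral x0 N (\<lambda>z. (norm (G z))\<^sup>2))"
proof -
  define A B I where "A = ring_integral x0 N (\<lambda>z. (norm (F z))\<^sup>2)" and "B = ring_integral x0 N (\<lambda>z. (norm (G z))\<^sup>2)"
    and "I = ring_integral x0 N (\<lambda>z. norm (F z) * norm (G z))"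
  have c: "continuous_on (closed_ring x0) (\<lambda>z. (norm (F z))\<^sup>2)" "continuous_on (closed_ring x0) (\<lambda>z. (norm (G z))\<^sup>2)"
     "continuous_on (closed_ring x0) (\<lambda>z. norm (F z) * norm (G z))"
    by (intro continuous_intros cF cG)+
  have quad: "0 \<le> u\<^sup>2 * A - 2 * u * v * I + v\<^sup>2 * B" for u v
  proof -
    have "0 = ring_integral x0 N (\<lambda>_. 0 :: real)" by (simp add: ring_integral_def case_prod_unfold)
    also have "\<dots> \<le> ring_integral x0 N (\<lambda>z. (u * norm (F z) - v * norm (G z))\<^sup>2)"
      by (rule ring_integral_mono) (auto intro!: continuous_intros cF cG)
    also have "(\<lambda>z. (u * norm (F z) - v * norm (G z))\<^sup>2)
        = (\<lambda>z. (u\<^sup>2 * (norm (F z))\<^sup>2 - (2 * u * v) * (norm (F z) * norm (G z))) + v\<^sup>2 * (norm (G z))\<^sup>2)"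
      by (auto simp: power2_eq_square algebra_simps)
    also have "ring_integral x0 N \<dots> = u\<^sup>2 * A - 2 * u * v * I + v\<^sup>2 * B"
    proof -
      have "ring_integral x0 N (\<lambda>z. (u\<^sup>2 * (norm (F z))\<^sup>2 - (2 * u * v) * (norm (F z) * norm (G z))) + v\<^sup>2 * (norm (G z))\<^sup>2)
          = ring_integral x0 N (\<lambda>z. u\<^sup>2 * (norm (F z))\<^sup>2 - (2 * u * v) * (norm (F z) * norm (G z)))
            + ring_integral x0 N (\<lambda>z. v\<^sup>2 * (norm (G z))\<^sup>2)"
        by (rule ring_integral_add) (intro continuous_intros cF cG)+
      also have "ring_integral x0 N (\<lambda>z. u\<^sup>2 * (norm (F z))\<^sup>2 - (2 * u * v) * (norm (F z) * norm (G z)))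
          = ring_integral x0 N (\<lambda>z. u\<^sup>2 * (norm (F z))\<^sup>2) - ring_integral x0 N (\<lambda>z. (2 * u * v) * (norm (F z) * norm (G z)))"
        by (rule ring_integral_diff) (intro continuous_intros cF cG)+
      finally show ?thesis by (simp only: ring_integral_cmult A_def B_def I_def)
    qed
    finally show ?thesis .
  qed
  have A0: "A \<ge> 0" and B0: "B \<ge> 0" using quad[of 1 0] quad[of 0 1] by auto
  have "I\<^sup>2 \<le> A * B"
  proof (cases "A = 0")
    case True
    have "I = 0"
    proof (rule ccontr)
      assume "I \<noteq> 0"
      \<comment> \<open>With these values the quadratic form would equal \<open>-1\<close>.\<close>
      with quad[of "(B + 1) / (2 * I)" 1] True B0 show False by simp
    qed
    thus ?thesis using True by simp
  next
    case False
    have "0 \<le> A * (A * B - I\<^sup>2)" using quad[of I A] by (simp add: power2_eq_square algebra_simps)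
    thus ?thesis using False A0 by (simp add: zero_le_mult_iff)
  qed
  hence "I \<le> sqrt (A * B)" by (rule real_le_rsqrt)
  thus ?thesis by (simp add: A_def B_def I_def real_sqrt_mult)
qed

section \<open>Laplace expansion\<close>

text \<open>Induction on \<open>k\<close>: write \<open>r\<close> as the square of its root, spend
  one root on the induction hypothesis and the other on the single additional factor
  \<open>N\<close>.\<close>

lemma power_decay:
  assumes "0 \<le> r" "r < (1::real)"
  obtains C where "C \<ge> 0" "\<And>N::nat. r ^ N * real N ^ k \<le> C"
proof -
  have "\<exists>C\<ge>0. \<forall>N::nat. r ^ N * real N ^ k \<le> C"
    using assms
  proof (induction k arbitrary: r)
    case 0
    thus ?case by (intro exI[of _ 1]) (auto intro: power_le_one)
  next
    case (Suc k)
    define s where "s = sqrt r"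
    have s: "0 \<le> s" "s < 1" "r = s * s" using Suc.prems by (auto simp: s_def)
    from Suc.IH[OF s(1,2)] obtain C where C: "C \<ge> 0" "\<And>N::nat. s ^ N * real N ^ k \<le> C" by blast
    have "(\<lambda>n. of_nat n * s ^ n) \<longlonglongrightarrow> 0" by (rule powser_times_n_limit_0) (use s in auto)
    hence "Bseq (\<lambda>n. of_nat n * s ^ n)" by (intro convergent_imp_Bseq convergentI)
    then obtain C' where C': "C' > 0" "\<And>n::nat. norm (real n * s ^ n) \<le> C'" unfolding Bseq_def by blast
    have "r ^ N * real N ^ Suc k \<le> C * C'" for N
    proof -
      have "r ^ N * real N ^ Suc k = (s ^ N * real N ^ k) * (real N * s ^ N)"
        by (simp add: s power_mult_distrib)
      also have "\<dots> \<le> C * C'"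
        using C C'(2)[of N] s C'(1) by (intro mult_mono) auto
      finally show ?thesis .
    qed
    thus ?case using C C' by (intro exI[of _ "C * C'"]) auto
  qed
  thus thesis using that by blast
qed

lemma exp_decay:
  assumes "x0 < 0"
  obtains C where "C \<ge> 0" "\<And>N. N \<ge> 1 \<Longrightarrow> exp (2 * (real N + 1) * x0) \<le> C / real N ^ k"
proof -
  have "exp x0 < 1" using assms by simp
  then obtain C where C: "C \<ge> 0" "\<And>N::nat. exp x0 ^ N * real N ^ k \<le> C" using power_decay[of "exp x0" k] by auto
  have "exp (2 * (real N + 1) * x0) \<le> C / real N ^ k" if "N \<ge> 1" for N
  proof -
    have "exp (2 * (real N + 1) * x0) \<le> exp (real N * x0)"
      using assms by (simp add: mult_right_mono_neg)
    also have "\<dots> = exp x0 ^ N" by (simp add: exp_of_nat_mult)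
    also have "\<dots> \<le> C / real N ^ k" using C(2)[of N] that by (simp add: field_simps)
    finally show ?thesis .
  qed
  thus thesis using that C by blast
qed

text \<open>\<open>Aop\<close> is \<open>-(r/2) d/dr\<close>, and \<open>Bop\<close> below is
  \<open>Aop\<close> minus the identity, both written through \<open>ld\<close> and
  \<open>ldb\<close> so that the calculus on annuli applies. On \<open>log_smooth\<close> functions
  they agree with the operators built from \<open>r_dr\<close>.\<close>

definition Aop :: "(complex \<Rightarrow> complex) \<Rightarrow> complex \<Rightarrow> complex" where
  "Aop h = (\<lambda>w. - (1/2) * (ld h w + ldb h w))"

definition Bop :: "(complex \<Rightarrow> complex) \<Rightarrow> complex \<Rightarrow> complex" where
  "Bop h = (\<lambda>w. Aop h w - h w)"

context
  fixes \<rho> :: real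
  assumes \<rho>: "0 < \<rho>" "\<rho> < 1"
begin

lemma log_smooth_cmult: "log_smooth b \<rho> f \<Longrightarrow> log_smooth b \<rho> (\<lambda>z. c * f z)"
  by (intro log_smooth_mult log_smooth_const \<rho>)

lemma log_smooth_diff: "log_smooth b \<rho> f \<Longrightarrow> log_smooth b \<rho> g \<Longrightarrow> log_smooth b \<rho> (\<lambda>z. f z - g z)"
  using log_smooth_add[OF \<rho>, of b f "\<lambda>z. (-1) * g z"] log_smooth_cmult[of b g "-1"] by simp

lemma log_smooth_sum:
  "(\<And>i. i \<in> I \<Longrightarrow> log_smooth b \<rho> (f i)) \<Longrightarrow> log_smooth b \<rho> (\<lambda>z. \<Sum>i\<in>I. f i z)"
  by (induction I rule: infinite_finite_induct) (auto intro!: log_smooth_add log_smooth_const \<rho>)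

lemma log_smooth_Aop: "log_smooth b \<rho> f \<Longrightarrow> log_smooth b \<rho> (Aop f)"
  unfolding Aop_def by (intro log_smooth_cmult log_smooth_add log_smooth_ld log_smooth_ldb \<rho>)

lemma log_smooth_Bop: "log_smooth b \<rho> f \<Longrightarrow> log_smooth b \<rho> (Bop f)"
  unfolding Bop_def by (intro log_smooth_diff log_smooth_Aop)

lemma log_smooth_Aop_funpow: "log_smooth b \<rho> f \<Longrightarrow> log_smooth b \<rho> ((Aop ^^ m) f)"
  by (induction m) (auto intro: log_smooth_Aop)

lemma log_smooth_Bop_funpow: "log_smooth b \<rho> f \<Longrightarrow> log_smooth b \<rho> ((Bop ^^ m) f)"
  by (induction m) (auto intro: log_smooth_Bop)

lemma has_log_deriv_cong_annulus:
  assumes "log_smooth b \<rho> f" "\<And>w. w \<in> annulus \<rho> \<Longrightarrow> g w = f w" "z \<in> annulus \<rho>"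
  shows "has_log_deriv g (ld f z) (ldb f z) z"
  by (rule has_log_deriv_transform[OF log_smooth_log_deriv[OF \<rho>(1) assms(1)] open_annulus])
     (use assms in auto)

lemma r_dr_cong_annulus:
  assumes "log_smooth b \<rho> f" "\<And>w. w \<in> annulus \<rho> \<Longrightarrow> g w = f w" "z \<in> annulus \<rho>"
  shows "r_dr g z = ld f z + ldb f z"
  using has_log_deriv_cong_annulus[OF assms] annulus_nonzero[OF \<rho>(1) assms(3)]
  by (simp add: r_dr_eq_log_deriv has_log_deriv_differentiable has_log_deriv_unique)

lemma Aop_cong: "log_smooth b \<rho> f \<Longrightarrow> (\<And>w. w \<in> annulus \<rho> \<Longrightarrow> g w = f w) \<Longrightarrow> z \<in> annulus \<rho> \<Longrightarrow> Aop g z = Aop f z"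
  using has_log_deriv_cong_annulus[of b f g z] by (simp add: Aop_def has_log_deriv_unique)

lemma Bop_cong: "log_smooth b \<rho> f \<Longrightarrow> (\<And>w. w \<in> annulus \<rho> \<Longrightarrow> g w = f w) \<Longrightarrow> z \<in> annulus \<rho> \<Longrightarrow> Bop g z = Bop f z"
  using Aop_cong[of b f g z] by (simp add: Bop_def)

lemma Aop_funpow_r_dr:
  assumes "log_smooth b \<rho> f" "z \<in> annulus \<rho>"
  shows "((\<lambda>h w. - (1/2) * r_dr h w) ^^ m) f z = (Aop ^^ m) f z"
  using assms(2)
proof (induction m arbitrary: z)
  case 0 thus ?case by simp
next
  case (Suc m)
  show ?case using r_dr_cong_annulus[OF log_smooth_Aop_funpow[OF assms(1), of m] Suc.IH Suc.prems]
    by (simp add: Aop_def[of "(Aop ^^ m) f"])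
qed

lemma Bop_funpow_r_dr:
  assumes "log_smooth b \<rho> f" "z \<in> annulus \<rho>"
  shows "((\<lambda>h w. - (1/2) * r_dr h w - h w) ^^ m) f z = (Bop ^^ m) f z"
  using assms(2)
proof (induction m arbitrary: z)
  case 0 thus ?case by simp
next
  case (Suc m)
  show ?case using r_dr_cong_annulus[OF log_smooth_Bop_funpow[OF assms(1), of m] Suc.IH Suc.prems] Suc.IH[OF Suc.prems]
    by (simp add: Bop_def[of "(Bop ^^ m) f"] Aop_def)
qed

lemma Bop_mult:
  assumes "log_smooth b \<rho> f" "log_smooth b \<rho> g" "z \<in> annulus \<rho>"
  shows "Bop (\<lambda>w. f w * g w) z = Aop f z * g z + f z * Bop g z"
  using has_log_deriv_unique[OF has_log_deriv_mult[OF log_smooth_log_deriv[OF \<rho>(1) assms(1,3)] log_smooth_log_deriv[OF \<rho>(1) assms(2,3)]]]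
  by (simp add: Bop_def Aop_def field_simps)

lemma Aop_cmult_sum:
  assumes "\<And>i. i \<in> I \<Longrightarrow> log_smooth b \<rho> (f i)" "z \<in> annulus \<rho>"
  shows "Aop (\<lambda>w. \<Sum>i\<in>I. c i * f i w) z = (\<Sum>i\<in>I. c i * Aop (f i) z)"
  using assms(1)
proof (induction I rule: infinite_finite_induct)
  case (insert i I)
  have cm: "Aop (\<lambda>w. c i * f i w) z = c i * Aop (f i) z"
  proof -
    have "has_log_deriv (\<lambda>_. c i) 0 0 z" using annulus_nonzero[OF \<rho>(1) assms(2)] by (simp add: has_log_deriv_def)
    from has_log_deriv_unique[OF has_log_deriv_mult[OF this log_smooth_log_deriv[OF \<rho>(1) insert.prems assms(2)], of i]]
    show ?thesis by (simp add: Aop_def algebra_simps)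
  qed
  have "log_smooth b \<rho> (\<lambda>w. c i * f i w)" "log_smooth b \<rho> (\<lambda>w. \<Sum>i\<in>I. c i * f i w)"
    using insert.prems by (auto intro!: log_smooth_cmult log_smooth_sum)
  from has_log_deriv_unique[OF has_log_deriv_add[OF log_smooth_log_deriv[OF \<rho>(1) this(1) assms(2)] log_smooth_log_deriv[OF \<rho>(1) this(2) assms(2)]]]
  have "Aop (\<lambda>w. c i * f i w + (\<Sum>i\<in>I. c i * f i w)) z = Aop (\<lambda>w. c i * f i w) z + Aop (\<lambda>w. \<Sum>i\<in>I. c i * f i w) z"
    by (simp add: Aop_def field_simps)
  thus ?case using insert cm by simp
next
  case empty
  have "has_log_deriv (\<lambda>_. 0) 0 0 z" using annulus_nonzero[OF \<rho>(1) assms(2)] by (simp add: has_log_deriv_def)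
  from has_log_deriv_unique[OF this] show ?case by (simp add: Aop_def)
next
  case (infinite I)
  have "has_log_deriv (\<lambda>_. 0) 0 0 z" using annulus_nonzero[OF \<rho>(1) assms(2)] by (simp add: has_log_deriv_def)
  from has_log_deriv_unique[OF this] show ?case using infinite by (simp add: Aop_def)
qed

text \<open>\<open>Aop\<close> is a derivation and \<open>Bop\<close> is \<open>Aop\<close> minus
  the identity, so on a product \<open>Bop\<close> acts as \<open>Aop\<close> on the first factor
  plus \<open>Bop\<close> on the second. The iterates follow as in the binomial theorem; these are
  the binomial coefficients of \<open>W_op\<close>.\<close>

lemma Bop_funpow_mult:
  assumes f: "log_smooth b \<rho> f" and g: "log_smooth b \<rho> g" and z: "z \<in> annulus \<rho>"
  shows "(Bop ^^ m) (\<lambda>w. f w * g w) z = (\<Sum>\<nu>\<le>m. of_nat (m choose \<nu>) * ((Aop ^^ \<nu>) f z * (Bop ^^ (m - \<nu>)) g z))"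
  using z
proof (induction m arbitrary: z)
  case 0 thus ?case by simp
next
  case (Suc m)
  let ?t = "\<lambda>\<nu> w. (Aop ^^ \<nu>) f w * (Bop ^^ (m - \<nu>)) g w"
  let ?S = "\<lambda>w. \<Sum>\<nu>\<le>m. of_nat (m choose \<nu>) * ?t \<nu> w"
  have t: "log_smooth b \<rho> (?t \<nu>)" for \<nu>
    by (intro log_smooth_mult log_smooth_Aop_funpow log_smooth_Bop_funpow f g \<rho>)
  have S: "log_smooth b \<rho> ?S" by (intro log_smooth_sum log_smooth_cmult t)
  have "(Bop ^^ Suc m) (\<lambda>w. f w * g w) z = Bop ?S z"
    using Bop_cong[OF S Suc.IH Suc.prems] by simp
  also have "\<dots> = (\<Sum>\<nu>\<le>m. of_nat (m choose \<nu>) * Bop (?t \<nu>) z)"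
    by (subst Bop_def, subst Aop_cmult_sum[OF t Suc.prems])
       (simp add: Bop_def sum_subtractf[symmetric] algebra_simps)
  also have "\<dots> = (\<Sum>\<nu>\<le>m. of_nat (m choose \<nu>) * ((Aop ^^ Suc \<nu>) f z * (Bop ^^ (m - \<nu>)) g z))
      + (\<Sum>\<nu>\<le>m. of_nat (m choose \<nu>) * ((Aop ^^ \<nu>) f z * (Bop ^^ (Suc m - \<nu>)) g z))"
    unfolding sum.distrib[symmetric]
  proof (rule sum.cong[OF refl])
    fix \<nu> assume "\<nu> \<in> {..m}"
    hence "Suc m - \<nu> = Suc (m - \<nu>)" by auto
    thus "of_nat (m choose \<nu>) * Bop (?t \<nu>) z =
      of_nat (m choose \<nu>) * ((Aop ^^ Suc \<nu>) f z * (Bop ^^ (m - \<nu>)) g z)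
      + of_nat (m choose \<nu>) * ((Aop ^^ \<nu>) f z * (Bop ^^ (Suc m - \<nu>)) g z)"
      by (subst Bop_mult[OF log_smooth_Aop_funpow[OF f] log_smooth_Bop_funpow[OF g] Suc.prems])
         (simp add: algebra_simps)
  qed
  also have "(\<Sum>\<nu>\<le>m. of_nat (m choose \<nu>) * ((Aop ^^ \<nu>) f z * (Bop ^^ (Suc m - \<nu>)) g z))
     = (\<Sum>\<nu>\<le>Suc m. of_nat (m choose \<nu>) * ((Aop ^^ \<nu>) f z * (Bop ^^ (Suc m - \<nu>)) g z))"
    by simp
  also have "\<dots> = (Bop ^^ Suc m) g z * f z
     + (\<Sum>\<nu>\<le>m. of_nat (m choose Suc \<nu>) * ((Aop ^^ Suc \<nu>) f z * (Bop ^^ (m - \<nu>)) g z))"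
    by (subst sum.atMost_Suc_shift) (simp add: mult.commute)
  also have "(\<Sum>\<nu>\<le>m. of_nat (m choose \<nu>) * ((Aop ^^ Suc \<nu>) f z * (Bop ^^ (m - \<nu>)) g z)) + \<dots>
     = (\<Sum>\<nu>\<le>Suc m. of_nat (Suc m choose \<nu>) * ((Aop ^^ \<nu>) f z * (Bop ^^ (Suc m - \<nu>)) g z))"
    unfolding sum.atMost_Suc_shift by (simp add: sum.distrib[symmetric] algebra_simps)
  finally show ?case .
qed

lemma closed_ring_subset_annulus:
  assumes "ln \<rho> < x0"
  shows "closed_ring x0 \<subseteq> annulus \<rho>"
proof
  fix z assume "z \<in> closed_ring x0"
  moreover have "\<rho> < exp x0" using assms \<rho> by (metis exp_less_mono exp_ln)
  moreover have "1 < 1 / \<rho>" using \<rho> by simp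
  ultimately show "z \<in> annulus \<rho>" by (auto simp: closed_ring_def annulus_def)
qed

lemma annulus_eq_exp: "annulus \<rho> = {z. exp (ln \<rho>) < norm z \<and> norm z < exp (- ln \<rho>)}"
  using \<rho> by (simp add: annulus_def exp_minus inverse_eq_divide)

lemma log_smooth_continuous_ring:
  "log_smooth b \<rho> f \<Longrightarrow> ln \<rho> < x0 \<Longrightarrow> continuous_on (closed_ring x0) f"
  using log_smooth_continuous closed_ring_subset_annulus continuous_on_subset by blast

lemma compact_closed_ring: "compact (closed_ring x0)"
proof -
  have "closed_ring x0 = {z. exp x0 \<le> norm z} \<inter> cball 0 1" by (auto simp: closed_ring_def)
  moreover have "closed {z::complex. exp x0 \<le> norm z}" by (intro closed_Collect_le continuous_intros)
  ultimately show ?thesis by (simp add: closed_Int_compact)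
qed

lemma continuous_on_ring_bounded:
  assumes "continuous_on (closed_ring x0) (f :: complex \<Rightarrow> 'a::real_normed_vector)"
  obtains B where "B \<ge> 0" "\<And>z. z \<in> closed_ring x0 \<Longrightarrow> norm (f z) \<le> B"
proof -
  have "bounded (f ` closed_ring x0)"
    by (intro compact_imp_bounded compact_continuous_image assms compact_closed_ring)
  then obtain B where "B > 0" "\<forall>w\<in>closed_ring x0. norm (f w) \<le> B" unfolding bounded_pos by blast
  thus thesis using that[of B] by auto
qed

lemma log_smooth_by_parts:
  assumes f: "log_smooth b \<rho> f" and x0: "ln \<rho> < x0" "x0 \<le> 0" and N: "N \<ge> 1"
  shows "ring_integral x0 N f = circle_mean f - of_real (exp (2 * (real N + 1) * x0)) * radial_mean f x0
           - ring_integral x0 N (\<lambda>z. ld f z + f z) / of_nat N"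
  by (rule ring_integral_by_parts[of "ln \<rho>" x0 "- ln \<rho>" f "ld f" "ldb f"])
     (use x0 \<rho> N in \<open>auto simp: annulus_eq_exp intro!: log_smooth_log_deriv[OF \<rho>(1) f]
        log_smooth_continuous[OF log_smooth_ld[OF f], unfolded annulus_eq_exp]
        log_smooth_continuous[OF log_smooth_ldb[OF f], unfolded annulus_eq_exp] simp del: exp_ln\<close>)

lemma ring_integral_ld_eq_ldb:
  assumes f: "log_smooth b \<rho> f" and x0: "ln \<rho> < x0" "x0 \<le> 0"
  shows "ring_integral x0 N (ld f) = ring_integral x0 N (ldb f)"
  by (rule ring_integral_log_deriv_eq[of "ln \<rho>" x0 "- ln \<rho>" f "ld f" "ldb f"])
     (use x0 \<rho> in \<open>auto simp: annulus_eq_exp intro!: log_smooth_log_deriv[OF \<rho>(1) f]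
        log_smooth_continuous[OF log_smooth_ld[OF f], unfolded annulus_eq_exp]
        log_smooth_continuous[OF log_smooth_ldb[OF f], unfolded annulus_eq_exp] simp del: exp_ln\<close>)

text \<open>\<open>ld f\<close> and \<open>ldb f\<close> have the same ring integral, so
  \<open>ld f\<close> may be replaced by half their sum. Integration by parts thereby takes the
  purely radial form: circle mean plus the ring integral of \<open>Bop f\<close> divided by
  \<open>N\<close>, up to the inner boundary term.\<close>

lemma ring_integral_Bop:
  assumes f: "log_smooth b \<rho> f" and x0: "ln \<rho> < x0" "x0 \<le> 0"
  shows "ring_integral x0 N (\<lambda>z. ld f z + f z) = - ring_integral x0 N (Bop f)"
proof -
  note c = log_smooth_continuous_ring[OF f x0(1)] log_smooth_continuous_ring[OF log_smooth_ld[OF f] x0(1)]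
    log_smooth_continuous_ring[OF log_smooth_ldb[OF f] x0(1)]
  have "ring_integral x0 N (Bop f) = -(1/2) * (ring_integral x0 N (ld f) + ring_integral x0 N (ldb f)) - ring_integral x0 N f"
  proof -
    have "ring_integral x0 N (Bop f) = ring_integral x0 N (\<lambda>w. - (1/2) * (ld f w + ldb f w)) - ring_integral x0 N f"
      unfolding Bop_def Aop_def by (intro ring_integral_diff continuous_intros c)
    thus ?thesis using c by (simp only: ring_integral_cmult ring_integral_add)
  qed
  thus ?thesis using ring_integral_ld_eq_ldb[OF assms, of N] c by (simp add: ring_integral_add)
qed

text \<open>Each integration by parts produces one circle mean and gains a factor
  \<open>1 / N\<close>. The boundary term on the inner circle is exponentially small and is absorbed
  into whatever power of \<open>N\<close> is called for.\<close>

lemma ring_integral_expansion: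
  assumes f: "log_smooth b \<rho> f" and x0: "ln \<rho> < x0" "x0 < 0"
  shows "\<exists>C. \<forall>N\<ge>1. norm (ring_integral x0 N f - (\<Sum>m\<le>\<kappa>. circle_mean ((Bop ^^ m) f) / of_nat N ^ m))
             \<le> C / real N ^ (\<kappa> + 1)"
  using f
proof (induction \<kappa> arbitrary: f)
  have step: "\<exists>C\<ge>0. \<forall>N\<ge>1. norm (ring_integral x0 N f - (circle_mean f + ring_integral x0 N (Bop f) / of_nat N)) \<le> C / real N ^ k"
    if f: "log_smooth b \<rho> f" for f k
  proof -
    obtain C where C: "C \<ge> 0" "\<And>N. N \<ge> 1 \<Longrightarrow> exp (2 * (real N + 1) * x0) \<le> C / real N ^ k"
      using exp_decay[OF x0(2), of k] by blast
    have "norm (ring_integral x0 N f - (circle_mean f + ring_integral x0 N (Bop f) / of_nat N)) \<le> C * norm (radial_mean f x0) / real N ^ k"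
      if "N \<ge> 1" for N
    proof -
      have "ring_integral x0 N f - (circle_mean f + ring_integral x0 N (Bop f) / of_nat N)
          = - (of_real (exp (2 * (real N + 1) * x0)) * radial_mean f x0)"
        using log_smooth_by_parts[OF f x0(1) _ that] ring_integral_Bop[OF f x0(1), of N] x0 by simp
      hence "norm (ring_integral x0 N f - (circle_mean f + ring_integral x0 N (Bop f) / of_nat N))
         = exp (2 * (real N + 1) * x0) * norm (radial_mean f x0)" by (simp add: norm_mult)
      also have "\<dots> \<le> C / real N ^ k * norm (radial_mean f x0)" by (intro mult_right_mono C that) auto
      finally show ?thesis by simp
    qed
    thus ?thesis using C by (intro exI[of _ "C * norm (radial_mean f x0)"]) auto
  qed
  {
    case 0
    obtain C where C: "C \<ge> 0" "\<And>N. N \<ge> 1 \<Longrightarrow> norm (ring_integral x0 N f - (circle_mean f + ring_integral x0 N (Bop f) / of_nat N)) \<le> C / real N ^ 1"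
      using step[OF 0, of 1] by blast
    have cB: "continuous_on (closed_ring x0) (Bop f)" by (rule log_smooth_continuous_ring[OF log_smooth_Bop[OF 0] x0(1)])
    obtain B where B: "B \<ge> 0" "\<And>z. z \<in> closed_ring x0 \<Longrightarrow> norm (Bop f z) \<le> B" using continuous_on_ring_bounded[OF cB] by blast
    have "norm (ring_integral x0 N f - circle_mean f) \<le> (C + B) / real N" if N: "N \<ge> 1" for N
    proof -
      have "norm (ring_integral x0 N f - circle_mean f) \<le>
         norm (ring_integral x0 N f - (circle_mean f + ring_integral x0 N (Bop f) / of_nat N)) + norm (ring_integral x0 N (Bop f) / of_nat N)"
        using norm_triangle_ineq[of "ring_integral x0 N f - (circle_mean f + ring_integral x0 N (Bop f) / of_nat N)" "ring_integral x0 N (Bop f) / of_nat N"]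
        by simp
      also have "\<dots> \<le> C / real N + B / real N"
        using C(2)[OF N] ring_integral_bound[OF cB _ B(2), of N] x0
        by (intro add_mono) (auto simp: norm_divide divide_right_mono)
      finally show ?thesis by (simp add: add_divide_distrib)
    qed
    thus ?case by (intro exI[of _ "C + B"]) auto
  next
    case (Suc \<kappa>)
    obtain C where C: "C \<ge> 0" "\<And>N. N \<ge> 1 \<Longrightarrow> norm (ring_integral x0 N f - (circle_mean f + ring_integral x0 N (Bop f) / of_nat N)) \<le> C / real N ^ (Suc \<kappa> + 1)"
      using step[OF Suc.prems, of "Suc \<kappa> + 1"] by blast
    obtain C' where C': "\<And>N. N \<ge> 1 \<Longrightarrow> norm (ring_integral x0 N (Bop f) - (\<Sum>m\<le>\<kappa>. circle_mean ((Bop ^^ m) (Bop f)) / of_nat N ^ m)) \<le> C' / real N ^ (\<kappa> + 1)"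
      using Suc.IH[OF log_smooth_Bop[OF Suc.prems]] by blast
    have "norm (ring_integral x0 N f - (\<Sum>m\<le>Suc \<kappa>. circle_mean ((Bop ^^ m) f) / of_nat N ^ m)) \<le> (C + C') / real N ^ (Suc \<kappa> + 1)"
      if N: "N \<ge> 1" for N
    proof -
      define S where "S = (\<Sum>m\<le>\<kappa>. circle_mean ((Bop ^^ m) (Bop f)) / of_nat N ^ m)"
      have eq: "(\<Sum>m\<le>Suc \<kappa>. circle_mean ((Bop ^^ m) f) / of_nat N ^ m) = circle_mean f + S / of_nat N"
        unfolding S_def by (subst sum.atMost_Suc_shift) (simp add: sum_divide_distrib funpow_swap1 mult.commute)
      have "ring_integral x0 N f - (circle_mean f + S / of_nat N)
          = (ring_integral x0 N f - (circle_mean f + ring_integral x0 N (Bop f) / of_nat N)) + (ring_integral x0 N (Bop f) - S) / of_nat N"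
        by (simp add: diff_divide_distrib)
      also have "norm \<dots> \<le> C / real N ^ (Suc \<kappa> + 1) + (C' / real N ^ (\<kappa> + 1)) / real N"
        using C(2)[OF N] C'[OF N] unfolding S_def[symmetric]
        by (intro norm_triangle_mono) (auto simp only: norm_divide norm_of_nat divide_right_mono of_nat_0_le_iff)
      also have "\<dots> = (C + C') / real N ^ (Suc \<kappa> + 1)" by (simp add: add_divide_distrib mult.commute)
      finally show ?thesis unfolding eq .
    qed
    thus ?case by (intro exI[of _ "C + C'"]) auto
  }
qed

lemma polar_in_closed_ring: "x0 \<le> x \<Longrightarrow> x \<le> 0 \<Longrightarrow> polar x t \<in> closed_ring x0"
  by (simp add: closed_ring_def)

text \<open>Induction on \<open>m\<close>. The radial derivative of \<open>v\<close> also vanishes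
  outside the disk, on the circle itself by continuity from outside, so it is of order
  \<open>|x|^m\<close> by induction. The mean value inequality along a ray, starting at the circle,
  gains one more power.\<close>

lemma log_smooth_flat:
  assumes "log_smooth b \<rho> v" "\<And>z. z \<in> annulus \<rho> \<Longrightarrow> 1 \<le> norm z \<Longrightarrow> v z = 0"
    and x0: "ln \<rho> < x0" "x0 < 0"
  obtains C where "C \<ge> 0" "\<And>x t. x0 \<le> x \<Longrightarrow> x \<le> 0 \<Longrightarrow> norm (v (polar x t)) \<le> C * \<bar>x\<bar> ^ m"
proof -
  have "\<exists>C\<ge>0. \<forall>x t. x0 \<le> x \<longrightarrow> x \<le> 0 \<longrightarrow> norm (v (polar x t)) \<le> C * \<bar>x\<bar> ^ m"
    using assms(1,2)
  proof (induction m arbitrary: v)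
    case 0
    obtain B where "B \<ge> 0" "\<And>z. z \<in> closed_ring x0 \<Longrightarrow> norm (v z) \<le> B"
      using continuous_on_ring_bounded[OF log_smooth_continuous_ring[OF 0(1) x0(1)]] by blast
    thus ?case using polar_in_closed_ring by (intro exI[of _ B]) auto
  next
    case (Suc m)
    define w where "w = (\<lambda>z. ld v z + ldb v z)"
    have w: "log_smooth b \<rho> w" unfolding w_def by (intro log_smooth_add log_smooth_ld log_smooth_ldb \<rho> Suc.prems)
    have w1: "w z = 0" if z: "z \<in> annulus \<rho>" "1 < norm z" for z
    proof -
      have "has_log_deriv (\<lambda>_. 0) (ld v z) (ldb v z) z"
        by (rule has_log_deriv_transform[OF log_smooth_log_deriv[OF \<rho>(1) Suc.prems(1) z(1)], of "annulus \<rho> \<inter> {z. 1 < norm z}"])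
           (use z Suc.prems(2) in \<open>auto intro!: open_Int open_annulus open_norm_gt\<close>)
      moreover have "has_log_deriv (\<lambda>_. 0) 0 0 z" using annulus_nonzero[OF \<rho>(1) z(1)] by (simp add: has_log_deriv_def)
      ultimately show ?thesis using has_log_deriv_unique by (metis w_def add.right_neutral)
    qed
    have w0: "w z = 0" if z: "z \<in> annulus \<rho>" "1 \<le> norm z" for z
    proof (cases "norm z = 1")
      case False thus ?thesis using w1 z by auto
    next
      case True
      have "isCont w z"
        using log_smooth_continuous[OF w] open_annulus z(1) by (simp add: continuous_on_eq_continuous_at)
      moreover have "(\<lambda>n. (1 + 1 / real (Suc n)) *\<^sub>R z) \<longlonglongrightarrow> (1 + 0) *\<^sub>R z"
        by (intro tendsto_intros LIMSEQ_Suc[OF lim_1_over_n])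
      ultimately have "(\<lambda>n. w ((1 + 1 / real (Suc n)) *\<^sub>R z)) \<longlonglongrightarrow> w z"
        by (intro isCont_tendsto_compose[of z w]) auto
      moreover have "\<forall>\<^sub>F n in sequentially. (1 + 1 / real (Suc n)) *\<^sub>R z \<in> annulus \<rho>"
        using \<open>(\<lambda>n. (1 + 1 / real (Suc n)) *\<^sub>R z) \<longlonglongrightarrow> (1 + 0) *\<^sub>R z\<close> open_annulus z(1)
        by (intro topological_tendstoD) auto
      hence "\<forall>\<^sub>F n in sequentially. w ((1 + 1 / real (Suc n)) *\<^sub>R z) = 0"
        by eventually_elim (rule w1, use True in \<open>auto simp: field_simps\<close>)
      ultimately show ?thesis by (metis tendsto_eventually LIMSEQ_unique)
    qed
    from Suc.IH[OF w w0] obtain C where C: "C \<ge> 0" "\<And>x t. x0 \<le> x \<Longrightarrow> x \<le> 0 \<Longrightarrow> norm (w (polar x t)) \<le> C * \<bar>x\<bar> ^ m" by blast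
    have "norm (v (polar x t)) \<le> C * \<bar>x\<bar> ^ Suc m" if x: "x0 \<le> x" "x \<le> 0" for x t
    proof -
      have "norm (v (polar x t) - v (polar 0 t)) \<le> (C * \<bar>x\<bar> ^ m) * norm (x - 0)"
      proof (rule differentiable_bound[of "{x..0}" "\<lambda>x. v (polar x t)" "\<lambda>x h. h *\<^sub>R w (polar x t)"])
        fix y assume y: "y \<in> {x..0}"
        have p: "polar y t \<in> annulus \<rho>" using polar_in_closed_ring[of x0 y t] closed_ring_subset_annulus[OF x0(1)] x y by auto
        show "((\<lambda>x. v (polar x t)) has_derivative (\<lambda>h. h *\<^sub>R w (polar y t))) (at y within {x..0})"
          using has_log_deriv_polar_radius[OF log_smooth_log_deriv[OF \<rho>(1) Suc.prems(1) p]]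
          by (simp add: has_vector_derivative_def w_def)
        have "norm (w (polar y t)) \<le> C * \<bar>y\<bar> ^ m" using C(2) x y by auto
        also have "\<dots> \<le> C * \<bar>x\<bar> ^ m" using y C(1) by (intro mult_left_mono power_mono) auto
        finally have "norm (w (polar y t)) \<le> C * \<bar>x\<bar> ^ m" .
        thus "onorm (\<lambda>h. h *\<^sub>R w (polar y t)) \<le> C * \<bar>x\<bar> ^ m"
          by (intro onorm_le) (simp add: mult.commute mult_left_mono)
      qed (use x in auto)
      moreover have "v (polar 0 t) = 0"
        by (rule Suc.prems(2)) (use sphere_subset_annulus[OF \<rho>] in \<open>auto simp: polar_0\<close>)
      ultimately show ?thesis by (simp add: mult_ac)
    qed
    thus ?case using C(1) by blast
  qed
  thus thesis using that by blast
qed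

end

section \<open>Behaviour at infinity and polynomial parts\<close>

text \<open>Inversion turns infinity into an isolated singularity at 0 at which the function is
  continuous, hence into a removable one.\<close>

lemma holomorphic_at_infinity_extend:
  assumes H: "H holomorphic_on {z. R < norm z}" and lim: "(H \<longlongrightarrow> 0) at_infinity"
  obtains K s where "s > 0" "K holomorphic_on ball 0 s" "K 0 = 0" "1 / s \<ge> R"
    "\<And>z. norm z > 1 / s \<Longrightarrow> H z = K (inverse z)"
proof -
  \<comment> \<open>\<open>R\<close> may be zero or negative; the maximum makes its reciprocal a
    genuine radius.\<close>
  define R' where "R' = max R 1"
  define s where "s = 1 / R'"
  define K where "K = (\<lambda>w. if w = 0 then 0 else H (inverse w))"
  have s: "s > 0" "1 / s = R'" by (auto simp: s_def R'_def)
  have "R' \<ge> R" "R' > 0" by (auto simp: R'_def)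
  have inv: "norm (inverse w) > R" if "w \<in> ball 0 s - {0}" for w :: complex
  proof -
    have "norm w < 1 / R'" "norm w > 0" using that by (auto simp: s_def)
    hence "R' < 1 / norm w" using \<open>R' > 0\<close> by (simp add: field_simps)
    thus ?thesis using \<open>R' \<ge> R\<close> by (simp add: norm_inverse inverse_eq_divide norm_divide)
  qed
  have hol: "K holomorphic_on ball 0 s - {0}"
  proof (rule holomorphic_transform)
    show "(H \<circ> inverse) holomorphic_on ball 0 s - {0}"
      by (rule holomorphic_on_compose[OF _ holomorphic_on_subset[OF H]])
         (use inv in \<open>auto intro!: holomorphic_intros\<close>)
  qed (auto simp: K_def)
  have "(K \<longlongrightarrow> 0) (at 0)"
  proof (rule Lim_transform_eventually)
    show "((H \<circ> inverse) \<longlongrightarrow> 0) (at 0)" using lim lim_at_infinity_0 by blast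
    show "\<forall>\<^sub>F w in at 0. (H \<circ> inverse) w = K w"
      unfolding eventually_at by (intro exI[of _ 1]) (auto simp: K_def)
  qed
  hence "isCont K 0" by (simp add: isCont_def K_def)
  hence cont: "continuous_on (ball 0 s) K"
    using holomorphic_on_imp_continuous_on[OF hol]
    by (metis DiffI continuous_at_imp_continuous_at_within continuous_on_eq_continuous_at continuous_on_eq_continuous_within open_ball open_delete singletonD)
  have "K holomorphic_on ball 0 s"
    by (rule no_isolated_singularity[OF cont hol]) auto
  moreover have "H z = K (inverse z)" if "norm z > 1 / s" for z
    using that s \<open>R' > 0\<close> by (auto simp: K_def)
  ultimately show thesis using that[of s K] s \<open>R' \<ge> R\<close> by (simp add: K_def)
qed

text \<open>In the variable \<open>1 / z\<close> both claims are local at 0: \<open>z H z\<close> is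
  the difference quotient of \<open>K\<close> there, and \<open>deriv H\<close> equals a bounded
  factor times the square of \<open>1 / z\<close>.\<close>

lemma holomorphic_tendsto_0_at_infinity:
  assumes H: "H holomorphic_on {z. R < norm z}" and lim: "(H \<longlongrightarrow> 0) at_infinity"
  shows "\<exists>l. ((\<lambda>z. z * H z) \<longlongrightarrow> l) at_infinity" and "(deriv H \<longlongrightarrow> 0) at_infinity"
proof -
  obtain K s where K: "s > 0" "K holomorphic_on ball 0 s" "K 0 = 0" "1 / s \<ge> R"
    "\<And>z. norm z > 1 / s \<Longrightarrow> H z = K (inverse z)"
    by (rule holomorphic_at_infinity_extend[OF assms]) blast
  have ev: "\<forall>\<^sub>F z in at_infinity. norm (z::complex) > 1 / s"
    unfolding eventually_at_infinity by (rule exI[of _ "1 / s + 1"]) auto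
  have inv: "filterlim inverse (at 0) (at_infinity :: complex filter)"
    by (simp add: filterlim_inverse_at_iff filterlim_ident)
  have "(K has_field_derivative deriv K 0) (at 0)"
    by (rule holomorphic_derivI[OF K(2)]) (use K in auto)
  hence "((\<lambda>w. K w / w) \<longlongrightarrow> deriv K 0) (at 0)" using K(3) by (simp add: has_field_derivative_iff)
  hence "((\<lambda>z. K (inverse z) / inverse z) \<longlongrightarrow> deriv K 0) at_infinity"
    by (rule filterlim_compose[OF _ inv])
  hence "((\<lambda>z. z * H z) \<longlongrightarrow> deriv K 0) at_infinity"
    by (rule Lim_transform_eventually) (use ev in eventually_elim, use K in \<open>auto simp: field_simps\<close>)
  thus "\<exists>l. ((\<lambda>z. z * H z) \<longlongrightarrow> l) at_infinity" by blast
  have d: "deriv H z = - deriv K (inverse z) * (inverse z)\<^sup>2" if z: "norm z > 1 / s" for z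
  proof -
    have z0: "z \<noteq> 0" using z K(1) by auto
    have "norm (inverse z) < s" using z z0 K(1) unfolding norm_inverse by (simp add: divide_simps mult.commute)
    hence "(K has_field_derivative deriv K (inverse z)) (at (inverse z))"
      by (intro holomorphic_derivI[OF K(2)]) auto
    moreover have "(inverse has_field_derivative - (inverse z)\<^sup>2) (at z)"
      using z0 by (auto intro!: derivative_eq_intros simp: power2_eq_square)
    ultimately have "((\<lambda>z. K (inverse z)) has_field_derivative deriv K (inverse z) * - (inverse z)\<^sup>2) (at z)"
      by (rule DERIV_chain2)
    hence "(H has_field_derivative deriv K (inverse z) * - (inverse z)\<^sup>2) (at z)"
      by (rule has_field_derivative_transform_within_open[where S="{z. 1 / s < norm z}"])
         (use z K open_norm_gt in auto)
    from DERIV_imp_deriv[OF this] show ?thesis by simp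
  qed
  have "deriv K holomorphic_on ball 0 s" by (intro holomorphic_deriv K(2) open_ball)
  hence "isCont (deriv K) 0"
    using K(1) holomorphic_on_imp_continuous_on continuous_on_eq_continuous_at[OF open_ball] by force
  hence "(deriv K \<longlongrightarrow> deriv K 0) (at 0)" by (simp add: isCont_def)
  hence "((\<lambda>z. deriv K (inverse z)) \<longlongrightarrow> deriv K 0) at_infinity"
    by (rule filterlim_compose[OF _ inv])
  hence "((\<lambda>z. - deriv K (inverse z) * (inverse z)\<^sup>2) \<longlongrightarrow> - deriv K 0 * 0\<^sup>2) at_infinity"
    by (intro tendsto_intros tendsto_inverse_0)
  hence "((\<lambda>z. - deriv K (inverse z) * (inverse z)\<^sup>2) \<longlongrightarrow> 0) at_infinity" by simp
  thus "(deriv H \<longlongrightarrow> 0) at_infinity"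
    by (rule Lim_transform_eventually) (use ev in eventually_elim, use d in auto)
qed

text \<open>From convergence of \<open>f z / z\<close> alone, \<open>f z - c z\<close> is shown to
  have a finite limit \<open>l\<close>. Once \<open>l\<close> is subtracted the rest tends to zero,
  and so does its derivative.\<close>

lemma deriv_tendsto_at_infinity:
  assumes f: "f holomorphic_on {z. R < norm z}" and lim: "((\<lambda>z. f z / z) \<longlongrightarrow> c) at_infinity"
  shows "(deriv f \<longlongrightarrow> c) at_infinity"
proof -
  define R' where "R' = max R 1"
  have R': "R' \<ge> R" "R' > 0" by (auto simp: R'_def)
  have f': "f holomorphic_on {z. R' < norm z}" by (rule holomorphic_on_subset[OF f]) (use R' in auto)
  define H where "H = (\<lambda>z. f z / z - c)"
  have H: "H holomorphic_on {z. R' < norm z}" unfolding H_def by (intro holomorphic_intros f') (use R' in auto)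
  have "(H \<longlongrightarrow> c - c) at_infinity" unfolding H_def by (intro tendsto_intros lim)
  from holomorphic_tendsto_0_at_infinity(1)[OF H] this obtain l where l: "((\<lambda>z. z * H z) \<longlongrightarrow> l) at_infinity" by auto
  define L where "L = (\<lambda>z. f z - c * z - l)"
  have ev: "\<forall>\<^sub>F z in at_infinity. norm (z::complex) > R'"
    unfolding eventually_at_infinity by (rule exI[of _ "R' + 1"]) auto
  have L: "L holomorphic_on {z. R' < norm z}" unfolding L_def by (intro holomorphic_intros f')
  have "((\<lambda>z. z * H z - l) \<longlongrightarrow> l - l) at_infinity" by (intro tendsto_intros l)
  hence "(L \<longlongrightarrow> 0) at_infinity" unfolding diff_self
    by (rule Lim_transform_eventually)
       (use ev in eventually_elim, use R' in \<open>auto simp: H_def L_def field_simps\<close>)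
  from holomorphic_tendsto_0_at_infinity(2)[OF L this] have "((\<lambda>z. deriv L z + c) \<longlongrightarrow> 0 + c) at_infinity"
    by (intro tendsto_intros)
  hence "((\<lambda>z. deriv L z + c) \<longlongrightarrow> c) at_infinity" by simp
  thus ?thesis
  proof (rule Lim_transform_eventually)
    show "\<forall>\<^sub>F z in at_infinity. deriv L z + c = deriv f z"
      using ev
    proof eventually_elim
      case (elim z)
      have "(f has_field_derivative deriv f z) (at z)"
        by (rule holomorphic_derivI[OF f' open_norm_gt]) (use elim in auto)
      hence "(L has_field_derivative deriv f z - c) (at z)"
        unfolding L_def by (auto intro!: derivative_eq_intros)
      thus ?case using DERIV_imp_deriv by fastforce
    qed
  qed
qed

text \<open>Induction on \<open>N\<close>: after subtracting the top term, the remainder divided by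
  the next lower power converges again, because a holomorphic function tending to zero at infinity
  still has a limit after multiplication by \<open>z\<close>.\<close>

lemma polynomial_part_at_infinity:
  assumes F: "F holomorphic_on {z. R < norm z}" and lim: "((\<lambda>z. F z / z ^ N) \<longlongrightarrow> a) at_infinity"
  shows "\<exists>q. degree q \<le> N \<and> coeff q N = a \<and> ((\<lambda>z. F z - poly q z) \<longlongrightarrow> 0) at_infinity"
  using assms
proof (induction N arbitrary: F a)
  case 0
  have "((\<lambda>z. F z - a) \<longlongrightarrow> a - a) at_infinity" using 0 by (intro tendsto_intros) auto
  thus ?case by (intro exI[of _ "[:a:]"]) auto
next
  case (Suc N)
  define R' where "R' = max R 1"
  have R': "R' \<ge> R" "R' > 0" by (auto simp: R'_def)
  have ev: "\<forall>\<^sub>F z in at_infinity. norm (z::complex) > R'"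
    unfolding eventually_at_infinity by (rule exI[of _ "R' + 1"]) auto
  have F': "F holomorphic_on {z. R' < norm z}" by (rule holomorphic_on_subset[OF Suc.prems(1)]) (use R' in auto)
  define H where "H = (\<lambda>z. F z / z ^ Suc N - a)"
  have H: "H holomorphic_on {z. R' < norm z}" unfolding H_def by (intro holomorphic_intros F') (use R' in auto)
  have "(H \<longlongrightarrow> a - a) at_infinity" unfolding H_def by (intro tendsto_intros Suc.prems(2))
  from holomorphic_tendsto_0_at_infinity(1)[OF H] this obtain l where l: "((\<lambda>z. z * H z) \<longlongrightarrow> l) at_infinity" by auto
  have "((\<lambda>z. (F z - a * z ^ Suc N) / z ^ N) \<longlongrightarrow> l) at_infinity"
    by (rule Lim_transform_eventually[OF l], use ev in eventually_elim)
       (use R' in \<open>auto simp: H_def field_simps\<close>)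
  moreover have "(\<lambda>z. F z - a * z ^ Suc N) holomorphic_on {z. R < norm z}"
    by (intro holomorphic_intros Suc.prems(1))
  ultimately obtain q where q: "degree q \<le> N" "((\<lambda>z. F z - a * z ^ Suc N - poly q z) \<longlongrightarrow> 0) at_infinity"
    using Suc.IH by blast
  show ?case
  proof (intro exI conjI)
    show "degree (q + monom a (Suc N)) \<le> Suc N" using q(1) by (intro degree_add_le) (auto simp: degree_monom_le)
    show "coeff (q + monom a (Suc N)) (Suc N) = a" using q(1) by (simp add: coeff_eq_0)
    show "((\<lambda>z. F z - poly (q + monom a (Suc N)) z) \<longlongrightarrow> 0) at_infinity"
      using q(2) by (simp add: poly_monom algebra_simps)
  qed
qed

text \<open>The outer circle of the annulus formula is sent to infinity. Taking \<open>R\<close> at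
  least \<open>2 norm \<zeta>\<close> bounds the kernel by \<open>2 / R\<close>, so the length of
  the circle cancels and the decay of \<open>f\<close> suffices.\<close>

lemma exterior_Cauchy_formula:
  assumes f: "f holomorphic_on {z. a < norm z}" and lim: "(f \<longlongrightarrow> 0) at_infinity"
    and r: "0 \<le> a" "a < r" "r < norm \<zeta>"
  shows "2 * pi * \<i> * f \<zeta> = - contour_integral (circlepath 0 r) (\<lambda>w. f w / (w - \<zeta>))"
proof -
  have "norm (2 * pi * \<i> * f \<zeta> + contour_integral (circlepath 0 r) (\<lambda>w. f w / (w - \<zeta>))) \<le> 0"
  proof (rule field_le_epsilon)
    fix e :: real assume e: "e > 0"
    define d where "d = e / (4 * pi)"
    have d: "d > 0" using e by (simp add: d_def)
    obtain B where B: "\<And>z. norm z \<ge> B \<Longrightarrow> norm (f z) < d"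
      using tendstoD[OF lim d] unfolding eventually_at_infinity by auto
    define R where "R = max B (2 * norm \<zeta>)"
    have R: "R \<ge> B" "R \<ge> 2 * norm \<zeta>" "R > 0" "norm \<zeta> < R" using r by (auto simp: R_def)
    have hol: "f holomorphic_on {w. a < norm w \<and> norm w < R + 1}" by (rule holomorphic_on_subset[OF f]) auto
    have eq: "2 * pi * \<i> * f \<zeta> + contour_integral (circlepath 0 r) (\<lambda>w. f w / (w - \<zeta>))
       = contour_integral (circlepath 0 R) (\<lambda>w. f w / (w - \<zeta>))"
      using annulus_Cauchy_formula[OF hol r R(4)] by simp
    have "continuous_on (sphere 0 R) f"
      by (rule holomorphic_on_imp_continuous_on[OF holomorphic_on_subset[OF f]]) (use R r in auto)
    hence "((\<lambda>w. f w / (w - \<zeta>)) has_contour_integral contour_integral (circlepath 0 R) (\<lambda>w. f w / (w - \<zeta>))) (circlepath 0 R)"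
      using R by (intro has_contour_integral_integral contour_integrable_continuous_circlepath continuous_intros) auto
    hence "norm (contour_integral (circlepath 0 R) (\<lambda>w. f w / (w - \<zeta>))) \<le> d / (R / 2) * (2 * pi * R)"
    proof (rule has_contour_integral_bound_circlepath)
      fix x :: complex assume x: "norm (x - 0) = R"
      have "R / 2 \<le> norm (x - \<zeta>)" using x R norm_triangle_ineq2[of x \<zeta>] by simp
      thus "norm (f x / (x - \<zeta>)) \<le> d / (R / 2)"
        unfolding norm_divide using B[of x] x R d by (intro frac_le) auto
    qed (use R d in auto)
    also have "\<dots> = e" using R by (simp add: d_def)
    finally show "norm (2 * pi * \<i> * f \<zeta> + contour_integral (circlepath 0 r) (\<lambda>w. f w / (w - \<zeta>))) \<le> 0 + e"
      unfolding eq by simp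
  qed
  thus ?thesis by (simp add: eq_neg_iff_add_eq_0)
qed

section \<open>Cauchy kernels transplanted by the exterior parametrisation\<close>

locale exterior_param =
  fixes \<psi> :: "complex \<Rightarrow> complex" and r0 :: real and \<gamma> :: complex
  assumes r0: "0 < r0"
    and hol: "\<psi> holomorphic_on {z. r0 < norm z}"
    and inj: "inj_on \<psi> {z. r0 < norm z}"
    and lim: "((\<lambda>z. \<psi> z / z) \<longlongrightarrow> \<gamma>) at_infinity" and \<gamma>: "\<gamma> \<noteq> 0"
begin

lemma tendsto_infinity: "filterlim \<psi> at_infinity at_infinity"
proof -
  have "filterlim (\<lambda>z. \<psi> z / z * z) at_infinity at_infinity"
    by (rule tendsto_mult_filterlim_at_infinity[OF lim \<gamma>]) (rule filterlim_ident)
  thus ?thesis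
  proof (rule filterlim_mono_eventually[OF _ order_refl order_refl])
    show "\<forall>\<^sub>F z in at_infinity. \<psi> z / z * z = \<psi> z"
      unfolding eventually_at_infinity by (rule exI[of _ 1]) auto
  qed
qed

lemma deriv_nonzero: "r0 < norm z \<Longrightarrow> deriv \<psi> z \<noteq> 0"
  by (rule holomorphic_injective_imp_regular[OF hol open_norm_gt inj]) auto

text \<open>The integrand contains the Cauchy kernel of the image plane, pulled back by
  \<open>\<psi>\<close>. Injectivity makes the divided difference \<open>d\<close> zero-free, so
  this is the ordinary exterior formula for \<open>e\<close> times \<open>\<psi>' / d\<close>; that
  function still tends to zero, since \<open>\<psi>'\<close> and \<open>d\<close> both tend to the
  nonzero number \<open>\<gamma>\<close>.\<close>

lemma Cauchy_kernel_formula: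
  assumes e: "e holomorphic_on {z. r0 < norm z}" and e0: "(e \<longlongrightarrow> 0) at_infinity"
    and r: "r0 < r" "r < norm \<zeta>"
  shows "2 * pi * \<i> * e \<zeta> = - contour_integral (circlepath 0 r) (\<lambda>\<eta>. e \<eta> * deriv \<psi> \<eta> / (\<psi> \<eta> - \<psi> \<zeta>))"
proof -
  define d where "d = (\<lambda>\<eta>. if \<eta> = \<zeta> then deriv \<psi> \<zeta> else (\<psi> \<eta> - \<psi> \<zeta>) / (\<eta> - \<zeta>))"
  have z: "r0 < norm \<zeta>" using r by simp
  have d: "d holomorphic_on {z. r0 < norm z}" unfolding d_def by (rule pole_lemma_open[OF hol open_norm_gt])
  have dn: "d \<eta> \<noteq> 0" if "r0 < norm \<eta>" for \<eta>
    using that z deriv_nonzero[OF z] inj by (auto simp: d_def inj_on_def)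
  define f where "f = (\<lambda>\<eta>. e \<eta> * deriv \<psi> \<eta> / d \<eta>)"
  have f: "f holomorphic_on {z. r0 < norm z}"
    unfolding f_def by (intro holomorphic_intros e d holomorphic_deriv hol open_norm_gt) (use dn in auto)
  have "((\<lambda>\<eta>. (\<psi> \<eta> / \<eta> - \<psi> \<zeta> / \<eta>) / (1 - \<zeta> / \<eta>)) \<longlongrightarrow> (\<gamma> - 0) / (1 - 0)) at_infinity"
    by (intro tendsto_intros lim tendsto_divide_0[OF tendsto_const] filterlim_ident) auto
  hence dl: "(d \<longlongrightarrow> (\<gamma> - 0) / (1 - 0)) at_infinity"
  proof (rule Lim_transform_eventually)
    have "\<forall>\<^sub>F \<eta> in at_infinity. norm (\<eta>::complex) > norm \<zeta>"
      unfolding eventually_at_infinity by (rule exI[of _ "norm \<zeta> + 1"]) auto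
    thus "\<forall>\<^sub>F \<eta> in at_infinity. (\<psi> \<eta> / \<eta> - \<psi> \<zeta> / \<eta>) / (1 - \<zeta> / \<eta>) = d \<eta>"
    proof eventually_elim
      case (elim \<eta>)
      hence "\<eta> \<noteq> 0" "\<eta> \<noteq> \<zeta>" by auto
      thus ?case by (simp add: d_def divide_simps)
    qed
  qed
  have "(f \<longlongrightarrow> 0 * \<gamma> / ((\<gamma> - 0) / (1 - 0))) at_infinity"
    unfolding f_def by (intro tendsto_intros e0 dl deriv_tendsto_at_infinity[OF hol lim]) (use \<gamma> in auto)
  hence f0: "(f \<longlongrightarrow> 0) at_infinity" by simp
  have "2 * pi * \<i> * f \<zeta> = - contour_integral (circlepath 0 r) (\<lambda>w. f w / (w - \<zeta>))"
    by (rule exterior_Cauchy_formula[OF f f0]) (use r r0 in auto)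
  also have "contour_integral (circlepath 0 r) (\<lambda>w. f w / (w - \<zeta>))
     = contour_integral (circlepath 0 r) (\<lambda>\<eta>. e \<eta> * deriv \<psi> \<eta> / (\<psi> \<eta> - \<psi> \<zeta>))"
    by (rule contour_integral_eq) (use r r0 in \<open>auto simp: f_def d_def\<close>)
  finally show ?thesis using deriv_nonzero[OF z] by (simp add: f_def d_def)
qed

text \<open>In the image plane this is Cauchy's formula for an entire function along the image of
  the circle, around a point outside it. The winding number is zero because the image of
  \<open>norm z > r\<close> is connected, misses the curve and contains points far away.\<close>

lemma kernel_poly_zero:
  assumes r: "r0 < r" "r < norm \<zeta>"
  shows "contour_integral (circlepath 0 r) (\<lambda>\<eta>. poly q (\<psi> \<eta>) * deriv \<psi> \<eta> / (\<psi> \<eta> - \<psi> \<zeta>)) = 0"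
proof -
  define \<Gamma> where "\<Gamma> = \<psi> \<circ> circlepath 0 r"
  have sub: "path_image (circlepath 0 r) \<subseteq> {z. r0 < norm z}" using r r0 by auto
  have vp: "valid_path \<Gamma>" unfolding \<Gamma>_def
    by (rule valid_path_compose_holomorphic[OF valid_path_circlepath hol open_norm_gt sub])
  have pi: "path_image \<Gamma> = \<psi> ` sphere 0 r" using r r0 by (simp add: \<Gamma>_def path_image_compose)
  have loop: "pathfinish \<Gamma> = pathstart \<Gamma>" by (simp add: \<Gamma>_def pathfinish_compose pathstart_compose)
  have disj: "\<psi> w \<notin> path_image \<Gamma>" if "r < norm w" for w
  proof
    assume "\<psi> w \<in> path_image \<Gamma>"
    then obtain x where "norm x = r" "\<psi> w = \<psi> x" unfolding pi by auto
    thus False using inj_onD[OF inj, of w x] that r by auto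
  qed
  have an: "\<psi> analytic_on {z. r0 < norm z}" using hol open_norm_gt by (simp add: analytic_on_open)
  have wn: "winding_number \<Gamma> (\<psi> \<zeta>) = 0"
  proof -
    obtain B where B: "\<And>z. B \<le> norm z \<Longrightarrow> winding_number \<Gamma> z = 0"
      using winding_number_zero_at_infinity[OF valid_path_imp_path[OF vp] loop] by blast
    from tendsto_infinity have "\<forall>\<^sub>F w in at_infinity. norm (\<psi> w) \<ge> B"
      unfolding filterlim_at_infinity[OF order_refl] using filterlim_at_infinity_imp_norm_at_top[OF tendsto_infinity]
      by (simp add: filterlim_at_top)
    then obtain b where b: "\<And>w. norm w \<ge> b \<Longrightarrow> norm (\<psi> w) \<ge> B" unfolding eventually_at_infinity by auto
    define w :: complex where "w = of_real (max b (r + 1))"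
    have w: "norm w \<ge> b" "norm w > r" using r r0 by (auto simp: w_def)
    have con: "connected (\<psi> ` {z. r < norm z})"
    proof (rule connected_continuous_image)
      show "continuous_on {z. r < norm z} \<psi>"
        by (rule holomorphic_on_imp_continuous_on[OF holomorphic_on_subset[OF hol]]) (use r in auto)
      have "{z::complex. r < norm z} = - cball 0 r" by (auto simp: not_le)
      thus "connected {z::complex. r < norm z}"
        by (simp add: connected_complement_bounded_convex)
    qed
    have "winding_number \<Gamma> (\<psi> \<zeta>) = winding_number \<Gamma> (\<psi> w)"
      by (rule winding_number_eq[OF valid_path_imp_path[OF vp] loop _ _ con]) (use w r disj in auto)
    thus ?thesis using B b w by simp
  qed
  have "((\<lambda>w. poly q w / (w - \<psi> \<zeta>)) has_contour_integral 2 * pi * \<i> * winding_number \<Gamma> (\<psi> \<zeta>) * poly q (\<psi> \<zeta>)) \<Gamma>"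
    by (rule Cauchy_integral_formula_convex_simple[of UNIV]) (use disj[OF r(2)] vp loop in \<open>auto intro!: holomorphic_intros\<close>)
  hence "contour_integral \<Gamma> (\<lambda>w. poly q w / (w - \<psi> \<zeta>)) = 0"
    using wn by (simp add: contour_integral_unique)
  moreover have "contour_integral \<Gamma> (\<lambda>w. poly q w / (w - \<psi> \<zeta>))
      = contour_integral (circlepath 0 r) (\<lambda>\<eta>. deriv \<psi> \<eta> * (poly q (\<psi> \<eta>) / (\<psi> \<eta> - \<psi> \<zeta>)))"
    unfolding \<Gamma>_def by (rule contour_integral_comp_analyticW[OF an valid_path_circlepath sub])
  ultimately show ?thesis by (simp add: mult_ac)
qed

text \<open>Faber-type construction: subtract from \<open>F\<close> its polynomial part at infinity, in the variable \<open>\<psi>\<close>.\<close>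

lemma polynomial_approximation:
  assumes \<phi>: "\<phi> holomorphic_on \<psi> ` {z. r0 < norm z}" "\<And>z. r0 < norm z \<Longrightarrow> \<phi> (\<psi> z) = z"
    and bd: "bounded (- \<psi> ` {z. r0 < norm z})"
    and F: "F holomorphic_on {z. r0 < norm z}" and Fl: "((\<lambda>z. F z / \<psi> z ^ N) \<longlongrightarrow> a) at_infinity"
    and \<phi>_inf: "filterlim \<phi> at_infinity at_infinity"
  shows "\<exists>q. degree q \<le> N \<and> coeff q N = a \<and>
     (\<forall>r \<zeta>. r0 < r \<longrightarrow> r < norm \<zeta> \<longrightarrow> 2 * pi * \<i> * (F \<zeta> - poly q (\<psi> \<zeta>)) =
        - contour_integral (circlepath 0 r) (\<lambda>\<eta>. F \<eta> * deriv \<psi> \<eta> / (\<psi> \<eta> - \<psi> \<zeta>)))"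
proof -
  obtain R where R: "\<And>z. R < norm z \<Longrightarrow> z \<in> \<psi> ` {z. r0 < norm z}"
  proof -
    from bd obtain R where "\<forall>z\<in>- \<psi> ` {z. r0 < norm z}. norm z \<le> R" unfolding bounded_iff by blast
    thus thesis using that[of R] by (metis ComplI linorder_not_le)
  qed
  have im: "\<phi> ` (\<psi> ` {z. r0 < norm z}) \<subseteq> {z. r0 < norm z}" using \<phi>(2) by auto
  have im2: "\<phi> ` {z. R < norm z} \<subseteq> {z. r0 < norm z}" "{z. R < norm z} \<subseteq> \<psi> ` {z. r0 < norm z}"
    using R im by blast+
  have FF: "(F \<circ> \<phi>) holomorphic_on {z. R < norm z}"
    by (intro holomorphic_on_compose holomorphic_on_subset[OF \<phi>(1) im2(2)] holomorphic_on_subset[OF F im2(1)])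
  have ev: "\<forall>\<^sub>F z in at_infinity. norm (z::complex) > R"
    unfolding eventually_at_infinity by (rule exI[of _ "R + 1"]) auto
  have "((\<lambda>z. F (\<phi> z) / \<psi> (\<phi> z) ^ N) \<longlongrightarrow> a) at_infinity"
    by (rule filterlim_compose[OF Fl \<phi>_inf])
  hence "((\<lambda>z. (F \<circ> \<phi>) z / z ^ N) \<longlongrightarrow> a) at_infinity"
    by (rule Lim_transform_eventually, use ev in eventually_elim) (use R \<phi>(2) in force)
  from polynomial_part_at_infinity[OF FF this]
  obtain q where q: "degree q \<le> N" "coeff q N = a" "((\<lambda>z. (F \<circ> \<phi>) z - poly q z) \<longlongrightarrow> 0) at_infinity" by blast
  define e where "e = (\<lambda>\<zeta>. F \<zeta> - poly q (\<psi> \<zeta>))"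
  have e: "e holomorphic_on {z. r0 < norm z}" unfolding e_def by (intro holomorphic_intros F hol)
  have "((\<lambda>z. (F \<circ> \<phi>) (\<psi> z) - poly q (\<psi> z)) \<longlongrightarrow> 0) at_infinity"
    by (rule filterlim_compose[OF q(3) tendsto_infinity])
  moreover have "\<forall>\<^sub>F z in at_infinity. norm (z::complex) > r0"
    unfolding eventually_at_infinity by (rule exI[of _ "r0 + 1"]) auto
  hence "\<forall>\<^sub>F z in at_infinity. (F \<circ> \<phi>) (\<psi> z) - poly q (\<psi> z) = e z"
    by eventually_elim (simp add: e_def \<phi>(2))
  ultimately have e0: "(e \<longlongrightarrow> 0) at_infinity" by (rule Lim_transform_eventually)
  have "2 * pi * \<i> * (F \<zeta> - poly q (\<psi> \<zeta>)) =
        - contour_integral (circlepath 0 r) (\<lambda>\<eta>. F \<eta> * deriv \<psi> \<eta> / (\<psi> \<eta> - \<psi> \<zeta>))"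
    if r: "r0 < r" "r < norm \<zeta>" for r \<zeta>
  proof -
    have nz: "\<psi> \<eta> - \<psi> \<zeta> \<noteq> 0" if "norm \<eta> = r" for \<eta>
      using that r inj_onD[OF inj, of \<eta> \<zeta>] by auto
    have c: "continuous_on (sphere 0 r) f" if "f holomorphic_on {z. r0 < norm z}" for f :: "complex \<Rightarrow> complex"
      by (rule holomorphic_on_imp_continuous_on[OF holomorphic_on_subset[OF that]]) (use r in auto)
    have dc: "deriv \<psi> holomorphic_on {z. r0 < norm z}" by (intro holomorphic_deriv hol open_norm_gt)
    have i: "(\<lambda>\<eta>. g \<eta> * deriv \<psi> \<eta> / (\<psi> \<eta> - \<psi> \<zeta>)) contour_integrable_on circlepath 0 r"
      if "g holomorphic_on {z. r0 < norm z}" for g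
      using r r0 nz by (intro contour_integrable_continuous_circlepath continuous_intros)
         (auto intro!: c that dc hol)
    have pq: "(\<lambda>\<eta>. poly q (\<psi> \<eta>)) holomorphic_on {z. r0 < norm z}" by (intro holomorphic_intros hol)
    \<comment> \<open>The polynomial contributes nothing, so the error may be written with
      \<open>F\<close> in place of \<open>e\<close>. This is decisive later: on a small circle the
      size of \<open>F\<close> is known explicitly, that of the polynomial is not.\<close>
    have "contour_integral (circlepath 0 r) (\<lambda>\<eta>. F \<eta> * deriv \<psi> \<eta> / (\<psi> \<eta> - \<psi> \<zeta>))
       = contour_integral (circlepath 0 r) (\<lambda>\<eta>. e \<eta> * deriv \<psi> \<eta> / (\<psi> \<eta> - \<psi> \<zeta>) + poly q (\<psi> \<eta>) * deriv \<psi> \<eta> / (\<psi> \<eta> - \<psi> \<zeta>))"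
      by (rule contour_integral_eq) (simp add: e_def add_divide_distrib[symmetric] algebra_simps)
    also have "\<dots> = contour_integral (circlepath 0 r) (\<lambda>\<eta>. e \<eta> * deriv \<psi> \<eta> / (\<psi> \<eta> - \<psi> \<zeta>)) + 0"
      using kernel_poly_zero[OF r, of q] by (subst contour_integral_add[OF i[OF e] i[OF pq]]) simp
    finally show ?thesis using Cauchy_kernel_formula[OF e e0 r] by (simp add: e_def)
  qed
  thus ?thesis using q by blast
qed

end

section \<open>Real-analytic and smooth functions\<close>

text \<open>For complex values unconditional summability over pairs is absolute, so the value at the
  corner \<open>(r, r)\<close> of a smaller square majorises the series on the whole square.
  Relabelling by \<open>prod_decode\<close> turns the double sum into an ordinary series to which
  the M-test applies.\<close>

lemma real_analytic2_at_enum: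
  fixes f :: "complex \<Rightarrow> complex"
  assumes "real_analytic2_at f z0"
  obtains a r where "r > 0" "summable (\<lambda>k. norm (case prod_decode k of (m, n) \<Rightarrow> r ^ (m + n) *\<^sub>R a m n))"
    "\<And>z. \<bar>Re (z - z0)\<bar> \<le> r \<Longrightarrow> \<bar>Im (z - z0)\<bar> \<le> r \<Longrightarrow>
       (\<lambda>k. case prod_decode k of (m, n) \<Rightarrow> (Re (z - z0) ^ m * Im (z - z0) ^ n) *\<^sub>R a m n) sums f z"
proof -
  from assms obtain a \<rho> where \<rho>: "\<rho> > 0" and S:
    "\<And>z. \<bar>Re (z - z0)\<bar> < \<rho> \<Longrightarrow> \<bar>Im (z - z0)\<bar> < \<rho> \<Longrightarrow>
       ((\<lambda>(m, n). (Re (z - z0) ^ m * Im (z - z0) ^ n) *\<^sub>R a m n) has_sum f z) UNIV"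
    unfolding real_analytic2_at_def by blast
  have S': "((\<lambda>k. case prod_decode k of (m, n) \<Rightarrow> (Re (z - z0) ^ m * Im (z - z0) ^ n) *\<^sub>R a m n) has_sum f z) UNIV"
    if "\<bar>Re (z - z0)\<bar> < \<rho>" "\<bar>Im (z - z0)\<bar> < \<rho>" for z
    using S[OF that] has_sum_reindex[of prod_decode UNIV "\<lambda>(m, n). (Re (z - z0) ^ m * Im (z - z0) ^ n) *\<^sub>R a m n" "f z"]
    by (simp add: o_def inj_prod_decode surj_prod_decode)
  define r where "r = \<rho> / 2"
  have r: "r > 0" "r < \<rho>" using \<rho> by (auto simp: r_def)
  have "((\<lambda>k. case prod_decode k of (m, n) \<Rightarrow> (r ^ m * r ^ n) *\<^sub>R a m n) has_sum f (z0 + Complex r r)) UNIV"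
    using S'[of "z0 + Complex r r"] r by simp
  hence "(\<lambda>k. case prod_decode k of (m, n) \<Rightarrow> (r ^ m * r ^ n) *\<^sub>R a m n) summable_on UNIV"
    by (auto simp: summable_on_def)
  hence "(\<lambda>k. norm (case prod_decode k of (m, n) \<Rightarrow> (r ^ m * r ^ n) *\<^sub>R a m n)) summable_on UNIV"
    by (simp only: summable_on_iff_abs_summable_on_complex)
  hence "summable (\<lambda>k. norm (case prod_decode k of (m, n) \<Rightarrow> (r ^ m * r ^ n) *\<^sub>R a m n))"
    by (rule summable_on_imp_summable)
  hence "summable (\<lambda>k. norm (case prod_decode k of (m, n) \<Rightarrow> r ^ (m + n) *\<^sub>R a m n))"
    by (simp only: power_add)
  moreover have "(\<lambda>k. case prod_decode k of (m, n) \<Rightarrow> (Re (z - z0) ^ m * Im (z - z0) ^ n) *\<^sub>R a m n) sums f z"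
    if "\<bar>Re (z - z0)\<bar> \<le> r" "\<bar>Im (z - z0)\<bar> \<le> r" for z
    by (rule has_sum_imp_sums[OF S']) (use that r in auto)
  ultimately show thesis using that[of r a] r by blast
qed

lemma nat_le_power2: "real p \<le> 2 ^ p"
  by (rule less_imp_le[OF of_nat_less_two_power])

text \<open>Halving the radius pays for the factor \<open>p\<close> created by differentiation,
  since \<open>p \<le> 2 ^ p\<close>.\<close>

lemma power_deriv_bound:
  assumes "0 < r" "\<bar>x\<bar> \<le> r / 2" "\<bar>y\<bar> \<le> (r::real)"
  shows "\<bar>real p * x ^ (p - 1) * y ^ q\<bar> \<le> 2 / r * r ^ (p + q)"
proof (cases p)
  case 0 thus ?thesis using assms by simp
next
  case (Suc n)
  have "\<bar>real p * x ^ (p - 1) * y ^ q\<bar> = real p * \<bar>x\<bar> ^ n * \<bar>y\<bar> ^ q"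
    using Suc by (simp add: abs_mult power_abs)
  also have "\<dots> \<le> 2 ^ p * (r / 2) ^ n * r ^ q"
    using assms nat_le_power2[of p] by (intro mult_mono power_mono) auto
  also have "\<dots> = 2 / r * r ^ (p + q)"
    using assms Suc by (simp add: power_divide power_add field_simps)
  finally show ?thesis .
qed

text \<open>The terms with \<open>m = 0\<close> carry the factor 0, so passing to successor indices
  loses nothing.\<close>

lemma has_sum_shift1:
  fixes a :: "nat \<Rightarrow> nat \<Rightarrow> complex"
  assumes "((\<lambda>(m, n). (real m * x ^ (m - 1) * y ^ n) *\<^sub>R a m n) has_sum s) UNIV"
  shows "((\<lambda>(m, n). (x ^ m * y ^ n) *\<^sub>R (real (Suc m) *\<^sub>R a (Suc m) n)) has_sum s) UNIV"
proof -
  let ?h = "\<lambda>(m, n). (Suc m, n :: nat)"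
  have "((\<lambda>(m, n). (real m * x ^ (m - 1) * y ^ n) *\<^sub>R a m n) has_sum s) (range ?h)"
    using assms
  proof (subst has_sum_cong_neutral[of UNIV _ _ "\<lambda>(m, n). (real m * x ^ (m - 1) * y ^ n) *\<^sub>R a m n"])
    fix p assume "p \<in> UNIV - range ?h"
    moreover obtain m n where p: "p = (m, n)" by (cases p)
    moreover have "m \<noteq> 0 \<Longrightarrow> p = ?h (m - 1, n)" using p by simp
    ultimately have "m = 0" by blast
    thus "(case p of (m, n) \<Rightarrow> (real m * x ^ (m - 1) * y ^ n) *\<^sub>R a m n) = 0" using p by simp
  qed auto
  moreover have "inj ?h" by (auto simp: inj_on_def)
  ultimately have "((\<lambda>(m, n). (real m * x ^ (m - 1) * y ^ n) *\<^sub>R a m n) \<circ> ?h has_sum s) UNIV"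
    by (subst has_sum_reindex[symmetric])
  thus ?thesis by (simp add: o_def case_prod_unfold mult_ac)
qed

lemma has_sum_shift2:
  fixes a :: "nat \<Rightarrow> nat \<Rightarrow> complex"
  assumes "((\<lambda>(m, n). (x ^ m * (real n * y ^ (n - 1))) *\<^sub>R a m n) has_sum s) UNIV"
  shows "((\<lambda>(m, n). (x ^ m * y ^ n) *\<^sub>R (real (Suc n) *\<^sub>R a m (Suc n))) has_sum s) UNIV"
proof -
  have sw: "(f has_sum s) UNIV \<longleftrightarrow> ((\<lambda>(m, n). f (n, m)) has_sum s) UNIV" for f :: "nat \<times> nat \<Rightarrow> complex"
  proof -
    have "range (\<lambda>x. (snd x, fst x)) = (UNIV :: (nat \<times> nat) set)" by (auto simp: image_iff)
    thus ?thesis using has_sum_reindex[of prod.swap UNIV f s] by (simp add: o_def case_prod_unfold prod.swap_def)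
  qed
  have "((\<lambda>(m, n). (real m * y ^ (m - 1) * x ^ n) *\<^sub>R a n m) has_sum s) UNIV"
    using assms by (subst sw) (simp add: mult_ac)
  from has_sum_shift1[OF this] show ?thesis by (subst sw) (simp add: mult_ac)
qed

text \<open>Termwise differentiation on the square of half side \<open>r / 2\<close>, where the
  differentiated series has the old majorant times \<open>2 / r\<close>. An index shift then
  exhibits the partial derivatives as power series about the same centre.\<close>

lemma real_analytic2_at_derivatives:
  fixes f :: "complex \<Rightarrow> complex"
  assumes "real_analytic2_at f z0"
  obtains fu fv d where "d > 0"
    "\<And>z. z \<in> ball z0 d \<Longrightarrow> (f has_derivative (\<lambda>h. Re h *\<^sub>R fu z + Im h *\<^sub>R fv z)) (at z)"
    "real_analytic2_at fu z0" "real_analytic2_at fv z0"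
proof -
  obtain a r where r: "r > 0" and sm: "summable (\<lambda>k. norm (case prod_decode k of (m, n) \<Rightarrow> r ^ (m + n) *\<^sub>R a m n))"
    and S: "\<And>z. \<bar>Re (z - z0)\<bar> \<le> r \<Longrightarrow> \<bar>Im (z - z0)\<bar> \<le> r \<Longrightarrow>
       (\<lambda>k. case prod_decode k of (m, n) \<Rightarrow> (Re (z - z0) ^ m * Im (z - z0) ^ n) *\<^sub>R a m n) sums f z"
    by (rule real_analytic2_at_enum[OF assms]) (rule that)
  define p q where "p k = fst (prod_decode k)" and "q k = snd (prod_decode k)" for k
  define b where "b k = a (p k) (q k)" for k
  have pd: "prod_decode k = (p k, q k)" for k by (simp add: p_def q_def)
  have sm': "summable (\<lambda>k. 2 / r * (r ^ (p k + q k) * norm (b k)))"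
    using sm r by (intro summable_mult) (simp add: pd b_def)
  define B where "B = {z. \<bar>Re (z - z0)\<bar> < r / 2 \<and> \<bar>Im (z - z0)\<bar> < r / 2}"
  have conv: "convex B"
  proof -
    define s where "s = r / 2"
    have "B = {z. \<bar>Re (z - z0)\<bar> < s \<and> \<bar>Im (z - z0)\<bar> < s}" by (simp add: B_def s_def)
    hence "B = Re -` {Re z0 - s<..<Re z0 + s} \<inter> Im -` {Im z0 - s<..<Im z0 + s}"
      by (auto simp: abs_less_iff)
    thus ?thesis by (simp only:) (intro convex_Int convex_linear_vimage; simp add: bounded_linear.linear[OF bounded_linear_Re] bounded_linear.linear[OF bounded_linear_Im])
  qed
  have opB: "open B" unfolding B_def by (intro open_Collect_conj open_Collect_less continuous_intros)
  define u where "u k z = (real (p k) * Re (z - z0) ^ (p k - 1) * Im (z - z0) ^ q k) *\<^sub>R b k" for k z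
  define v where "v k z = (Re (z - z0) ^ p k * (real (q k) * Im (z - z0) ^ (q k - 1))) *\<^sub>R b k" for k z
  define fu where "fu z = (\<Sum>k. u k z)" for z
  define fv where "fv z = (\<Sum>k. v k z)" for z
  have ub: "norm (u k z) \<le> 2 / r * (r ^ (p k + q k) * norm (b k))" if "z \<in> B" for k z
  proof -
    have "norm (u k z) = \<bar>real (p k) * Re (z - z0) ^ (p k - 1) * Im (z - z0) ^ q k\<bar> * norm (b k)" by (simp add: u_def)
    also have "\<dots> \<le> (2 / r * r ^ (p k + q k)) * norm (b k)"
      using that r by (intro mult_right_mono power_deriv_bound) (auto simp: B_def)
    finally show ?thesis by (simp add: mult_ac)
  qed
  have vb: "norm (v k z) \<le> 2 / r * (r ^ (p k + q k) * norm (b k))" if "z \<in> B" for k z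
  proof -
    have "norm (v k z) = \<bar>real (q k) * Im (z - z0) ^ (q k - 1) * Re (z - z0) ^ p k\<bar> * norm (b k)" by (simp add: v_def abs_mult)
    also have "\<dots> \<le> (2 / r * r ^ (q k + p k)) * norm (b k)"
      using that r by (intro mult_right_mono power_deriv_bound) (auto simp: B_def)
    finally show ?thesis by (simp add: mult_ac add_ac)
  qed
  have ulu: "uniform_limit B (\<lambda>n z. \<Sum>k<n. u k z) fu sequentially"
    unfolding fu_def by (rule Weierstrass_m_test[OF ub sm'])
  have ulv: "uniform_limit B (\<lambda>n z. \<Sum>k<n. v k z) fv sequentially"
    unfolding fv_def by (rule Weierstrass_m_test[OF vb sm'])
  have z0B: "z0 \<in> B" using r by (simp add: B_def)
  have SB: "(\<lambda>k. (Re (z - z0) ^ p k * Im (z - z0) ^ q k) *\<^sub>R b k) sums f z" if "z \<in> B" for z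
    using S[of z] that r by (simp add: pd b_def B_def)
  have "\<exists>g. \<forall>z\<in>B. (\<lambda>k. (Re (z - z0) ^ p k * Im (z - z0) ^ q k) *\<^sub>R b k) sums g z \<and>
      (g has_derivative (\<lambda>h. Re h *\<^sub>R fu z + Im h *\<^sub>R fv z)) (at z within B)"
  proof (rule has_derivative_series[where f = "\<lambda>k z. (Re (z - z0) ^ p k * Im (z - z0) ^ q k) *\<^sub>R b k"
        and f' = "\<lambda>k z h. Re h *\<^sub>R u k z + Im h *\<^sub>R v k z"
        and g' = "\<lambda>z h. Re h *\<^sub>R fu z + Im h *\<^sub>R fv z" and x = z0 and l = "f z0", OF conv])
    show "z0 \<in> B" "(\<lambda>k. (Re (z0 - z0) ^ p k * Im (z0 - z0) ^ q k) *\<^sub>R b k) sums f z0"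
      by (rule z0B, rule SB[OF z0B])
    show "((\<lambda>z. (Re (z - z0) ^ p k * Im (z - z0) ^ q k) *\<^sub>R b k) has_derivative
        (\<lambda>h. Re h *\<^sub>R u k z + Im h *\<^sub>R v k z)) (at z within B)" for k z
      unfolding u_def v_def by (auto intro!: derivative_eq_intros simp: algebra_simps)
    fix e :: real assume e: "e > 0"
    have "\<forall>\<^sub>F n in sequentially. \<forall>z\<in>B. dist (\<Sum>k<n. u k z) (fu z) < e / 2"
      using uniform_limitD[OF ulu, of "e / 2"] e by simp
    moreover have "\<forall>\<^sub>F n in sequentially. \<forall>z\<in>B. dist (\<Sum>k<n. v k z) (fv z) < e / 2"
      using uniform_limitD[OF ulv, of "e / 2"] e by simp
    ultimately show "\<forall>\<^sub>F n in sequentially. \<forall>z\<in>B. \<forall>h.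
        norm ((\<Sum>i<n. Re h *\<^sub>R u i z + Im h *\<^sub>R v i z) - (Re h *\<^sub>R fu z + Im h *\<^sub>R fv z)) \<le> e * norm h"
    proof eventually_elim
      case (elim n)
      show ?case
      proof (intro ballI allI)
        fix z h assume z: "z \<in> B"
        have "(\<Sum>i<n. Re h *\<^sub>R u i z + Im h *\<^sub>R v i z) - (Re h *\<^sub>R fu z + Im h *\<^sub>R fv z)
           = Re h *\<^sub>R ((\<Sum>i<n. u i z) - fu z) + Im h *\<^sub>R ((\<Sum>i<n. v i z) - fv z)"
          by (simp add: sum.distrib scaleR_sum_right algebra_simps)
        also have "norm \<dots> \<le> norm h * (e / 2) + norm h * (e / 2)"
        proof (rule norm_triangle_mono)
          have "norm ((\<Sum>i<n. u i z) - fu z) \<le> e / 2" "norm ((\<Sum>i<n. v i z) - fv z) \<le> e / 2"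
            using elim z by (simp_all only: dist_norm less_imp_le)
          thus "norm (Re h *\<^sub>R ((\<Sum>i<n. u i z) - fu z)) \<le> norm h * (e / 2)"
            "norm (Im h *\<^sub>R ((\<Sum>i<n. v i z) - fv z)) \<le> norm h * (e / 2)"
            unfolding norm_scaleR using abs_Re_le_cmod[of h] abs_Im_le_cmod[of h]
            by (auto intro!: mult_mono simp del: times_divide_eq_right)
        qed
        finally show "norm ((\<Sum>i<n. Re h *\<^sub>R u i z + Im h *\<^sub>R v i z) - (Re h *\<^sub>R fu z + Im h *\<^sub>R fv z)) \<le> e * norm h"
          by (simp add: mult_ac)
      qed
    qed
  qed
  then obtain g where g: "\<And>z. z \<in> B \<Longrightarrow> (\<lambda>k. (Re (z - z0) ^ p k * Im (z - z0) ^ q k) *\<^sub>R b k) sums g z"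
    "\<And>z. z \<in> B \<Longrightarrow> (g has_derivative (\<lambda>h. Re h *\<^sub>R fu z + Im h *\<^sub>R fv z)) (at z within B)" by blast
  have gf: "g z = f z" if "z \<in> B" for z using sums_unique2[OF g(1)[OF that] SB[OF that]] .
  have D: "(f has_derivative (\<lambda>h. Re h *\<^sub>R fu z + Im h *\<^sub>R fv z)) (at z)" if z: "z \<in> B" for z
  proof (rule has_derivative_transform_within_open[OF _ opB z gf])
    show "(g has_derivative (\<lambda>h. Re h *\<^sub>R fu z + Im h *\<^sub>R fv z)) (at z)"
      using g(2)[OF z] by (simp only: at_within_open[OF z opB])
  qed
  have Su: "((\<lambda>k. u k z) has_sum fu z) UNIV" "((\<lambda>k. v k z) has_sum fv z) UNIV" if z: "z \<in> B" for z
  proof -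
    have su: "summable (\<lambda>k. norm (u k z))" and sv: "summable (\<lambda>k. norm (v k z))"
      using ub[OF z] vb[OF z] by (auto intro!: summable_comparison_test'[OF sm', of 0])
    show "((\<lambda>k. u k z) has_sum fu z) UNIV" "((\<lambda>k. v k z) has_sum fv z) UNIV"
      unfolding fu_def fv_def
      by (intro norm_summable_imp_has_sum su sv summable_sums summable_norm_cancel)+
  qed
  have re: "((\<lambda>(m, n). F m n) has_sum s) UNIV" if "((\<lambda>k. F (p k) (q k)) has_sum s) UNIV" for F :: "nat \<Rightarrow> nat \<Rightarrow> complex" and s
  proof -
    have "(\<lambda>(m, n). F m n) \<circ> prod_decode = (\<lambda>k. F (p k) (q k))" by (auto simp: pd)
    with that have "((\<lambda>(m, n). F m n) \<circ> prod_decode has_sum s) UNIV" by simp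
    hence "((\<lambda>(m, n). F m n) has_sum s) (range prod_decode)"
      by (subst has_sum_reindex[OF inj_prod_decode])
    thus ?thesis by (simp only: surj_prod_decode)
  qed
  have Bi: "z \<in> B" if "\<bar>Re (z - z0)\<bar> < r / 2 \<and> \<bar>Im (z - z0)\<bar> < r / 2" for z using that by (simp add: B_def)
  have "real_analytic2_at fu z0"
  proof (unfold real_analytic2_at_def, intro exI conjI allI impI)
    show "0 < r / 2" using r by simp
    fix z assume "\<bar>Re (z - z0)\<bar> < r / 2 \<and> \<bar>Im (z - z0)\<bar> < r / 2"
    from has_sum_shift1[OF re[OF Su(1)[OF Bi[OF this], unfolded u_def b_def]]]
    show "((\<lambda>(m, n). (Re (z - z0) ^ m * Im (z - z0) ^ n) *\<^sub>R (real (Suc m) *\<^sub>R a (Suc m) n)) has_sum fu z) UNIV" .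
  qed
  moreover have "real_analytic2_at fv z0"
  proof (unfold real_analytic2_at_def, intro exI conjI allI impI)
    show "0 < r / 2" using r by simp
    fix z assume "\<bar>Re (z - z0)\<bar> < r / 2 \<and> \<bar>Im (z - z0)\<bar> < r / 2"
    from has_sum_shift2[OF re[OF Su(2)[OF Bi[OF this], unfolded v_def b_def]]]
    show "((\<lambda>(m, n). (Re (z - z0) ^ m * Im (z - z0) ^ n) *\<^sub>R (real (Suc n) *\<^sub>R a m (Suc n))) has_sum fv z) UNIV" .
  qed
  moreover obtain d where d: "d > 0" "ball z0 d \<subseteq> B" using opB z0B openE by blast
  ultimately show thesis using that[of d fu fv] D by blast
qed

lemma real_analytic2_at_cong:
  assumes "real_analytic2_at f z0" "d > 0" "\<And>z. z \<in> ball z0 d \<Longrightarrow> f z = g z"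
  shows "real_analytic2_at g z0"
proof -
  from assms(1) obtain a \<rho> where \<rho>: "\<rho> > 0" and S:
    "\<And>z. \<bar>Re (z - z0)\<bar> < \<rho> \<Longrightarrow> \<bar>Im (z - z0)\<bar> < \<rho> \<Longrightarrow>
       ((\<lambda>(m, n). (Re (z - z0) ^ m * Im (z - z0) ^ n) *\<^sub>R a m n) has_sum f z) UNIV"
    unfolding real_analytic2_at_def by blast
  have "z \<in> ball z0 d" if "\<bar>Re (z - z0)\<bar> < min \<rho> (d / 2)" "\<bar>Im (z - z0)\<bar> < min \<rho> (d / 2)" for z
    using that cmod_le[of "z - z0"] by (auto simp: dist_norm norm_minus_commute)
  hence "((\<lambda>(m, n). (Re (z - z0) ^ m * Im (z - z0) ^ n) *\<^sub>R a m n) has_sum g z) UNIV"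
    if "\<bar>Re (z - z0)\<bar> < min \<rho> (d / 2)" "\<bar>Im (z - z0)\<bar> < min \<rho> (d / 2)" for z
    using S[of z] assms(3)[of z] that by (simp only: min_less_iff_conj)
  thus ?thesis unfolding real_analytic2_at_def using assms(2) \<rho>
    by (intro exI[of _ a] exI[of _ "min \<rho> (d / 2)"]) auto
qed

text \<open>The partial derivatives found locally around different centres must come from one global
  function; the Frechet derivative evaluated at \<open>1\<close> and \<open>\<i>\<close> supplies
  it.\<close>

lemma real_analytic2_class_closed:
  fixes f :: "complex \<Rightarrow> complex"
  assumes U: "open U" and f: "\<And>z. z \<in> U \<Longrightarrow> real_analytic2_at f z"
  shows "\<exists>fu fv :: complex \<Rightarrow> complex. (\<forall>z\<in>U. real_analytic2_at fu z) \<and> (\<forall>z\<in>U. real_analytic2_at fv z) \<and>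
     (\<forall>z\<in>U. (f has_derivative (\<lambda>h. of_real (Re h) * fu z + of_real (Im h) * fv z)) (at z))"
proof -
  define fu where "fu z = frechet_derivative f (at z) 1" for z
  define fv where "fv z = frechet_derivative f (at z) \<i>" for z
  have "real_analytic2_at fu z \<and> real_analytic2_at fv z \<and>
     (f has_derivative (\<lambda>h. of_real (Re h) * fu z + of_real (Im h) * fv z)) (at z)" if z: "z \<in> U" for z
  proof -
    obtain gu gv d where g: "d > 0"
      "\<And>w. w \<in> ball z d \<Longrightarrow> (f has_derivative (\<lambda>h. Re h *\<^sub>R gu w + Im h *\<^sub>R gv w)) (at w)"
      "real_analytic2_at gu z" "real_analytic2_at gv z"
      by (rule real_analytic2_at_derivatives[OF f[OF z]]) (rule that)
    have e: "gu w = fu w" "gv w = fv w" if "w \<in> ball z d" for w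
      using frechet_derivative_at[OF g(2)[OF that]] by (auto simp: fu_def fv_def fun_eq_iff dest: spec[of _ 1] spec[of _ \<i>])
    have "real_analytic2_at fu z" "real_analytic2_at fv z"
      by (rule real_analytic2_at_cong[OF g(3,1)] real_analytic2_at_cong[OF g(4,1)]; simp add: e)+
    thus ?thesis using g(2)[of z] e[of z] g(1) by (simp add: scaleR_conv_of_real)
  qed
  thus ?thesis by blast
qed

lemma smooth_fun_class_closed:
  fixes f :: "complex \<Rightarrow> complex"
  assumes "smooth_fun f"
  shows "\<exists>fu fv :: complex \<Rightarrow> complex. smooth_fun fu \<and> smooth_fun fv \<and>
     (\<forall>z\<in>UNIV. (f has_derivative (\<lambda>h. of_real (Re h) * fu z + of_real (Im h) * fv z)) (at z))"
proof (intro exI conjI ballI)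
  have s: "times_differentiable (Suc k) f" for k using assms by (simp add: smooth_fun_def)
  show "smooth_fun (\<lambda>z. frechet_derivative f (at z) 1)" "smooth_fun (\<lambda>z. frechet_derivative f (at z) \<i>)"
    using s by (auto simp: smooth_fun_def)
  fix z
  have d: "(f has_derivative frechet_derivative f (at z)) (at z)" using s[of 0] frechet_derivative_works by auto
  have l: "linear (frechet_derivative f (at z))" by (rule has_derivative_linear[OF d])
  have "frechet_derivative f (at z) h = of_real (Re h) * frechet_derivative f (at z) 1 + of_real (Im h) * frechet_derivative f (at z) \<i>" for h
  proof -
    have "frechet_derivative f (at z) h = frechet_derivative f (at z) (Re h *\<^sub>R 1 + Im h *\<^sub>R \<i>)"
      by (rule arg_cong[of _ _ "frechet_derivative f (at z)"]) (simp add: complex_eq_iff)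
    thus ?thesis by (simp only: linear_add[OF l] linear_cmul[OF l]) (simp add: scaleR_conv_of_real)
  qed
  hence "frechet_derivative f (at z) = (\<lambda>h. of_real (Re h) * frechet_derivative f (at z) 1 + of_real (Im h) * frechet_derivative f (at z) \<i>)"
    by (rule ext)
  with d show "(f has_derivative (\<lambda>h. of_real (Re h) * frechet_derivative f (at z) 1 + of_real (Im h) * frechet_derivative f (at z) \<i>)) (at z)"
    by (simp only:)
qed

text \<open>Local holomorphic extensions off the circle agree on overlaps by the identity theorem, because the
  overlap of two disks centred on the circle meets the circle in an arc.\<close>

lemma circle_ext_local:
  assumes loc: "\<And>z0. norm z0 = 1 \<Longrightarrow> \<exists>S u. open S \<and> z0 \<in> S \<and> u holomorphic_on S \<and> (\<forall>z\<in>S. norm z = 1 \<longrightarrow> f z = u z)"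
  shows "circle_ext f"
proof -
  define \<G> where "\<G> = {S. open S \<and> (\<exists>u. u holomorphic_on S \<and> (\<forall>z\<in>S. norm z = 1 \<longrightarrow> f z = u z))}"
  have "compact (sphere (0::complex) 1)" by (rule compact_sphere)
  moreover have "sphere 0 1 \<subseteq> \<Union>\<G>" using loc by (fastforce simp: \<G>_def)
  moreover have "\<And>G. G \<in> \<G> \<Longrightarrow> open G" by (simp add: \<G>_def)
  \<comment> \<open>A Lebesgue number of the cover: one radius that works for all centres on the
    circle.\<close>
  ultimately obtain e where e: "0 < e" "\<And>x. x \<in> sphere 0 1 \<Longrightarrow> \<exists>G\<in>\<G>. ball x e \<subseteq> G"
    using Heine_Borel_lemma by metis
  have "\<exists>u. u holomorphic_on ball w e \<and> (\<forall>z\<in>ball w e. norm z = 1 \<longrightarrow> f z = u z)" if "norm w = 1" for w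
    using e(2)[of w] that holomorphic_on_subset unfolding \<G>_def by fastforce
  then obtain u where u: "\<And>w. norm w = 1 \<Longrightarrow> u w holomorphic_on ball w e"
    "\<And>w z. norm w = 1 \<Longrightarrow> z \<in> ball w e \<Longrightarrow> norm z = 1 \<Longrightarrow> f z = u w z" by metis
  have agree: "u w z = u w' z" if w: "norm w = 1" "norm w' = 1" "dist w w' < e" "z \<in> ball w e" "z \<in> ball w' e" for w w' z
  proof -
    let ?S = "ball w e \<inter> ball w' e"
    have "u w z - u w' z = 0"
    proof (rule analytic_continuation[of "\<lambda>z. u w z - u w' z" ?S "sphere 0 1 \<inter> ?S" w])
      show "(\<lambda>z. u w z - u w' z) holomorphic_on ?S"
        using u(1) w by (intro holomorphic_intros) (auto intro: holomorphic_on_subset)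
      show "connected ?S" by (intro convex_connected convex_Int convex_ball)
      have "w islimpt sphere 0 1"
      proof (rule connected_imp_perfect)
        show "connected (sphere (0::complex) 1)" by (rule connected_sphere) simp
        show "sphere (0::complex) 1 \<noteq> {x}" for x
        proof
          assume "sphere 0 1 = {x}"
          moreover have "1 \<in> sphere (0::complex) 1" "-1 \<in> sphere (0::complex) 1" by auto
          ultimately show False by force
        qed
      qed (use w in auto)
      thus "w islimpt (sphere 0 1 \<inter> ?S)"
      proof (rule islimpt_Int_eventually)
        have "open ?S" "w \<in> ?S" using w e(1) by (auto simp: dist_commute)
        thus "\<forall>\<^sub>F y in at w. y \<in> ?S" using eventually_at_topological by blast
      qed
      show "u w x - u w' x = 0" if "x \<in> sphere 0 1 \<inter> ?S" for x
        using that u(2)[of w x] u(2)[of w' x] w by simp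
      show "w \<in> ?S" using w e(1) by (auto simp: dist_commute)
    qed (use w in auto)
    thus ?thesis by simp
  qed
  \<comment> \<open>Every point uses the extension centred at its radial projection. By
    \<open>agree\<close> the choice of centre may be frozen near any given point, which gives
    holomorphy.\<close>
  define U where "U z = u (sgn z) z" for z
  have "open (\<Union>w\<in>sphere 0 1. ball w e)" "sphere 0 1 \<subseteq> (\<Union>w\<in>sphere (0::complex) 1. ball w e)" using e(1) by force+
  define V where "V = {z::complex. z \<noteq> 0 \<and> dist (sgn z) z < e}"
  have csgn: "continuous_on (- {0}) (sgn :: complex \<Rightarrow> complex)"
    unfolding sgn_div_norm by (intro continuous_intros) auto
  have opV: "open V"
  proof -
    have "V = - {0} \<inter> (\<lambda>z. dist (sgn z) z) -` {..<e}" by (auto simp: V_def)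
    moreover have "open \<dots>"
      by (rule continuous_open_preimage) (auto intro!: continuous_intros csgn)
    ultimately show ?thesis by simp
  qed
  have "sphere 0 1 \<subseteq> V" using e(1) by (auto simp: V_def sgn_div_norm)
  then obtain \<rho> where \<rho>: "0 < \<rho>" "\<rho> < 1" "annulus \<rho> \<subseteq> V" using open_contains_annulus[OF opV] by blast
  have "U holomorphic_on annulus \<rho>"
    unfolding holomorphic_on_open[OF open_annulus]
  proof (intro ballI)
    fix z assume z: "z \<in> annulus \<rho>"
    hence zV: "z \<noteq> 0" "dist (sgn z) z < e" using \<rho> by (auto simp: V_def)
    have ns: "norm (sgn w) = 1" if "w \<noteq> 0" for w :: complex using that by (simp add: norm_sgn)
    have "(u (sgn z) has_field_derivative deriv (u (sgn z)) z) (at z)"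
      by (rule holomorphic_derivI[OF u(1)[OF ns[OF zV(1)]] open_ball]) (use zV in auto)
    moreover have "\<forall>\<^sub>F w in nhds z. u (sgn z) w = U w"
    proof -
      have "isCont sgn z" using csgn zV(1) continuous_on_eq_continuous_at[of "- {0::complex}" sgn] by (simp add: open_Compl)
      hence "(sgn \<longlongrightarrow> sgn z) (nhds z)" by (simp add: isCont_def tendsto_nhds_iff)
      hence "\<forall>\<^sub>F w in nhds z. dist (sgn w) (sgn z) < e" using e(1) by (rule tendstoD)
      moreover have "\<forall>\<^sub>F w in nhds z. w \<in> V \<inter> ball (sgn z) e"
        by (rule eventually_nhds_in_open) (use opV z \<rho> zV in auto)
      ultimately show ?thesis
      proof eventually_elim
        case (elim w)
        thus ?case unfolding U_def using agree[of "sgn z" "sgn w" w] ns zV by (auto simp: V_def dist_commute)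
      qed
    qed
    ultimately show "\<exists>f'. (U has_field_derivative f') (at z)" using DERIV_cong_ev[OF refl _ refl] by blast
  qed
  moreover have "f z = U z" if "norm z = 1" for z
    using u(2)[of z z] that e(1) by (simp add: U_def sgn_div_norm)
  ultimately show ?thesis using \<rho> by (intro circle_extI)
qed

text \<open>Complexification. On the circle the real and imaginary parts of
  \<open>\<psi> - w0\<close> are combinations of \<open>\<psi>\<close> and its conjugate, and the
  conjugate extends holomorphically by reflection. Substituting the resulting \<open>X\<close> and
  \<open>Y\<close> into the double power series of \<open>f\<close> yields a local extension; the
  local pieces are then glued.\<close>

lemma circle_ext_real_analytic:
  fixes f :: "complex \<Rightarrow> complex"
  assumes \<rho>: "0 < \<rho>" "\<rho> < 1" and \<psi>: "\<psi> holomorphic_on annulus \<rho>"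
    and f: "\<And>z. z \<in> annulus \<rho> \<Longrightarrow> real_analytic2_at f (\<psi> z)"
  shows "circle_ext (\<lambda>z. f (\<psi> z))"
proof (rule circle_ext_local)
  fix \<zeta>0 :: complex assume n: "norm \<zeta>0 = 1"
  hence z0: "\<zeta>0 \<in> annulus \<rho>" using sphere_subset_annulus[OF \<rho>] by auto
  define w0 where "w0 = \<psi> \<zeta>0"
  have ra: "real_analytic2_at f w0" using f[OF z0] by (simp add: w0_def)
  obtain a r where r: "r > 0" and sm: "summable (\<lambda>k. norm (case prod_decode k of (m, n) \<Rightarrow> r ^ (m + n) *\<^sub>R a m n))"
    and S: "\<And>z. \<bar>Re (z - w0)\<bar> \<le> r \<Longrightarrow> \<bar>Im (z - w0)\<bar> \<le> r \<Longrightarrow>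
       (\<lambda>k. case prod_decode k of (m, n) \<Rightarrow> (Re (z - w0) ^ m * Im (z - w0) ^ n) *\<^sub>R a m n) sums f z"
    by (rule real_analytic2_at_enum[OF ra]) (rule that)
  define p q where "p k = fst (prod_decode k)" and "q k = snd (prod_decode k)" for k
  define b where "b k = a (p k) (q k)" for k
  have pd: "prod_decode k = (p k, q k)" for k by (simp add: p_def q_def)
  have sm': "summable (\<lambda>k. r ^ (p k + q k) * norm (b k))"
    using sm r by (simp add: pd b_def)
  have "circle_ext (\<lambda>z. cnj (\<psi> z))" by (intro circle_ext_cnj circle_extI[OF \<rho> \<psi>]) auto
  then obtain \<rho>' \<psi>' where \<psi>': "0 < \<rho>'" "\<rho>' < 1" "\<psi>' holomorphic_on annulus \<rho>'" "\<And>z. norm z = 1 \<Longrightarrow> cnj (\<psi> z) = \<psi>' z"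
    unfolding circle_ext_def by blast
  let ?A = "annulus \<rho> \<inter> annulus \<rho>'"
  define X where "X z = (\<psi> z - w0 + (\<psi>' z - cnj w0)) / 2" for z
  define Y where "Y z = (\<psi> z - w0 - (\<psi>' z - cnj w0)) / (2 * \<i>)" for z
  have hol: "X holomorphic_on ?A" "Y holomorphic_on ?A"
    unfolding X_def Y_def by (intro holomorphic_intros holomorphic_on_subset[OF \<psi>] holomorphic_on_subset[OF \<psi>'(3)]; simp)+
  have XY: "X z = of_real (Re (\<psi> z - w0))" "Y z = of_real (Im (\<psi> z - w0))" if "norm z = 1" for z
  proof -
    define w where "w = \<psi> z - w0"
    have "X z = (w + cnj w) / 2" "Y z = (w - cnj w) / (2 * \<i>)"
      unfolding X_def Y_def \<psi>'(4)[OF that, symmetric] by (simp_all add: w_def)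
    moreover have "w + cnj w = 2 * of_real (Re w)" "w - cnj w = 2 * \<i> * of_real (Im w)"
      by (simp_all add: complex_eq_iff)
    ultimately show "X z = of_real (Re (\<psi> z - w0))" "Y z = of_real (Im (\<psi> z - w0))"
      by (simp_all add: w_def[symmetric])
  qed
  have zA: "\<zeta>0 \<in> ?A" using z0 n sphere_subset_annulus[OF \<psi>'(1,2)] by auto
  have opA: "open ?A" by (intro open_Int open_annulus)
  define V where "V = {z \<in> ?A. norm (X z) < r \<and> norm (Y z) < r}"
  have opO: "open V"
  proof -
    have "open (?A \<inter> (\<lambda>z. norm (X z)) -` {..<r})" "open (?A \<inter> (\<lambda>z. norm (Y z)) -` {..<r})"
      by (intro continuous_open_preimage continuous_intros holomorphic_on_imp_continuous_on hol opA; simp)+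
    moreover have "V = (?A \<inter> (\<lambda>z. norm (X z)) -` {..<r}) \<inter> (?A \<inter> (\<lambda>z. norm (Y z)) -` {..<r})"
      by (auto simp: V_def)
    ultimately show ?thesis by (simp only: open_Int)
  qed
  have zO: "\<zeta>0 \<in> V" using zA XY[OF n] r by (simp add: V_def w0_def)
  define u where "u z = (\<Sum>k. X z ^ p k * Y z ^ q k * b k)" for z
  have ul: "uniform_limit V (\<lambda>n z. \<Sum>k<n. X z ^ p k * Y z ^ q k * b k) u sequentially"
    unfolding u_def
  proof (rule Weierstrass_m_test[OF _ sm'])
    fix k z assume "z \<in> V"
    hence "norm (X z ^ p k * Y z ^ q k * b k) \<le> r ^ p k * r ^ q k * norm (b k)"
      unfolding norm_mult norm_power using r
      by (intro mult_mono power_mono mult_nonneg_nonneg) (auto simp: V_def)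
    thus "norm (X z ^ p k * Y z ^ q k * b k) \<le> r ^ (p k + q k) * norm (b k)" by (simp add: power_add)
  qed
  have "u holomorphic_on V"
  proof (rule holomorphic_uniform_sequence[OF opO])
    show "(\<lambda>z. \<Sum>k<n. X z ^ p k * Y z ^ q k * b k) holomorphic_on V" for n
      by (intro holomorphic_intros holomorphic_on_subset[OF hol(1)] holomorphic_on_subset[OF hol(2)]) (auto simp: V_def)
    fix x assume "x \<in> V"
    then obtain d where "d > 0" "cball x d \<subseteq> V" using opO open_contains_cball by blast
    thus "\<exists>d>0. cball x d \<subseteq> V \<and> uniform_limit (cball x d) (\<lambda>n z. \<Sum>k<n. X z ^ p k * Y z ^ q k * b k) u sequentially"
      using uniform_limit_on_subset[OF ul] by blast
  qed
  moreover have "f (\<psi> z) = u z" if "z \<in> V" "norm z = 1" for z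
  proof -
    have "\<bar>Re (\<psi> z - w0)\<bar> \<le> r" "\<bar>Im (\<psi> z - w0)\<bar> \<le> r"
      using that unfolding V_def XY[OF that(2)] norm_of_real mem_Collect_eq XY(1)[OF that(2)]
      by (auto simp: XY[OF that(2)] simp del: minus_complex.sel of_real_diff)
    from S[OF this] have "(\<lambda>k. (Re (\<psi> z - w0) ^ p k * Im (\<psi> z - w0) ^ q k) *\<^sub>R b k) sums f (\<psi> z)"
      by (simp add: pd b_def)
    thus ?thesis unfolding u_def XY[OF that(2)] by (simp add: sums_iff scaleR_conv_of_real)
  qed
  ultimately show "\<exists>S u. open S \<and> \<zeta>0 \<in> S \<and> u holomorphic_on S \<and> (\<forall>z\<in>S. norm z = 1 \<longrightarrow> f (\<psi> z) = u z)"
    using opO zO by blast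
qed

lemma log_smooth_real_analytic:
  fixes f :: "complex \<Rightarrow> complex"
  assumes \<rho>: "0 < \<rho>" "\<rho> < 1" and \<psi>: "\<psi> holomorphic_on annulus \<rho>" "\<psi> ` annulus \<rho> \<subseteq> U" and U: "open U"
    and f: "\<And>z. z \<in> U \<Longrightarrow> real_analytic2_at f z"
  shows "log_smooth True \<rho> (\<lambda>z. f (\<psi> z))"
  unfolding log_smooth_def
proof
  fix k
  show "log_smooth_k True \<rho> k (\<lambda>z. f (\<psi> z))"
  proof (rule log_smooth_k_comp[OF \<rho> \<psi>, of "{g. \<forall>z\<in>U. real_analytic2_at g z}"])
    show "\<exists>gu gv :: complex \<Rightarrow> complex. gu \<in> {g. \<forall>z\<in>U. real_analytic2_at g z} \<and> gv \<in> {g. \<forall>z\<in>U. real_analytic2_at g z} \<and>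
       (\<forall>w\<in>U. (g has_derivative (\<lambda>h. of_real (Re h) * gu w + of_real (Im h) * gv w)) (at w))"
      if "g \<in> {g. \<forall>z\<in>U. real_analytic2_at g z}" for g
      using real_analytic2_class_closed[OF U, of g] that by simp
    show "circle_ext (\<lambda>z. g (\<psi> z))" if "g \<in> {g. \<forall>z\<in>U. real_analytic2_at g z}" for g
      using that \<psi>(2) by (intro circle_ext_real_analytic[OF \<rho> \<psi>(1)]) auto
  qed (use f in auto)
qed

lemma log_smooth_smooth_fun:
  assumes \<rho>: "0 < \<rho>" "\<rho> < 1" and \<psi>: "\<psi> holomorphic_on annulus \<rho>" and f: "smooth_fun f"
  shows "log_smooth False \<rho> (\<lambda>z. f (\<psi> z))"
  unfolding log_smooth_def
proof
  fix k
  show "log_smooth_k False \<rho> k (\<lambda>z. f (\<psi> z))"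
    by (rule log_smooth_k_comp[OF \<rho> \<psi>, of UNIV "Collect smooth_fun"])
       (use f smooth_fun_class_closed in auto)
qed

lemma real_analytic2_at_of_real:
  assumes "real_analytic2_at f z0"
  shows "real_analytic2_at (\<lambda>z. complex_of_real (f z)) z0"
proof -
  from assms obtain a \<rho> where \<rho>: "\<rho> > 0" and S:
    "\<And>z. \<bar>Re (z - z0)\<bar> < \<rho> \<Longrightarrow> \<bar>Im (z - z0)\<bar> < \<rho> \<Longrightarrow>
       ((\<lambda>(m, n). (Re (z - z0) ^ m * Im (z - z0) ^ n) *\<^sub>R a m n) has_sum f z) UNIV"
    unfolding real_analytic2_at_def by blast
  have "((\<lambda>(m, n). (Re (z - z0) ^ m * Im (z - z0) ^ n) *\<^sub>R complex_of_real (a m n)) has_sum complex_of_real (f z)) UNIV"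
    if "\<bar>Re (z - z0)\<bar> < \<rho>" "\<bar>Im (z - z0)\<bar> < \<rho>" for z
    using has_sum_of_real[OF S[OF that]] by (simp add: case_prod_unfold scaleR_conv_of_real)
  thus ?thesis unfolding real_analytic2_at_def using \<rho>
    by (intro exI[of _ "\<lambda>m n. complex_of_real (a m n)"] exI[of _ \<rho>]) simp
qed

section \<open>Change of variables in the plane\<close>

text \<open>The change of variables theorem speaks about Cartesian vectors, the area integrals about
  complex numbers, and iterated integration about pairs. These coordinate maps carry boxes to boxes
  of equal content between the three.\<close>

definition vec_complex :: "real^2 \<Rightarrow> complex" where "vec_complex v = Complex (vec_nth v 1) (vec_nth v 2)"
definition complex_vec :: "complex \<Rightarrow> real^2" where "complex_vec z = vector [Re z, Im z]"
definition vec_pair :: "real^2 \<Rightarrow> real \<times> real" where "vec_pair v = (vec_nth v 1, vec_nth v 2)"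
definition pair_vec :: "real \<times> real \<Rightarrow> real^2" where "pair_vec p = vector [fst p, snd p]"

lemma vec_complex_inverse [simp]: "complex_vec (vec_complex v) = v" "vec_complex (complex_vec z) = z"
  by (simp_all add: vec_complex_def complex_vec_def vec_eq_iff forall_2)

lemma vec_pair_inverse [simp]: "pair_vec (vec_pair v) = v" "vec_pair (pair_vec z) = z"
  by (simp_all add: vec_pair_def pair_vec_def vec_eq_iff forall_2)

lemma bounded_linear_vec_complex: "bounded_linear vec_complex"
proof -
  have "linear vec_complex"
    by (rule linearI) (simp_all add: vec_complex_def complex_eq_iff)
  thus ?thesis by (simp add: linear_conv_bounded_linear)
qed

lemma bounded_linear_complex_vec: "bounded_linear complex_vec"
proof -
  have "linear complex_vec"
    by (rule linearI) (simp_all add: complex_vec_def vec_eq_iff forall_2)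
  thus ?thesis by (simp add: linear_conv_bounded_linear)
qed

lemma bounded_linear_vec_pair: "bounded_linear vec_pair"
proof -
  have "linear vec_pair"
    by (rule linearI) (simp_all add: vec_pair_def)
  thus ?thesis by (simp add: linear_conv_bounded_linear)
qed

lemma mem_cbox_vec2: "v \<in> cbox a b \<longleftrightarrow> vec_nth a 1 \<le> vec_nth v 1 \<and> vec_nth v 1 \<le> vec_nth b 1 \<and> vec_nth a 2 \<le> vec_nth v 2 \<and> vec_nth v 2 \<le> vec_nth (b :: real^2) 2"
  by (auto simp: mem_box_cart forall_2)

lemma mem_cbox_pair: "p \<in> cbox a b \<longleftrightarrow> fst a \<le> fst p \<and> fst p \<le> fst b \<and> snd a \<le> snd p \<and> snd p \<le> snd (b :: real \<times> real)"
  by (cases a, cases b, cases p) (auto simp: cbox_Pair_eq)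

lemma vec_complex_cbox: "vec_complex ` cbox u v = cbox (vec_complex u) (vec_complex v)"
proof (intro set_eqI iffI)
  fix z assume "z \<in> cbox (vec_complex u) (vec_complex v)"
  hence "complex_vec z \<in> cbox u v" by (auto simp: in_cbox_complex_iff mem_cbox_vec2 vec_complex_def complex_vec_def)
  thus "z \<in> vec_complex ` cbox u v" by (metis image_eqI vec_complex_inverse(2))
qed (auto simp: in_cbox_complex_iff mem_cbox_vec2 vec_complex_def)

lemma complex_vec_cbox: "complex_vec ` cbox u v = cbox (complex_vec u) (complex_vec v)"
proof (intro set_eqI iffI)
  fix z assume "z \<in> cbox (complex_vec u) (complex_vec v)"
  hence "vec_complex z \<in> cbox u v" by (auto simp: in_cbox_complex_iff mem_cbox_vec2 vec_complex_def complex_vec_def)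
  thus "z \<in> complex_vec ` cbox u v" by (metis image_eqI vec_complex_inverse(1))
qed (auto simp: in_cbox_complex_iff mem_cbox_vec2 complex_vec_def)

lemma vec_pair_cbox: "vec_pair ` cbox u v = cbox (vec_pair u) (vec_pair v)"
proof (intro set_eqI iffI)
  fix z assume "z \<in> cbox (vec_pair u) (vec_pair v)"
  hence "pair_vec z \<in> cbox u v" by (auto simp: mem_cbox_pair mem_cbox_vec2 vec_pair_def pair_vec_def)
  thus "z \<in> vec_pair ` cbox u v" by (metis image_eqI vec_pair_inverse(2))
qed (auto simp: mem_cbox_pair mem_cbox_vec2 vec_pair_def)

lemma pair_vec_cbox: "pair_vec ` cbox u v = cbox (pair_vec u) (pair_vec v)"
proof (intro set_eqI iffI)
  fix z assume "z \<in> cbox (pair_vec u) (pair_vec v)"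
  hence "vec_pair z \<in> cbox u v" by (auto simp: mem_cbox_pair mem_cbox_vec2 vec_pair_def pair_vec_def)
  thus "z \<in> pair_vec ` cbox u v" by (metis image_eqI vec_pair_inverse(1))
qed (auto simp: mem_cbox_pair mem_cbox_vec2 pair_vec_def)

lemma content_vec2: "measure lborel (cbox a (b :: real^2)) = (if vec_nth a 1 \<le> vec_nth b 1 \<and> vec_nth a 2 \<le> vec_nth b 2 then (vec_nth b 1 - vec_nth a 1) * (vec_nth b 2 - vec_nth a 2) else 0)"
proof -
  have "cbox a b = {} \<longleftrightarrow> \<not> (vec_nth a 1 \<le> vec_nth b 1 \<and> vec_nth a 2 \<le> vec_nth b 2)"
  proof -
    have "(\<exists>i::2. P i) \<longleftrightarrow> P 1 \<or> P 2" for P by (metis exhaust_2)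
    thus ?thesis by (auto simp: interval_eq_empty_cart not_le)
  qed
  thus ?thesis by (simp add: content_cbox_if_cart UNIV_2)
qed

lemma content_complex: "measure lborel (cbox a (b :: complex)) = (if Re a \<le> Re b \<and> Im a \<le> Im b then (Re b - Re a) * (Im b - Im a) else 0)"
proof -
  have "cbox a b = {} \<longleftrightarrow> \<not> (Re a \<le> Re b \<and> Im a \<le> Im b)"
    by (auto simp: box_eq_empty Basis_complex_def not_le)
  thus ?thesis by (simp add: content_cbox_if Basis_complex_def)
qed

lemma content_pair: "measure lborel (cbox a (b :: real \<times> real)) = (if fst a \<le> fst b \<and> snd a \<le> snd b then (fst b - fst a) * (snd b - snd a) else 0)"
  by (cases a, cases b) (auto simp: content_Pair)

text \<open>A bijection that maps boxes to boxes of the same content preserves gauge integrals over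
  boxes. A bounded \<open>S\<close> is enclosed in a box and the integrand extended by zero.\<close>

lemma has_integral_transfer:
  fixes T :: "'a::euclidean_space \<Rightarrow> 'b::euclidean_space" and f :: "'a \<Rightarrow> 'c::banach"
  assumes inv: "\<And>x. T' (T x) = x" "\<And>y. T (T' y) = y" and lin: "bounded_linear T'"
    and cb: "\<And>u v. T ` cbox u v = cbox (T u) (T v)" "\<And>u v. T' ` cbox u v = cbox (T' u) (T' v)"
    and cont: "\<And>u v. measure lborel (cbox (T' u) (T' v)) = measure lborel (cbox u v)"
    and S: "bounded S" and f: "(f has_integral i) S"
  shows "((\<lambda>y. f (T' y)) has_integral i) (T ` S)"
proof -
  obtain a where a: "S \<subseteq> cbox (-a) a" using bounded_subset_cbox_symmetric[OF S] by blast
  have "((\<lambda>x. if x \<in> S then f x else 0) has_integral i) (cbox (-a) a)"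
    using has_integral_restrict[OF a] f by blast
  hence "((\<lambda>y. if T' y \<in> S then f (T' y) else 0) has_integral (1 / 1) *\<^sub>R i) (T ` cbox (-a) a)"
    by (rule has_integral_twiddle[rotated -1])
       (auto simp: inv cb cont intro: linear_continuous_at[OF lin])
  moreover have "(T' y \<in> S) = (y \<in> T ` S)" for y using inv by (metis image_iff)
  ultimately have "((\<lambda>y. if y \<in> T ` S then f (T' y) else 0) has_integral i) (T ` cbox (-a) a)" by simp
  moreover have "T ` S \<subseteq> T ` cbox (-a) a" using a by blast
  ultimately show ?thesis using has_integral_restrict[of "T ` S" "T ` cbox (-a) a" "\<lambda>y. f (T' y)" i] by blast
qed

lemma has_integral_vec_complex:
  fixes f :: "real^2 \<Rightarrow> 'c::banach"
  assumes "bounded S" "(f has_integral i) S"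
  shows "((\<lambda>y. f (complex_vec y)) has_integral i) (vec_complex ` S)"
proof (rule has_integral_transfer[OF vec_complex_inverse bounded_linear_complex_vec vec_complex_cbox complex_vec_cbox _ assms])
  show "measure lborel (cbox (complex_vec u) (complex_vec v)) = measure lborel (cbox u v)" for u v
    by (simp add: content_vec2 content_complex complex_vec_def)
qed

lemma has_integral_pair_vec:
  fixes f :: "real \<times> real \<Rightarrow> 'c::banach"
  assumes "bounded S" "(f has_integral i) S"
  shows "((\<lambda>y. f (vec_pair y)) has_integral i) (pair_vec ` S)"
proof (rule has_integral_transfer[OF vec_pair_inverse(2,1) bounded_linear_vec_pair pair_vec_cbox vec_pair_cbox _ assms])
  show "measure lborel (cbox (vec_pair u) (vec_pair v)) = measure lborel (cbox u v)" for u v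
    by (simp add: content_vec2 content_pair vec_pair_def)
qed

text \<open>The box is half open because the map will be built from \<open>exp\<close>: with both
  horizontal sides included it would not be injective. The two missing edges are null sets, so the
  closed box may be used for the continuous function \<open>F\<close>. The Jacobian of a holomorphic
  map is the squared modulus of its derivative.\<close>

lemma integral_change_of_variables_box:
  fixes g f :: "complex \<Rightarrow> complex" and F :: "real \<times> real \<Rightarrow> complex" and a b c d :: real
  defines "S \<equiv> {\<xi>. a \<le> Re \<xi> \<and> Re \<xi> < b \<and> c \<le> Im \<xi> \<and> Im \<xi> < d}"
  assumes g: "\<And>\<xi>. \<xi> \<in> S \<Longrightarrow> (g has_field_derivative g' \<xi>) (at \<xi>)" and inj: "inj_on g S"
    and bd: "bounded (g ` S)"
    and F: "continuous_on (cbox (a, c) (b, d)) F"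
      "\<And>\<xi>. \<xi> \<in> S \<Longrightarrow> F (Re \<xi>, Im \<xi>) = (norm (g' \<xi>))\<^sup>2 *\<^sub>R f (g \<xi>)"
  shows "(f has_integral integral (cbox (a, c) (b, d)) F) (g ` S)"
proof -
  define K :: "(real^2) set" where "K = cbox (pair_vec (a, c)) (pair_vec (b, d))"
  define S' where "S' = complex_vec ` S"
  have S'_eq: "S' = {v::real^2. a \<le> vec_nth v 1 \<and> vec_nth v 1 < b \<and> c \<le> vec_nth v 2 \<and> vec_nth v 2 < d}"
  proof (intro set_eqI iffI)
    fix v assume "v \<in> {v::real^2. a \<le> vec_nth v 1 \<and> vec_nth v 1 < b \<and> c \<le> vec_nth v 2 \<and> vec_nth v 2 < d}"
    hence "vec_complex v \<in> S" by (simp add: S_def vec_complex_def)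
    thus "v \<in> S'" unfolding S'_def by (metis image_eqI vec_complex_inverse(1))
  qed (auto simp: S'_def S_def complex_vec_def)
  have sub: "S' \<subseteq> K" by (auto simp: S'_eq K_def mem_cbox_vec2 pair_vec_def)
  define H where "H = (\<lambda>v. F (vec_pair v))"
  have Hint: "(H has_integral integral (cbox (a, c) (b, d)) F) K"
    using has_integral_pair_vec[OF bounded_cbox integrable_integral[OF integrable_continuous[OF F(1)]]]
    by (simp add: H_def K_def pair_vec_cbox)
  have Hc: "continuous_on K H"
    unfolding H_def
  proof (rule continuous_on_compose2[OF F(1)])
    show "continuous_on K vec_pair" by (rule bounded_linear.continuous_on[OF bounded_linear_vec_pair continuous_on_id])
    show "vec_pair ` K \<subseteq> cbox (a, c) (b, d)" by (simp add: K_def vec_pair_cbox)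
  qed
  have meas: "S' \<in> sets lebesgue"
  proof -
    have "S' = {v::real^2. a \<le> vec_nth v 1} \<inter> {v. vec_nth v 1 < b} \<inter> {v. c \<le> vec_nth v 2} \<inter> {v. vec_nth v 2 < d}" by (auto simp: S'_eq)
    moreover have "closed {v::real^2. a \<le> vec_nth v 1}" "closed {v::real^2. c \<le> vec_nth v 2}"
      "open {v::real^2. vec_nth v 1 < b}" "open {v::real^2. vec_nth v 2 < d}"
      by (intro closed_Collect_le open_Collect_less continuous_intros)+
    ultimately have "S' \<in> sets borel" by (auto intro!: sets.Int)
    thus ?thesis by (simp add: sets_completionI_sets)
  qed
  have Habs: "H absolutely_integrable_on S'"
    using set_integrable_subset[OF absolutely_integrable_continuous[OF Hc[unfolded K_def]] meas] sub by (simp add: K_def)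
  have HS': "(H has_integral integral (cbox (a, c) (b, d)) F) S'"
  proof (rule has_integral_spike_set_eq[of K S' H, THEN iffD1, OF _ _ Hint])
    have "negligible ({v::real^2. vec_nth v 1 = b} \<union> {v. vec_nth v 2 = d})"
    proof (rule negligible_Un)
      have "negligible {v::real^2. v \<bullet> axis i 1 = y}" for i y
        by (rule negligible_standard_hyperplane) (auto simp: Basis_vec_def)
      thus "negligible {v::real^2. vec_nth v 1 = b}" "negligible {v::real^2. vec_nth v 2 = d}"
        by (simp_all add: inner_axis)
    qed
    moreover have "K - S' \<subseteq> {v::real^2. vec_nth v 1 = b} \<union> {v. vec_nth v 2 = d}"
      by (auto simp: S'_eq K_def mem_cbox_vec2 pair_vec_def)
    ultimately have "negligible (K - S')" by (rule negligible_subset)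
    thus "negligible {x \<in> K - S'. H x \<noteq> 0}" by (rule negligible_subset) auto
    show "negligible {x \<in> S' - K. H x \<noteq> 0}" by (rule negligible_subset[OF negligible_empty]) (use sub in auto)
  qed
  define G where "G = (\<lambda>v. complex_vec (g (vec_complex v)))"
  define G' where "G' = (\<lambda>v h. complex_vec (g' (vec_complex v) * vec_complex h))"
  define f' where "f' = (\<lambda>v. complex_vec (f (vec_complex v)))"
  have vS: "vec_complex v \<in> S" if "v \<in> S'" for v using that by (auto simp: S'_def)
  have der: "(G has_derivative G' v) (at v within S')" if "v \<in> S'" for v
  proof -
    have "(g has_derivative (\<lambda>h. g' (vec_complex v) * h)) (at (vec_complex v))"
      using g[OF vS[OF that]] by (simp add: has_field_derivative_def)
    from bounded_linear.has_derivative[OF bounded_linear_complex_vec has_derivative_compose[OF bounded_linear_imp_has_derivative[OF bounded_linear_vec_complex] this]]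
    show ?thesis unfolding G_def G'_def .
  qed
  have injG: "inj_on G S'"
    using inj vS by (auto simp: inj_on_def G_def) (metis vec_complex_inverse)
  have det: "\<bar>det (matrix (G' v))\<bar> = (norm (g' (vec_complex v)))\<^sup>2" for v
  proof -
    define w where "w = g' (vec_complex v)"
    have "det (matrix (G' v)) = (Re w)\<^sup>2 + (Im w)\<^sup>2"
    proof -
      have "G' v = (\<lambda>h. complex_vec (w * vec_complex h))" by (simp add: G'_def w_def)
      thus ?thesis unfolding det_2 matrix_def
        by (simp add: complex_vec_def vec_complex_def axis_def power2_eq_square)
    qed
    thus ?thesis by (simp add: cmod_power2 w_def)
  qed
  have eq: "\<bar>det (matrix (G' v))\<bar> *\<^sub>R f' (G v) = complex_vec (H v)" if v: "v \<in> S'" for v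
  proof -
    have "H v = F (Re (vec_complex v), Im (vec_complex v))" by (simp add: H_def vec_pair_def vec_complex_def)
    also have "\<dots> = (norm (g' (vec_complex v)))\<^sup>2 *\<^sub>R f (g (vec_complex v))" by (rule F(2)[OF vS[OF v]])
    finally have "complex_vec (H v) = (norm (g' (vec_complex v)))\<^sup>2 *\<^sub>R complex_vec (f (g (vec_complex v)))"
      by (simp add: linear_cmul[OF bounded_linear.linear[OF bounded_linear_complex_vec]])
    thus ?thesis unfolding det by (simp add: f'_def G_def)
  qed
  have "(\<lambda>v. complex_vec (H v)) absolutely_integrable_on S'"
    using absolutely_integrable_linear[OF Habs bounded_linear_complex_vec] by (simp add: o_def)
  hence 1: "(\<lambda>v. \<bar>det (matrix (G' v))\<bar> *\<^sub>R f' (G v)) absolutely_integrable_on S'"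
    by (rule absolutely_integrable_spike[OF _ negligible_empty]) (simp add: eq)
  have "((\<lambda>v. complex_vec (H v)) has_integral complex_vec (integral (cbox (a, c) (b, d)) F)) S'"
    using has_integral_linear[OF HS' bounded_linear_complex_vec] by (simp add: o_def)
  hence 2: "integral S' (\<lambda>v. \<bar>det (matrix (G' v))\<bar> *\<^sub>R f' (G v)) = complex_vec (integral (cbox (a, c) (b, d)) F)"
    by (intro integral_unique) (subst has_integral_cong[OF eq], auto)
  from has_absolute_integral_change_of_variables[OF meas der injG, of f' "complex_vec (integral (cbox (a, c) (b, d)) F)"] 1 2
  have "f' absolutely_integrable_on (G ` S')" "integral (G ` S') f' = complex_vec (integral (cbox (a, c) (b, d)) F)" by blast+
  hence "(f' has_integral complex_vec (integral (cbox (a, c) (b, d)) F)) (G ` S')"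
    by (simp add: has_integral_iff set_lebesgue_integral_eq_integral(1))
  from has_integral_linear[OF this bounded_linear_vec_complex]
  have 3: "((\<lambda>v. f (vec_complex v)) has_integral integral (cbox (a, c) (b, d)) F) (G ` S')" by (simp add: o_def f'_def)
  have GS: "G ` S' = complex_vec ` g ` S" by (auto simp: S'_def G_def image_image)
  have "bounded (G ` S')"
    unfolding GS by (rule bounded_linear_image[OF bd bounded_linear_complex_vec])
  from has_integral_vec_complex[OF this 3] show ?thesis by (simp add: GS image_image)
qed

section \<open>Topology of the Jordan domain\<close>

lemma real_analytic_at_isCont:
  fixes c :: "real \<Rightarrow> complex"
  assumes "real_analytic_at c t0"
  shows "isCont c t0"
proof -
  from assms obtain a \<rho> where \<rho>: "\<rho> > 0" and S: "\<And>t. \<bar>t - t0\<bar> < \<rho> \<Longrightarrow> (\<lambda>n. (t - t0) ^ n *\<^sub>R a n) sums c t"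
    unfolding real_analytic_at_def by blast
  have S': "(\<lambda>n. a n * of_real (t - t0) ^ n) sums c t" if "\<bar>t - t0\<bar> < \<rho>" for t
    using S[OF that] by (simp add: scaleR_conv_of_real mult.commute)
  have "summable (\<lambda>n. a n * complex_of_real (\<rho> / 2) ^ n)"
    using S'[of "t0 + \<rho> / 2"] \<rho> by (simp add: sums_iff)
  hence "isCont (\<lambda>z. \<Sum>n. a n * z ^ n) (complex_of_real (t0 - t0))"
    by (rule isCont_powser) (use \<rho> in auto)
  hence "isCont (\<lambda>t. \<Sum>n. a n * complex_of_real (t - t0) ^ n) t0"
    by (rule isCont_o2[rotated]) (intro continuous_intros)
  moreover have "\<forall>\<^sub>F t in nhds t0. (\<Sum>n. a n * complex_of_real (t - t0) ^ n) = c t"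
    unfolding eventually_nhds_metric
  proof (intro exI conjI allI impI)
    fix t assume "dist t t0 < \<rho>"
    hence "\<bar>t - t0\<bar> < \<rho>" by (simp add: dist_real_def)
    thus "(\<Sum>n. a n * complex_of_real (t - t0) ^ n) = c t" by (rule sums_unique[OF S', symmetric])
  qed (rule \<rho>)
  ultimately show ?thesis by (subst (asm) isCont_cong)
qed

text \<open>Rescaled to the unit interval the parametrisation is a simple loop, so Jordan's theorem
  applies. The curve is the frontier of both complementary components; this gives the last claim,
  through which boundary points are later approached from outside.\<close>

lemma analytic_jordan_domain_topology:
  assumes "analytic_jordan_domain D"
  shows "open D" "bounded D" "frontier D \<subseteq> closure (- closure D)"
proof -
  from assms obtain c :: "real \<Rightarrow> complex" where c: "\<And>t. real_analytic_at c t" "\<And>t. c (t + 2 * pi) = c t"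
    "inj_on c {0..<2 * pi}" "D = inside (range c)" unfolding analytic_jordan_domain_def by blast
  define g where "g = (\<lambda>s. c (2 * pi * s))"
  have cont: "continuous_on UNIV c"
    using real_analytic_at_isCont[OF c(1)] by (simp add: continuous_at_imp_continuous_on)
  have pg: "path g" unfolding path_def g_def
    by (rule continuous_on_compose2[OF cont]) (auto intro!: continuous_intros)
  have c2: "c (2 * pi) = c 0" using c(2)[of 0] by simp
  have loop: "pathfinish g = pathstart g" by (simp add: g_def pathfinish_def pathstart_def c2)
  have *: "x = y \<or> x = 0 \<and> y = 1 \<or> x = 1 \<and> y = 0" if x: "x \<in> {0..1}" and y: "y \<in> {0..1}" and e: "g x = g y" for x y :: real
  proof -
    have inj: "u = v" if "u \<in> {0..<1}" "v \<in> {0..<1}" "g u = g v" for u v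
    proof -
      have "2 * pi * u \<in> {0..<2 * pi}" "2 * pi * v \<in> {0..<2 * pi}" using that by auto
      from inj_onD[OF c(3) _ this] that(3) show ?thesis by (simp add: g_def)
    qed
    have g1: "g 1 = g 0" by (simp add: g_def c2)
    have "x = 1 \<or> x \<in> {0..<1}" "y = 1 \<or> y \<in> {0..<1}" using x y by auto
    moreover have "y = 0" if "x = 1" "y \<in> {0..<1}" using inj[of y 0] that e g1 by simp
    moreover have "x = 0" if "y = 1" "x \<in> {0..<1}" using inj[of x 0] that e g1 by simp
    ultimately show ?thesis using inj[OF _ _ e] by blast
  qed
  have sp: "simple_path g" unfolding simple_path_def loop_free_def using pg * by blast
  have pi: "path_image g = range c"
  proof
    show "path_image g \<subseteq> range c" by (auto simp: path_image_def g_def)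
    show "range c \<subseteq> path_image g"
    proof
      fix z assume "z \<in> range c"
      then obtain t where t: "z = c t" by auto
      define s where "s = t / (2 * pi)"
      have per: "c (u + 2 * pi * of_nat n) = c u" for u n
      proof (induction n)
        case (Suc n)
        thus ?case using c(2)[of "u + 2 * pi * of_nat n"] by (simp add: algebra_simps)
      qed simp
      have per2: "c (u + 2 * pi * of_int n) = c u" for u n
        using per[of u "nat n"] per[of "u + 2 * pi * of_int n" "nat (- n)"]
        by (cases "n \<ge> 0") (auto simp: algebra_simps)
      have "c (2 * pi * frac s) = c t"
        using per2[of "2 * pi * frac s" "\<lfloor>s\<rfloor>"] by (simp add: frac_def s_def algebra_simps)
      hence "z = g (frac s)" by (simp add: t g_def)
      moreover have "frac s \<in> {0..1}" using frac_ge_0[of s] frac_lt_1[of s] by simp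
      ultimately show "z \<in> path_image g" by (auto simp: path_image_def)
    qed
  qed
  note J = Jordan_inside_outside[OF sp loop, unfolded pi, folded c(4)]
  show "open D" "bounded D" using J by auto
  have fD: "frontier D = range c" "frontier (outside (range c)) = range c" using J by auto
  have "- closure D = outside (range c)"
  proof -
    have "closure D = D \<union> range c" using fD by (simp add: closure_Un_frontier)
    moreover have "D \<inter> outside (range c) = {}" "D \<union> outside (range c) = - range c" using J by auto
    ultimately show ?thesis by blast
  qed
  thus "frontier D \<subseteq> closure (- closure D)"
    using fD by (simp add: closure_Un_frontier)
qed

section \<open>The exterior conformal map\<close>

text \<open>Only the image of the open exterior is prescribed. Boundary points go to the circle,
  since approximation from outside gives modulus at least 1, and a modulus above 1 would violate
  injectivity. Every point of the circle is attained by compactness. Openness of the image then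
  provides a radius below 1 beyond which the inverse is defined.\<close>

lemma exterior_map_properties:
  assumes D: "open D" "bounded D" "frontier D \<subseteq> closure (- closure D)"
    and ext: "exterior_conformal_map D W \<phi>"
  defines "\<psi> \<equiv> the_inv_into W \<phi>"
  obtains r c where "0 < r" "r < 1" "0 < c" "deriv_at_infinity \<phi> = c"
    "\<And>z. r < norm z \<Longrightarrow> \<phi> (\<psi> z) = z"
    "\<phi> holomorphic_on \<psi> ` {z. r < norm z}"
    "exterior_param \<psi> r (inverse (of_real c))"
    "filterlim \<phi> at_infinity at_infinity"
    "\<psi> ` {z. 1 < norm z} = - closure D"
    "\<psi> ` {z. 1 \<le> norm z} = - D"
    "\<psi> ` sphere 0 1 = frontier D"
    "((\<lambda>z. deriv \<phi> z) \<longlongrightarrow> of_real c) at_infinity" "((\<lambda>z. \<phi> z / z) \<longlongrightarrow> of_real c) at_infinity"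
proof -
  from ext obtain c where W: "open W" "- D \<subseteq> W" and hol: "\<phi> holomorphic_on W" and inj: "inj_on \<phi> W"
    and im: "\<phi> ` (- closure D) = {z. 1 < norm z}" and inf: "filterlim \<phi> at_infinity at_infinity"
    and c: "c > 0" "((\<lambda>z. \<phi> z / z) \<longlongrightarrow> complex_of_real c) at_infinity"
    unfolding exterior_conformal_map_def by blast
  have dc: "deriv_at_infinity \<phi> = c"
    unfolding deriv_at_infinity_def using tendsto_Lim[OF trivial_limit_at_infinity c(2)] by simp
  have sub: "- closure D \<subseteq> - D" using closure_subset by auto
  have cont: "continuous_on W \<phi>" by (rule holomorphic_on_imp_continuous_on[OF hol])
  have fr: "frontier D = (- D) - (- closure D)" using D(1) by (auto simp: frontier_def interior_open)
  have f1: "norm (\<phi> z) = 1" if z: "z \<in> frontier D" for z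
  proof -
    have zW: "z \<in> - D" "z \<notin> - closure D" "z \<in> W" using z fr W by auto
    have "z \<in> closure (- closure D)" using D z by auto
    then obtain x where x: "\<And>n. x n \<in> - closure D" "x \<longlonglongrightarrow> z" unfolding closure_sequential by blast
    have "(\<lambda>n. \<phi> (x n)) \<longlonglongrightarrow> \<phi> z"
      using continuous_on_tendsto_compose[OF cont x(2) zW(3)] x(1) sub W by (simp add: subset_iff)
    hence "(\<lambda>n. norm (\<phi> (x n))) \<longlonglongrightarrow> norm (\<phi> z)" by (rule tendsto_norm)
    moreover have "norm (\<phi> (x n)) \<ge> 1" for n using im x(1)[of n] by (auto dest!: equalityD1 simp: image_subset_iff intro: less_imp_le)
    ultimately have "norm (\<phi> z) \<ge> 1" by (intro LIMSEQ_le_const[of "\<lambda>n. norm (\<phi> (x n))"]) auto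
    moreover have "\<not> norm (\<phi> z) > 1"
    proof
      assume "norm (\<phi> z) > 1"
      then obtain w where "w \<in> - closure D" "\<phi> w = \<phi> z" using im by (metis (mono_tags, lifting) imageE mem_Collect_eq)
      hence "w = z" using inj_onD[OF inj] zW sub W by blast
      thus False using \<open>w \<in> - closure D\<close> zW by simp
    qed
    ultimately show ?thesis by simp
  qed
  have T: "\<exists>z\<in>frontier D. \<phi> z = \<zeta>" if \<zeta>: "norm \<zeta> = 1" for \<zeta>
  proof -
    \<comment> \<open>Points mapped to modulus below 2 lie in the compact set \<open>K\<close>. The
      double successor in the approximating sequence keeps every term, including the first, below
      2.\<close>
    obtain B where B: "\<And>z. norm z \<ge> B \<Longrightarrow> norm (\<phi> z) \<ge> 2"
      using filterlim_at_infinity_imp_norm_at_top[OF inf] unfolding filterlim_at_top eventually_at_infinity by metis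
    define K where "K = cball 0 B \<inter> - D"
    have K: "compact K" unfolding K_def using D(1) by (intro compact_Int_closed compact_cball) (simp add: closed_Compl)
    have "K \<subseteq> W" using W by (auto simp: K_def)
    hence cK: "closed (\<phi> ` K)" by (intro compact_imp_closed compact_continuous_image continuous_on_subset[OF cont] K)
    have m1: "(1 + 1 / real (Suc (Suc n))) *\<^sub>R \<zeta> \<in> \<phi> ` K" for n
    proof -
      define w where "w = (1 + 1 / real (Suc (Suc n))) *\<^sub>R \<zeta>"
      have nw: "norm w = 1 + 1 / real (Suc (Suc n))" using \<zeta> by (simp add: w_def)
      have "1 < norm w" "norm w < 2" unfolding nw by (auto simp: field_simps)
      then obtain z where z: "z \<in> - closure D" "\<phi> z = w" using im by (metis (mono_tags, lifting) imageE mem_Collect_eq)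
      have "norm z \<le> B" using B[of z] z \<open>norm w < 2\<close> by fastforce
      hence "z \<in> K" using z sub by (auto simp: K_def)
      thus ?thesis using z(2) unfolding w_def by (metis image_eqI)
    qed
    have m2: "(\<lambda>n. (1 + 1 / real (Suc (Suc n))) *\<^sub>R \<zeta>) \<longlonglongrightarrow> (1 + 0) *\<^sub>R \<zeta>"
      by (intro tendsto_intros LIMSEQ_Suc[OF LIMSEQ_Suc[OF lim_1_over_n]])
    have "(1 + 0) *\<^sub>R \<zeta> \<in> \<phi> ` K" by (rule closed_sequentially[OF cK m1 m2])
    then obtain z where z: "z \<in> - D" "\<phi> z = \<zeta>" by (auto simp: K_def)
    have "z \<notin> - closure D"
    proof
      assume "z \<in> - closure D"
      hence "\<phi> z \<in> {z. 1 < norm z}" using im by blast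
      thus False using z \<zeta> by simp
    qed
    with z fr show ?thesis by blast
  qed
  have imD: "\<phi> ` (- D) = {z. 1 \<le> norm z}"
  proof
    have "- D = (- closure D) \<union> frontier D" using fr sub by auto
    thus "\<phi> ` (- D) \<subseteq> {z. 1 \<le> norm z}" using im f1 by (force simp: image_Un)
    show "{z. 1 \<le> norm z} \<subseteq> \<phi> ` (- D)"
    proof
      fix z assume "z \<in> {z::complex. 1 \<le> norm z}"
      hence "norm z > 1 \<or> norm z = 1" by auto
      thus "z \<in> \<phi> ` (- D)"
      proof
        assume "norm z > 1"
        thus ?thesis using im sub by blast
      next
        assume "norm z = 1"
        thus ?thesis using T[of z] fr by blast
      qed
    qed
  qed
  have opW: "open (\<phi> ` W)" by (rule open_mapping_thm3[OF hol W(1) inj])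
  have "{z. 1 \<le> norm z} \<subseteq> \<phi> ` W" using imD W by blast
  from open_contains_exterior[OF opW this] obtain r where r: "0 < r" "r < 1" "{z. r < norm z} \<subseteq> \<phi> ` W" by blast
  have inv: "\<phi> (\<psi> z) = z" if "r < norm z" for z
    unfolding \<psi>_def by (rule f_the_inv_into_f[OF inj]) (use that r in auto)
  have \<psi>W: "\<psi> z \<in> W" if "r < norm z" for z
    unfolding \<psi>_def by (rule the_inv_into_into[OF inj]) (use that r in auto)
  have inv2: "\<psi> (\<phi> z) = z" if "z \<in> W" for z unfolding \<psi>_def by (rule the_inv_into_f_f[OF inj that])
  have h\<psi>: "\<psi> holomorphic_on {z. r < norm z}"
  proof -
    obtain g where g: "g holomorphic_on \<phi> ` W" "\<And>z. z \<in> W \<Longrightarrow> g (\<phi> z) = z"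
      using holomorphic_has_inverse[OF hol W(1) inj] by metis
    have "g z = \<psi> z" if "z \<in> {z. r < norm z}" for z using g(2)[OF \<psi>W] inv that by simp
    thus ?thesis using holomorphic_transform[OF holomorphic_on_subset[OF g(1) r(3)]] by blast
  qed
  have inj\<psi>: "inj_on \<psi> {z. r < norm z}" by (rule inj_on_inverseI[where g = \<phi>]) (use inv in auto)
  have imid: "\<psi> ` \<phi> ` A = A" if "A \<subseteq> W" for A
  proof -
    have "\<psi> ` \<phi> ` A = (\<lambda>x. x) ` A" unfolding image_image by (rule image_cong) (use that inv2 in auto)
    thus ?thesis by simp
  qed
  have frW: "frontier D \<subseteq> W" "- closure D \<subseteq> W" using fr W sub by auto
  have i1: "\<psi> ` {z. 1 < norm z} = - closure D" unfolding im[symmetric] by (rule imid[OF frW(2)])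
  have i2: "\<psi> ` {z. 1 \<le> norm z} = - D" unfolding imD[symmetric] by (rule imid[OF W(2)])
  have i3: "\<psi> ` sphere 0 1 = frontier D"
  proof -
    have "sphere 0 1 = \<phi> ` frontier D"
    proof
      show "sphere 0 1 \<subseteq> \<phi> ` frontier D" using T by force
      show "\<phi> ` frontier D \<subseteq> sphere 0 1" using f1 by auto
    qed
    thus ?thesis using imid[OF frW(1)] by simp
  qed
  have \<psi>inf: "filterlim \<psi> at_infinity at_infinity"
    unfolding filterlim_at_infinity[OF order_refl]
  proof (intro allI impI)
    fix B :: real
    define K where "K = cball 0 B \<inter> - D"
    have K: "compact K" unfolding K_def using D(1) by (intro compact_Int_closed compact_cball) (simp add: closed_Compl)
    have "K \<subseteq> W" using W by (auto simp: K_def)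
    hence "bounded (\<phi> ` K)" by (intro compact_imp_bounded compact_continuous_image continuous_on_subset[OF cont] K)
    then obtain M where M: "\<And>z. z \<in> K \<Longrightarrow> norm (\<phi> z) \<le> M" unfolding bounded_iff by auto
    have "B \<le> norm (\<psi> z)" if z: "norm z \<ge> max 1 (M + 1)" for z
    proof (rule ccontr)
      assume "\<not> B \<le> norm (\<psi> z)"
      moreover have "\<psi> z \<in> - D" using i2 z by auto
      ultimately have "norm (\<phi> (\<psi> z)) \<le> M" by (intro M) (auto simp: K_def)
      thus False using inv[of z] z r by simp
    qed
    thus "\<forall>\<^sub>F z in at_infinity. B \<le> norm (\<psi> z)" unfolding eventually_at_infinity by blast
  qed
  have ev: "\<forall>\<^sub>F z in at_infinity. norm (z::complex) > 1"
    unfolding eventually_at_infinity by (rule exI[of _ 2]) auto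
  have "((\<lambda>z. \<phi> (\<psi> z) / \<psi> z) \<longlongrightarrow> of_real c) at_infinity"
    by (rule filterlim_compose[OF c(2) \<psi>inf])
  hence "((\<lambda>z. inverse (\<phi> (\<psi> z) / \<psi> z)) \<longlongrightarrow> inverse (of_real c)) at_infinity"
    by (rule tendsto_inverse) (use c in auto)
  hence l\<psi>: "((\<lambda>z. \<psi> z / z) \<longlongrightarrow> inverse (of_real c)) at_infinity"
  proof (rule Lim_transform_eventually)
    show "\<forall>\<^sub>F z in at_infinity. inverse (\<phi> (\<psi> z) / \<psi> z) = \<psi> z / z"
      using ev by eventually_elim (use inv r in \<open>simp add: inverse_eq_divide\<close>)
  qed
  have ep: "exterior_param \<psi> r (inverse (of_real c))"
    by unfold_locales (use r h\<psi> inj\<psi> l\<psi> c in auto)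
  obtain R where R: "D \<subseteq> ball 0 R" using bounded_subset_ballD[OF D(2)] by blast
  have "{z. R < norm z} \<subseteq> W" using R W by force
  have d\<phi>: "(deriv \<phi> \<longlongrightarrow> of_real c) at_infinity"
    by (rule deriv_tendsto_at_infinity[OF holomorphic_on_subset[OF hol \<open>{z. R < norm z} \<subseteq> W\<close>] c(2)])
  have h\<phi>: "\<phi> holomorphic_on \<psi> ` {z. r < norm z}" by (rule holomorphic_on_subset[OF hol]) (use \<psi>W in auto)
  show thesis
    by (rule that[OF r(1,2) c(1) dc inv h\<phi> ep inf i1 i2 i3 d\<phi> c(2)])
qed

section \<open>The functions X and Z and the modified weight\<close>

text \<open>Isolates the iterate nested inside \<open>X_fun\<close>, so that the recursion linking
  the two sequences can be used without unfolding powers of an operator.\<close>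

definition Z_fun :: "(complex \<Rightarrow> complex) \<Rightarrow> nat \<Rightarrow> (complex \<Rightarrow> complex)" where
  "Z_fun \<Omega> j = ((\<lambda>f z. Q_op (T_op \<Omega> f) z - T_op \<Omega> f z) ^^ j) (\<lambda>_. 1)"

lemma X_fun_0 [simp]: "X_fun \<Omega> 0 = (\<lambda>_. 1)"
  by (simp add: X_fun_def)

lemma X_fun_Suc: "X_fun \<Omega> (Suc j) = Q_op (T_op \<Omega> (Z_fun \<Omega> j))"
  by (simp add: X_fun_def Z_fun_def)

lemma Z_fun_0 [simp]: "Z_fun \<Omega> 0 = (\<lambda>_. 1)"
  by (simp add: Z_fun_def)

lemma Z_fun_Suc: "Z_fun \<Omega> (Suc j) z = X_fun \<Omega> (Suc j) z - T_op \<Omega> (Z_fun \<Omega> j) z"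
  by (simp add: X_fun_Suc) (simp add: Z_fun_def)

lemma Q_op_properties:
  assumes "circle_ext f"
  shows "Q_op f analytic_on {z. 1 \<le> norm z}" "is_orthogonal_projection_H2_minus0 f (Q_op f)"
proof -
  from assms obtain \<rho> g where g: "0 < \<rho>" "\<rho> < 1" "g holomorphic_on annulus \<rho>" "\<And>z. norm z = 1 \<Longrightarrow> f z = g z"
    unfolding circle_ext_def by blast
  have ex: "\<exists>h. h analytic_on {z. 1 \<le> norm z} \<and> is_orthogonal_projection_H2_minus0 f h"
    by (rule projection_H2_minus0_exists[OF g(3,1,2)]) (rule g(4))
  from someI_ex[OF ex] show "Q_op f analytic_on {z. 1 \<le> norm z}" "is_orthogonal_projection_H2_minus0 f (Q_op f)"
    by (simp_all add: Q_op_def)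
qed

lemma T_op_eq: "T_op \<Omega> f z * \<Omega> z = ld (\<lambda>w. f w * \<Omega> w) z + f z * \<Omega> z" if "\<Omega> z \<noteq> 0"
  using that by (simp add: T_op_def ld_def)

lemma log_smooth_T_op:
  assumes "0 < \<rho>" "\<rho> < 1" "log_smooth b \<rho> \<Omega>" "log_smooth b \<rho> (\<lambda>z. inverse (\<Omega> z))" "log_smooth b \<rho> f"
  shows "log_smooth b \<rho> (T_op \<Omega> f)"
proof -
  have "T_op \<Omega> f = (\<lambda>z. (ld (\<lambda>w. f w * \<Omega> w) z + f z * \<Omega> z) * inverse (\<Omega> z))"
    by (simp add: T_op_def ld_def divide_inverse fun_eq_iff)
  thus ?thesis by (simp only:) (intro log_smooth_mult log_smooth_add log_smooth_ld assms)
qed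

lemma circle_inner_1_H2_minus0: "k \<in> H2_minus0 \<Longrightarrow> circle_inner (\<lambda>_. 1) k = 0"
proof -
  assume "k \<in> H2_minus0"
  hence "fourier_coeff k 0 = 0" by (simp add: H2_minus0_def)
  thus ?thesis using circle_inner_commute[of "\<lambda>_. 1" k] by (simp add: fourier_coeff_def)
qed

text \<open>Induction on the number of terms. The radius has to be allowed to grow towards 1 at
  every step, because \<open>Q_op\<close> yields a function holomorphic on an unspecified
  neighbourhood of the closed exterior disk. Orthogonality is inherited since the new
  \<open>Z_fun\<close> is, up to sign, the residual of an orthogonal projection.\<close>

lemma XZ_family:
  assumes \<rho>0: "0 < \<rho>0" "\<rho>0 < 1" and \<Omega>: "log_smooth True \<rho>0 \<Omega>" "log_smooth True \<rho>0 (\<lambda>z. inverse (\<Omega> z))"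
  shows "\<exists>\<rho>. \<rho>0 \<le> \<rho> \<and> \<rho> < 1 \<and>
    (\<forall>j\<le>n. log_smooth True \<rho> (Z_fun \<Omega> j) \<and> (\<forall>k\<in>H2_minus0. circle_inner (Z_fun \<Omega> j) k = 0)) \<and>
    (\<forall>j<n. X_fun \<Omega> (Suc j) holomorphic_on {z. \<rho> < norm z} \<and> (X_fun \<Omega> (Suc j) \<longlongrightarrow> 0) at_infinity)"
proof (induction n)
  case 0
  show ?case using \<rho>0 by (intro exI[of _ \<rho>0]) (auto intro: log_smooth_const circle_inner_1_H2_minus0)
next
  case (Suc n)
  then obtain \<rho> where \<rho>: "\<rho>0 \<le> \<rho>" "\<rho> < 1"
    and Z: "\<And>j. j \<le> n \<Longrightarrow> log_smooth True \<rho> (Z_fun \<Omega> j)" "\<And>j k. j \<le> n \<Longrightarrow> k \<in> H2_minus0 \<Longrightarrow> circle_inner (Z_fun \<Omega> j) k = 0"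
    and X: "\<And>j. j < n \<Longrightarrow> X_fun \<Omega> (Suc j) holomorphic_on {z. \<rho> < norm z}" "\<And>j. j < n \<Longrightarrow> (X_fun \<Omega> (Suc j) \<longlongrightarrow> 0) at_infinity"
    by blast
  have \<rho>': "0 < \<rho>" using \<rho>0 \<rho> by simp
  have T: "log_smooth True \<rho> (T_op \<Omega> (Z_fun \<Omega> n))"
    by (intro log_smooth_T_op \<rho>' \<rho>(2) log_smooth_mono[OF \<rho>0(1) \<rho>(1)] \<Omega> Z(1)) simp
  define X' where "X' = X_fun \<Omega> (Suc n)"
  have X': "X' analytic_on {z. 1 \<le> norm z}" "is_orthogonal_projection_H2_minus0 (T_op \<Omega> (Z_fun \<Omega> n)) X'"
    using Q_op_properties[OF log_smooth_circle_ext[OF T]] by (simp_all add: X'_def X_fun_Suc)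
  obtain a where a: "0 < a" "a < 1" "X' holomorphic_on {z. a < norm z}"
    using analytic_exterior_holomorphic[OF X'(1)] by blast
  have lim: "(X' \<longlongrightarrow> 0) at_infinity"
    by (rule H2_minus0_exterior_tendsto_0[OF a(3,1,2)]) (use X'(2) in \<open>simp add: is_orthogonal_projection_H2_minus0_def\<close>)
  define r where "r = max \<rho> a"
  have r: "0 < r" "r < 1" "\<rho> \<le> r" "a \<le> r" "\<rho>0 \<le> r" using \<rho> \<rho>' a by (auto simp: r_def)
  have hX: "X' holomorphic_on {z. r < norm z}" by (rule holomorphic_on_subset[OF a(3)]) (use r in auto)
  have hX2: "X_fun \<Omega> (Suc j) holomorphic_on {z. r < norm z}" if "j < n" for j
    by (rule holomorphic_on_subset[OF X(1)[OF that]]) (use r in auto)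
  have Zeq: "Z_fun \<Omega> (Suc n) = (\<lambda>z. X' z - T_op \<Omega> (Z_fun \<Omega> n) z)"
    by (simp add: Z_fun_Suc X'_def fun_eq_iff)
  have "log_smooth True r X'"
    by (rule log_smooth_holomorphic[OF r(1,2) holomorphic_on_subset[OF hX]]) (auto simp: annulus_def)
  hence ZS: "log_smooth True r (Z_fun \<Omega> (Suc n))"
    unfolding Zeq by (intro log_smooth_diff r(1,2) log_smooth_mono[OF \<rho>' r(3) T])
  have ZS2: "circle_inner (Z_fun \<Omega> (Suc n)) k = 0" if "k \<in> H2_minus0" for k
  proof -
    have "circle_inner (\<lambda>z. T_op \<Omega> (Z_fun \<Omega> n) z - X' z) k = 0"
      using X'(2) that by (simp add: is_orthogonal_projection_H2_minus0_def)
    hence "(-1) * circle_mean (\<lambda>z. (T_op \<Omega> (Z_fun \<Omega> n) z - X' z) * cnj (k z)) = 0" by (simp add: circle_inner_eq_mean)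
    thus ?thesis unfolding circle_mean_cmult[symmetric] Zeq circle_inner_eq_mean by (simp add: algebra_simps)
  qed
  show ?case
  proof (intro exI[of _ r] conjI allI impI r(5) r(2))
    fix j assume "j \<le> Suc n"
    thus "log_smooth True r (Z_fun \<Omega> j)" using ZS log_smooth_mono[OF \<rho>' r(3) Z(1)] by (cases "j = Suc n") auto
    show "\<forall>k\<in>H2_minus0. circle_inner (Z_fun \<Omega> j) k = 0" using \<open>j \<le> Suc n\<close> ZS2 Z(2) by (cases "j = Suc n") auto
  next
    fix j assume "j < Suc n"
    thus "X_fun \<Omega> (Suc j) holomorphic_on {z. r < norm z}" using hX hX2 by (cases "j = n") (auto simp: X'_def)
    show "(X_fun \<Omega> (Suc j) \<longlongrightarrow> 0) at_infinity" using \<open>j < Suc n\<close> lim X(2) by (cases "j = n") (auto simp: X'_def)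
  qed
qed

text \<open>The weight is the exponential of \<open>L\<close>, the sum of \<open>V\<close>, its
  conjugate and \<open>ln \<omega>\<close> pulled back by \<open>\<psi>\<close>. The boundary
  condition of the Szego function says that \<open>L\<close> is zero on the circle; replacing
  \<open>L\<close> by \<open>-L\<close> treats the reciprocal.\<close>

lemma modified_weight_log_smooth:
  assumes \<rho>: "0 < \<rho>" "\<rho> < 1" and \<psi>: "\<psi> holomorphic_on annulus \<rho>" "\<psi> ` annulus \<rho> \<subseteq> U" and U: "open U"
    and \<omega>: "\<And>z. z \<in> U \<Longrightarrow> 0 < \<omega> z \<and> real_analytic2_at (\<lambda>w. ln (\<omega> w)) z"
    and V: "(\<lambda>z. V (\<psi> z)) holomorphic_on annulus \<rho>"
    and bdry: "\<And>z. norm z = 1 \<Longrightarrow> 2 * Re (V (\<psi> z)) = - ln (\<omega> (\<psi> z))"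
  shows "log_smooth True \<rho> (modified_weight \<omega> V \<psi>)"
    and "log_smooth True \<rho> (\<lambda>z. inverse (modified_weight \<omega> V \<psi> z))"
    and "\<And>z. norm z = 1 \<Longrightarrow> modified_weight \<omega> V \<psi> z = 1"
proof -
  define L where "L z = (V (\<psi> z) + cnj (V (\<psi> z))) + of_real (ln (\<omega> (\<psi> z)))" for z
  have l: "log_smooth True \<rho> (\<lambda>z. of_real (ln (\<omega> (\<psi> z))))"
    by (rule log_smooth_real_analytic[OF \<rho> \<psi> U, of "\<lambda>w. of_real (ln (\<omega> w))"])
       (intro real_analytic2_at_of_real conjunct2[OF \<omega>])
  have L: "log_smooth True \<rho> L"
    unfolding L_def[abs_def]
    by (intro log_smooth_add[OF \<rho>] log_smooth_cnj[OF \<rho>] log_smooth_holomorphic[OF \<rho> V] l)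
  have Lr: "L z = of_real (2 * Re (V (\<psi> z)) + ln (\<omega> (\<psi> z)))" for z
    by (simp add: L_def complex_eq_iff)
  have L0: "L z = 0" if "norm z = 1" for z using bdry[OF that] by (simp add: Lr)
  have e: "exp (L z) = modified_weight \<omega> V \<psi> z" if "z \<in> annulus \<rho>" for z
  proof -
    have "0 < \<omega> (\<psi> z)" using that \<psi>(2) \<omega> by blast
    thus ?thesis unfolding Lr modified_weight_def exp_of_real by (simp add: exp_add)
  qed
  have L': "log_smooth True \<rho> (\<lambda>z. (-1) * L z)" by (intro log_smooth_mult log_smooth_const \<rho> L)
  show "log_smooth True \<rho> (modified_weight \<omega> V \<psi>)"
    by (rule log_smooth_cong[OF \<rho> log_smooth_exp[OF \<rho> L L0] e])
  show "log_smooth True \<rho> (\<lambda>z. inverse (modified_weight \<omega> V \<psi> z))"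
    by (rule log_smooth_cong[OF \<rho> log_smooth_exp[OF \<rho> L']])
       (use L0 e in \<open>auto simp: exp_minus simp flip: e\<close>)
  show "modified_weight \<omega> V \<psi> z = 1" if "norm z = 1" for z
    using e[of z] L0[OF that] that sphere_subset_annulus[OF \<rho>] by auto
qed

text \<open>There is no holomorphic continuation across the circle here, so contours can be moved
  only among radii above 1. The mean over radius \<open>R\<close> is constant there, zero by decay,
  and continuous down to \<open>R = 1\<close>. This is the version suited to \<open>G_+\<close>,
  which is merely smooth up to the circle.\<close>

lemma fourier_coeff_boundary_zero:
  assumes c: "continuous_on {z. 1 \<le> norm z} h" and h: "h holomorphic_on {z. 1 < norm z}"
    and lim: "(h \<longlongrightarrow> 0) at_infinity" and n: "0 \<le> n"
  shows "fourier_coeff h n = 0"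
proof -
  obtain m where m: "n = int m" using n by (metis nonneg_int_cases)
  define I where "I R = circle_mean (\<lambda>z. h (of_real R * z) * (inverse (of_real R * z)) ^ m)" for R
  have hm: "(\<lambda>z. h z * inverse z ^ m) holomorphic_on {z. 1 < norm z}" by (intro holomorphic_intros h) auto
  have cs: "continuous_on (sphere 0 1) (\<lambda>z. h (of_real R * z) * (inverse (of_real R * z)) ^ m)" if "R \<ge> 1" for R :: real
    by (intro continuous_intros continuous_on_compose2[OF c]) (use that in \<open>auto simp: norm_mult\<close>)
  have const: "I R = I R'" if R: "1 < R" "1 < R'" for R R'
  proof -
    have *: "contour_integral (circlepath 0 s) (\<lambda>z. h z * inverse z ^ m / z) = 2 * pi * \<i> * I s" if "1 < s" for s
    proof -
      have "continuous_on (sphere 0 s) (\<lambda>z. h z * inverse z ^ m / z)"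
        by (intro continuous_intros continuous_on_subset[OF c]) (use that in auto)
      from contour_integral_circlepath_mean[OF _ this] that
      have "contour_integral (circlepath 0 s) (\<lambda>z. h z * inverse z ^ m / z)
        = 2 * pi * \<i> * circle_mean (\<lambda>z. of_real s * z * (h (of_real s * z) * inverse (of_real s * z) ^ m / (of_real s * z)))" by simp
      also have "circle_mean (\<lambda>z. of_real s * z * (h (of_real s * z) * inverse (of_real s * z) ^ m / (of_real s * z))) = I s"
        unfolding I_def by (rule circle_mean_cong) (use that in auto)
      finally show ?thesis .
    qed
    have eq: "I r = I s" if "1 < r" "r \<le> s" for r s
    proof -
      have "(\<lambda>z. h z * inverse z ^ m / z) holomorphic_on {w. 1 < norm w \<and> norm w < s + 1}"
        by (intro holomorphic_intros holomorphic_on_subset[OF hm]) auto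
      from contour_integral_circlepath_radius[OF this, of r s] *[of r] *[of s] that show ?thesis by simp
    qed
    show ?thesis
    proof (cases "R \<le> R'")
      case True thus ?thesis by (rule eq[OF R(1)])
    next
      case False
      hence "R' \<le> R" by simp
      thus ?thesis by (rule eq[OF R(2), symmetric])
    qed
  qed
  have I2: "I 2 = 0"
  proof -
    have "norm (I 2) \<le> 0"
    proof (rule field_le_epsilon)
      fix e :: real assume e: "e > 0"
      obtain B where B: "\<And>z. norm z \<ge> B \<Longrightarrow> norm (h z) < e"
        using tendstoD[OF lim e] unfolding eventually_at_infinity by auto
      define R where "R = max B 2"
      have R: "R \<ge> B" "R \<ge> 2" by (auto simp: R_def)
      have "norm (I R) \<le> e" unfolding I_def
      proof (rule circle_mean_bound[OF cs])
        fix z :: complex assume z: "norm z = 1"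
        have nz: "norm (of_real R * z) = R" using z R by (simp add: norm_mult)
        have "norm (h (of_real R * z) * inverse (of_real R * z) ^ m) = norm (h (of_real R * z)) * inverse R ^ m"
          using nz by (simp only: norm_mult norm_power norm_inverse)
        also have "\<dots> \<le> e * 1" using B[of "of_real R * z"] nz R e
          by (intro mult_mono power_le_one) (auto simp: inverse_le_1_iff less_imp_le)
        finally show "norm (h (of_real R * z) * inverse (of_real R * z) ^ m) \<le> e" by simp
      qed (use R in auto)
      thus "norm (I 2) \<le> 0 + e" using const[of 2 R] R by simp
    qed
    thus ?thesis by simp
  qed
  have "continuous_on {1..2} I"
  proof -
    have A: "continuous_on {1..2} (\<lambda>R. integral (cbox 0 (2*pi)) (\<lambda>t. h (of_real R * cis t) * (inverse (of_real R * cis t)) ^ m) / (2 * pi))"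
    proof (intro continuous_intros integral_continuous_on_param)
      have "continuous_on ({1..2} \<times> cbox 0 (2 * pi)) (\<lambda>p. h (of_real (fst p) * cis (snd p)) * (inverse (of_real (fst p) * cis (snd p))) ^ m)"
        by (intro continuous_intros continuous_on_compose2[OF c]) (auto simp: norm_mult)
      thus "continuous_on ({1..2} \<times> cbox 0 (2 * pi)) (\<lambda>(R, t). h (of_real R * cis t) * (inverse (of_real R * cis t)) ^ m)"
        by (simp add: case_prod_unfold)
    qed auto
    have B: "integral (cbox 0 (2*pi)) (\<lambda>t. h (of_real R * cis t) * (inverse (of_real R * cis t)) ^ m) / (2 * pi) = I R"
      if "R \<in> {1..2}" for R
      unfolding I_def by (subst circle_mean_eq_integral[OF cs]) (use that in auto)
    show ?thesis by (rule continuous_on_eq[OF A B])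
  qed
  hence "(I \<longlongrightarrow> I 1) (at 1 within {1..2})" by (simp add: continuous_on_def)
  hence "(I \<longlongrightarrow> I 1) (at_right 1)"
    by (simp add: at_within_Icc_at_right)
  moreover have "\<forall>\<^sub>F R in at_right 1. I R = 0"
    unfolding eventually_at_right_field by (rule exI[of _ 2]) (use const[of _ 2] I2 in auto)
  hence "(I \<longlongrightarrow> 0) (at_right 1)" by (rule tendsto_eventually)
  ultimately have "I 1 = 0" using tendsto_unique trivial_limit_at_right_real by blast
  moreover have "fourier_coeff h n = I 1"
    unfolding fourier_coeff_def circle_inner_eq_mean I_def m
    by (rule circle_mean_cong) (simp add: cnj_unit)
  ultimately show ?thesis by simp
qed

lemma boundary_H2_minus0:
  assumes "continuous_on {z. 1 \<le> norm z} h" "h holomorphic_on {z. 1 < norm z}" "(h \<longlongrightarrow> 0) at_infinity"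
  shows "h \<in> H2_minus0"
proof -
  have "continuous_on (sphere 0 1) h" by (rule continuous_on_subset[OF assms(1)]) auto
  thus ?thesis using L2_circle_continuous fourier_coeff_boundary_zero[OF assms] by (simp add: H2_minus0_def)
qed

section \<open>Approximate orthogonality on the ring\<close>

lemma has_log_deriv_sum:
  assumes "\<And>i. i \<in> I \<Longrightarrow> has_log_deriv (f i) (a i) (b i) z" "z \<noteq> 0"
  shows "has_log_deriv (\<lambda>w. \<Sum>i\<in>I. c i * f i w) (\<Sum>i\<in>I. c i * a i) (\<Sum>i\<in>I. c i * b i) z"
proof -
  have "((\<lambda>w. \<Sum>i\<in>I. c i * f i w) has_derivative (\<lambda>h. \<Sum>i\<in>I. c i * (h / z * a i + cnj (h / z) * b i))) (at z)"
    using assms by (intro has_derivative_sum has_derivative_mult_right) (auto simp: has_log_deriv_def)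
  also have "(\<lambda>h. \<Sum>i\<in>I. c i * (h / z * a i + cnj (h / z) * b i))
     = (\<lambda>h. h / z * (\<Sum>i\<in>I. c i * a i) + cnj (h / z) * (\<Sum>i\<in>I. c i * b i))"
    by (simp add: sum_distrib_left sum.distrib[symmetric] algebra_simps)
  finally show ?thesis using assms(2) by (simp add: has_log_deriv_def)
qed

text \<open>Trades distance to the circle for powers of \<open>1 / N\<close>: with
  \<open>y = N |x|\<close> it bounds \<open>|x|^m\<close> by \<open>m! exp (N |x|) / N^m\<close>,
  and the exponential is still dominated by the ring weight \<open>exp (2 (N + 1) x)\<close> for
  \<open>x \<le> 0\<close>.\<close>

lemma fact_exp_bound:
  assumes "0 \<le> (y::real)"
  shows "y ^ m \<le> fact m * exp y"
proof -
  have s: "(\<lambda>n. y ^ n /\<^sub>R fact n) sums exp y" by (rule exp_converges)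
  have "(\<Sum>n\<in>{m}. y ^ n /\<^sub>R fact n) \<le> (\<Sum>n. y ^ n /\<^sub>R fact n)"
    by (rule sum_le_suminf) (use assms s in \<open>auto simp: sums_iff\<close>)
  hence "y ^ m / fact m \<le> exp y" using s by (simp add: sums_iff divide_inverse mult.commute)
  thus ?thesis by (simp add: divide_le_eq mult.commute)
qed

lemma ring_integral_norm_power:
  assumes "x0 < 0" "N \<ge> 1" "a = 2 * (real N + 1) + b" "a > 0"
  shows "ring_integral x0 N (\<lambda>z. exp (b * ln (norm z))) \<le> 2 * real N / a"
proof -
  have c: "continuous_on (cbox (x0, 0) (0, 2 * pi)) (\<lambda>p::real\<times>real. exp (a * fst p))"
    by (intro continuous_intros)
  have "ring_integral x0 N (\<lambda>z. exp (b * ln (norm z)))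
      = real N / pi * integral (cbox (x0, 0) (0, 2 * pi)) (\<lambda>p::real\<times>real. exp (a * fst p))"
    unfolding ring_integral_def assms(3)
    by (simp add: case_prod_unfold exp_add[symmetric] algebra_simps)
  also have "integral (cbox (x0, 0) (0, 2 * pi)) (\<lambda>p::real\<times>real. exp (a * fst p))
      = integral {x0..0} (\<lambda>x. 2 * pi * exp (a * x))"
    using integral_prod_continuous[OF c] by simp
  also have "\<dots> = 2 * pi * ((1 - exp (a * x0)) / a)"
    using integral_exp_interval[of x0 a] assms by (simp add: integral_unique)
  also have "real N / pi * \<dots> = 2 * real N / a * (1 - exp (a * x0))" by simp
  also have "\<dots> \<le> 2 * real N / a * 1" using assms(4) by (intro mult_left_mono) auto
  finally show ?thesis by simp
qed

text \<open>Values on the circle are limits of values at slightly larger radii.\<close>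

lemma annulus_zero_on_circle:
  assumes \<rho>: "0 < \<rho>" "\<rho> < 1" and c: "continuous_on (annulus \<rho>) w"
    and w1: "\<And>z. z \<in> annulus \<rho> \<Longrightarrow> 1 < norm z \<Longrightarrow> w z = (0::complex)" and z: "z \<in> annulus \<rho>" "1 \<le> norm z"
  shows "w z = 0"
proof (cases "norm z = 1")
  case False thus ?thesis using w1 z by auto
next
  case True
  have "isCont w z" using c open_annulus z(1) by (simp add: continuous_on_eq_continuous_at)
  moreover have lim: "(\<lambda>n. (1 + 1 / real (Suc n)) *\<^sub>R z) \<longlonglongrightarrow> (1 + 0) *\<^sub>R z"
    by (intro tendsto_intros LIMSEQ_Suc[OF lim_1_over_n])
  ultimately have "(\<lambda>n. w ((1 + 1 / real (Suc n)) *\<^sub>R z)) \<longlonglongrightarrow> w z"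
    by (intro isCont_tendsto_compose[of z w]) auto
  moreover have "\<forall>\<^sub>F n in sequentially. (1 + 1 / real (Suc n)) *\<^sub>R z \<in> annulus \<rho>"
    using lim open_annulus z(1) by (intro topological_tendstoD) auto
  hence "\<forall>\<^sub>F n in sequentially. w ((1 + 1 / real (Suc n)) *\<^sub>R z) = 0"
    by eventually_elim (rule w1, use True in \<open>auto simp: field_simps\<close>)
  ultimately show ?thesis by (metis tendsto_eventually LIMSEQ_unique)
qed

text \<open>Collects, on one annulus that contains the ring, everything about the finitely many
  functions with index at most \<open>\<kappa>\<close>. The real-valued \<open>\<Omega>r\<close>
  accompanies \<open>\<Omega>\<close> for order arguments.\<close>

locale ring_setting =
  fixes r0 x0 :: real and \<Omega> :: "complex \<Rightarrow> complex" and \<Omega>r :: "complex \<Rightarrow> real" and \<kappa> :: nat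
  assumes r0: "0 < r0" "r0 < 1" and x0: "ln r0 < x0" "x0 < 0"
    and \<Omega>: "log_smooth True r0 \<Omega>" and \<Omega>_inv: "log_smooth True r0 (\<lambda>z. inverse (\<Omega> z))"
    and \<Omega>r: "\<And>z. \<Omega> z = of_real (\<Omega>r z)" "\<And>z. z \<in> annulus r0 \<Longrightarrow> 0 < \<Omega>r z"
    and \<Omega>1: "\<And>z. norm z = 1 \<Longrightarrow> \<Omega> z = 1"
    and Z: "\<And>j. j \<le> \<kappa> \<Longrightarrow> log_smooth True r0 (Z_fun \<Omega> j)"
    and Zinner: "\<And>j k. j \<le> \<kappa> \<Longrightarrow> k \<in> H2_minus0 \<Longrightarrow> circle_inner (Z_fun \<Omega> j) k = 0"
    and XS: "\<And>j. j < \<kappa> \<Longrightarrow> X_fun \<Omega> (Suc j) holomorphic_on {z. r0 < norm z}"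
    and XSlim: "\<And>j. j < \<kappa> \<Longrightarrow> (X_fun \<Omega> (Suc j) \<longlongrightarrow> 0) at_infinity"
begin

definition Yf :: "nat \<Rightarrow> complex \<Rightarrow> complex" where
  "Yf N z = (\<Sum>j\<le>\<kappa>. inverse (of_nat N ^ j) * X_fun \<Omega> j z)"

text \<open>The truncated sum of the \<open>Z_fun\<close>, multiplied by \<open>\<Omega>\<close>.
  Including \<open>\<Omega>\<close> removes the conjugation in \<open>T_op\<close>: after
  multiplication by \<open>\<Omega>\<close> that operator becomes \<open>ld\<close> plus the
  identity.\<close>

definition Su :: "nat \<Rightarrow> complex \<Rightarrow> complex" where
  "Su N z = (\<Sum>j\<le>\<kappa>. inverse (of_nat N ^ j) * (Z_fun \<Omega> j z * \<Omega> z))"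

abbreviation YY :: "nat \<Rightarrow> complex \<Rightarrow> complex" where
  "YY N z \<equiv> Yf N z * cnj (Yf N z) * \<Omega> z"

abbreviation op_mean :: "(complex \<Rightarrow> complex) \<Rightarrow> nat \<Rightarrow> nat \<Rightarrow> nat \<Rightarrow> nat \<Rightarrow> complex" where
  "op_mean g N \<nu> j k \<equiv> circle_mean (\<lambda>z. ((\<lambda>h w. - (1/2) * r_dr h w) ^^ \<nu>) g z *
     W_op \<Omega> N \<nu> \<kappa> (\<lambda>w. X_fun \<Omega> j w * cnj (X_fun \<Omega> k w)) z)"

abbreviation expansion :: "(complex \<Rightarrow> complex) \<Rightarrow> nat \<Rightarrow> complex" where
  "expansion g N \<equiv> \<Sum>(\<nu>, j, k)\<in>I_set \<kappa>. 1 / of_nat N ^ (\<nu> + j + k) * op_mean g N \<nu> j k"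

abbreviation ring :: "complex set" where "ring \<equiv> closed_ring x0"

abbreviation R :: "nat \<Rightarrow> (complex \<Rightarrow> 'a::euclidean_space) \<Rightarrow> 'a" where "R \<equiv> ring_integral x0"

lemma X_holomorphic: "j \<le> \<kappa> \<Longrightarrow> X_fun \<Omega> j holomorphic_on {z. r0 < norm z}"
  by (cases j) (auto intro: XS simp: less_eq_Suc_le)

lemma X_log_smooth: "j \<le> \<kappa> \<Longrightarrow> log_smooth b r0 (X_fun \<Omega> j)"
  by (rule log_smooth_holomorphic[OF r0 holomorphic_on_subset[OF X_holomorphic]]) (auto simp: annulus_def)

lemma Yf_holomorphic: "Yf N holomorphic_on {z. r0 < norm z}"
  unfolding Yf_def[abs_def] by (intro holomorphic_intros X_holomorphic) auto

lemma Yf_log_smooth: "log_smooth b r0 (Yf N)"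
  by (rule log_smooth_holomorphic[OF r0 holomorphic_on_subset[OF Yf_holomorphic]]) (auto simp: annulus_def)

lemma Yf_tendsto: "(Yf N \<longlongrightarrow> 1) at_infinity"
proof -
  have "((\<lambda>z. \<Sum>j\<le>\<kappa>. inverse (of_nat N ^ j) * X_fun \<Omega> j z) \<longlongrightarrow> (\<Sum>j\<le>\<kappa>. inverse (of_nat N ^ j) * (if j = 0 then 1 else 0))) at_infinity"
  proof (intro tendsto_intros)
    fix j assume "j \<in> {..\<kappa>}"
    thus "(X_fun \<Omega> j \<longlongrightarrow> (if j = 0 then 1 else 0)) at_infinity"
      using XSlim[of "j - 1"] by (cases j) (auto simp: less_eq_Suc_le)
  qed
  also have "(\<Sum>j\<le>\<kappa>. inverse (of_nat N ^ j) * (if j = 0 then 1 else 0)) = (1::complex)"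
    by (simp add: sum.delta if_distrib[of "\<lambda>x. _ * x"] cong: if_cong)
  finally show ?thesis unfolding Yf_def[abs_def] .
qed

lemma ZO_log_smooth: "j \<le> \<kappa> \<Longrightarrow> log_smooth True r0 (\<lambda>z. Z_fun \<Omega> j z * \<Omega> z)"
  by (intro log_smooth_mult r0 Z \<Omega>)

lemma Su_log_smooth: "log_smooth True r0 (Su N)"
  unfolding Su_def[abs_def] by (intro log_smooth_sum[OF r0] log_smooth_cmult[OF r0] ZO_log_smooth) auto

lemma T_log_smooth: "j \<le> \<kappa> \<Longrightarrow> log_smooth True r0 (\<lambda>z. T_op \<Omega> (Z_fun \<Omega> j) z * \<Omega> z)"
  by (intro log_smooth_mult log_smooth_T_op r0 Z \<Omega> \<Omega>_inv)

lemma ring_annulus: "z \<in> ring \<Longrightarrow> z \<in> annulus r0"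
  using closed_ring_subset_annulus[OF r0 x0(1)] by blast

lemmas cont_ring = log_smooth_continuous_ring[OF r0 _ x0(1)]

lemma Su_ld:
  assumes "z \<in> annulus r0"
  shows "ld (Su N) z + Su N z = (\<Sum>j\<le>\<kappa>. inverse (of_nat N ^ j) * (T_op \<Omega> (Z_fun \<Omega> j) z * \<Omega> z))"
proof -
  have z0: "z \<noteq> 0" and nz: "\<Omega> z \<noteq> 0" using assms annulus_nonzero[OF r0(1)] \<Omega>r[of z] by auto
  have "ld (Su N) z = (\<Sum>j\<le>\<kappa>. inverse (of_nat N ^ j) * ld (\<lambda>z. Z_fun \<Omega> j z * \<Omega> z) z)"
    unfolding Su_def[abs_def]
    by (rule has_log_deriv_unique(1)[OF has_log_deriv_sum[OF log_smooth_log_deriv[OF r0(1) ZO_log_smooth assms] z0]]) auto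
  thus ?thesis unfolding Su_def T_op_eq[of \<Omega> z, OF nz] by (simp add: sum.distrib[symmetric] algebra_simps)
qed

text \<open>The defining relation \<open>X\<^sub>j\<^sub>+\<^sub>1 = Z\<^sub>j\<^sub>+\<^sub>1 + T Z\<^sub>j\<close> turns \<open>Y\<close> into \<open>(1 + T / N)\<close> applied to the truncated
  sum of the \<open>Z\<^sub>j\<close>, up to one term of order \<open>\<kappa> + 1\<close>.\<close>

lemma Yf_relation:
  assumes z: "z \<in> annulus r0" and N: "N \<ge> 1"
  shows "Yf N z * \<Omega> z = Su N z + (ld (Su N) z + Su N z) / of_nat N
          - T_op \<Omega> (Z_fun \<Omega> \<kappa>) z * \<Omega> z / of_nat N ^ (\<kappa> + 1)"
proof -
  define n :: complex where "n = of_nat N"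
  have n: "n \<noteq> 0" using N by (simp add: n_def)
  have "Yf N z * \<Omega> z = (\<Sum>j\<le>\<kappa>. inverse (n ^ j) * (Z_fun \<Omega> j z * \<Omega> z))
       + (\<Sum>j<\<kappa>. inverse (n ^ j) * (T_op \<Omega> (Z_fun \<Omega> j) z * \<Omega> z)) / n"
  proof -
    have 1: "Yf N z * \<Omega> z = \<Omega> z + (\<Sum>j<\<kappa>. inverse (n ^ Suc j) * (X_fun \<Omega> (Suc j) z * \<Omega> z))"
      unfolding Yf_def n_def[symmetric] lessThan_Suc_atMost[symmetric] sum.lessThan_Suc_shift
      by (simp add: algebra_simps sum_distrib_left)
    have 2: "(\<Sum>j\<le>\<kappa>. inverse (n ^ j) * (Z_fun \<Omega> j z * \<Omega> z)) = \<Omega> z + (\<Sum>j<\<kappa>. inverse (n ^ Suc j) * (Z_fun \<Omega> (Suc j) z * \<Omega> z))"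
      unfolding lessThan_Suc_atMost[symmetric] sum.lessThan_Suc_shift by simp
    have 3: "X_fun \<Omega> (Suc j) z = Z_fun \<Omega> (Suc j) z + T_op \<Omega> (Z_fun \<Omega> j) z" for j by (simp add: Z_fun_Suc)
    show ?thesis unfolding 1 2 3 sum_divide_distrib
      using n by (simp add: sum.distrib[symmetric] field_simps)
  qed
  \<comment> \<open>The sum of the terms \<open>T Z_j\<close> stops one short of
    \<open>\<kappa>\<close>. Completing it gives the full operator applied to \<open>Su\<close> and
    leaves a single remainder term.\<close>
  also have "(\<Sum>j<\<kappa>. inverse (n ^ j) * (T_op \<Omega> (Z_fun \<Omega> j) z * \<Omega> z))
     = (ld (Su N) z + Su N z) - inverse (n ^ \<kappa>) * (T_op \<Omega> (Z_fun \<Omega> \<kappa>) z * \<Omega> z)"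
    unfolding Su_ld[OF z] n_def[symmetric] lessThan_Suc_atMost[symmetric] by simp
  finally have eq: "Yf N z * \<Omega> z = Su N z + ((ld (Su N) z + Su N z) - inverse (n ^ \<kappa>) * (T_op \<Omega> (Z_fun \<Omega> \<kappa>) z * \<Omega> z)) / n"
    by (simp add: Su_def n_def[symmetric])
  have gen: "A + (L - inverse (n ^ \<kappa>) * t) / n = A + L / n - t / n ^ (\<kappa> + 1)" for A L t
    using n by (simp add: divide_inverse algebra_simps)
  show ?thesis using eq unfolding gen by (simp only: n_def)
qed

text \<open>Inverse powers of \<open>N\<close> are at most 1, so bounds for the finitely many
  coefficients are uniform in \<open>N\<close>.\<close>

lemma family_bounded:
  assumes K: "compact K" and c: "\<And>j. j \<le> \<kappa> \<Longrightarrow> continuous_on K (F j :: complex \<Rightarrow> complex)"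
  shows "\<exists>B\<ge>0. \<forall>N\<ge>1. \<forall>z\<in>K. norm (\<Sum>j\<le>\<kappa>. inverse (of_nat N ^ j) * F j z) \<le> B"
proof -
  have "\<exists>B. \<forall>z\<in>K. norm (F j z) \<le> B" if "j \<le> \<kappa>" for j
    using compact_imp_bounded[OF compact_continuous_image[OF c[OF that] K]] unfolding bounded_iff by auto
  hence "\<forall>j\<in>{..\<kappa>}. \<exists>B. \<forall>z\<in>K. norm (F j z) \<le> B" by simp
  from bchoice[OF this] obtain B where B: "\<forall>j\<in>{..\<kappa>}. \<forall>z\<in>K. norm (F j z) \<le> B j" ..
  have "norm (\<Sum>j\<le>\<kappa>. inverse (of_nat N ^ j) * F j z) \<le> (\<Sum>j\<le>\<kappa>. \<bar>B j\<bar>)" if N: "N \<ge> 1" and z: "z \<in> K" for N z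
  proof (rule order_trans[OF norm_sum sum_mono])
    fix j assume j: "j \<in> {..\<kappa>}"
    have "norm (inverse (of_nat N ^ j) * F j z) = inverse (real N ^ j) * norm (F j z)"
      by (simp add: norm_mult norm_inverse norm_power)
    also have "\<dots> \<le> 1 * \<bar>B j\<bar>"
      using B j z N by (intro mult_mono) (auto simp: inverse_le_1_iff intro: order_trans[OF _ abs_ge_self])
    finally show "norm (inverse (of_nat N ^ j) * F j z) \<le> \<bar>B j\<bar>" by simp
  qed
  thus ?thesis by (intro exI[of _ "\<Sum>j\<le>\<kappa>. \<bar>B j\<bar>"]) (auto intro!: sum_nonneg)
qed

lemma Yf_bounded: "\<exists>B\<ge>0. \<forall>N\<ge>1. \<forall>z\<in>ring. norm (Yf N z) \<le> B"
  unfolding Yf_def by (rule family_bounded[OF compact_closed_ring[OF r0]]) (rule cont_ring[OF X_log_smooth[where b = True]])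

lemma Su_bounded: "\<exists>B\<ge>0. \<forall>N\<ge>1. \<forall>z\<in>ring. norm (Su N z) \<le> B"
  unfolding Su_def by (rule family_bounded[OF compact_closed_ring[OF r0]]) (rule cont_ring[OF ZO_log_smooth])

lemma Su_ld_bounded: "\<exists>B\<ge>0. \<forall>N\<ge>1. \<forall>z\<in>ring. norm (ld (Su N) z) \<le> B"
proof -
  obtain B1 where B1: "B1 \<ge> 0" "\<And>N z. N \<ge> 1 \<Longrightarrow> z \<in> ring \<Longrightarrow> norm (Su N z) \<le> B1" using Su_bounded by blast
  have "\<exists>B\<ge>0. \<forall>N\<ge>1. \<forall>z\<in>ring. norm (\<Sum>j\<le>\<kappa>. inverse (of_nat N ^ j) * (T_op \<Omega> (Z_fun \<Omega> j) z * \<Omega> z)) \<le> B"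
    by (rule family_bounded[OF compact_closed_ring[OF r0]]) (rule cont_ring[OF T_log_smooth])
  then obtain B2 where B2: "B2 \<ge> 0" "\<And>N z. N \<ge> 1 \<Longrightarrow> z \<in> ring \<Longrightarrow> norm (ld (Su N) z + Su N z) \<le> B2"
    using Su_ld ring_annulus by (metis (no_types, lifting))
  have "norm (ld (Su N) z) \<le> B1 + B2" if "N \<ge> 1" "z \<in> ring" for N z
    using norm_triangle_ineq4[of "ld (Su N) z + Su N z" "Su N z"] B1(2)[OF that] B2(2)[OF that] by simp
  thus ?thesis using B1 B2 by (intro exI[of _ "B1 + B2"]) auto
qed

text \<open>On the circle \<open>\<Omega>\<close> is 1, so \<open>Su\<close> is a linear combination
  of the functions \<open>Z_fun\<close>, each orthogonal to \<open>h\<close>.\<close>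

lemma Su_circle_mean:
  assumes "h \<in> H2_minus0" "continuous_on (sphere 0 1) h"
  shows "circle_mean (\<lambda>z. cnj (h z) * Su N z) = 0"
proof -
  have cz: "continuous_on (sphere 0 1) (Z_fun \<Omega> j)" if "j \<le> \<kappa>" for j
    by (rule log_smooth_continuous_circle[OF r0 Z[OF that]])
  have "circle_mean (\<lambda>z. cnj (h z) * Su N z) = circle_mean (\<lambda>z. \<Sum>j\<le>\<kappa>. inverse (of_nat N ^ j) * (Z_fun \<Omega> j z * cnj (h z)))"
    by (rule circle_mean_cong) (simp add: Su_def \<Omega>1 sum_distrib_left mult_ac)
  also have "\<dots> = (\<Sum>j\<le>\<kappa>. circle_mean (\<lambda>z. inverse (of_nat N ^ j) * (Z_fun \<Omega> j z * cnj (h z))))"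
    by (rule circle_mean_sum) (intro continuous_intros cz assms(2); simp)
  also have "\<dots> = 0"
    using Zinner[OF _ assms(1)] by (simp add: circle_mean_cmult circle_inner_eq_mean)
  finally show ?thesis .
qed

lemma ring_norm_le_product:
  assumes "continuous_on ring (F :: complex \<Rightarrow> complex)" "continuous_on ring (G :: complex \<Rightarrow> complex)"
  shows "norm (R N (\<lambda>z. F z * G z)) \<le> sqrt (R N (\<lambda>z. (norm (F z))\<^sup>2)) * sqrt (R N (\<lambda>z. (norm (G z))\<^sup>2))"
proof -
  have "norm (R N (\<lambda>z. F z * G z)) \<le> R N (\<lambda>z. norm (F z * G z))"
    by (rule ring_integral_norm_le) (intro continuous_intros assms)
  also have "\<dots> = R N (\<lambda>z. norm (F z) * norm (G z))" by (simp add: norm_mult)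
  finally show ?thesis using ring_integral_Cauchy_Schwarz[OF assms, of N] by simp
qed

end

context ring_setting
begin

text \<open>The right-hand side contains only the norm of \<open>h\<close> over the ring, which
  gives no usable bound for \<open>h\<close> on the inner circle. Integration by parts is therefore
  applied to \<open>w = f (1 - E)\<close>, where \<open>f\<close> is \<open>cnj h\<close> times
  \<open>Su\<close> and \<open>E\<close> is 1 on the inner circle. The remainders are estimated by
  Cauchy-Schwarz against \<open>h\<close>.\<close>

lemma approximate_orthogonality:
  "\<exists>C\<ge>0. \<forall>N\<ge>1. \<forall>h. h holomorphic_on {z. r0 < norm z} \<longrightarrow> (h \<longlongrightarrow> 0) at_infinity \<longrightarrow>
     norm (R N (\<lambda>z. cnj (h z) * (Yf N z * \<Omega> z))) \<le> C / real N ^ (\<kappa> + 1) * sqrt (R N (\<lambda>z. (norm (h z))\<^sup>2))"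
proof -
  define \<tau> where "\<tau> = (\<lambda>z. T_op \<Omega> (Z_fun \<Omega> \<kappa>) z * \<Omega> z)"
  have \<tau>: "log_smooth True r0 \<tau>" unfolding \<tau>_def by (rule T_log_smooth) simp
  obtain B\<tau> where B\<tau>: "B\<tau> \<ge> 0" "\<And>z. z \<in> ring \<Longrightarrow> norm (\<tau> z) \<le> B\<tau>"
    using continuous_on_ring_bounded[OF r0 cont_ring[OF \<tau>]] by blast
  obtain Bu where Bu: "Bu \<ge> 0" "\<And>N z. N \<ge> 1 \<Longrightarrow> z \<in> ring \<Longrightarrow> norm (ld (Su N) z) \<le> Bu" using Su_ld_bounded by blast
  \<comment> \<open>Twice the final exponent is requested, since the remainder containing
    \<open>E\<close> is bounded through the square root of an integral.\<close>
  obtain Ce where Ce: "Ce \<ge> 0" "\<And>N. N \<ge> 1 \<Longrightarrow> exp (2 * (real N + 1) * x0) \<le> Ce / real N ^ (2 * (\<kappa> + 1))"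
    using exp_decay[OF x0(2), of "2 * (\<kappa> + 1)"] by blast
  have "norm (R N (\<lambda>z. cnj (h z) * (Yf N z * \<Omega> z))) \<le> (Bu * sqrt (2 * (Ce * \<bar>x0\<bar>)) + B\<tau>) / real N ^ (\<kappa> + 1) * sqrt (R N (\<lambda>z. (norm (h z))\<^sup>2))"
    if N: "N \<ge> 1" and h: "h holomorphic_on {z. r0 < norm z}" and h0: "(h \<longlongrightarrow> 0) at_infinity" for N h
  proof -
    define e0 where "e0 = exp (2 * (real N + 1) * x0)"
    \<comment> \<open>\<open>E\<close> is \<open>(exp x0 / |z|)^(2 (N + 1))\<close>: equal to 1 on
      the inner circle, to \<open>e0\<close> on the unit circle, and constant after multiplication
      by the weight \<open>exp (2 (N + 1) x)\<close>. Writing it as a holomorphic function times its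
      conjugate makes its logarithmic derivatives explicit.\<close>
    define E where "E = (\<lambda>z. of_real e0 * ((inverse z) ^ (N + 1) * cnj ((inverse z) ^ (N + 1))))"
    define u where "u = Su N"
    define f where "f = (\<lambda>z. cnj (h z) * u z)"
    have n: "(of_nat N :: complex) \<noteq> 0" using N by simp
    have hs: "log_smooth b r0 h" for b
      by (rule log_smooth_holomorphic[OF r0 holomorphic_on_subset[OF h]]) (auto simp: annulus_def)
    have hc: "continuous_on (sphere 0 1) h" by (rule log_smooth_continuous_circle[OF r0 hs])
    have hH: "h \<in> H2_minus0"
      using L2_circle_continuous[OF hc] fourier_coeff_exterior_zero[OF h _ r0(2) h0] r0 by (simp add: H2_minus0_def)
    have us: "log_smooth True r0 u" unfolding u_def by (rule Su_log_smooth)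
    have ih: "(\<lambda>z. (inverse z) ^ (N + 1)) holomorphic_on annulus r0"
      by (intro holomorphic_intros) (use annulus_nonzero[OF r0(1)] in auto)
    have ihs: "log_smooth True r0 (\<lambda>z. (inverse z) ^ (N + 1))" by (rule log_smooth_holomorphic[OF r0 ih])
    have Es: "log_smooth True r0 E" unfolding E_def
      by (intro log_smooth_mult log_smooth_const log_smooth_cnj r0 ihs)
    have fs: "log_smooth True r0 f" unfolding f_def by (intro log_smooth_mult log_smooth_cnj r0 hs us)
    have dE: "has_log_deriv E (- of_nat (N + 1) * E z) (- of_nat (N + 1) * E z) z" if z: "z \<in> annulus r0" for z
    proof -
      have z0: "z \<noteq> 0" using annulus_nonzero[OF r0(1) z] .
      have "(inverse has_field_derivative - (inverse z * inverse z)) (at z)"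
        using z0 by (auto intro!: derivative_eq_intros)
      from DERIV_power[OF this, of "N + 1"]
      have "((\<lambda>z. inverse z ^ (N + 1)) has_field_derivative of_nat (N + 1) * (- (inverse z * inverse z) * inverse z ^ N)) (at z)"
        by simp
      hence "has_log_deriv (\<lambda>z. inverse z ^ (N + 1)) (z * (of_nat (N + 1) * (- (inverse z * inverse z) * inverse z ^ N))) 0 z"
        by (rule has_log_deriv_holomorphic[OF _ z0])
      also have "z * (of_nat (N + 1) * (- (inverse z * inverse z) * inverse z ^ N)) = - of_nat (N + 1) * inverse z ^ (N + 1)"
      proof -
        have zi: "z * inverse z = 1" using z0 by simp
        have "z * (of_nat (N + 1) * (- (inverse z * inverse z) * inverse z ^ N)) = - of_nat (N + 1) * (z * inverse z) * inverse z ^ (N + 1)"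
          by (simp only: power_Suc Suc_eq_plus1[symmetric] mult_minus_left mult_minus_right mult_ac)
        thus ?thesis unfolding zi by simp
      qed
      finally have 1: "has_log_deriv (\<lambda>z. inverse z ^ (N + 1)) (- of_nat (N + 1) * inverse z ^ (N + 1)) 0 z" .
      have 2: "has_log_deriv (\<lambda>_. of_real e0) 0 0 z" using z0 by (simp add: has_log_deriv_def)
      from has_log_deriv_mult[OF 2 has_log_deriv_mult[OF 1 has_log_deriv_cnj[OF 1]]]
      show ?thesis unfolding E_def by (simp add: mult_ac)
    qed
    \<comment> \<open>By holomorphy of \<open>h\<close>, the operator \<open>ld\<close> annihilates
      \<open>cnj h\<close>, so in \<open>f\<close> it falls on \<open>u\<close> alone.\<close>
    have ldb_h: "ldb h z = 0" if z: "z \<in> annulus r0" for z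
      by (rule has_log_deriv_unique(2)[OF has_log_deriv_holomorphic[OF holomorphic_derivI[OF h open_norm_gt]]])
         (use z annulus_nonzero[OF r0(1) z] in \<open>auto simp: annulus_def\<close>)
    have df: "has_log_deriv f (cnj (h z) * ld u z) (ldb f z) z" if z: "z \<in> annulus r0" for z
    proof -
      have "ld f z = cnj (ldb h z) * u z + cnj (h z) * ld u z"
        unfolding f_def
        by (rule has_log_deriv_unique(1)[OF has_log_deriv_mult[OF has_log_deriv_cnj[OF log_smooth_log_deriv[OF r0(1) hs[of True] z]] log_smooth_log_deriv[OF r0(1) us z]]])
      thus ?thesis using log_smooth_log_deriv[OF r0(1) fs z] ldb_h[OF z] by simp
    qed
    define w where "w = (\<lambda>z. f z * (1 - E z))"
    have ws: "log_smooth True r0 w" unfolding w_def by (intro log_smooth_mult log_smooth_diff log_smooth_const r0 fs Es)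
    have ldw: "ld w z = cnj (h z) * ld u z * (1 - E z) + f z * (of_nat (N + 1) * E z)" if z: "z \<in> annulus r0" for z
    proof -
      have z0: "z \<noteq> 0" using annulus_nonzero[OF r0(1) z] .
      have 1: "has_log_deriv (\<lambda>_. 1) 0 0 z" using z0 by (simp add: has_log_deriv_def)
      have 2: "has_log_deriv (\<lambda>_. -1) 0 0 z" using z0 by (simp add: has_log_deriv_def)
      have "has_log_deriv (\<lambda>z. 1 + (-1) * E z) (0 + (0 * E z + (-1) * (- of_nat (N + 1) * E z))) (0 + (0 * E z + (-1) * (- of_nat (N + 1) * E z))) z"
        by (rule has_log_deriv_add[OF 1 has_log_deriv_mult[OF 2 dE[OF z]]])
      hence 3: "has_log_deriv (\<lambda>z. 1 - E z) (of_nat (N + 1) * E z) (of_nat (N + 1) * E z) z" by (simp add: algebra_simps)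
      show ?thesis unfolding w_def by (rule has_log_deriv_unique(1)[OF has_log_deriv_mult[OF df[OF z] 3]])
    qed
    have nE: "E z = of_real (exp (2 * (real N + 1) * (x0 - ln (norm z))))" if z: "z \<noteq> 0" for z
    proof -
      have "inverse z ^ (N + 1) * cnj (inverse z ^ (N + 1)) = of_real ((norm (inverse z ^ (N + 1)))\<^sup>2)"
        by (simp only: complex_norm_square)
      also have "(norm (inverse z ^ (N + 1)))\<^sup>2 = exp (- (2 * (real N + 1) * ln (norm z)))"
      proof -
        have "(norm (inverse z ^ (N + 1)))\<^sup>2 = inverse (norm z) ^ (2 * (N + 1))"
          by (simp only: norm_power norm_inverse power_mult[symmetric] mult.commute)
        also have "inverse (norm z) = exp (- ln (norm z))" using z by (simp add: exp_minus)
        also have "exp (- ln (norm z)) ^ (2 * (N + 1)) = exp (- (2 * (real N + 1) * ln (norm z)))"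
          unfolding exp_of_nat_mult[symmetric] by (simp add: algebra_simps)
        finally show ?thesis .
      qed
      finally have q: "inverse z ^ (N + 1) * cnj (inverse z ^ (N + 1)) = of_real (exp (- (2 * (real N + 1) * ln (norm z))))" .
      show ?thesis unfolding E_def q e0_def of_real_mult[symmetric] exp_add[symmetric] by (simp add: algebra_simps)
    qed
    have wx0: "radial_mean w x0 = 0"
    proof -
      have "radial_mean w x0 = radial_mean (\<lambda>_. 0) x0"
      proof (rule radial_mean_cong)
        fix z :: complex assume z: "norm z = exp x0"
        hence "z \<noteq> 0" by auto
        from nE[OF this] have "E z = 1" by (simp add: z)
        thus "w z = 0" by (simp add: w_def)
      qed
      thus ?thesis by (simp add: radial_mean_def)
    qed
    have w0: "circle_mean w = 0"
    proof -
      have "circle_mean w = circle_mean (\<lambda>z. (1 - of_real e0) * (cnj (h z) * Su N z))"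
      proof (rule circle_mean_cong)
        fix z :: complex assume z: "norm z = 1"
        hence "z \<noteq> 0" by auto
        from nE[OF this] have "E z = of_real e0" by (simp add: z e0_def)
        thus "w z = (1 - of_real e0) * (cnj (h z) * Su N z)" by (simp add: w_def f_def u_def)
      qed
      thus ?thesis using Su_circle_mean[OF hH hc] by (simp add: circle_mean_cmult)
    qed
    have cw: "continuous_on ring w" "continuous_on ring (ld w)" "continuous_on ring E"
      "continuous_on ring (ld u)" "continuous_on ring h" "continuous_on ring \<tau>"
      by (rule cont_ring[OF ws] cont_ring[OF log_smooth_ld[OF ws]] cont_ring[OF Es] cont_ring[OF log_smooth_ld[OF us]]
            cont_ring[OF hs[of True]] cont_ring[OF \<tau>])+
    \<comment> \<open>Both boundary terms are zero: the inner one through the factor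
      \<open>1 - E\<close>, the one on the unit circle because \<open>E\<close> is constant there
      and \<open>Su\<close> is orthogonal to \<open>h\<close>.\<close>
    have main: "R N w + R N (\<lambda>z. ld w z + w z) / of_nat N = 0"
      using log_smooth_by_parts[OF r0 ws x0(1) _ N] x0 wx0 w0 by simp
    have "R N (\<lambda>z. cnj (h z) * (Yf N z * \<Omega> z)) = R N (\<lambda>z. (w z + inverse (of_nat N) * (ld w z + w z))
        + (inverse (of_nat N) * (cnj (h z) * (ld u z * E z)) - inverse (of_nat N ^ (\<kappa> + 1)) * (cnj (h z) * \<tau> z)))"
    proof (rule ring_integral_cong)
      fix z assume "z \<in> ring"
      hence z: "z \<in> annulus r0" by (rule ring_annulus)
      show "cnj (h z) * (Yf N z * \<Omega> z) = (w z + inverse (of_nat N) * (ld w z + w z))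
        + (inverse (of_nat N) * (cnj (h z) * (ld u z * E z)) - inverse (of_nat N ^ (\<kappa> + 1)) * (cnj (h z) * \<tau> z))"
      proof -
        have t: "T_op \<Omega> (Z_fun \<Omega> \<kappa>) z * \<Omega> z = \<tau> z" by (simp add: \<tau>_def)
        \<comment> \<open>The term \<open>(N + 1) E f\<close> that comes from differentiating
          \<open>E\<close> cancels exactly against the parts of \<open>w\<close> and
          \<open>w / N\<close> that contain \<open>E\<close>. What survives is \<open>ld u\<close>
          times \<open>E / N\<close> and the truncation remainder.\<close>
        have alg: "cu * (sv + (ls + sv) / m - t / p) = (cu * sv * (1 - e) + inverse m * ((cu * ls * (1 - e) + cu * sv * ((m + 1) * e)) + cu * sv * (1 - e)))
            + (inverse m * (cu * (ls * e)) - inverse p * (cu * t))"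
          if "m \<noteq> 0" "p \<noteq> 0" for cu sv ls m t p e :: complex
          using that by (simp add: field_simps)
        have N1: "(of_nat (N + 1) :: complex) = of_nat N + 1" by simp
        show ?thesis
          unfolding Yf_relation[OF z N] ldw[OF z] t unfolding w_def f_def u_def[symmetric] N1
          by (rule alg[OF n]) (use n in simp)
      qed
    qed
    also have "\<dots> = R N (\<lambda>z. w z + inverse (of_nat N) * (ld w z + w z))
       + (inverse (of_nat N) * R N (\<lambda>z. cnj (h z) * (ld u z * E z)) - inverse (of_nat N ^ (\<kappa> + 1)) * R N (\<lambda>z. cnj (h z) * \<tau> z))"
    proof -
      have c: "continuous_on ring (\<lambda>z. w z + inverse (of_nat N) * (ld w z + w z))"
        "continuous_on ring (\<lambda>z. inverse (of_nat N) * (cnj (h z) * (ld u z * E z)))"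
        "continuous_on ring (\<lambda>z. inverse (of_nat N ^ (\<kappa> + 1)) * (cnj (h z) * \<tau> z))"
        by (intro continuous_intros cw)+
      show ?thesis
        by (simp only: ring_integral_add[OF c(1) continuous_on_diff[OF c(2,3)]] ring_integral_diff[OF c(2,3)] ring_integral_cmult)
    qed
    also have "R N (\<lambda>z. w z + inverse (of_nat N) * (ld w z + w z)) = 0"
    proof -
      have c: "continuous_on ring (\<lambda>z. inverse (of_nat N) * (ld w z + w z))" by (intro continuous_intros cw)
      show ?thesis using main by (simp only: ring_integral_add[OF cw(1) c] ring_integral_cmult) (simp add: field_simps)
    qed
    finally have eq: "R N (\<lambda>z. cnj (h z) * (Yf N z * \<Omega> z))
       = inverse (of_nat N) * R N (\<lambda>z. cnj (h z) * (ld u z * E z)) - inverse (of_nat N ^ (\<kappa> + 1)) * R N (\<lambda>z. cnj (h z) * \<tau> z)"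
      by simp
    define H where "H = sqrt (R N (\<lambda>z. (norm (h z))\<^sup>2))"
    have "0 = R N (\<lambda>_. 0::real)" by (simp add: ring_integral_def case_prod_unfold)
    also have "\<dots> \<le> R N (\<lambda>z. (norm (h z))\<^sup>2)" by (rule ring_integral_mono) (auto intro!: continuous_intros cw)
    finally have H0: "H \<ge> 0" by (simp add: H_def)
    have b1: "norm (R N (\<lambda>z. cnj (h z) * (ld u z * E z))) \<le> H * (Bu * (sqrt (2 * (Ce * \<bar>x0\<bar>)) / real N ^ \<kappa>))"
    proof -
      have "norm (R N (\<lambda>z. cnj (h z) * (ld u z * E z))) \<le> H * sqrt (R N (\<lambda>z. (norm (ld u z * E z))\<^sup>2))"
        using ring_norm_le_product[of "\<lambda>z. cnj (h z)" "\<lambda>z. ld u z * E z" N] cw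
        by (simp add: H_def continuous_on_cnj continuous_on_mult)
      also have "sqrt (R N (\<lambda>z. (norm (ld u z * E z))\<^sup>2)) \<le> Bu * (sqrt (2 * (Ce * \<bar>x0\<bar>)) / real N ^ \<kappa>)"
      proof (rule real_le_lsqrt)
        \<comment> \<open>On the ring \<open>E \<le> 1\<close>, so \<open>E\<close> squared may be
          replaced by \<open>E\<close>, and the weighted integral of \<open>E\<close> is that of the
          constant \<open>e0\<close>, which is exponentially small.\<close>
        have le: "(norm (ld u z * E z))\<^sup>2 \<le> Bu\<^sup>2 * (e0 * exp (- (2 * (real N + 1) * ln (norm z))))" if z: "z \<in> ring" for z
        proof -
          have z0: "z \<noteq> 0" "exp x0 \<le> norm z" using z by (auto simp: closed_ring_def)
          have "x0 \<le> ln (norm z)" using z0 by (subst ln_ge_iff) auto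
          hence "exp (2 * (real N + 1) * (x0 - ln (norm z))) \<le> 1" by (simp add: mult_nonneg_nonpos)
          moreover have nEz: "norm (E z) = exp (2 * (real N + 1) * (x0 - ln (norm z)))" using nE[OF z0(1)] by simp
          ultimately have "(norm (E z))\<^sup>2 \<le> norm (E z)"
            by (simp add: power2_eq_square mult_left_le)
          moreover have "(norm (ld u z))\<^sup>2 \<le> Bu\<^sup>2" using Bu(2)[OF N z] by (intro power_mono) (auto simp: u_def)
          ultimately have "(norm (ld u z * E z))\<^sup>2 \<le> Bu\<^sup>2 * norm (E z)"
            unfolding norm_mult power_mult_distrib by (intro mult_mono) auto
          also have "norm (E z) = e0 * exp (- (2 * (real N + 1) * ln (norm z)))"
            unfolding nEz e0_def by (simp add: exp_add[symmetric] algebra_simps)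
          finally show ?thesis .
        qed
        have cl: "continuous_on ring (\<lambda>z. exp (- (2 * (real N + 1) * ln (norm z))))"
          by (intro continuous_intros) (auto simp: closed_ring_def)
        have "R N (\<lambda>z. (norm (ld u z * E z))\<^sup>2) \<le> R N (\<lambda>z. Bu\<^sup>2 * (e0 * exp (- (2 * (real N + 1) * ln (norm z)))))"
          by (rule ring_integral_mono[OF _ _ le])
             (intro continuous_on_power continuous_on_norm continuous_on_mult continuous_on_const cw cl)+
        also have "\<dots> = Bu\<^sup>2 * (e0 * R N (\<lambda>z. exp (- (2 * (real N + 1) * ln (norm z)))))"
          by (simp only: ring_integral_cmult)
        also have "R N (\<lambda>z. exp (- (2 * (real N + 1) * ln (norm z)))) \<le> 2 * (real N * \<bar>x0\<bar>)"
        proof -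
          have "R N (\<lambda>z. exp (- (2 * (real N + 1) * ln (norm z)))) = real N / pi * integral (cbox (x0, 0) (0, 2 * pi)) (\<lambda>_. 1)"
            by (simp add: ring_integral_def case_prod_unfold exp_minus)
          also have "\<dots> = 2 * (real N * \<bar>x0\<bar>)" using x0 by (simp add: content_pair)
          finally show ?thesis by simp
        qed
        also have "Bu\<^sup>2 * (e0 * (2 * (real N * \<bar>x0\<bar>))) \<le> (Bu * (sqrt (2 * (Ce * \<bar>x0\<bar>)) / real N ^ \<kappa>))\<^sup>2"
        proof -
          have N1: "real N ^ (2 * \<kappa>) * real N \<le> real N ^ (2 * (\<kappa> + 1))"
            using N by (simp add: power_add mult_left_mono self_le_power numeral_2_eq_2)
          have "e0 * real N \<le> Ce / real N ^ (2 * (\<kappa> + 1)) * real N"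
            using Ce(2)[OF N] by (intro mult_right_mono) (auto simp: e0_def)
          also have "\<dots> = Ce / real N ^ (2 * \<kappa> + 1)"
            using N by (simp add: divide_simps power_add power2_eq_square)
          also have "\<dots> \<le> Ce / real N ^ (2 * \<kappa>)"
            using N Ce(1) by (intro divide_left_mono power_increasing) auto
          finally have "e0 * real N * (2 * \<bar>x0\<bar>) \<le> Ce / real N ^ (2 * \<kappa>) * (2 * \<bar>x0\<bar>)" by (intro mult_right_mono) auto
          hence "Bu\<^sup>2 * (e0 * (2 * (real N * \<bar>x0\<bar>))) \<le> Bu\<^sup>2 * (2 * (Ce * \<bar>x0\<bar>) / real N ^ (2 * \<kappa>))"
            by (intro mult_left_mono) (auto simp: mult_ac)
          also have "\<dots> = (Bu * (sqrt (2 * (Ce * \<bar>x0\<bar>)) / real N ^ \<kappa>))\<^sup>2"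
            using Ce(1) by (simp add: power_mult_distrib power_divide power_mult[symmetric] mult.commute)
          finally show ?thesis .
        qed
        finally show "R N (\<lambda>z. (norm (ld u z * E z))\<^sup>2) \<le> (Bu * (sqrt (2 * (Ce * \<bar>x0\<bar>)) / real N ^ \<kappa>))\<^sup>2"
          using Bu(1) by (simp add: e0_def mult_left_mono)
      qed (use Bu Ce in auto)
      finally show ?thesis using H0 by (simp add: mult_left_mono)
    qed
    have b2: "norm (R N (\<lambda>z. cnj (h z) * \<tau> z)) \<le> H * B\<tau>"
    proof -
      have "norm (R N (\<lambda>z. cnj (h z) * \<tau> z)) \<le> H * sqrt (R N (\<lambda>z. (norm (\<tau> z))\<^sup>2))"
        using ring_norm_le_product[of "\<lambda>z. cnj (h z)" \<tau> N] cw by (simp add: H_def continuous_on_cnj)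
      also have "sqrt (R N (\<lambda>z. (norm (\<tau> z))\<^sup>2)) \<le> B\<tau>"
      proof (rule real_le_lsqrt)
        have "R N (\<lambda>z. (norm (\<tau> z))\<^sup>2) \<le> R N (\<lambda>_. B\<tau>\<^sup>2)"
          by (rule ring_integral_mono) (auto intro!: continuous_intros cw power_mono B\<tau>)
        also have "\<dots> \<le> B\<tau>\<^sup>2" by (rule ring_integral_const_le) (use x0 in auto)
        finally show "R N (\<lambda>z. (norm (\<tau> z))\<^sup>2) \<le> B\<tau>\<^sup>2" .
      qed (rule B\<tau>)
      finally show ?thesis using H0 by (simp add: mult_left_mono)
    qed
    have "norm (R N (\<lambda>z. cnj (h z) * (Yf N z * \<Omega> z))) \<le> inverse (real N) * (H * (Bu * (sqrt (2 * (Ce * \<bar>x0\<bar>)) / real N ^ \<kappa>))) + inverse (real N ^ (\<kappa> + 1)) * (H * B\<tau>)"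
      unfolding eq
      by (rule order_trans[OF norm_triangle_ineq4 add_mono], unfold norm_mult norm_inverse norm_power norm_of_nat)
         (intro mult_left_mono b1 b2 inverse_nonnegative_iff_nonnegative[THEN iffD2] zero_le_power of_nat_0_le_iff)+
    also have "\<dots> = (Bu * sqrt (2 * (Ce * \<bar>x0\<bar>)) + B\<tau>) / real N ^ (\<kappa> + 1) * H" using N by (simp add: field_simps)
    finally show ?thesis by (simp add: H_def)
  qed
  thus ?thesis using Bu Ce B\<tau> by (intro exI[of _ "Bu * sqrt (2 * (Ce * \<bar>x0\<bar>)) + B\<tau>"]) auto
qed

end

context ring_setting
begin

lemma X_cont: "j \<le> \<kappa> \<Longrightarrow> continuous_on ring (X_fun \<Omega> j)"
  by (rule cont_ring[OF X_log_smooth[where b = True]])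

lemma ring_abs_ln: "z \<in> ring \<Longrightarrow> \<exists>x t. x0 \<le> x \<and> x \<le> 0 \<and> z = polar x t \<and> x = ln (norm z)"
proof -
  assume z: "z \<in> ring"
  hence z0: "exp x0 \<le> norm z" "norm z \<le> 1" by (auto simp: closed_ring_def)
  have p: "0 < norm z" using z0(1) by (rule less_le_trans[OF exp_gt_zero])
  have "x0 \<le> ln (norm z)" "ln (norm z) \<le> 0" using z0 p by (auto simp: ln_ge_iff)
  moreover have "z = polar (ln (norm z)) (Arg z)"
    using p rcis_cmod_Arg[of z] by (simp add: polar_def rcis_def exp_of_real)
  ultimately show ?thesis by blast
qed

text \<open>Here \<open>u\<close> times \<open>Yf N\<close> is bounded on the ring uniformly in
  \<open>N\<close>, so the inner boundary term is exponentially small without any correcting factor.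
  The new error \<open>g\<close> contains \<open>ldb u\<close>: as \<open>u\<close> is holomorphic
  outside and smooth across the circle, \<open>ldb u\<close> is flat along it, and flatness of order
  \<open>\<kappa> + 1\<close> is worth \<open>N^(-\<kappa>-1)\<close> after integration.\<close>

lemma holomorphic_factor_negligible:
  assumes us: "log_smooth False r0 u" and uc: "continuous_on {z. 1 \<le> norm z} u"
    and uh: "u holomorphic_on {z. 1 < norm z}" and u0: "(u \<longlongrightarrow> 0) at_infinity"
  shows "\<exists>C. \<forall>N\<ge>1. norm (R N (\<lambda>z. cnj (u z * Yf N z) * (Yf N z * \<Omega> z))) \<le> C / real N ^ (\<kappa> + 1)"
proof -
  define \<tau> where "\<tau> = (\<lambda>z. T_op \<Omega> (Z_fun \<Omega> \<kappa>) z * \<Omega> z)"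
  have \<tau>: "log_smooth True r0 \<tau>" unfolding \<tau>_def by (rule T_log_smooth) simp
  obtain Bt where Bt: "Bt \<ge> 0" "\<And>z. z \<in> ring \<Longrightarrow> norm (\<tau> z) \<le> Bt"
    using continuous_on_ring_bounded[OF r0 cont_ring[OF \<tau>]] by blast
  obtain Bu where Bu: "Bu \<ge> 0" "\<And>z. z \<in> ring \<Longrightarrow> norm (u z) \<le> Bu"
    using continuous_on_ring_bounded[OF r0 cont_ring[OF us]] by blast
  obtain BS where BS: "BS \<ge> 0" "\<And>N z. N \<ge> 1 \<Longrightarrow> z \<in> ring \<Longrightarrow> norm (Su N z) \<le> BS" using Su_bounded by blast
  obtain BY where BY: "BY \<ge> 0" "\<And>N z. N \<ge> 1 \<Longrightarrow> z \<in> ring \<Longrightarrow> norm (Yf N z) \<le> BY" using Yf_bounded by blast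
  obtain Ce where Ce: "Ce \<ge> 0" "\<And>N. N \<ge> 1 \<Longrightarrow> exp (2 * (real N + 1) * x0) \<le> Ce / real N ^ (\<kappa> + 1)"
    using exp_decay[OF x0(2), of "\<kappa> + 1"] by blast
  have ldb_ext: "ldb u z = 0" if "z \<in> annulus r0" "1 \<le> norm z" for z
  proof (rule annulus_zero_on_circle[OF r0 _ _ that])
    show "continuous_on (annulus r0) (ldb u)" by (rule log_smooth_continuous[OF log_smooth_ldb[OF us]])
    fix z assume z: "z \<in> annulus r0" "1 < norm z"
    show "ldb u z = 0"
      by (rule has_log_deriv_unique(2)[OF has_log_deriv_holomorphic[OF holomorphic_derivI[OF uh open_norm_gt]]])
         (use z annulus_nonzero[OF r0(1) z(1)] in auto)
  qed
  obtain Cv where Cv: "Cv \<ge> 0" "\<And>x t. x0 \<le> x \<Longrightarrow> x \<le> 0 \<Longrightarrow> norm (ldb u (polar x t)) \<le> Cv * \<bar>x\<bar> ^ (\<kappa> + 1)"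
    using log_smooth_flat[OF r0 log_smooth_ldb[OF us] ldb_ext x0, of "\<kappa> + 1"] by blast
  define Cf where "Cf = Cv * fact (\<kappa> + 1) * BY * BS"
  have Cf0: "Cf \<ge> 0" using Cv BY BS by (simp add: Cf_def)
  have "norm (R N (\<lambda>z. cnj (u z * Yf N z) * (Yf N z * \<Omega> z)))
      \<le> (Ce * (Bu * BY * BS) + 2 * Cf + Bu * BY * Bt) / real N ^ (\<kappa> + 1)" if N: "N \<ge> 1" for N
  proof -
    define y where "y = Yf N"
    define s where "s = Su N"
    define f where "f = (\<lambda>z. cnj (u z * y z) * s z)"
    define g where "g = (\<lambda>z. cnj (ldb u z * y z) * s z)"
    have ys: "log_smooth b r0 y" for b unfolding y_def by (rule Yf_log_smooth)
    have ss: "log_smooth True r0 s" unfolding s_def by (rule Su_log_smooth)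
    have fs: "log_smooth False r0 f" unfolding f_def
      by (intro log_smooth_mult log_smooth_cnj r0 us ys log_smooth_weaken[OF ss])
    have ldf: "ld f z = g z + cnj (u z * y z) * ld s z" if z: "z \<in> annulus r0" for z
    proof -
      have z0: "z \<noteq> 0" using annulus_nonzero[OF r0(1) z] .
      have "ldb (Yf N) z = 0"
        by (rule has_log_deriv_unique(2)[OF has_log_deriv_holomorphic[OF holomorphic_derivI[OF Yf_holomorphic open_norm_gt], of z N]])
           (use z z0 in \<open>auto simp: annulus_def\<close>)
      hence "ldb y z = 0" by (simp only: y_def)
      hence hy: "has_log_deriv y (ld y z) 0 z" using log_smooth_log_deriv[OF r0(1) ys[of True] z] by simp
      show ?thesis unfolding f_def g_def
        by (rule trans[OF has_log_deriv_unique(1)[OF has_log_deriv_mult[OF has_log_deriv_cnj[OF has_log_deriv_mult[OF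
             log_smooth_log_deriv[OF r0(1) us z] hy]] log_smooth_log_deriv[OF r0(1) ss z]]]]) simp
    qed
    have c: "continuous_on ring u" "continuous_on ring y" "continuous_on ring s"
      "continuous_on ring (ldb u)" "continuous_on ring f" "continuous_on ring (ld f)"
      "continuous_on ring \<tau>"
      by (rule cont_ring[OF us] cont_ring[OF ys[of True]] cont_ring[OF ss] cont_ring[OF log_smooth_ldb[OF us]]
            cont_ring[OF fs] cont_ring[OF log_smooth_ld[OF fs]] cont_ring[OF \<tau>])+
    have cg: "continuous_on ring g" unfolding g_def by (intro continuous_intros c)
    \<comment> \<open>Since \<open>u\<close> is holomorphic only strictly outside the disk,
      membership of the product in \<open>H2_minus0\<close> is obtained from its continuous boundary
      values.\<close>
    have mean0: "circle_mean f = 0"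
    proof -
      have sub: "{z::complex. 1 \<le> norm z} \<subseteq> {z. r0 < norm z}" "{z::complex. 1 < norm z} \<subseteq> {z. r0 < norm z}" using r0 by auto
      have yh: "y holomorphic_on {z. r0 < norm z}" unfolding y_def by (rule Yf_holomorphic)
      have 1: "continuous_on {z. 1 \<le> norm z} (\<lambda>z. u z * y z)"
        by (intro continuous_on_mult uc continuous_on_subset[OF holomorphic_on_imp_continuous_on[OF yh] sub(1)])
      have 2: "(\<lambda>z. u z * y z) holomorphic_on {z. 1 < norm z}"
        by (intro holomorphic_on_mult uh holomorphic_on_subset[OF yh sub(2)])
      have 3: "((\<lambda>z. u z * y z) \<longlongrightarrow> 0) at_infinity"
        using tendsto_mult[OF u0 Yf_tendsto[of N]] by (simp add: y_def)
      have 4: "continuous_on (sphere 0 1) (\<lambda>z. u z * y z)" by (rule continuous_on_subset[OF 1]) auto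
      show ?thesis unfolding f_def s_def by (rule Su_circle_mean[OF boundary_H2_minus0[OF 1 2 3] 4])
    qed
    have parts: "R N f + R N (\<lambda>z. ld f z + f z) / of_nat N = - (of_real (exp (2 * (real N + 1) * x0)) * radial_mean f x0)"
      using log_smooth_by_parts[OF r0 fs x0(1) _ N] x0 mean0 by simp
    have n: "(of_nat N :: complex) \<noteq> 0" using N by simp
    have alg: "cu * (sv + (ls + sv) / m - t / p) = (cu * sv + inverse m * ((gv + cu * ls) + cu * sv))
        - (inverse m * gv + inverse p * (cu * t))" for cu sv ls m t p gv :: complex
      by (simp add: divide_inverse algebra_simps)
    have "R N (\<lambda>z. cnj (u z * Yf N z) * (Yf N z * \<Omega> z)) = R N (\<lambda>z. (f z + inverse (of_nat N) * (ld f z + f z))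
        - (inverse (of_nat N) * g z + inverse (of_nat N ^ (\<kappa> + 1)) * (cnj (u z * y z) * \<tau> z)))"
    proof (rule ring_integral_cong)
      fix z assume "z \<in> ring"
      hence z: "z \<in> annulus r0" by (rule ring_annulus)
      show "cnj (u z * Yf N z) * (Yf N z * \<Omega> z) = (f z + inverse (of_nat N) * (ld f z + f z))
        - (inverse (of_nat N) * g z + inverse (of_nat N ^ (\<kappa> + 1)) * (cnj (u z * y z) * \<tau> z))"
      proof -
        have t: "T_op \<Omega> (Z_fun \<Omega> \<kappa>) z * \<Omega> z = \<tau> z" by (simp add: \<tau>_def)
        show ?thesis
          unfolding Yf_relation[OF z N] ldf[OF z] t unfolding f_def y_def[symmetric] s_def[symmetric] by (rule alg)
      qed
    qed
    also have "\<dots> = (R N f + inverse (of_nat N) * R N (\<lambda>z. ld f z + f z))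
        - (inverse (of_nat N) * R N g + inverse (of_nat N ^ (\<kappa> + 1)) * R N (\<lambda>z. cnj (u z * y z) * \<tau> z))"
    proof -
      have k: "continuous_on ring (\<lambda>z. inverse (of_nat N) * (ld f z + f z))"
        "continuous_on ring (\<lambda>z. inverse (of_nat N) * g z)"
        "continuous_on ring (\<lambda>z. inverse (of_nat N ^ (\<kappa> + 1)) * (cnj (u z * y z) * \<tau> z))"
        by (intro continuous_intros c cg)+
      show ?thesis
        by (simp only: ring_integral_diff[OF continuous_on_add[OF c(5) k(1)] continuous_on_add[OF k(2,3)]]
             ring_integral_add[OF c(5) k(1)] ring_integral_add[OF k(2,3)] ring_integral_cmult)
    qed
    also have "R N f + inverse (of_nat N) * R N (\<lambda>z. ld f z + f z) = - (of_real (exp (2 * (real N + 1) * x0)) * radial_mean f x0)"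
      using parts by (simp add: divide_inverse mult.commute)
    finally have eq: "R N (\<lambda>z. cnj (u z * Yf N z) * (Yf N z * \<Omega> z))
       = - (of_real (exp (2 * (real N + 1) * x0)) * radial_mean f x0)
        - (inverse (of_nat N) * R N g + inverse (of_nat N ^ (\<kappa> + 1)) * R N (\<lambda>z. cnj (u z * y z) * \<tau> z))" .
    have fb: "norm (f z) \<le> Bu * BY * BS" if "z \<in> ring" for z
      unfolding f_def norm_mult complex_mod_cnj y_def s_def
      by (intro mult_mono Bu BY(1) BS(1) BY(2)[OF N that] BS(2)[OF N that] Bu(2)[OF that] mult_nonneg_nonneg norm_ge_zero)
    have b1: "norm (of_real (exp (2 * (real N + 1) * x0)) * radial_mean f x0) \<le> Ce / real N ^ (\<kappa> + 1) * (Bu * BY * BS)"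
    proof -
      have "norm (radial_mean f x0) \<le> Bu * BY * BS"
        by (rule radial_mean_bound[OF continuous_on_subset[OF c(5)] fb]) (use x0 in \<open>auto simp: closed_ring_def\<close>)
      moreover have "norm (of_real (exp (2 * (real N + 1) * x0)) :: complex) \<le> Ce / real N ^ (\<kappa> + 1)"
        using Ce(2)[OF N] by (simp only: norm_of_real abs_exp_cancel)
      ultimately show ?thesis unfolding norm_mult using Ce(1) by (intro mult_mono) auto
    qed
    have b2: "norm (R N g) \<le> 2 * Cf / real N ^ (\<kappa> + 1)"
    proof -
      have ce: "continuous_on ring (\<lambda>z. exp (- real N * ln (norm z)))"
        by (intro continuous_intros) (auto simp: closed_ring_def)
      have gle: "norm (g z) \<le> Cf / real N ^ (\<kappa> + 1) * exp (- real N * ln (norm z))" if z: "z \<in> ring" for z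
      proof -
        obtain x t where x: "x0 \<le> x" "x \<le> 0" "z = polar x t" "x = ln (norm z)" using ring_abs_ln[OF z] by blast
        have "(real N * \<bar>x\<bar>) ^ (\<kappa> + 1) \<le> fact (\<kappa> + 1) * exp (real N * \<bar>x\<bar>)" by (rule fact_exp_bound) simp
        hence "\<bar>x\<bar> ^ (\<kappa> + 1) \<le> fact (\<kappa> + 1) * exp (real N * \<bar>x\<bar>) / real N ^ (\<kappa> + 1)"
        proof -
          assume le: "(real N * \<bar>x\<bar>) ^ (\<kappa> + 1) \<le> fact (\<kappa> + 1) * exp (real N * \<bar>x\<bar>)"
          have p: "0 < real N ^ (\<kappa> + 1)" using N by simp
          show ?thesis unfolding pos_le_divide_eq[OF p] using le unfolding power_mult_distrib by (subst mult.commute)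
        qed
        hence "Cv * \<bar>x\<bar> ^ (\<kappa> + 1) \<le> Cv * (fact (\<kappa> + 1) * exp (real N * \<bar>x\<bar>) / real N ^ (\<kappa> + 1))"
          using Cv(1) by (rule mult_left_mono)
        hence "norm (ldb u z) \<le> Cv * (fact (\<kappa> + 1) * exp (real N * \<bar>x\<bar>) / real N ^ (\<kappa> + 1))"
          using Cv(2)[OF x(1,2), of t] unfolding x(3) by (rule order_trans[rotated])
        hence "norm (ldb u z) * BY * BS \<le> Cv * (fact (\<kappa> + 1) * exp (real N * \<bar>x\<bar>) / real N ^ (\<kappa> + 1)) * BY * BS"
          using BY(1) BS(1) by (intro mult_right_mono) auto
        moreover have "norm (g z) \<le> norm (ldb u z) * BY * BS"
          unfolding g_def norm_mult complex_mod_cnj y_def s_def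
          by (intro mult_mono BY(1) BS(1) BY(2)[OF N z] BS(2)[OF N z] mult_nonneg_nonneg norm_ge_zero order_refl)
        moreover have "real N * \<bar>x\<bar> = - real N * ln (norm z)" using x(2,4) by simp
        ultimately show ?thesis by (simp add: Cf_def mult_ac)
      qed
      have "norm (R N g) \<le> R N (\<lambda>z. norm (g z))" by (rule ring_integral_norm_le[OF cg])
      also have "\<dots> \<le> R N (\<lambda>z. Cf / real N ^ (\<kappa> + 1) * exp (- real N * ln (norm z)))"
        by (rule ring_integral_mono[OF continuous_on_norm[OF cg] continuous_on_mult[OF continuous_on_const ce] gle])
      also have "\<dots> = Cf / real N ^ (\<kappa> + 1) * R N (\<lambda>z. exp (- real N * ln (norm z)))" by (rule ring_integral_cmult)
      also have "\<dots> \<le> Cf / real N ^ (\<kappa> + 1) * 2"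
      proof (rule mult_left_mono)
        have "R N (\<lambda>z. exp (- real N * ln (norm z))) \<le> 2 * real N / (real N + 2)"
          by (rule ring_integral_norm_power[OF x0(2) N]) auto
        also have "\<dots> \<le> 2" by (simp add: divide_le_eq)
        finally show "R N (\<lambda>z. exp (- real N * ln (norm z))) \<le> 2" .
      qed (use Cf0 in simp)
      finally show ?thesis by (simp add: mult.commute)
    qed
    have b3: "norm (R N (\<lambda>z. cnj (u z * y z) * \<tau> z)) \<le> Bu * BY * Bt"
    proof (rule ring_integral_bound)
      show "continuous_on ring (\<lambda>z. cnj (u z * y z) * \<tau> z)" by (intro continuous_intros c)
      fix z assume z: "z \<in> ring"
      show "norm (cnj (u z * y z) * \<tau> z) \<le> Bu * BY * Bt"
        unfolding norm_mult complex_mod_cnj y_def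
        by (intro mult_mono Bu(1) BY(1) BY(2)[OF N z] Bt(2)[OF z] Bu(2)[OF z] mult_nonneg_nonneg norm_ge_zero)
    qed (use x0 in simp)
    have c2: "norm (inverse (of_nat N) * R N g) \<le> 2 * Cf / real N ^ (\<kappa> + 1)"
    proof -
      have "norm (inverse (of_nat N) * R N g) = inverse (real N) * norm (R N g)" by (simp add: norm_mult norm_inverse)
      also have "\<dots> \<le> 1 * norm (R N g)" using N by (intro mult_right_mono) (auto simp: inverse_le_1_iff)
      finally show ?thesis using b2 by simp
    qed
    have c3: "norm (inverse (of_nat N ^ (\<kappa> + 1)) * R N (\<lambda>z. cnj (u z * y z) * \<tau> z)) \<le> Bu * BY * Bt / real N ^ (\<kappa> + 1)"
    proof -
      have "norm (inverse (of_nat N ^ (\<kappa> + 1)) * R N (\<lambda>z. cnj (u z * y z) * \<tau> z))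
         = norm (R N (\<lambda>z. cnj (u z * y z) * \<tau> z)) / real N ^ (\<kappa> + 1)"
        by (simp only: norm_mult norm_inverse norm_power norm_of_nat divide_inverse mult.commute)
      also have "\<dots> \<le> Bu * BY * Bt / real N ^ (\<kappa> + 1)" by (rule divide_right_mono[OF b3]) simp
      finally show ?thesis .
    qed
    have tri: "norm (- a - (b + c)) \<le> norm a + norm b + norm c" for a b c :: complex
      using norm_triangle_ineq4[of "-a" "b + c"] norm_triangle_ineq[of b c] by simp
    have "norm (R N (\<lambda>z. cnj (u z * Yf N z) * (Yf N z * \<Omega> z)))
      \<le> Ce / real N ^ (\<kappa> + 1) * (Bu * BY * BS) + 2 * Cf / real N ^ (\<kappa> + 1) + Bu * BY * Bt / real N ^ (\<kappa> + 1)"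
      unfolding eq by (rule order_trans[OF tri add_mono[OF add_mono[OF b1 c2] c3]])
    thus ?thesis by (simp add: add_divide_distrib)
  qed
  thus ?thesis by blast
qed

lemma Yf_square_expansion:
  assumes g: "continuous_on ring g"
  shows "R N (\<lambda>z. g z * YY N z)
    = (\<Sum>j\<le>\<kappa>. \<Sum>k\<le>\<kappa>. inverse (of_nat N ^ (j + k)) * R N (\<lambda>z. g z * (\<Omega> z * (X_fun \<Omega> j z * cnj (X_fun \<Omega> k z)))))"
proof -
  have "R N (\<lambda>z. g z * YY N z)
     = R N (\<lambda>z. \<Sum>j\<le>\<kappa>. \<Sum>k\<le>\<kappa>. inverse (of_nat N ^ (j + k)) * (g z * (\<Omega> z * (X_fun \<Omega> j z * cnj (X_fun \<Omega> k z)))))"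
  proof (rule ring_integral_cong)
    fix z
    have "g z * YY N z
       = (\<Sum>j\<le>\<kappa>. inverse (of_nat N ^ j) * X_fun \<Omega> j z) * (\<Sum>k\<le>\<kappa>. inverse (of_nat N ^ k) * cnj (X_fun \<Omega> k z)) * (g z * \<Omega> z)"
      by (simp add: Yf_def mult_ac)
    also have "\<dots> = (\<Sum>j\<le>\<kappa>. \<Sum>k\<le>\<kappa>. (inverse (of_nat N ^ j) * X_fun \<Omega> j z) * (inverse (of_nat N ^ k) * cnj (X_fun \<Omega> k z)) * (g z * \<Omega> z))"
      by (subst sum_product) (simp only: sum_distrib_right)
    also have "\<dots> = (\<Sum>j\<le>\<kappa>. \<Sum>k\<le>\<kappa>. inverse (of_nat N ^ (j + k)) * (g z * (\<Omega> z * (X_fun \<Omega> j z * cnj (X_fun \<Omega> k z)))))"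
      by (intro sum.cong refl) (simp add: power_add mult_ac)
    finally show "g z * YY N z
      = (\<Sum>j\<le>\<kappa>. \<Sum>k\<le>\<kappa>. inverse (of_nat N ^ (j + k)) * (g z * (\<Omega> z * (X_fun \<Omega> j z * cnj (X_fun \<Omega> k z)))))" .
  qed
  also have "\<dots> = (\<Sum>j\<le>\<kappa>. \<Sum>k\<le>\<kappa>. R N (\<lambda>z. inverse (of_nat N ^ (j + k)) * (g z * (\<Omega> z * (X_fun \<Omega> j z * cnj (X_fun \<Omega> k z))))))"
  proof -
    have c: "continuous_on ring (\<lambda>z. inverse (of_nat N ^ (j + k)) * (g z * (\<Omega> z * (X_fun \<Omega> j z * cnj (X_fun \<Omega> k z)))))"
      if "j \<le> \<kappa>" "k \<le> \<kappa>" for j k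
      by (intro continuous_intros g cont_ring[OF \<Omega>] X_cont that)
    show ?thesis
      by (subst ring_integral_sum) (auto intro!: continuous_on_sum c sum.cong ring_integral_sum)
  qed
  finally show ?thesis by (simp only: ring_integral_cmult)
qed

section \<open>Coefficients of the Laplace expansion\<close>

definition wt :: "nat \<Rightarrow> nat \<Rightarrow> complex \<Rightarrow> complex" where
  "wt j k = (\<lambda>z. \<Omega> z * (X_fun \<Omega> j z * cnj (X_fun \<Omega> k z)))"

text \<open>The common currency of two computations: the means of \<open>W_op\<close> and the means
  of iterates of \<open>Bop\<close> on \<open>g\<close> times \<open>wt j k\<close> are both sums of
  these numbers. Such a number belongs to the order \<open>\<nu> + \<mu>\<close> in
  \<open>1 / N\<close>, apart from the powers attached to \<open>j\<close> and
  \<open>k\<close>.\<close>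

definition coef :: "(complex \<Rightarrow> complex) \<Rightarrow> nat \<Rightarrow> nat \<Rightarrow> nat \<Rightarrow> nat \<Rightarrow> complex" where
  "coef g j k \<nu> \<mu> = of_nat ((\<nu> + \<mu>) choose \<nu>) * circle_mean (\<lambda>z. (Aop ^^ \<nu>) g z * (Bop ^^ \<mu>) (wt j k) z)"

lemma wt_log_smooth: "j \<le> \<kappa> \<Longrightarrow> k \<le> \<kappa> \<Longrightarrow> log_smooth True r0 (wt j k)"
  unfolding wt_def by (intro log_smooth_mult log_smooth_cnj \<Omega> r0 X_log_smooth)

lemma circle_annulus: "norm z = 1 \<Longrightarrow> z \<in> annulus r0"
  using sphere_subset_annulus[OF r0] by auto

lemma coef_cont:
  assumes "log_smooth False r0 g" "j \<le> \<kappa>" "k \<le> \<kappa>"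
  shows "continuous_on (sphere 0 1) (\<lambda>z. (Aop ^^ \<nu>) g z * (Bop ^^ \<mu>) (wt j k) z)"
  by (intro continuous_on_mult log_smooth_continuous_circle[OF r0 log_smooth_Aop_funpow[OF r0 assms(1)]]
       log_smooth_continuous_circle[OF r0 log_smooth_Bop_funpow[OF r0 wt_log_smooth[OF assms(2,3)]]])

lemma operator_mean:
  assumes g: "log_smooth False r0 g" and jk: "j \<le> \<kappa>" "k \<le> \<kappa>"
  shows "op_mean g N \<nu> j k
    = (\<Sum>\<mu>\<le>\<kappa> - \<nu>. coef g j k \<nu> \<mu> / of_nat N ^ \<mu>)"
proof -
  have "op_mean g N \<nu> j k
    = circle_mean (\<lambda>z. \<Sum>\<mu>\<le>\<kappa> - \<nu>. (of_nat ((\<nu> + \<mu>) choose \<nu>) / of_nat N ^ \<mu>) * ((Aop ^^ \<nu>) g z * (Bop ^^ \<mu>) (wt j k) z))"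
  proof (rule circle_mean_cong)
    fix z :: complex assume "norm z = 1"
    hence z: "z \<in> annulus r0" by (rule circle_annulus)
    show "((\<lambda>h w. - (1/2) * r_dr h w) ^^ \<nu>) g z * W_op \<Omega> N \<nu> \<kappa> (\<lambda>w. X_fun \<Omega> j w * cnj (X_fun \<Omega> k w)) z
      = (\<Sum>\<mu>\<le>\<kappa> - \<nu>. (of_nat ((\<nu> + \<mu>) choose \<nu>) / of_nat N ^ \<mu>) * ((Aop ^^ \<nu>) g z * (Bop ^^ \<mu>) (wt j k) z))"
      unfolding W_op_def wt_def[symmetric] Aop_funpow_r_dr[OF r0 g z] Bop_funpow_r_dr[OF r0 wt_log_smooth[OF jk] z] atLeast0AtMost
        sum_distrib_left
      by (intro sum.cong refl) (simp add: mult_ac)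
  qed
  also have "\<dots> = (\<Sum>\<mu>\<le>\<kappa> - \<nu>. circle_mean (\<lambda>z. (of_nat ((\<nu> + \<mu>) choose \<nu>) / of_nat N ^ \<mu>) * ((Aop ^^ \<nu>) g z * (Bop ^^ \<mu>) (wt j k) z)))"
    by (rule circle_mean_sum) (intro continuous_on_mult continuous_on_const coef_cont[OF g jk])
  also have "\<dots> = (\<Sum>\<mu>\<le>\<kappa> - \<nu>. coef g j k \<nu> \<mu> / of_nat N ^ \<mu>)"
    unfolding circle_mean_cmult coef_def by (intro sum.cong refl) simp
  finally show ?thesis .
qed

text \<open>By the Leibniz rule the contribution of order \<open>m\<close> collects exactly the
  coefficients with \<open>\<nu> + \<mu> = m\<close>.\<close>

lemma Bop_mean:
  assumes g: "log_smooth False r0 g" and jk: "j \<le> \<kappa>" "k \<le> \<kappa>"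
  shows "circle_mean ((Bop ^^ m) (\<lambda>z. g z * wt j k z)) = (\<Sum>\<nu>\<le>m. coef g j k \<nu> (m - \<nu>))"
proof -
  have "circle_mean ((Bop ^^ m) (\<lambda>z. g z * wt j k z))
     = circle_mean (\<lambda>z. \<Sum>\<nu>\<le>m. of_nat (m choose \<nu>) * ((Aop ^^ \<nu>) g z * (Bop ^^ (m - \<nu>)) (wt j k) z))"
    by (rule circle_mean_cong) (rule Bop_funpow_mult[OF r0 g log_smooth_weaken[OF wt_log_smooth[OF jk]] circle_annulus])
  also have "\<dots> = (\<Sum>\<nu>\<le>m. circle_mean (\<lambda>z. of_nat (m choose \<nu>) * ((Aop ^^ \<nu>) g z * (Bop ^^ (m - \<nu>)) (wt j k) z)))"
    by (rule circle_mean_sum) (intro continuous_on_mult continuous_on_const coef_cont[OF g jk])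
  also have "\<dots> = (\<Sum>\<nu>\<le>m. coef g j k \<nu> (m - \<nu>))"
    unfolding circle_mean_cmult coef_def by (intro sum.cong refl) simp
  finally show ?thesis .
qed

lemma ring_expansion_coef:
  assumes g: "log_smooth False r0 g" and jk: "j \<le> \<kappa>" "k \<le> \<kappa>"
  shows "\<exists>C. \<forall>N\<ge>1. norm (R N (\<lambda>z. g z * wt j k z) - (\<Sum>(\<nu>, \<mu>)\<in>{(\<nu>, \<mu>). \<nu> + \<mu> \<le> m}. coef g j k \<nu> \<mu> / of_nat N ^ (\<nu> + \<mu>)))
     \<le> C / real N ^ (m + 1)"
proof -
  have "log_smooth False r0 (\<lambda>z. g z * wt j k z)"
    by (intro log_smooth_mult r0 g log_smooth_weaken[OF wt_log_smooth[OF jk]])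
  from ring_integral_expansion[OF r0 this x0, of m]
  obtain C where C: "\<And>N. N \<ge> 1 \<Longrightarrow> norm (R N (\<lambda>z. g z * wt j k z) - (\<Sum>i\<le>m. circle_mean ((Bop ^^ i) (\<lambda>z. g z * wt j k z)) / of_nat N ^ i)) \<le> C / real N ^ (m + 1)"
    by blast
  have eq: "(\<Sum>i\<le>m. circle_mean ((Bop ^^ i) (\<lambda>z. g z * wt j k z)) / of_nat N ^ i)
     = (\<Sum>(\<nu>, \<mu>)\<in>{(\<nu>, \<mu>). \<nu> + \<mu> \<le> m}. coef g j k \<nu> \<mu> / of_nat N ^ (\<nu> + \<mu>))" for N
    unfolding sum.triangle_reindex_eq Bop_mean[OF g jk] sum_divide_distrib by (intro sum.cong refl) simp
  show ?thesis
  proof (intro exI allI impI)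
    fix N :: nat assume "1 \<le> N"
    from C[OF this] show "norm (R N (\<lambda>z. g z * wt j k z) - (\<Sum>(\<nu>, \<mu>)\<in>{(\<nu>, \<mu>). \<nu> + \<mu> \<le> m}. coef g j k \<nu> \<mu> / of_nat N ^ (\<nu> + \<mu>)))
      \<le> C / real N ^ (m + 1)" unfolding eq .
  qed
qed

lemma ring_expansion_zero:
  assumes g: "log_smooth False r0 g" and jk: "j \<le> \<kappa>" "k \<le> \<kappa>"
  shows "\<exists>C\<ge>0. \<forall>N\<ge>1. norm (R N (\<lambda>z. g z * wt j k z)) \<le> C"
proof -
  have c: "continuous_on ring (\<lambda>z. g z * wt j k z)"
    by (intro continuous_on_mult cont_ring[OF g] cont_ring[OF wt_log_smooth[OF jk]])
  obtain C where "C \<ge> 0" "\<And>z. z \<in> ring \<Longrightarrow> norm (g z * wt j k z) \<le> C"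
    using continuous_on_ring_bounded[OF r0 c] by blast
  with ring_integral_bound[OF c] x0 show ?thesis by (metis less_imp_le)
qed

lemma inverse_power_le:
  assumes "N \<ge> 1" "a \<le> b"
  shows "inverse (real N ^ b) \<le> inverse (real N ^ a)"
  using assms by (intro le_imp_inverse_le power_increasing) auto

text \<open>Only the pair \<open>(0, 0)\<close> contributes at order zero, and its coefficient is
  the circle mean of \<open>\<Omega>\<close>, which is 1. This makes the norm of the approximating
  polynomial close to 1 and thereby bounds \<open>D_N\<close>.\<close>

lemma Yf_square_mean:
  "\<exists>C. \<forall>N\<ge>1. norm (R N (YY N) - 1) \<le> C / real N"
proof -
  have one: "log_smooth False r0 (\<lambda>_. 1)" by (intro log_smooth_const r0)
  have "\<forall>p\<in>{..\<kappa>} \<times> {..\<kappa>}. \<exists>C\<ge>0. \<forall>N\<ge>1. norm (R N (\<lambda>z. 1 * wt (fst p) (snd p) z)) \<le> C"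
    using ring_expansion_zero[OF one] by auto
  from bchoice[OF this] obtain C where C': "\<forall>p\<in>{..\<kappa>} \<times> {..\<kappa>}. C p \<ge> 0 \<and> (\<forall>N\<ge>1. norm (R N (\<lambda>z. 1 * wt (fst p) (snd p) z)) \<le> C p)" ..
  have C: "C (j, k) \<ge> 0" "\<And>N. N \<ge> 1 \<Longrightarrow> norm (R N (\<lambda>z. 1 * wt j k z)) \<le> C (j, k)" if "j \<le> \<kappa>" "k \<le> \<kappa>" for j k
    using bspec[OF C', of "(j, k)"] that by auto
  obtain C0 where C0: "\<And>N. N \<ge> 1 \<Longrightarrow> norm (R N (\<lambda>z. 1 * wt 0 0 z) - (\<Sum>(\<nu>, \<mu>)\<in>{(\<nu>, \<mu>). \<nu> + \<mu> \<le> 0}. coef (\<lambda>_. 1) 0 0 \<nu> \<mu> / of_nat N ^ (\<nu> + \<mu>))) \<le> C0 / real N ^ (0 + 1)"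
    using ring_expansion_coef[OF one, of 0 0 0] by blast
  have s0: "{(\<nu>::nat, \<mu>::nat). \<nu> + \<mu> \<le> 0} = {(0, 0)}" by auto
  have m0: "coef (\<lambda>_. 1) 0 0 0 0 = 1"
  proof -
    have "circle_mean (\<lambda>z. wt 0 0 z) = circle_mean (\<lambda>_. 1)"
      by (rule circle_mean_cong) (simp add: wt_def X_fun_0 \<Omega>1)
    thus ?thesis by (simp add: coef_def)
  qed
  have c0: "norm (R N (\<lambda>z. 1 * wt 0 0 z) - 1) \<le> C0 / real N" if "N \<ge> 1" for N
    using C0[OF that] by (simp add: s0 m0)
  define P where "P = ({..\<kappa>} \<times> {..\<kappa>}) - {(0::nat, 0::nat)}"
  have "norm (R N (YY N) - 1) \<le> (C0 + (\<Sum>p\<in>P. C p)) / real N" if N: "N \<ge> 1" for N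
  proof -
    have "R N (YY N) = (\<Sum>j\<le>\<kappa>. \<Sum>k\<le>\<kappa>. inverse (of_nat N ^ (j + k)) * R N (\<lambda>z. 1 * wt j k z))"
      using Yf_square_expansion[of "\<lambda>_. 1" N] by (simp add: wt_def continuous_on_const)
    also have "\<dots> = (\<Sum>(j, k)\<in>{..\<kappa>} \<times> {..\<kappa>}. inverse (of_nat N ^ (j + k)) * R N (\<lambda>z. 1 * wt j k z))"
      by (rule sum.cartesian_product)
    also have "\<dots> = R N (\<lambda>z. 1 * wt 0 0 z) + (\<Sum>(j, k)\<in>P. inverse (of_nat N ^ (j + k)) * R N (\<lambda>z. 1 * wt j k z))"
      unfolding P_def by (subst sum.remove[of _ "(0, 0)"]) auto
    finally have eq: "R N (YY N) - 1
       = (R N (\<lambda>z. 1 * wt 0 0 z) - 1) + (\<Sum>(j, k)\<in>P. inverse (of_nat N ^ (j + k)) * R N (\<lambda>z. 1 * wt j k z))" by simp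
    have "norm (\<Sum>(j, k)\<in>P. inverse (of_nat N ^ (j + k)) * R N (\<lambda>z. 1 * wt j k z)) \<le> (\<Sum>p\<in>P. C p / real N)"
    proof (rule order_trans[OF norm_sum sum_mono], clarify)
      fix j k assume "(j, k) \<in> P"
      hence jk: "j \<le> \<kappa>" "k \<le> \<kappa>" "1 \<le> j + k" by (auto simp: P_def)
      have "norm (inverse (of_nat N ^ (j + k)) * R N (\<lambda>z. 1 * wt j k z)) = inverse (real N ^ (j + k)) * norm (R N (\<lambda>z. 1 * wt j k z))"
        by (simp only: norm_mult norm_inverse norm_power norm_of_nat)
      also have "\<dots> \<le> inverse (real N ^ 1) * C (j, k)"
        by (intro mult_mono inverse_power_le[OF N jk(3)] C(2)[OF jk(1,2) N]) auto
      finally show "norm (inverse (of_nat N ^ (j + k)) * R N (\<lambda>z. 1 * wt j k z)) \<le> C (j, k) / real N"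
        by (simp add: divide_inverse mult.commute)
    qed
    hence "norm (R N (YY N) - 1) \<le> C0 / real N + (\<Sum>p\<in>P. C p / real N)"
      unfolding eq by (rule order_trans[OF norm_triangle_ineq add_mono[OF c0[OF N]]])
    thus ?thesis by (simp add: add_divide_distrib sum_divide_distrib)
  qed
  thus ?thesis by blast
qed

text \<open>Two truncations of one fourfold expansion are compared. Expanding each ring integral to
  order \<open>\<kappa>\<close> yields the index set \<open>Q\<close>, where
  \<open>\<nu> + \<mu> \<le> \<kappa>\<close>; the claimed sum runs over the subset
  \<open>Q'\<close>. The surplus consists of terms with \<open>\<nu> = 0\<close>, which vanish
  because \<open>g\<close> is zero on the circle, and of terms whose total order exceeds
  \<open>\<kappa>\<close>.\<close>

lemma Laplace_expansion:
  assumes g: "log_smooth False r0 g" and g0: "\<And>z. norm z = 1 \<Longrightarrow> g z = 0"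
  shows "\<exists>C. \<forall>N\<ge>1. norm (R N (\<lambda>z. g z * YY N z)
     - expansion g N)
     \<le> C / real N ^ (\<kappa> + 1)"
proof -
  define Tr where "Tr = {(\<nu>::nat, \<mu>::nat). \<nu> + \<mu> \<le> \<kappa>}"
  have fTr: "finite Tr" by (rule finite_subset[of _ "{..\<kappa>} \<times> {..\<kappa>}"]) (auto simp: Tr_def)
  define J where "J = {..\<kappa>} \<times> {..\<kappa>}"
  have fJ: "finite J" by (simp add: J_def)
  define Q where "Q = J \<times> Tr"
  define Q' where "Q' = {((j, k), (\<nu>, \<mu>)). 1 \<le> \<nu> \<and> \<nu> + j + k \<le> \<kappa> \<and> \<nu> + \<mu> \<le> \<kappa>}"
  have fQ: "finite Q" using fJ fTr by (simp add: Q_def)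
  have Q': "Q' \<subseteq> Q" by (auto simp: Q_def Q'_def J_def Tr_def)
  define t where "t N = (\<lambda>((j, k), (\<nu>, \<mu>)). coef g j k \<nu> \<mu> * inverse (of_nat N ^ (\<nu> + \<mu> + (j + k))) :: complex)" for N :: nat
  have "\<forall>p\<in>J. \<exists>C. \<forall>N\<ge>1. norm (R N (\<lambda>z. g z * wt (fst p) (snd p) z) - (\<Sum>(\<nu>, \<mu>)\<in>Tr. coef g (fst p) (snd p) \<nu> \<mu> / of_nat N ^ (\<nu> + \<mu>)))
     \<le> C / real N ^ (\<kappa> + 1)"
    using ring_expansion_coef[OF g, where m = \<kappa>] unfolding J_def Tr_def by auto
  from bchoice[OF this] obtain C where C': "\<forall>p\<in>J. \<forall>N\<ge>1. norm (R N (\<lambda>z. g z * wt (fst p) (snd p) z) - (\<Sum>(\<nu>, \<mu>)\<in>Tr. coef g (fst p) (snd p) \<nu> \<mu> / of_nat N ^ (\<nu> + \<mu>)))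
     \<le> C p / real N ^ (\<kappa> + 1)" ..
  have C: "\<And>p N. p \<in> J \<Longrightarrow> N \<ge> 1 \<Longrightarrow> norm (R N (\<lambda>z. g z * wt (fst p) (snd p) z) - (\<Sum>(\<nu>, \<mu>)\<in>Tr. coef g (fst p) (snd p) \<nu> \<mu> / of_nat N ^ (\<nu> + \<mu>)))
     \<le> C p / real N ^ (\<kappa> + 1)"
    using C' by (simp only: Ball_def)
  define C2 where "C2 = (\<Sum>q\<in>Q. case q of ((j, k), (\<nu>, \<mu>)) \<Rightarrow> norm (coef g j k \<nu> \<mu>))"
  \<comment> \<open>The sum over \<open>\<mu>\<close> hidden in \<open>W_op\<close> has a range
    independent of \<open>j\<close> and \<open>k\<close>. Hence \<open>Q'\<close> also contains
    terms of total order above \<open>\<kappa>\<close>; they are carried along rather than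
    discarded.\<close>
  have target: "expansion g N
     = (\<Sum>q\<in>Q'. t N q)" for N
  proof -
    have fI: "finite (I_set \<kappa>)"
      by (rule finite_subset[of _ "{..\<kappa>} \<times> {..\<kappa>} \<times> {..\<kappa>}"]) (auto simp: I_set_def)
    have "expansion g N
       = (\<Sum>i\<in>I_set \<kappa>. \<Sum>\<mu>\<in>{..\<kappa> - fst i}. t N ((fst (snd i), snd (snd i)), (fst i, \<mu>)))"
    proof (rule sum.cong[OF refl], clarify)
      fix \<nu> j k assume "(\<nu>, j, k) \<in> I_set \<kappa>"
      hence jk: "j \<le> \<kappa>" "k \<le> \<kappa>" by (auto simp: I_set_def)
      show "1 / of_nat N ^ (\<nu> + j + k) *
          op_mean g N \<nu> j k
        = (\<Sum>\<mu>\<in>{..\<kappa> - fst (\<nu>, j, k)}. t N ((fst (snd (\<nu>, j, k)), snd (snd (\<nu>, j, k))), (fst (\<nu>, j, k), \<mu>)))"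
        unfolding operator_mean[OF g jk] sum_distrib_left fst_conv snd_conv t_def prod.case
        by (intro sum.cong refl) (simp add: power_add divide_inverse mult_ac)
    qed
    also have "\<dots> = (\<Sum>(i, \<mu>)\<in>(SIGMA i:I_set \<kappa>. {..\<kappa> - fst i}). t N ((fst (snd i), snd (snd i)), (fst i, \<mu>)))"
      by (rule sum.Sigma) (use fI in auto)
    also have "\<dots> = (\<Sum>q\<in>Q'. t N q)"
      by (rule sum.reindex_bij_witness[of _ "\<lambda>((j, k), (\<nu>, \<mu>)). ((\<nu>, j, k), \<mu>)" "\<lambda>((\<nu>, j, k), \<mu>). ((j, k), (\<nu>, \<mu>))"])
         (auto simp: Q'_def I_set_def)
    finally show ?thesis .
  qed
  have "norm (R N (\<lambda>z. g z * YY N z) - (\<Sum>q\<in>Q'. t N q)) \<le> ((\<Sum>p\<in>J. C p) + C2) / real N ^ (\<kappa> + 1)"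
    if N: "N \<ge> 1" for N
  proof -
    have 1: "norm (R N (\<lambda>z. g z * YY N z) - (\<Sum>q\<in>Q. t N q)) \<le> (\<Sum>p\<in>J. C p / real N ^ (\<kappa> + 1))"
    proof -
      have "R N (\<lambda>z. g z * YY N z) = (\<Sum>(j, k)\<in>J. inverse (of_nat N ^ (j + k)) * R N (\<lambda>z. g z * wt j k z))"
        unfolding Yf_square_expansion[OF cont_ring[OF g]] wt_def J_def by (rule sum.cartesian_product)
      also have "\<dots> = (\<Sum>p\<in>J. inverse (of_nat N ^ (fst p + snd p)) * R N (\<lambda>z. g z * wt (fst p) (snd p) z))"
        by (simp add: case_prod_unfold)
      finally have e1: "R N (\<lambda>z. g z * YY N z) = \<dots>" .
      have "(\<Sum>q\<in>Q. t N q) = (\<Sum>p\<in>J. \<Sum>r\<in>Tr. t N (p, r))"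
        unfolding Q_def by (simp only: sum.cartesian_product case_prod_unfold prod.collapse)
      also have "\<dots> = (\<Sum>p\<in>J. inverse (of_nat N ^ (fst p + snd p)) * (\<Sum>(\<nu>, \<mu>)\<in>Tr. coef g (fst p) (snd p) \<nu> \<mu> / of_nat N ^ (\<nu> + \<mu>)))"
        unfolding sum_distrib_left
        by (intro sum.cong refl) (simp add: t_def case_prod_unfold power_add divide_inverse mult_ac)
      finally have e2: "(\<Sum>q\<in>Q. t N q) = \<dots>" .
      show ?thesis unfolding e1 e2 sum_subtractf[symmetric] right_diff_distrib[symmetric]
      proof (rule order_trans[OF norm_sum sum_mono])
        fix p assume p: "p \<in> J"
        let ?d = "R N (\<lambda>z. g z * wt (fst p) (snd p) z) - (\<Sum>(\<nu>, \<mu>)\<in>Tr. coef g (fst p) (snd p) \<nu> \<mu> / of_nat N ^ (\<nu> + \<mu>))"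
        have "norm (inverse (of_nat N ^ (fst p + snd p)) * ?d) = inverse (real N ^ (fst p + snd p)) * norm ?d"
          by (simp only: norm_mult norm_inverse norm_power norm_of_nat)
        also have "\<dots> \<le> inverse (real N ^ 0) * norm ?d" by (intro mult_right_mono inverse_power_le[OF N]) auto
        also have "\<dots> \<le> C p / real N ^ (\<kappa> + 1)" using C[OF p N] by simp
        finally show "norm (inverse (of_nat N ^ (fst p + snd p)) * ?d) \<le> C p / real N ^ (\<kappa> + 1)" .
      qed
    qed
    have 2: "norm (\<Sum>q\<in>Q - Q'. t N q) \<le> C2 / real N ^ (\<kappa> + 1)"
    proof -
      have tb: "norm (t N q) \<le> (case q of ((j, k), (\<nu>, \<mu>)) \<Rightarrow> norm (coef g j k \<nu> \<mu>)) / real N ^ (\<kappa> + 1)" if q: "q \<in> Q - Q'" for q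
      proof -
        obtain j k \<nu> \<mu> where q_eq: "q = ((j, k), (\<nu>, \<mu>))" by (metis prod.collapse)
        show ?thesis
        proof (cases "\<nu> = 0")
          case True
          have "circle_mean (\<lambda>z. (Aop ^^ \<nu>) g z * (Bop ^^ \<mu>) (wt j k) z) = circle_mean (\<lambda>_. 0)"
            by (rule circle_mean_cong) (simp add: True g0)
          hence "coef g j k \<nu> \<mu> = 0" by (simp add: coef_def)
          thus ?thesis by (simp add: q_eq t_def)
        next
          case False
          hence gt: "\<kappa> + 1 \<le> \<nu> + \<mu> + (j + k)" using q by (auto simp: q_eq Q_def Q'_def Tr_def)
          have "norm (t N q) = norm (coef g j k \<nu> \<mu>) * inverse (real N ^ (\<nu> + \<mu> + (j + k)))"
            unfolding q_eq t_def prod.case by (simp only: norm_mult norm_inverse norm_power norm_of_nat)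
          also have "\<dots> \<le> norm (coef g j k \<nu> \<mu>) * inverse (real N ^ (\<kappa> + 1))"
            by (intro mult_left_mono inverse_power_le[OF N gt]) auto
          finally show ?thesis by (simp only: q_eq prod.case divide_inverse)
        qed
      qed
      have "norm (\<Sum>q\<in>Q - Q'. t N q) \<le> (\<Sum>q\<in>Q - Q'. (case q of ((j, k), (\<nu>, \<mu>)) \<Rightarrow> norm (coef g j k \<nu> \<mu>)) / real N ^ (\<kappa> + 1))"
        by (rule order_trans[OF norm_sum sum_mono[OF tb]])
      also have "\<dots> \<le> (\<Sum>q\<in>Q. (case q of ((j, k), (\<nu>, \<mu>)) \<Rightarrow> norm (coef g j k \<nu> \<mu>)) / real N ^ (\<kappa> + 1))"
        by (rule sum_mono2[OF fQ]) (auto split: prod.split)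
      finally show ?thesis by (simp only: C2_def sum_divide_distrib)
    qed
    have "(\<Sum>q\<in>Q. t N q) = (\<Sum>q\<in>Q - Q'. t N q) + (\<Sum>q\<in>Q'. t N q)"
      by (rule sum.subset_diff[OF Q' fQ])
    hence "R N (\<lambda>z. g z * YY N z) - (\<Sum>q\<in>Q'. t N q)
       = (R N (\<lambda>z. g z * YY N z) - (\<Sum>q\<in>Q. t N q)) + (\<Sum>q\<in>Q - Q'. t N q)" by simp
    also have "norm \<dots> \<le> (\<Sum>p\<in>J. C p / real N ^ (\<kappa> + 1)) + C2 / real N ^ (\<kappa> + 1)"
      by (rule order_trans[OF norm_triangle_ineq add_mono[OF 1 2]])
    finally show ?thesis by (simp add: add_divide_distrib sum_divide_distrib)
  qed
  thus ?thesis unfolding target by blast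
qed

end

lemma quadratic_form_Cauchy_Schwarz:
  fixes a b c :: real
  assumes nn: "\<And>u v. 0 \<le> u\<^sup>2 * a - 2 * u * v * b + v\<^sup>2 * c"
  shows "b \<le> sqrt a * sqrt c"
proof -
  have a: "0 \<le> a" and c: "0 \<le> c" using nn[of 1 0] nn[of 0 1] by auto
  have "b\<^sup>2 \<le> a * c"
  proof (cases "a = 0")
    case True
    have "b = 0"
    proof (rule ccontr)
      assume b: "b \<noteq> 0"
      have "0 \<le> ((c + 1) / b)\<^sup>2 * a - 2 * ((c + 1) / b) * 1 * b + 1\<^sup>2 * c" by (rule nn)
      also have "\<dots> = - 2 * (c + 1) + c" using b True by simp
      finally show False using c by simp
    qed
    thus ?thesis using True by simp
  next
    case False
    have "0 \<le> b\<^sup>2 * a - 2 * b * a * b + a\<^sup>2 * c" by (rule nn)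
    also have "\<dots> = a * (a * c - b\<^sup>2)" by (simp add: power2_eq_square algebra_simps)
    finally show ?thesis using a False by (simp add: zero_le_mult_iff)
  qed
  hence "sqrt (b\<^sup>2) \<le> sqrt (a * c)" by (rule real_sqrt_le_mono)
  thus ?thesis by (simp add: real_sqrt_mult)
qed

section \<open>Weighted area integrals\<close>

text \<open>Boundedness of the weight on \<open>D\<close> makes every function continuous on the
  plane integrable against it, which covers polynomials multiplied by \<open>G\<close>.\<close>

locale weighted_domain =
  fixes D :: "complex set" and \<omega> :: "complex \<Rightarrow> real"
  assumes D: "open D" "bounded D"
    and \<omega>_nonneg: "\<And>z. z \<in> D \<Longrightarrow> 0 \<le> \<omega> z" and \<omega>_cont: "continuous_on D \<omega>" and \<omega>_bounded: "bounded (\<omega> ` D)"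
begin

definition wint :: "complex set \<Rightarrow> (complex \<Rightarrow> 'a::euclidean_space) \<Rightarrow> 'a" where
  "wint S f = (LINT z:S|lborel. \<omega> z *\<^sub>R f z) /\<^sub>R pi"

lemma w_integrable:
  fixes f :: "complex \<Rightarrow> 'a::euclidean_space"
  assumes f: "continuous_on UNIV f" and S: "S \<in> sets borel" "S \<subseteq> D"
  shows "set_integrable lborel S (\<lambda>z. \<omega> z *\<^sub>R f z)"
proof -
  have "compact (closure D)" using D(2) by (simp add: compact_closure)
  hence "bounded (f ` closure D)" by (intro compact_imp_bounded compact_continuous_image continuous_on_subset[OF f]) auto
  then obtain B where B: "\<And>z. z \<in> D \<Longrightarrow> norm (f z) \<le> B" unfolding bounded_iff using closure_subset by blast
  obtain B' where B': "\<And>z. z \<in> D \<Longrightarrow> norm (\<omega> z) \<le> B'" using \<omega>_bounded unfolding bounded_iff by blast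
  have le: "norm (indicat_real D z *\<^sub>R (\<omega> z *\<^sub>R f z)) \<le> \<bar>B'\<bar> * \<bar>B\<bar>" if z: "z \<in> D" for z
  proof -
    have "norm (\<omega> z) * norm (f z) \<le> \<bar>B'\<bar> * \<bar>B\<bar>" using B[OF z] B'[OF z] by (intro mult_mono) auto
    thus ?thesis using z by simp
  qed
  have "set_integrable lborel D (\<lambda>z. \<omega> z *\<^sub>R f z)"
  proof (unfold set_integrable_def, rule integrableI_bounded_set[where A = D and B = "\<bar>B'\<bar> * \<bar>B\<bar>"])
    show "D \<in> sets lborel" using D(1) by simp
    have cd: "continuous_on D (\<lambda>z. \<omega> z *\<^sub>R f z)"
      by (intro continuous_on_scaleR \<omega>_cont continuous_on_subset[OF f]) auto
    show "(\<lambda>z. indicat_real D z *\<^sub>R (\<omega> z *\<^sub>R f z)) \<in> borel_measurable lborel"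
      using borel_measurable_continuous_on_indicator[OF _ cd] D(1) by simp
    show "emeasure lborel D < \<infinity>" using emeasure_bounded_finite[OF D(2)] by simp
    show "AE z in lborel. z \<in> D \<longrightarrow> norm (indicat_real D z *\<^sub>R (\<omega> z *\<^sub>R f z)) \<le> \<bar>B'\<bar> * \<bar>B\<bar>" by (intro AE_I2 impI le)
    show "AE z in lborel. z \<notin> D \<longrightarrow> indicat_real D z *\<^sub>R (\<omega> z *\<^sub>R f z) = 0" by (intro AE_I2) simp
  qed
  thus ?thesis by (rule set_integrable_subset) (use S in auto)
qed

context
  fixes S :: "complex set"
  assumes S: "S \<in> sets borel" "S \<subseteq> D"
begin

lemma wint_add:
  assumes "continuous_on UNIV f" "continuous_on UNIV g"
  shows "wint S (\<lambda>z. f z + g z) = wint S f + wint S g"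
  using set_integral_add(2)[OF w_integrable[OF assms(1) S] w_integrable[OF assms(2) S]]
  by (simp add: wint_def scaleR_right_distrib)

lemma wint_diff:
  assumes "continuous_on UNIV f" "continuous_on UNIV g"
  shows "wint S (\<lambda>z. f z - g z) = wint S f - wint S g"
  using set_integral_diff(2)[OF w_integrable[OF assms(1) S] w_integrable[OF assms(2) S]]
  by (simp add: wint_def scaleR_right_diff_distrib)

lemma wint_mono:
  fixes f g :: "complex \<Rightarrow> real"
  assumes "continuous_on UNIV f" "continuous_on UNIV g" "\<And>z. z \<in> S \<Longrightarrow> f z \<le> g z"
  shows "wint S f \<le> wint S g"
  unfolding wint_def
  by (intro scaleR_left_mono set_integral_mono w_integrable assms S) (use \<omega>_nonneg S assms(3) in \<open>auto intro!: mult_left_mono\<close>)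

lemma wint_norm_le:
  fixes f :: "complex \<Rightarrow> complex"
  assumes f: "continuous_on UNIV f"
  shows "norm (wint S f) \<le> wint S (\<lambda>z. norm (f z))"
proof -
  have "norm (LINT z:S|lborel. \<omega> z *\<^sub>R f z) \<le> (LINT z:S|lborel. norm (\<omega> z *\<^sub>R f z))"
    by (rule set_integral_norm_bound[OF w_integrable[OF f S]])
  also have "\<dots> = (LINT z:S|lborel. \<omega> z *\<^sub>R norm (f z))"
    by (rule set_lebesgue_integral_cong) (use S \<omega>_nonneg in auto)
  finally show ?thesis by (simp add: wint_def divide_right_mono)
qed

lemma wint_cmult: "wint S (\<lambda>z. c * f z) = c * wint S f" for c :: complex
proof -
  have eq: "(\<lambda>z. \<omega> z *\<^sub>R (c * f z)) = (\<lambda>z. c * (\<omega> z *\<^sub>R f z))" by auto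
  show ?thesis unfolding wint_def eq set_integral_mult_right by simp
qed

lemma wint_cmult_real: "wint S (\<lambda>z. c * f z) = c * wint S f" for c :: real
proof -
  have eq: "(\<lambda>z. \<omega> z *\<^sub>R (c * f z)) = (\<lambda>z. c * (\<omega> z *\<^sub>R f z))" by auto
  show ?thesis unfolding wint_def eq set_integral_mult_right by simp
qed

lemma wint_of_real: "wint S (\<lambda>z. complex_of_real (f z)) = of_real (wint S f)"
proof -
  have eq: "(\<lambda>z. \<omega> z *\<^sub>R complex_of_real (f z)) = (\<lambda>z. complex_of_real (\<omega> z *\<^sub>R f z))" by (auto simp: scaleR_conv_of_real)
  show ?thesis unfolding wint_def eq set_integral_complex_of_real by (simp add: scaleR_conv_of_real)
qed

lemma wint_nonneg:
  fixes f :: "complex \<Rightarrow> real"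
  assumes "continuous_on UNIV f" "\<And>z. 0 \<le> f z"
  shows "0 \<le> wint S f"
  using wint_mono[OF continuous_on_const assms(1), of 0] assms(2) by (simp add: wint_def)

lemma wint_Cauchy_Schwarz:
  fixes f g :: "complex \<Rightarrow> complex"
  assumes f: "continuous_on UNIV f" and g: "continuous_on UNIV g"
  shows "norm (wint S (\<lambda>z. f z * g z)) \<le> sqrt (wint S (\<lambda>z. (norm (f z))\<^sup>2)) * sqrt (wint S (\<lambda>z. (norm (g z))\<^sup>2))"
proof -
  have c: "continuous_on UNIV (\<lambda>z. norm (f z))" "continuous_on UNIV (\<lambda>z. norm (g z))"
    "continuous_on UNIV (\<lambda>z. (norm (f z))\<^sup>2)" "continuous_on UNIV (\<lambda>z. (norm (g z))\<^sup>2)"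
    "continuous_on UNIV (\<lambda>z. norm (f z) * norm (g z))"
    by (intro continuous_intros f g)+
  have "norm (wint S (\<lambda>z. f z * g z)) \<le> wint S (\<lambda>z. norm (f z * g z))"
    by (rule wint_norm_le) (intro continuous_intros f g)
  also have "\<dots> = wint S (\<lambda>z. norm (f z) * norm (g z))" by (simp add: norm_mult)
  also have "\<dots> \<le> sqrt (wint S (\<lambda>z. (norm (f z))\<^sup>2)) * sqrt (wint S (\<lambda>z. (norm (g z))\<^sup>2))"
  proof (rule quadratic_form_Cauchy_Schwarz)
    fix u v :: real
    have k: "continuous_on UNIV (\<lambda>z. u\<^sup>2 * (norm (f z))\<^sup>2)" "continuous_on UNIV (\<lambda>z. 2 * u * v * (norm (f z) * norm (g z)))"
      "continuous_on UNIV (\<lambda>z. v\<^sup>2 * (norm (g z))\<^sup>2)"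
      by (intro continuous_on_mult continuous_on_const c)+
    have "0 \<le> wint S (\<lambda>z. (u * norm (f z) - v * norm (g z))\<^sup>2)"
      by (rule wint_nonneg) (auto intro!: continuous_intros c)
    also have "(\<lambda>z. (u * norm (f z) - v * norm (g z))\<^sup>2)
       = (\<lambda>z. (u\<^sup>2 * (norm (f z))\<^sup>2 - 2 * u * v * (norm (f z) * norm (g z))) + v\<^sup>2 * (norm (g z))\<^sup>2)"
      by (simp add: power2_eq_square algebra_simps)
    also have "wint S \<dots> = (u\<^sup>2 * wint S (\<lambda>z. (norm (f z))\<^sup>2) - 2 * u * v * wint S (\<lambda>z. norm (f z) * norm (g z))) + v\<^sup>2 * wint S (\<lambda>z. (norm (g z))\<^sup>2)"
      by (simp only: wint_add[OF continuous_on_diff[OF k(1,2)] k(3)] wint_diff[OF k(1,2)] wint_cmult_real)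
    finally show "0 \<le> u\<^sup>2 * wint S (\<lambda>z. (norm (f z))\<^sup>2) - 2 * u * v * wint S (\<lambda>z. norm (f z) * norm (g z)) + v\<^sup>2 * wint S (\<lambda>z. (norm (g z))\<^sup>2)" .
  qed
  finally show ?thesis .
qed

end

lemma wint_split:
  assumes f: "continuous_on UNIV f" and A: "A \<in> sets borel" "A \<subseteq> D"
  shows "wint D f = wint A f + wint (D - A) f"
proof -
  have DA: "D - A \<in> sets borel" using A(1) D(1) by auto
  have "(LINT z:A \<union> (D - A)|lborel. \<omega> z *\<^sub>R f z) = (LINT z:A|lborel. \<omega> z *\<^sub>R f z) + (LINT z:D - A|lborel. \<omega> z *\<^sub>R f z)"
    by (rule set_integral_Un) (use w_integrable[OF f A] w_integrable[OF f DA] in auto)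
  moreover have "A \<union> (D - A) = D" using A by auto
  ultimately show ?thesis by (simp add: wint_def scaleR_right_distrib)
qed

lemma wint_subset_le:
  fixes f :: "complex \<Rightarrow> real"
  assumes f: "continuous_on UNIV f" "\<And>z. 0 \<le> f z" and A: "A \<in> sets borel" "A \<subseteq> D"
  shows "wint A f \<le> wint D f"
  using wint_split[OF f(1) A] wint_nonneg[OF _ _ f, of "D - A"] A D(1) by auto

lemma area_integral_wint:
  "area_integral D (\<lambda>z. f z * complex_of_real (\<omega> z)) = wint D f"
proof -
  have "(\<lambda>z. f z * complex_of_real (\<omega> z)) = (\<lambda>z. \<omega> z *\<^sub>R f z)" by (auto simp: scaleR_conv_of_real mult.commute)
  thus ?thesis by (simp add: area_integral_def wint_def scaleR_conv_of_real divide_inverse mult.commute)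
qed

end

lemma real_analytic2_at_isCont:
  fixes f :: "complex \<Rightarrow> real"
  assumes "real_analytic2_at f z"
  shows "isCont f z"
proof -
  obtain fu fv d where d: "d > 0"
    "\<And>w. w \<in> ball z d \<Longrightarrow> ((\<lambda>z. complex_of_real (f z)) has_derivative (\<lambda>h. Re h *\<^sub>R fu w + Im h *\<^sub>R fv w)) (at w)"
    by (rule real_analytic2_at_derivatives[OF real_analytic2_at_of_real[OF assms]]) (rule that)
  have "isCont (\<lambda>z. complex_of_real (f z)) z"
    using has_derivative_continuous[OF d(2)[of z]] d(1) by simp
  hence "isCont (\<lambda>z. Re (complex_of_real (f z))) z" by (rule isCont_Re)
  thus ?thesis by simp
qed

text \<open>The weight is continuous on \<open>D\<close> and near the frontier, hence on an open set
  containing the compact closure, so it is bounded. Near the frontier continuity is recovered from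
  that of the logarithm by positivity.\<close>

lemma admissible_weight_domain:
  assumes D: "open D" "bounded D" and w: "admissible_weight D \<omega>"
  shows "weighted_domain D \<omega>"
proof
  from w obtain U where U: "open U" "frontier D \<subseteq> U" "\<And>z. z \<in> U \<Longrightarrow> 0 < \<omega> z \<and> real_analytic2_at (\<lambda>w. ln (\<omega> w)) z"
    and nn: "\<And>z. z \<in> D \<Longrightarrow> 0 \<le> \<omega> z" and c: "continuous_on D \<omega>"
    unfolding admissible_weight_def by blast
  show "open D" "bounded D" by (rule D)+
  show "0 \<le> \<omega> z" if "z \<in> D" for z by (rule nn[OF that])
  show "continuous_on D \<omega>" by (rule c)
  have cU: "continuous_on U \<omega>"
  proof -
    have "continuous_on U (\<lambda>w. ln (\<omega> w))"
      using real_analytic2_at_isCont U(3) by (simp add: continuous_at_imp_continuous_on)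
    hence "continuous_on U (\<lambda>w. exp (ln (\<omega> w)))" by (rule continuous_on_exp)
    thus ?thesis by (rule continuous_on_eq) (use U(3) in auto)
  qed
  have "continuous_on (D \<union> U) \<omega>" by (rule continuous_on_open_Un[OF D(1) U(1) c cU])
  moreover have "closure D \<subseteq> D \<union> U" using U(2) D(1) by (auto simp: frontier_def interior_open)
  ultimately have "bounded (\<omega> ` closure D)"
    using D(2) by (intro compact_imp_bounded compact_continuous_image) (auto intro: continuous_on_subset simp: compact_closure)
  thus "bounded (\<omega> ` D)" by (rule bounded_subset) (use closure_subset in auto)
qed

section \<open>Comparison with the orthogonal polynomials\<close>

text \<open>Here \<open>c\<close> is the derivative of \<open>\<phi>\<close> at infinity,
  \<open>\<gamma>\<close> its reciprocal and \<open>v\<close> the value of \<open>V\<close> at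
  infinity. The radius \<open>\<rho>1\<close> lies strictly between \<open>r0\<close> and the inner
  radius of the ring; the Cauchy integrals for the approximation error are taken over it.\<close>

locale orth_setting = ring_setting r0 x0 \<Omega> \<Omega>r \<kappa> + ep: exterior_param \<psi> r0 \<gamma> + wd: weighted_domain D \<omega>
  for r0 x0 \<Omega> \<Omega>r \<kappa> \<psi> \<gamma> D \<omega> +
  fixes V \<phi> :: "complex \<Rightarrow> complex" and c v \<rho>1 :: real
  assumes \<Omega>r_eq: "\<And>z. \<Omega>r z = exp (2 * Re (V (\<psi> z))) * \<omega> (\<psi> z)"
    and \<phi>: "\<phi> holomorphic_on \<psi> ` {z. r0 < norm z}" "\<And>z. r0 < norm z \<Longrightarrow> \<phi> (\<psi> z) = z" "filterlim \<phi> at_infinity at_infinity"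
    and \<psi>D: "\<psi> ` {z. 1 \<le> norm z} = - D"
    and V: "(\<lambda>z. V (\<psi> z)) holomorphic_on {z. r0 < norm z}" "((\<lambda>z. V (\<psi> z)) \<longlongrightarrow> of_real v) at_infinity"
    and c: "0 < c" "\<gamma> = inverse (of_real c)"
    and \<rho>1: "r0 < \<rho>1" "\<rho>1 < exp x0"
begin

abbreviation (input) wint :: "complex set \<Rightarrow> (complex \<Rightarrow> 'a::euclidean_space) \<Rightarrow> 'a" where "wint \<equiv> wd.wint"

lemma s0: "r0 < exp x0" "exp x0 < 1" "0 < exp x0"
  using \<rho>1 x0 by auto

text \<open>The reciprocal of \<open>N^(1/2) \<phi>' \<phi>^N e^V\<close>, expressed in the variable
  \<open>z\<close> through \<open>\<phi>' = 1 / \<psi>'\<close>. Multiplication by it turns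
  polynomials in \<open>\<psi>\<close> into functions comparable with \<open>Yf\<close>.\<close>

definition J :: "nat \<Rightarrow> complex \<Rightarrow> complex" where
  "J N z = deriv \<psi> z / (of_real (sqrt (real N)) * z ^ N * exp (V (\<psi> z)))"

text \<open>The layer of \<open>D\<close> next to its boundary; the unit circle is left out so that
  the image stays inside the open set \<open>D\<close>.\<close>

definition A :: "complex set" where "A = \<psi> ` {z. exp x0 \<le> norm z \<and> norm z < 1}"

lemma ring_dom: "z \<in> ring \<Longrightarrow> r0 < norm z"
  using s0 by (auto simp: closed_ring_def)

lemma dom_nonzero: "r0 < norm z \<Longrightarrow> z \<noteq> 0"
  using r0 by auto

lemma deriv_holomorphic: "deriv \<psi> holomorphic_on {z. r0 < norm z}"
  by (rule holomorphic_deriv[OF ep.hol open_norm_gt])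

lemma J_holomorphic: "N \<ge> 1 \<Longrightarrow> J N holomorphic_on {z. r0 < norm z}"
  unfolding J_def[abs_def] by (intro holomorphic_intros deriv_holomorphic V) (use dom_nonzero in auto)

lemma continuous_dom: "f holomorphic_on {z. r0 < norm z} \<Longrightarrow> K \<subseteq> {z. r0 < norm z} \<Longrightarrow> continuous_on K f"
  using holomorphic_on_imp_continuous_on holomorphic_on_subset by blast

lemma continuous_ring: "f holomorphic_on {z. r0 < norm z} \<Longrightarrow> continuous_on ring f"
  using continuous_dom[of f "ring"] ring_dom by auto

lemma \<psi>_ring: "continuous_on ring \<psi>"
  by (rule continuous_ring[OF ep.hol])

lemma A_subset: "A \<subseteq> D"
proof
  fix z assume "z \<in> A"
  then obtain w where w: "exp x0 \<le> norm w" "norm w < 1" "z = \<psi> w" by (auto simp: A_def)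
  show "z \<in> D"
  proof (rule ccontr)
    assume "z \<notin> D"
    hence "z \<in> \<psi> ` {z. 1 \<le> norm z}" by (simp add: \<psi>D)
    then obtain w' where w': "1 \<le> norm w'" "z = \<psi> w'" by auto
    have "w = w'" by (rule inj_onD[OF ep.inj]) (use w w' s0 r0 in auto)
    thus False using w w' by simp
  qed
qed

lemma A_borel: "A \<in> sets borel"
proof -
  have "A = \<psi> ` ring \<inter> D"
  proof
    show "A \<subseteq> \<psi> ` ring \<inter> D" using A_subset by (auto simp: A_def closed_ring_def)
    show "\<psi> ` ring \<inter> D \<subseteq> A"
    proof
      fix z assume z: "z \<in> \<psi> ` ring \<inter> D"
      then obtain w where w: "w \<in> ring" "z = \<psi> w" by blast
      have "\<not> 1 \<le> norm w" using z w(2) \<psi>D by auto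
      thus "z \<in> A" using w by (auto simp: A_def closed_ring_def)
    qed
  qed
  moreover have "compact (\<psi> ` ring)" by (rule compact_continuous_image[OF \<psi>_ring compact_closed_ring[OF r0]])
  hence "\<psi> ` ring \<in> sets borel" by (simp add: borel_closed compact_imp_closed)
  ultimately show ?thesis using wd.D(1) by auto
qed

lemma DA_borel: "D - A \<in> sets borel" "D - A \<subseteq> D" and D_borel: "D \<in> sets borel" "D \<subseteq> D"
  using A_borel wd.D(1) by auto

lemma DA_inner: "z \<in> D - A \<Longrightarrow> z \<notin> \<psi> ` {w. exp x0 \<le> norm w}"
proof
  assume z: "z \<in> D - A" and "z \<in> \<psi> ` {w. exp x0 \<le> norm w}"
  then obtain w where w: "exp x0 \<le> norm w" "z = \<psi> w" by blast
  show False
  proof (cases "norm w < 1")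
    case True thus False using w z by (auto simp: A_def)
  next
    case False
    hence "z \<in> \<psi> ` {z. 1 \<le> norm z}" using w(2) by auto
    thus False using z unfolding \<psi>D by simp
  qed
qed

lemma J_norm:
  assumes "N \<ge> 1" "r0 < norm z"
  shows "J N z * cnj (J N z) * \<Omega> z = of_real ((norm (deriv \<psi> z))\<^sup>2 * \<omega> (\<psi> z) / (real N * norm z ^ (2 * N)))"
proof -
  have z0: "norm z > 0" using assms(2) r0 by auto
  have "(norm (J N z))\<^sup>2 = (norm (deriv \<psi> z))\<^sup>2 / (real N * (norm z ^ N)\<^sup>2 * (exp (Re (V (\<psi> z))))\<^sup>2)"
    using assms(1) by (simp add: J_def norm_divide norm_mult norm_power power_divide power_mult_distrib)
  also have "(norm z ^ N)\<^sup>2 = norm z ^ (2 * N)" by (simp add: power_mult[symmetric] mult.commute)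
  also have "(exp (Re (V (\<psi> z))))\<^sup>2 = exp (2 * Re (V (\<psi> z)))" by (simp add: exp_double)
  finally have 1: "(norm (J N z))\<^sup>2 = (norm (deriv \<psi> z))\<^sup>2 / (real N * norm z ^ (2 * N) * exp (2 * Re (V (\<psi> z))))" .
  have "J N z * cnj (J N z) * \<Omega> z = of_real ((norm (J N z))\<^sup>2 * \<Omega>r z)"
    unfolding \<Omega>r(1) by (simp only: complex_norm_square of_real_mult)
  also have "(norm (J N z))\<^sup>2 * \<Omega>r z = (norm (deriv \<psi> z))\<^sup>2 * \<omega> (\<psi> z) / (real N * norm z ^ (2 * N))"
    unfolding 1 \<Omega>r_eq using z0 assms(1) by (simp add: field_simps)
  finally show ?thesis .
qed

text \<open>In the product of the ring weight with \<open>|J|^2 \<Omega>\<close> the factors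
  \<open>N |z|^(2 N)\<close> cancel, and what remains is \<open>\<omega>\<close> composed with
  \<open>\<psi>\<close> times the Jacobian of \<open>\<psi>\<close>. The composition with
  \<open>exp\<close> accounts for the remaining \<open>exp (2 x)\<close>.\<close>

lemma change_of_variables:
  assumes f: "continuous_on UNIV (f :: complex \<Rightarrow> complex)" and N: "N \<ge> 1"
  shows "wint A f = R N (\<lambda>z. f (\<psi> z) * (J N z * cnj (J N z) * \<Omega> z))"
proof -
  define K where "K = (\<lambda>z. f (\<psi> z) * (J N z * cnj (J N z) * \<Omega> z))"
  have cK: "continuous_on ring K" unfolding K_def
    by (intro continuous_on_mult continuous_on_cnj continuous_ring[OF J_holomorphic[OF N]] cont_ring[OF \<Omega>]
          continuous_on_compose2[OF f \<psi>_ring]) auto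
  define F where "F = (\<lambda>p. real N *\<^sub>R (case p of (x, t) \<Rightarrow> exp (2 * (real N + 1) * x) *\<^sub>R K (polar x t)))"
  have cF: "continuous_on (cbox (x0, 0) (0, 2 * pi)) F" unfolding F_def
    by (intro continuous_on_scaleR continuous_on_const continuous_on_ring_integrand[OF cK])
  define g where "g = (\<lambda>\<xi>. \<psi> (exp \<xi>))"
  define g' where "g' = (\<lambda>\<xi>. deriv \<psi> (exp \<xi>) * exp \<xi>)"
  let ?S = "{\<xi>. x0 \<le> Re \<xi> \<and> Re \<xi> < 0 \<and> 0 \<le> Im \<xi> \<and> Im \<xi> < 2 * pi}"
  have dom: "r0 < norm (exp \<xi>)" if "\<xi> \<in> ?S" for \<xi> :: complex
  proof -
    have "exp x0 \<le> exp (Re \<xi>)" using that by simp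
    thus ?thesis using s0(1) by (simp only: norm_exp_eq_Re)
  qed
  have gS: "g ` ?S = A"
  proof
    show "g ` ?S \<subseteq> A" by (auto simp: g_def A_def norm_exp_eq_Re)
    show "A \<subseteq> g ` ?S"
    proof
      fix z assume "z \<in> A"
      then obtain w where w: "exp x0 \<le> norm w" "norm w < 1" "z = \<psi> w" by (auto simp: A_def)
      have w0: "norm w > 0" using w(1) s0(3) by linarith
      define \<xi> where "\<xi> = Complex (ln (norm w)) (Arg2pi w)"
      have "exp \<xi> = of_real (exp (ln (norm w))) * exp (\<i> * of_real (Arg2pi w))"
        unfolding \<xi>_def Complex_eq exp_add exp_of_real ..
      also have "exp (ln (norm w)) = norm w" using w0 by (rule exp_ln)
      also have "of_real (norm w) * exp (\<i> * of_real (Arg2pi w)) = w" by (rule Arg2pi_eq[symmetric])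
      finally have "exp \<xi> = w" .
      moreover have "\<xi> \<in> ?S" using w w0 Arg2pi[of w] by (auto simp: \<xi>_def ln_ge_iff)
      ultimately show "z \<in> g ` ?S" using w(3) unfolding g_def by blast
    qed
  qed
  have HK: "((\<lambda>z. \<omega> z *\<^sub>R f z) has_integral integral (cbox (x0, 0) (0, 2 * pi)) F) (g ` ?S)"
  proof (rule integral_change_of_variables_box[where g' = g'])
    show "(g has_field_derivative g' \<xi>) (at \<xi>)" if "\<xi> \<in> ?S" for \<xi>
      unfolding g_def g'_def
      by (rule DERIV_chain2[OF holomorphic_derivI[OF ep.hol open_norm_gt] DERIV_exp]) (use dom[OF that] in simp)
    show "inj_on g ?S"
    proof (rule inj_onI)
      fix x y :: complex assume x: "x \<in> ?S" and y: "y \<in> ?S" and eq: "g x = g y"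
      have e: "exp x = exp y" by (rule inj_onD[OF ep.inj]) (use eq dom[OF x] dom[OF y] in \<open>auto simp: g_def\<close>)
      hence "norm (exp x) = norm (exp y)" by simp
      hence "Re x = Re y" by (simp add: norm_exp_eq_Re)
      moreover have "Im x = Im y" using Arg2pi_exp[of x] Arg2pi_exp[of y] x y e by auto
      ultimately show "x = y" by (simp add: complex_eq_iff)
    qed
    show "bounded (g ` ?S)" unfolding gS by (rule bounded_subset[OF wd.D(2) A_subset])
    show "continuous_on (cbox (x0, 0) (0, 2 * pi)) F" by (rule cF)
    fix \<xi> assume \<xi>: "\<xi> \<in> ?S"
    have pol: "polar (Re \<xi>) (Im \<xi>) = exp \<xi>" by (simp add: polar_def exp_eq_polar exp_of_real)
    have n: "norm (exp \<xi>) = exp (Re \<xi>)" by (rule norm_exp_eq_Re)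
    have N0: "real N > 0" using N by simp
    have e2: "exp (2 * (real N + 1) * Re \<xi>) = exp (Re \<xi>) ^ (2 * N) * (exp (Re \<xi>))\<^sup>2"
      by (simp add: exp_of_nat_mult[symmetric] exp_add[symmetric] power2_eq_square algebra_simps)
    have alg: "n * (p * q * (d * w / (n * p))) = (d * q) * w" if "n > 0" "p > 0" for n p q d w :: real
      using that by simp
    have e0: "exp (Re \<xi>) ^ (2 * N) > 0" by simp
    have "F (Re \<xi>, Im \<xi>) = f (g \<xi>) * of_real (real N * (exp (Re \<xi>) ^ (2 * N) * (exp (Re \<xi>))\<^sup>2 * ((norm (deriv \<psi> (exp \<xi>)))\<^sup>2 * \<omega> (\<psi> (exp \<xi>)) / (real N * exp (Re \<xi>) ^ (2 * N)))))"
      unfolding F_def prod.case pol K_def J_norm[OF N dom[OF \<xi>]] n e2 g_def by (simp only: scaleR_conv_of_real of_real_mult mult_ac)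
    also have "\<dots> = (norm (g' \<xi>))\<^sup>2 *\<^sub>R (\<omega> (g \<xi>) *\<^sub>R f (g \<xi>))"
      unfolding alg[OF N0 e0] g'_def norm_mult n power_mult_distrib g_def scaleR_conv_of_real of_real_mult by (simp only: mult_ac)
    finally show "F (Re \<xi>, Im \<xi>) = (norm (g' \<xi>))\<^sup>2 *\<^sub>R (\<omega> (g \<xi>) *\<^sub>R f (g \<xi>))" .
  qed
  have "(LINT z:A|lborel. \<omega> z *\<^sub>R f z) = integral A (\<lambda>z. \<omega> z *\<^sub>R f z)"
    by (rule set_borel_integral_eq_integral(2)[OF wd.w_integrable[OF f A_borel A_subset]])
  also have "\<dots> = integral (cbox (x0, 0) (0, 2 * pi)) F"
    using HK unfolding gS by (rule integral_unique)
  also have "\<dots> = pi *\<^sub>R R N K"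
    unfolding F_def ring_integral_def by (simp add: integral_cmul)
  finally show ?thesis by (simp add: wd.wint_def K_def[symmetric])
qed

text \<open>One number bounding the weight and its reciprocal on the ring, fixed by choice so that
  the constants of later lemmas can refer to it.\<close>

definition \<Omega>B where "\<Omega>B = (SOME B. 0 \<le> B \<and> (\<forall>z\<in>ring. \<Omega>r z \<le> B \<and> inverse (\<Omega>r z) \<le> B))"

lemma \<Omega>B: "0 \<le> \<Omega>B" "\<And>z. z \<in> ring \<Longrightarrow> \<Omega>r z \<le> \<Omega>B" "\<And>z. z \<in> ring \<Longrightarrow> inverse (\<Omega>r z) \<le> \<Omega>B"
proof -
  obtain B1 where B1: "B1 \<ge> 0" "\<And>z. z \<in> ring \<Longrightarrow> norm (\<Omega> z) \<le> B1"
    using continuous_on_ring_bounded[OF r0 cont_ring[OF \<Omega>]] by blast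
  obtain B2 where B2: "B2 \<ge> 0" "\<And>z. z \<in> ring \<Longrightarrow> norm (inverse (\<Omega> z)) \<le> B2"
    using continuous_on_ring_bounded[OF r0 cont_ring[OF \<Omega>_inv]] by blast
  have "\<Omega>r z \<le> B1 + B2 \<and> inverse (\<Omega>r z) \<le> B1 + B2" if z: "z \<in> ring" for z
  proof -
    have p: "\<Omega>r z > 0" using \<Omega>r(2) ring_annulus z by auto
    have "norm (\<Omega> z) = \<Omega>r z" "norm (inverse (\<Omega> z)) = inverse (\<Omega>r z)"
      using p by (simp_all add: \<Omega>r(1) norm_inverse del: of_real_inverse)
    thus ?thesis using B1(1) B2(1) B1(2)[OF z] B2(2)[OF z] by linarith
  qed
  hence "\<exists>B. 0 \<le> B \<and> (\<forall>z\<in>ring. \<Omega>r z \<le> B \<and> inverse (\<Omega>r z) \<le> B)"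
    using B1(1) B2(1) by (intro exI[of _ "B1 + B2"]) auto
  from someI_ex[OF this] show "0 \<le> \<Omega>B" "\<And>z. z \<in> ring \<Longrightarrow> \<Omega>r z \<le> \<Omega>B" "\<And>z. z \<in> ring \<Longrightarrow> inverse (\<Omega>r z) \<le> \<Omega>B"
    unfolding \<Omega>B_def by auto
qed

lemma ring_\<Omega>_pos: "z \<in> ring \<Longrightarrow> 0 < \<Omega>r z"
  using \<Omega>r(2) ring_annulus by auto

lemma norm_\<Omega>_le: "z \<in> ring \<Longrightarrow> norm (\<Omega> z) \<le> \<Omega>B"
  using \<Omega>B(2) ring_\<Omega>_pos by (simp add: \<Omega>r(1) less_imp_le)

text \<open>On the ring \<open>\<Omega>\<close> is bounded away from zero, so omitting it costs the
  constant \<open>\<Omega>B\<close>. This converts the ring norm in the orthogonality estimate into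
  the norm of the weighted space on \<open>D\<close>.\<close>

lemma pullback_norm:
  assumes N: "N \<ge> 1" and p: "continuous_on UNIV p"
  shows "R N (\<lambda>z. (norm (p (\<psi> z) * J N z))\<^sup>2) \<le> \<Omega>B * wint D (\<lambda>z. (norm (p z))\<^sup>2)"
proof -
  define h where "h = (\<lambda>z. p (\<psi> z) * J N z)"
  have ch: "continuous_on ring h" unfolding h_def
    by (intro continuous_on_mult continuous_ring[OF J_holomorphic[OF N]] continuous_on_compose2[OF p \<psi>_ring]) auto
  have c\<Omega>: "continuous_on ring \<Omega>r"
  proof -
    have "continuous_on ring (\<lambda>z. Re (\<Omega> z))" by (intro continuous_on_Re cont_ring[OF \<Omega>])
    thus ?thesis by (simp add: \<Omega>r(1))
  qed
  have c1: "continuous_on ring (\<lambda>z. (norm (h z))\<^sup>2)" "continuous_on ring (\<lambda>z. (norm (h z))\<^sup>2 * \<Omega>r z)"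
    by (intro continuous_intros ch c\<Omega>)+
  have cp: "continuous_on UNIV (\<lambda>z. (norm (p z))\<^sup>2)" by (intro continuous_intros p)
  have "complex_of_real (wint A (\<lambda>z. (norm (p z))\<^sup>2)) = wint A (\<lambda>z. complex_of_real ((norm (p z))\<^sup>2))"
    by (rule wd.wint_of_real[OF A_borel A_subset, symmetric])
  also have "\<dots> = R N (\<lambda>z. complex_of_real ((norm (p (\<psi> z)))\<^sup>2) * (J N z * cnj (J N z) * \<Omega> z))"
    by (rule change_of_variables[OF continuous_on_of_real[OF cp] N])
  also have "\<dots> = R N (\<lambda>z. complex_of_real ((norm (h z))\<^sup>2 * \<Omega>r z))"
    by (rule ring_integral_cong)
       (simp only: h_def norm_mult power_mult_distrib of_real_mult complex_norm_square \<Omega>r(1) mult_ac)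
  also have "\<dots> = of_real (R N (\<lambda>z. (norm (h z))\<^sup>2 * \<Omega>r z))" by (rule ring_integral_of_real[OF c1(2)])
  finally have eq: "wint A (\<lambda>z. (norm (p z))\<^sup>2) = R N (\<lambda>z. (norm (h z))\<^sup>2 * \<Omega>r z)" by (simp only: of_real_eq_iff)
  have "R N (\<lambda>z. (norm (h z))\<^sup>2) \<le> R N (\<lambda>z. \<Omega>B * ((norm (h z))\<^sup>2 * \<Omega>r z))"
  proof (rule ring_integral_mono[OF c1(1) continuous_on_mult[OF continuous_on_const c1(2)]])
    fix z assume z: "z \<in> ring"
    have "1 \<le> \<Omega>B * \<Omega>r z" using \<Omega>B(3)[OF z] ring_\<Omega>_pos[OF z] by (simp add: inverse_eq_divide pos_divide_le_eq)
    hence "(norm (h z))\<^sup>2 * 1 \<le> (norm (h z))\<^sup>2 * (\<Omega>B * \<Omega>r z)" by (intro mult_left_mono) auto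
    thus "(norm (h z))\<^sup>2 \<le> \<Omega>B * ((norm (h z))\<^sup>2 * \<Omega>r z)" by (simp only: mult_ac mult_1)
  qed
  also have "\<dots> = \<Omega>B * wint A (\<lambda>z. (norm (p z))\<^sup>2)" unfolding eq by (rule ring_integral_cmult)
  also have "\<dots> \<le> \<Omega>B * wint D (\<lambda>z. (norm (p z))\<^sup>2)"
    by (intro mult_left_mono \<Omega>B wd.wint_subset_le[OF cp _ A_borel A_subset]) simp
  finally show ?thesis by (simp only: h_def)
qed

text \<open>\<open>J\<close> decays like \<open>z^(-N)\<close> while \<open>\<psi>\<close> grows
  linearly, so a degree below \<open>N\<close> leaves decay at infinity. Pulled-back polynomials are
  thus admissible test functions for the orthogonality estimate.\<close>

lemma pullback_poly:
  assumes N: "N \<ge> 1" and p: "degree p < N"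
  shows "(\<lambda>z. poly p (\<psi> z) * J N z) holomorphic_on {z. r0 < norm z}"
    and "((\<lambda>z. poly p (\<psi> z) * J N z) \<longlongrightarrow> 0) at_infinity"
proof -
  show "(\<lambda>z. poly p (\<psi> z) * J N z) holomorphic_on {z. r0 < norm z}"
    by (intro holomorphic_on_mult J_holomorphic[OF N] holomorphic_on_compose_gen[OF ep.hol, of _ UNIV, unfolded o_def])
       (auto intro!: holomorphic_intros)
  have inv0: "((\<lambda>z::complex. inverse z) \<longlongrightarrow> 0) at_infinity" by (rule tendsto_inverse_0)
  have mon: "((\<lambda>z. \<psi> z ^ i / z ^ N) \<longlongrightarrow> 0) at_infinity" if i: "i < N" for i
  proof -
    have "((\<lambda>z. (\<psi> z / z) ^ i * inverse z ^ (N - i)) \<longlongrightarrow> \<gamma> ^ i * 0 ^ (N - i)) at_infinity"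
      by (intro tendsto_intros ep.lim inv0)
    moreover have "\<forall>\<^sub>F z in at_infinity. (\<psi> z / z) ^ i * inverse z ^ (N - i) = \<psi> z ^ i / z ^ N"
      unfolding eventually_at_infinity
    proof (intro exI allI impI)
      fix z :: complex assume "1 \<le> norm z"
      hence z: "z \<noteq> 0" by auto
      have "z ^ N = z ^ i * z ^ (N - i)" using i by (simp add: power_add[symmetric])
      thus "(\<psi> z / z) ^ i * inverse z ^ (N - i) = \<psi> z ^ i / z ^ N"
        using z by (simp add: divide_inverse power_inverse power_mult_distrib)
    qed
    ultimately show ?thesis using i by (simp add: tendsto_cong zero_power)
  qed
  have "((\<lambda>z. (\<Sum>i\<le>degree p. coeff p i * (\<psi> z ^ i / z ^ N)) * (deriv \<psi> z / (of_real (sqrt (real N)) * exp (V (\<psi> z)))))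
      \<longlongrightarrow> (\<Sum>i\<le>degree p. coeff p i * 0) * (\<gamma> / (of_real (sqrt (real N)) * exp (of_real v)))) at_infinity"
    by (intro tendsto_intros mon deriv_tendsto_at_infinity[OF ep.hol ep.lim] V(2) tendsto_compose[OF isCont_tendsto_compose])
       (use N p in auto)
  moreover have "(\<Sum>i\<le>degree p. coeff p i * (\<psi> z ^ i / z ^ N)) * (deriv \<psi> z / (of_real (sqrt (real N)) * exp (V (\<psi> z)))) = poly p (\<psi> z) * J N z" for z
    by (simp add: poly_altdef J_def sum_divide_distrib[symmetric] times_divide_eq_right)
  ultimately show "((\<lambda>z. poly p (\<psi> z) * J N z) \<longlongrightarrow> 0) at_infinity" by simp
qed

lemma Yf_bounded_compact:
  assumes "compact K" "K \<subseteq> {z. r0 < norm z}"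
  shows "\<exists>B\<ge>0. \<forall>N\<ge>1. \<forall>z\<in>K. norm (Yf N z) \<le> B"
  unfolding Yf_def by (rule family_bounded[OF assms(1)]) (rule continuous_dom[OF X_holomorphic assms(2)])

text \<open>The region enclosed by the ring is bounded and its frontier lies on the image of the
  inner circle, because the image of \<open>norm w > exp x0\<close> is open; the maximum principle
  applies.\<close>

lemma inner_maximum:
  assumes b: "\<And>w. norm w = exp x0 \<Longrightarrow> norm (poly q (\<psi> w)) \<le> B" and z: "z \<in> D - A"
  shows "norm (poly q z) \<le> B"
proof (rule maximum_modulus_frontier[of "poly q" "- \<psi> ` {w. exp x0 \<le> norm w}"])
  let ?T = "\<psi> ` {w. exp x0 \<le> norm w}"
  have T: "?T = \<psi> ` ring \<union> - D"
    unfolding \<psi>D[symmetric] image_Un[symmetric] by (rule arg_cong[of _ _ "image \<psi>"]) (auto simp: closed_ring_def intro: order_trans[OF less_imp_le[OF s0(2)]])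
  have "closed ?T"
    unfolding T using compact_imp_closed[OF compact_continuous_image[OF \<psi>_ring compact_closed_ring[OF r0]]] wd.D(1)
    by (intro closed_Un) (auto simp: closed_def)
  have op: "open (\<psi> ` {w. exp x0 < norm w})"
    by (rule open_mapping_thm3[OF holomorphic_on_subset[OF ep.hol] open_norm_gt inj_on_subset[OF ep.inj]]) (use s0 in auto)
  have "\<psi> ` {w. exp x0 < norm w} \<subseteq> ?T" by auto
  hence int: "\<psi> ` {w. exp x0 < norm w} \<subseteq> interior ?T" using op by (rule interior_maximal)
  show "poly q holomorphic_on interior (- ?T)" by (auto intro!: holomorphic_intros)
  show "continuous_on (closure (- ?T)) (poly q)" by (intro continuous_intros)
  show "bounded (- ?T)" by (rule bounded_subset[OF wd.D(2)]) (auto simp: T)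
  fix z assume "z \<in> frontier (- ?T)"
  hence "z \<in> frontier ?T" by (simp add: frontier_complement)
  hence "z \<in> ?T" "z \<notin> interior ?T" using \<open>closed ?T\<close> by (auto simp: frontier_def)
  then obtain w where "exp x0 \<le> norm w" "z = \<psi> w" "\<not> exp x0 < norm w" using int by blast
  thus "norm (poly q z) \<le> B" using b by simp
next
  show "z \<in> - \<psi> ` {w. exp x0 \<le> norm w}" using DA_inner[OF z] by simp
qed

section \<open>Polynomial approximation of the asymptotic profile\<close>

text \<open>This is \<open>N^(1/2) / C_N\<close>, so the leading coefficient of \<open>P_N\<close>
  is \<open>D_N\<close> times it.\<close>

definition lead :: "nat \<Rightarrow> real" where "lead N = sqrt (real N) * c ^ (N + 1) * exp v"

text \<open>Two bounds of different nature: near the boundary the polynomial is compared with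
  \<open>Yf\<close>, whereas in the interior there is no profile to compare with and the polynomial
  itself has to be small.\<close>

definition approx_poly :: "real \<Rightarrow> real \<Rightarrow> nat \<Rightarrow> complex poly \<Rightarrow> bool" where
  "approx_poly a b N q \<longleftrightarrow> degree q \<le> N \<and> coeff q N = of_real (lead N) \<and>
      (\<forall>z\<in>ring. norm (poly q (\<psi> z) * J N z - Yf N z) \<le> a) \<and> (\<forall>z\<in>D - A. norm (poly q z) \<le> b)"

text \<open>The error is a Cauchy integral over radius \<open>\<rho>1\<close>, where
  \<open>F\<close> has size \<open>N^(1/2) \<rho>1^N\<close>; on the ring \<open>J\<close> is at
  most of order \<open>N^(-1/2) (exp x0)^(-N)\<close>. The product is geometrically small because
  \<open>\<rho>1 < exp x0\<close>. In the interior the polynomial is bounded by its values on the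
  inner circle.\<close>

lemma quasi_polynomial:
  "\<exists>C\<ge>0. \<forall>N\<ge>1. \<exists>q. approx_poly (C * (\<rho>1 / exp x0) ^ N) (C * (sqrt (real N) * exp x0 ^ N)) N q"
proof -
  have \<rho>10: "\<rho>1 > 0" using \<rho>1 r0 by simp
  have sph: "sphere 0 \<rho>1 \<subseteq> {z. r0 < norm z}" using \<rho>1 by auto
  have cr: "ring \<subseteq> {z. r0 < norm z}" using ring_dom by auto
  have crc: "compact ring" by (rule compact_closed_ring[OF r0])
  obtain BY where BY: "BY \<ge> 0" "\<And>N z. N \<ge> 1 \<Longrightarrow> z \<in> sphere 0 \<rho>1 \<Longrightarrow> norm (Yf N z) \<le> BY"
    using Yf_bounded_compact[OF compact_sphere sph] by blast
  obtain BY' where BY': "BY' \<ge> 0" "\<And>N z. N \<ge> 1 \<Longrightarrow> z \<in> ring \<Longrightarrow> norm (Yf N z) \<le> BY'"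
    using Yf_bounded_compact[OF crc cr] by blast
  have hE: "(\<lambda>z. exp (V (\<psi> z))) holomorphic_on {z. r0 < norm z}" by (intro holomorphic_intros V)
  have hJ: "(\<lambda>z. deriv \<psi> z / exp (V (\<psi> z))) holomorphic_on {z. r0 < norm z}"
    by (intro holomorphic_intros deriv_holomorphic V) auto
  have hi: "(\<lambda>z. exp (V (\<psi> z)) / deriv \<psi> z) holomorphic_on {z. r0 < norm z}"
    by (intro holomorphic_intros deriv_holomorphic V) (use ep.deriv_nonzero in auto)
  have bnd: "\<exists>B\<ge>0. \<forall>z\<in>K. norm (h z) \<le> B" if "h holomorphic_on {z. r0 < norm z}" "compact K" "K \<subseteq> {z. r0 < norm z}"
    for h :: "complex \<Rightarrow> complex" and K
  proof -
    have "bounded (h ` K)" by (intro compact_imp_bounded compact_continuous_image continuous_dom[OF that(1,3)] that(2))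
    then obtain B where "\<forall>z\<in>K. norm (h z) \<le> B" unfolding bounded_iff by auto
    thus ?thesis by (intro exI[of _ "\<bar>B\<bar>"]) (auto intro: order_trans[OF _ abs_ge_self])
  qed
  obtain BE where BE: "BE \<ge> 0" "\<And>z. z \<in> sphere 0 \<rho>1 \<Longrightarrow> norm (exp (V (\<psi> z))) \<le> BE" using bnd[OF hE compact_sphere sph] by blast
  obtain BJ where BJ: "BJ \<ge> 0" "\<And>z. z \<in> ring \<Longrightarrow> norm (deriv \<psi> z / exp (V (\<psi> z))) \<le> BJ" using bnd[OF hJ crc cr] by blast
  obtain Bi where Bi: "Bi \<ge> 0" "\<And>z. z \<in> ring \<Longrightarrow> norm (exp (V (\<psi> z)) / deriv \<psi> z) \<le> Bi" using bnd[OF hi crc cr] by blast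
  \<comment> \<open>Injectivity keeps the images of the small circle and of the ring disjoint; by
    compactness they are at positive distance, which bounds the kernel uniformly.\<close>
  obtain \<delta> where \<delta>: "\<delta> > 0" "\<And>\<eta> z. \<eta> \<in> sphere 0 \<rho>1 \<Longrightarrow> z \<in> ring \<Longrightarrow> \<delta> \<le> dist (\<psi> \<eta>) (\<psi> z)"
  proof -
    have k: "compact (\<psi> ` sphere 0 \<rho>1)" "compact (\<psi> ` ring)"
      by (rule compact_continuous_image[OF continuous_dom[OF ep.hol sph] compact_sphere]) (rule compact_continuous_image[OF \<psi>_ring crc])
    have disj: "\<psi> ` sphere 0 \<rho>1 \<inter> \<psi> ` ring = {}"
    proof -
      have "\<psi> ` sphere 0 \<rho>1 \<inter> \<psi> ` ring = \<psi> ` (sphere 0 \<rho>1 \<inter> ring)"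
        by (rule inj_on_image_Int[OF ep.inj sph cr, symmetric])
      moreover have "sphere 0 \<rho>1 \<inter> ring = {}" using \<rho>1 by (auto simp: closed_ring_def)
      ultimately show ?thesis by simp
    qed
    have "\<exists>d>0. \<forall>x\<in>\<psi> ` sphere 0 \<rho>1. \<forall>y\<in>\<psi> ` ring. d \<le> dist x y"
      by (rule separate_compact_closed[OF k(1) compact_imp_closed[OF k(2)] disj])
    thus thesis using that by blast
  qed
  define B2 where "B2 = BE * BY / \<delta> * \<rho>1"
  have B20: "B2 \<ge> 0" using BE BY \<delta> \<rho>10 by (simp add: B2_def)
  define C where "C = BJ * B2 + (Bi * BY' + B2)"
  have "\<exists>q. approx_poly (C * (\<rho>1 / exp x0) ^ N) (C * (sqrt (real N) * exp x0 ^ N)) N q" if N: "N \<ge> 1" for N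
  proof -
    define sN where "sN = sqrt (real N)"
    have sN: "sN > 0" using N by (simp add: sN_def)
    \<comment> \<open>The profile \<open>N^(1/2) \<phi>' \<phi>^N e^V Y(\<phi>)\<close> in the
      variable \<open>z\<close>; it is \<open>Yf N\<close> divided by \<open>J N\<close>.\<close>
    define F where "F = (\<lambda>z. of_real sN * z ^ N * exp (V (\<psi> z)) * Yf N z / deriv \<psi> z)"
    have Fh: "F holomorphic_on {z. r0 < norm z}" unfolding F_def
      by (intro holomorphic_intros V Yf_holomorphic deriv_holomorphic) (use ep.deriv_nonzero in auto)
    have Fl: "((\<lambda>z. F z / \<psi> z ^ N) \<longlongrightarrow> of_real (lead N)) at_infinity"
    proof -
      have g: "inverse \<gamma> = of_real c" "\<gamma> \<noteq> 0" using c by simp_all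
      have "((\<lambda>z. of_real sN * inverse (\<psi> z / z) ^ N * exp (V (\<psi> z)) * Yf N z / deriv \<psi> z)
          \<longlongrightarrow> of_real sN * inverse \<gamma> ^ N * exp (of_real v) * 1 / \<gamma>) at_infinity"
        by (intro tendsto_intros ep.lim V(2) Yf_tendsto deriv_tendsto_at_infinity[OF ep.hol ep.lim] g)
      also have "of_real sN * inverse \<gamma> ^ N * exp (of_real v) * 1 / \<gamma> = of_real (lead N)"
        unfolding g divide_inverse by (simp add: lead_def sN_def exp_of_real)
      also have "(\<lambda>z. of_real sN * inverse (\<psi> z / z) ^ N * exp (V (\<psi> z)) * Yf N z / deriv \<psi> z) = (\<lambda>z. F z / \<psi> z ^ N)"
        by (auto simp: F_def power_divide divide_inverse power_inverse power_mult_distrib mult_ac)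
      finally show ?thesis .
    qed
    have bdd: "bounded (- \<psi> ` {z. r0 < norm z})"
    proof (rule bounded_subset[OF wd.D(2)])
      have "{z::complex. 1 \<le> norm z} \<subseteq> {z. r0 < norm z}" using r0 by auto
      thus "- \<psi> ` {z. r0 < norm z} \<subseteq> D" using \<psi>D by blast
    qed
    obtain q where q: "degree q \<le> N" "coeff q N = of_real (lead N)"
      "\<And>r z. r0 < r \<Longrightarrow> r < norm z \<Longrightarrow> 2 * pi * \<i> * (F z - poly q (\<psi> z)) =
        - contour_integral (circlepath 0 r) (\<lambda>\<eta>. F \<eta> * deriv \<psi> \<eta> / (\<psi> \<eta> - \<psi> z))"
      using ep.polynomial_approximation[OF \<phi>(1,2) bdd Fh Fl \<phi>(3)] by blast
    have err: "norm (F z - poly q (\<psi> z)) \<le> sN * \<rho>1 ^ N * B2" if z: "z \<in> ring" for z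
    proof -
      have zr: "\<rho>1 < norm z" using z \<rho>1 by (auto simp: closed_ring_def)
      let ?k = "\<lambda>\<eta>. F \<eta> * deriv \<psi> \<eta> / (\<psi> \<eta> - \<psi> z)"
      have ne: "\<psi> \<eta> - \<psi> z \<noteq> 0" if "\<eta> \<in> sphere 0 \<rho>1" for \<eta> using \<delta>(2)[OF that z] \<delta>(1) by auto
      have "continuous_on (path_image (circlepath 0 \<rho>1)) ?k"
        using \<rho>10 ne by (auto intro!: continuous_intros continuous_dom[OF Fh sph] continuous_dom[OF deriv_holomorphic sph] continuous_dom[OF ep.hol sph])
      hence hc: "(?k has_contour_integral contour_integral (circlepath 0 \<rho>1) ?k) (circlepath 0 \<rho>1)"
        by (intro has_contour_integral_integral contour_integrable_continuous_circlepath)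
      have "norm (contour_integral (circlepath 0 \<rho>1) ?k) \<le> sN * \<rho>1 ^ N * (BE * BY / \<delta>) * (2 * pi * \<rho>1)"
      proof (rule has_contour_integral_bound_circlepath[OF hc])
        show "0 \<le> sN * \<rho>1 ^ N * (BE * BY / \<delta>)" using sN \<rho>10 BE BY \<delta> by simp
        show "0 < \<rho>1" by (rule \<rho>10)
        fix \<eta> :: complex assume "norm (\<eta> - 0) = \<rho>1"
        hence \<eta>: "\<eta> \<in> sphere 0 \<rho>1" "norm \<eta> = \<rho>1" "r0 < norm \<eta>" using \<rho>1 by auto
        have "F \<eta> * deriv \<psi> \<eta> = of_real sN * \<eta> ^ N * (exp (V (\<psi> \<eta>)) * Yf N \<eta>)"
          using ep.deriv_nonzero[OF \<eta>(3)] by (simp add: F_def)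
        hence "norm (F \<eta> * deriv \<psi> \<eta>) = sN * \<rho>1 ^ N * (norm (exp (V (\<psi> \<eta>))) * norm (Yf N \<eta>))"
          using sN \<eta>(2) by (simp only: norm_mult norm_power norm_of_real abs_of_pos)
        also have "\<dots> \<le> sN * \<rho>1 ^ N * (BE * BY)"
          using sN \<rho>10 by (intro mult_left_mono mult_mono BE(1) BE(2)[OF \<eta>(1)] BY(2)[OF N \<eta>(1)]) auto
        finally have le: "norm (F \<eta> * deriv \<psi> \<eta>) \<le> sN * \<rho>1 ^ N * (BE * BY)" .
        have \<delta>': "\<delta> \<le> norm (\<psi> \<eta> - \<psi> z)" using \<delta>(2)[OF \<eta>(1) z] by (simp add: dist_norm)
        have "norm (?k \<eta>) \<le> sN * \<rho>1 ^ N * (BE * BY) / \<delta>"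
          unfolding norm_divide by (rule frac_le[OF order_trans[OF norm_ge_zero le] le \<delta>(1) \<delta>'])
        thus "norm (?k \<eta>) \<le> sN * \<rho>1 ^ N * (BE * BY / \<delta>)" by simp
      qed
      moreover have "norm (2 * pi * \<i> * (F z - poly q (\<psi> z))) = norm (contour_integral (circlepath 0 \<rho>1) ?k)"
        unfolding q(3)[OF \<rho>1(1) zr] by simp
      ultimately have "2 * pi * norm (F z - poly q (\<psi> z)) \<le> 2 * pi * (sN * \<rho>1 ^ N * B2)"
      proof -
        have nm: "norm (2 * pi * \<i> * X) = 2 * pi * norm X" for X :: complex by (simp add: norm_mult)
        assume "norm (contour_integral (circlepath 0 \<rho>1) ?k) \<le> sN * \<rho>1 ^ N * (BE * BY / \<delta>) * (2 * pi * \<rho>1)"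
          "norm (2 * pi * \<i> * (F z - poly q (\<psi> z))) = norm (contour_integral (circlepath 0 \<rho>1) ?k)"
        thus ?thesis unfolding nm by (simp only: B2_def mult_ac)
      qed
      thus ?thesis by simp
    qed
    have "norm (poly q (\<psi> z) * J N z - Yf N z) \<le> C * (\<rho>1 / exp x0) ^ N" if z: "z \<in> ring" for z
    proof -
      have zd: "r0 < norm z" "z \<noteq> 0" "exp x0 \<le> norm z" using ring_dom[OF z] dom_nonzero z by (auto simp: closed_ring_def)
      have JF: "J N z * F z = Yf N z"
        using zd ep.deriv_nonzero[OF zd(1)] sN by (simp add: J_def F_def sN_def)
      have "poly q (\<psi> z) * J N z - Yf N z = - (J N z * (F z - poly q (\<psi> z)))"
        unfolding JF[symmetric] by (simp add: algebra_simps)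
      hence "norm (poly q (\<psi> z) * J N z - Yf N z) = norm (J N z) * norm (F z - poly q (\<psi> z))" by (simp only: norm_minus_cancel norm_mult)
      also have "\<dots> \<le> (BJ / (sN * exp x0 ^ N)) * (sN * \<rho>1 ^ N * B2)"
      proof (rule mult_mono[OF _ err[OF z]])
        have "norm (J N z) = norm (deriv \<psi> z / exp (V (\<psi> z))) / (sN * norm z ^ N)"
          using sN by (simp add: J_def sN_def[symmetric] norm_divide norm_mult norm_power)
        also have "\<dots> \<le> BJ / (sN * exp x0 ^ N)"
          using sN zd(3) by (intro frac_le BJ(1) BJ(2)[OF z] mult_left_mono power_mono) auto
        finally show "norm (J N z) \<le> BJ / (sN * exp x0 ^ N)" .
      qed (use BJ sN in auto)
      also have "\<dots> = BJ * B2 * (\<rho>1 / exp x0) ^ N" using sN by (simp add: power_divide)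
      also have "\<dots> \<le> C * (\<rho>1 / exp x0) ^ N"
        using \<rho>10 Bi BY' B20 by (intro mult_right_mono) (auto simp: C_def)
      finally show ?thesis .
    qed
    moreover have "norm (poly q z) \<le> C * (sqrt (real N) * exp x0 ^ N)" if z: "z \<in> D - A" for z
    proof (rule inner_maximum[OF _ z])
      fix w :: complex assume w: "norm w = exp x0"
      hence wr: "w \<in> ring" using x0 by (simp add: closed_ring_def)
      have "F w = of_real sN * w ^ N * ((exp (V (\<psi> w)) / deriv \<psi> w) * Yf N w)" by (simp add: F_def)
      hence "norm (F w) = sN * exp x0 ^ N * (norm (exp (V (\<psi> w)) / deriv \<psi> w) * norm (Yf N w))"
        using sN w by (simp only: norm_mult norm_power norm_of_real abs_of_pos)
      also have "\<dots> \<le> sN * exp x0 ^ N * (Bi * BY')"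
        using sN by (intro mult_left_mono mult_mono Bi(1) Bi(2)[OF wr] BY'(2)[OF N wr]) auto
      finally have 1: "norm (F w) \<le> sN * exp x0 ^ N * (Bi * BY')" .
      have "sN * \<rho>1 ^ N * B2 \<le> sN * exp x0 ^ N * B2"
        using sN \<rho>10 \<rho>1 B20 by (intro mult_right_mono mult_left_mono power_mono) auto
      hence 2: "norm (F w - poly q (\<psi> w)) \<le> sN * exp x0 ^ N * B2" using err[OF wr] by linarith
      have "norm (poly q (\<psi> w)) \<le> norm (F w) + norm (F w - poly q (\<psi> w))"
        using norm_triangle_ineq4[of "F w" "F w - poly q (\<psi> w)"] by simp
      also have "\<dots> \<le> sN * exp x0 ^ N * (Bi * BY' + B2)" using 1 2 by (simp add: distrib_left)
      also have "\<dots> \<le> sN * exp x0 ^ N * C"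
        using sN BJ B20 by (intro mult_left_mono) (auto simp: C_def)
      finally show "norm (poly q (\<psi> w)) \<le> C * (sqrt (real N) * exp x0 ^ N)" by (simp only: sN_def mult_ac)
    qed
    ultimately show ?thesis using q(1,2) unfolding approx_poly_def by blast
  qed
  moreover have "C \<ge> 0" using BJ Bi BY' B20 by (simp add: C_def)
  ultimately show ?thesis by blast
qed

end

lemma (in weighted_domain) wint_cnj: "wint S (\<lambda>z. cnj (f z)) = cnj (wint S f)"
proof -
  have "(LINT z:S|lborel. \<omega> z *\<^sub>R cnj (f z)) = cnj (LINT z:S|lborel. \<omega> z *\<^sub>R f z)"
    unfolding set_lebesgue_integral_def by (subst Bochner_Integration.integral_cnj [symmetric]) simp
  thus ?thesis by (simp add: wint_def)
qed

context orth_setting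
begin

abbreviation near_qp :: "real \<Rightarrow> nat \<Rightarrow> complex poly \<Rightarrow> bool" where
  "near_qp C N \<equiv> approx_poly (C / real N ^ (\<kappa> + 1)) (C / real N ^ (\<kappa> + 1)) N"

abbreviation sq_norm :: "complex poly \<Rightarrow> real" where
  "sq_norm p \<equiv> wint D (\<lambda>z. (norm (poly p z))\<^sup>2)"

lemma approx_poly_mono: "approx_poly a b N q \<Longrightarrow> a \<le> a' \<Longrightarrow> b \<le> b' \<Longrightarrow> approx_poly a' b' N q"
  unfolding approx_poly_def by (meson order_trans)

lemma quasi_polynomial_negligible: "\<exists>C\<ge>0. \<forall>N\<ge>1. \<exists>q. near_qp C N q"
proof -
  obtain C where C: "C \<ge> 0"
    "\<And>N. N \<ge> 1 \<Longrightarrow> \<exists>q. approx_poly (C * (\<rho>1 / exp x0) ^ N) (C * (sqrt (real N) * exp x0 ^ N)) N q"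
    using quasi_polynomial by blast
  have t: "0 \<le> \<rho>1 / exp x0" "\<rho>1 / exp x0 < 1" using \<rho>1 r0 by simp_all
  obtain C1 where C1: "C1 \<ge> 0" "\<And>N::nat. (\<rho>1 / exp x0) ^ N * real N ^ (\<kappa> + 1) \<le> C1" by (rule power_decay[OF t]) (rule that)
  \<comment> \<open>One power more than in \<open>C1\<close>, to absorb the factor
    \<open>sqrt N\<close> of the interior bound.\<close>
  obtain C2 where C2: "C2 \<ge> 0" "\<And>N::nat. exp x0 ^ N * real N ^ (\<kappa> + 2) \<le> C2"
    by (rule power_decay[OF less_imp_le[OF s0(3)] s0(2)]) (rule that)
  have gen: "C * a \<le> C * (C1 + C2) / real N ^ (\<kappa> + 1)" if "N \<ge> 1" "a * real N ^ (\<kappa> + 1) \<le> C1 + C2" for a and N :: nat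
  proof -
    have p: "0 < real N ^ (\<kappa> + 1)" using that(1) by simp
    show ?thesis unfolding pos_le_divide_eq[OF p] mult.assoc using that(2) C(1) by (rule mult_left_mono)
  qed
  have 1: "C * (\<rho>1 / exp x0) ^ N \<le> C * (C1 + C2) / real N ^ (\<kappa> + 1)" if N: "N \<ge> 1" for N
    by (rule gen[OF N]) (use C1(2)[of N] C2(1) in linarith)
  have 2: "C * (sqrt (real N) * exp x0 ^ N) \<le> C * (C1 + C2) / real N ^ (\<kappa> + 1)" if N: "N \<ge> 1" for N
  proof (rule gen[OF N])
    have "sqrt (real N) \<le> real N" using N by (intro real_le_lsqrt) (auto simp: power2_eq_square)
    hence "sqrt (real N) * (exp x0 ^ N * real N ^ (\<kappa> + 1)) \<le> real N * (exp x0 ^ N * real N ^ (\<kappa> + 1))"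
      by (rule mult_right_mono) simp
    also have "\<dots> = exp x0 ^ N * real N ^ (\<kappa> + 2)" by simp
    also have "\<dots> \<le> C1 + C2" using C2(2)[of N] C1(1) by linarith
    finally show "sqrt (real N) * exp x0 ^ N * real N ^ (\<kappa> + 1) \<le> C1 + C2" by (simp only: mult.assoc)
  qed
  have "C * (C1 + C2) \<ge> 0" using C(1) C1(1) C2(1) by simp
  thus ?thesis using C(2) approx_poly_mono[OF _ 1 2] by blast
qed

definition Wtot :: real where "Wtot = wint D (\<lambda>_. 1::real)"

lemma Wtot_nonneg: "Wtot \<ge> 0"
  unfolding Wtot_def by (rule wd.wint_nonneg[OF D_borel]) auto

lemma poly_cont: "continuous_on UNIV (poly p :: complex \<Rightarrow> complex)"
  by (intro continuous_intros)

lemma wint_inner_bound: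
  fixes f :: "complex \<Rightarrow> real"
  assumes f: "continuous_on UNIV f" and b: "\<And>z. z \<in> D - A \<Longrightarrow> f z \<le> b" "0 \<le> b"
  shows "wint (D - A) f \<le> b * Wtot"
proof -
  have "wint (D - A) f \<le> wint (D - A) (\<lambda>_. b * 1)"
    by (rule wd.wint_mono[OF DA_borel f continuous_on_const]) (use b in simp)
  also have "\<dots> = b * wint (D - A) (\<lambda>_. 1)" by (rule wd.wint_cmult_real[OF DA_borel])
  also have "\<dots> \<le> b * Wtot"
    unfolding Wtot_def by (intro mult_left_mono b(2) wd.wint_subset_le[OF continuous_on_const _ DA_borel]) simp
  finally show ?thesis .
qed

lemma Npow: "N \<ge> 1 \<Longrightarrow> 1 \<le> real N ^ k"
  by (simp add: one_le_power)

text \<open>Three contributions: \<open>Yf\<close> against the pullback of \<open>p\<close>, covered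
  by approximate orthogonality; the approximation error of \<open>q\<close> on the ring; and the
  interior, where \<open>q\<close> is small. In each of them Cauchy-Schwarz or the estimate already
  proved leaves one factor equal to the norm of \<open>p\<close>.\<close>

lemma inner_product_small:
  assumes C: "C \<ge> 0"
  shows "\<exists>C1\<ge>0. \<forall>N\<ge>1. \<forall>q p. near_qp C N q \<longrightarrow> degree p < N \<longrightarrow>
     norm (wint D (\<lambda>z. poly q z * cnj (poly p z))) \<le> C1 / real N ^ (\<kappa> + 1) * sqrt (sq_norm p)"
proof -
  obtain CA where CA: "CA \<ge> 0" "\<And>N h. N \<ge> 1 \<Longrightarrow> h holomorphic_on {z. r0 < norm z} \<Longrightarrow> (h \<longlongrightarrow> 0) at_infinity \<Longrightarrow>
     norm (R N (\<lambda>z. cnj (h z) * (Yf N z * \<Omega> z))) \<le> CA / real N ^ (\<kappa> + 1) * sqrt (R N (\<lambda>z. (norm (h z))\<^sup>2))"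
    using approximate_orthogonality by blast
  define C1 where "C1 = (CA * sqrt \<Omega>B + sqrt \<Omega>B * (C * \<Omega>B)) + C * sqrt Wtot"
  have "norm (wint D (\<lambda>z. poly q z * cnj (poly p z))) \<le> C1 / real N ^ (\<kappa> + 1) * sqrt (sq_norm p)"
    if N: "N \<ge> 1" and q: "near_qp C N q" and p: "degree p < N" for N q p
  proof -
    define n where "n = real N ^ (\<kappa> + 1)"
    have n: "n > 0" using N by (simp add: n_def)
    define P where "P = sq_norm p"
    have cp: "continuous_on UNIV (\<lambda>z. (norm (poly p z))\<^sup>2)" by (intro continuous_intros)
    have P0: "P \<ge> 0" unfolding P_def by (rule wd.wint_nonneg[OF D_borel cp]) simp
    define h where "h = (\<lambda>z. poly p (\<psi> z) * J N z)"
    define e where "e = (\<lambda>z. poly q (\<psi> z) * J N z - Yf N z)"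
    have hh: "h holomorphic_on {z. r0 < norm z}" and h0: "(h \<longlongrightarrow> 0) at_infinity"
      unfolding h_def by (rule pullback_poly[OF N p])+
    have eb: "norm (e z) \<le> C / n" if "z \<in> ring" for z
      using q that unfolding approx_poly_def e_def n_def by blast
    have qb: "norm (poly q z) \<le> C / n" if "z \<in> D - A" for z
      using q that unfolding approx_poly_def n_def by blast
    have c: "continuous_on ring h" "continuous_on ring e" "continuous_on ring (Yf N)"
      "continuous_on ring \<Omega>"
      unfolding e_def
      by (intro continuous_on_diff continuous_on_mult continuous_on_compose2[OF poly_cont \<psi>_ring] continuous_ring[OF J_holomorphic[OF N]]
            continuous_ring[OF Yf_holomorphic] continuous_ring[OF hh] cont_ring[OF \<Omega>] subset_UNIV)+
    define H where "H = sqrt (R N (\<lambda>z. (norm (h z))\<^sup>2))"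
    have H: "H \<le> sqrt \<Omega>B * sqrt P"
      unfolding H_def P_def real_sqrt_mult[symmetric] h_def by (rule real_sqrt_le_mono[OF pullback_norm[OF N poly_cont]])
    have cpr: "continuous_on UNIV (\<lambda>z. poly q z * cnj (poly p z))" by (intro continuous_intros)
    have "wint A (\<lambda>z. poly q z * cnj (poly p z)) = R N (\<lambda>z. poly q (\<psi> z) * cnj (poly p (\<psi> z)) * (J N z * cnj (J N z) * \<Omega> z))"
      by (rule change_of_variables[OF cpr N])
    also have "\<dots> = R N (\<lambda>z. cnj (h z) * (Yf N z * \<Omega> z) + cnj (h z) * (e z * \<Omega> z))"
      by (rule ring_integral_cong) (simp add: h_def e_def algebra_simps)
    also have "\<dots> = R N (\<lambda>z. cnj (h z) * (Yf N z * \<Omega> z)) + R N (\<lambda>z. cnj (h z) * (e z * \<Omega> z))"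
      by (rule ring_integral_add) (intro continuous_on_mult continuous_on_cnj c)+
    finally have eqA: "wint A (\<lambda>z. poly q z * cnj (poly p z)) = \<dots>" .
    have a1: "norm (R N (\<lambda>z. cnj (h z) * (Yf N z * \<Omega> z))) \<le> CA / n * (sqrt \<Omega>B * sqrt P)"
      by (rule order_trans[OF CA(2)[OF N hh h0]], fold n_def H_def, rule mult_left_mono[OF H]) (use CA n in simp)
    have a2: "norm (R N (\<lambda>z. cnj (h z) * (e z * \<Omega> z))) \<le> (sqrt \<Omega>B * sqrt P) * (C / n * \<Omega>B)"
    proof -
      have ce: "continuous_on ring (\<lambda>z. (norm (e z * \<Omega> z))\<^sup>2)" by (intro continuous_intros c)
      have "norm (R N (\<lambda>z. cnj (h z) * (e z * \<Omega> z))) \<le> sqrt (R N (\<lambda>z. (norm (cnj (h z)))\<^sup>2)) * sqrt (R N (\<lambda>z. (norm (e z * \<Omega> z))\<^sup>2))"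
        by (rule ring_norm_le_product) (intro continuous_on_mult continuous_on_cnj c)+
      also have "\<dots> = H * sqrt (R N (\<lambda>z. (norm (e z * \<Omega> z))\<^sup>2))" by (simp add: H_def)
      also have "\<dots> \<le> (sqrt \<Omega>B * sqrt P) * (C / n * \<Omega>B)"
      proof (rule mult_mono[OF H])
        have b: "norm (e z * \<Omega> z) \<le> C / n * \<Omega>B" if "z \<in> ring" for z
          unfolding norm_mult by (intro mult_mono eb norm_\<Omega>_le that) (use C n in auto)
        have "R N (\<lambda>z. (norm (e z * \<Omega> z))\<^sup>2) \<le> R N (\<lambda>_. (C / n * \<Omega>B)\<^sup>2)"
          by (rule ring_integral_mono[OF ce continuous_on_const]) (intro power_mono b norm_ge_zero)
        also have "\<dots> \<le> (C / n * \<Omega>B)\<^sup>2" by (rule ring_integral_const_le) (use x0 in auto)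
        finally show "sqrt (R N (\<lambda>z. (norm (e z * \<Omega> z))\<^sup>2)) \<le> C / n * \<Omega>B"
          by (rule real_le_lsqrt[rotated -1]) (use C n \<Omega>B(1) in auto)
        have "0 \<le> R N (\<lambda>z. (norm (e z * \<Omega> z))\<^sup>2)"
          using ring_integral_mono[OF continuous_on_const ce, of 0 N] by (simp add: ring_integral_def case_prod_unfold)
        thus "0 \<le> sqrt (R N (\<lambda>z. (norm (e z * \<Omega> z))\<^sup>2))" by simp
      qed (use \<Omega>B(1) P0 in simp)
      finally show ?thesis .
    qed
    have a3: "norm (wint (D - A) (\<lambda>z. poly q z * cnj (poly p z))) \<le> (C / n * sqrt Wtot) * sqrt P"
    proof -
      have cq: "continuous_on UNIV (\<lambda>z. (norm (poly q z))\<^sup>2)" by (intro continuous_intros)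
      have "norm (wint (D - A) (\<lambda>z. poly q z * cnj (poly p z)))
         \<le> sqrt (wint (D - A) (\<lambda>z. (norm (poly q z))\<^sup>2)) * sqrt (wint (D - A) (\<lambda>z. (norm (cnj (poly p z)))\<^sup>2))"
        by (rule wd.wint_Cauchy_Schwarz[OF DA_borel]) (intro continuous_on_cnj poly_cont)+
      also have "\<dots> = sqrt (wint (D - A) (\<lambda>z. (norm (poly q z))\<^sup>2)) * sqrt (wint (D - A) (\<lambda>z. (norm (poly p z))\<^sup>2))" by simp
      also have "\<dots> \<le> (C / n * sqrt Wtot) * sqrt P"
      proof (rule mult_mono)
        have "wint (D - A) (\<lambda>z. (norm (poly q z))\<^sup>2) \<le> (C / n)\<^sup>2 * Wtot"
          by (rule wint_inner_bound[OF cq]) (auto intro!: power_mono qb)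
        hence "sqrt (wint (D - A) (\<lambda>z. (norm (poly q z))\<^sup>2)) \<le> sqrt ((C / n)\<^sup>2 * Wtot)" by (rule real_sqrt_le_mono)
        also have "\<dots> = C / n * sqrt Wtot" using C n by (simp add: real_sqrt_mult)
        finally show "sqrt (wint (D - A) (\<lambda>z. (norm (poly q z))\<^sup>2)) \<le> C / n * sqrt Wtot" .
        show "sqrt (wint (D - A) (\<lambda>z. (norm (poly p z))\<^sup>2)) \<le> sqrt P"
          unfolding P_def by (rule real_sqrt_le_mono[OF wd.wint_subset_le[OF cp _ DA_borel]]) simp
        show "0 \<le> C / n * sqrt Wtot" using C n Wtot_nonneg by simp
        show "0 \<le> sqrt (wint (D - A) (\<lambda>z. (norm (poly p z))\<^sup>2))" using wd.wint_nonneg[OF DA_borel cp] by simp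
      qed
      finally show ?thesis .
    qed
    have "norm (wint D (\<lambda>z. poly q z * cnj (poly p z))) \<le> (CA / n * (sqrt \<Omega>B * sqrt P) + (sqrt \<Omega>B * sqrt P) * (C / n * \<Omega>B)) + (C / n * sqrt Wtot) * sqrt P"
      unfolding wd.wint_split[OF cpr A_borel A_subset] eqA
      by (rule order_trans[OF norm_triangle_ineq add_mono[OF order_trans[OF norm_triangle_ineq add_mono[OF a1 a2]] a3]])
    also have "\<dots> = C1 / n * sqrt P" by (simp add: C1_def field_simps add_divide_distrib)
    finally show ?thesis by (simp only: n_def P_def)
  qed
  moreover have "C1 \<ge> 0" using CA C \<Omega>B(1) Wtot_nonneg by (simp add: C1_def)
  ultimately show ?thesis by blast
qed

text \<open>On the ring the difference of the squared moduli is the approximation error times a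
  bounded factor; in the interior the contribution is quadratic in the smallness. \<open>G\<close>
  enters only through a sup bound, so one constant serves every \<open>G\<close>, including
  \<open>G = 1\<close>.\<close>

lemma quasi_polynomial_density:
  assumes C: "C \<ge> 0"
  shows "\<exists>C2\<ge>0. \<forall>N\<ge>1. \<forall>q G B. near_qp C N q \<longrightarrow> continuous_on UNIV G \<longrightarrow> (\<forall>z. norm (G z) \<le> B) \<longrightarrow>
     norm (wint D (\<lambda>z. G z * (poly q z * cnj (poly q z))) - R N (\<lambda>z. G (\<psi> z) * YY N z))
       \<le> B * C2 / real N ^ (\<kappa> + 1)"
proof -
  obtain BY where BY: "BY \<ge> 0" "\<And>N z. N \<ge> 1 \<Longrightarrow> z \<in> ring \<Longrightarrow> norm (Yf N z) \<le> BY" using Yf_bounded by blast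
  define C2 where "C2 = C * (2 * BY + C) * \<Omega>B + C\<^sup>2 * Wtot"
  have "norm (wint D (\<lambda>z. G z * (poly q z * cnj (poly q z))) - R N (\<lambda>z. G (\<psi> z) * YY N z))
       \<le> B * C2 / real N ^ (\<kappa> + 1)"
    if N: "N \<ge> 1" and q: "near_qp C N q" and G: "continuous_on UNIV G" and GB: "\<forall>z. norm (G z) \<le> B" for N q G B
  proof -
    define n where "n = real N ^ (\<kappa> + 1)"
    have n: "n \<ge> 1" unfolding n_def by (rule Npow[OF N])
    have B: "B \<ge> 0" using GB norm_ge_zero order_trans by blast
    define u where "u = (\<lambda>z. poly q (\<psi> z) * J N z)"
    have eb: "norm (u z - Yf N z) \<le> C / n" if "z \<in> ring" for z
      using q that unfolding approx_poly_def u_def n_def by blast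
    have qb: "norm (poly q z) \<le> C / n" if "z \<in> D - A" for z
      using q that unfolding approx_poly_def n_def by blast
    have c: "continuous_on ring u" "continuous_on ring (Yf N)" "continuous_on ring \<Omega>"
      "continuous_on ring (\<lambda>z. G (\<psi> z))"
      unfolding u_def
      by (intro continuous_on_mult continuous_on_compose2[OF poly_cont \<psi>_ring] continuous_on_compose2[OF G \<psi>_ring] continuous_ring[OF J_holomorphic[OF N]]
            continuous_ring[OF Yf_holomorphic] cont_ring[OF \<Omega>] subset_UNIV)+
    have cG: "continuous_on UNIV (\<lambda>z. G z * (poly q z * cnj (poly q z)))" by (intro continuous_intros G)
    have "wint A (\<lambda>z. G z * (poly q z * cnj (poly q z)))
        = R N (\<lambda>z. G (\<psi> z) * (poly q (\<psi> z) * cnj (poly q (\<psi> z))) * (J N z * cnj (J N z) * \<Omega> z))"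
      by (rule change_of_variables[OF cG N])
    also have "\<dots> = R N (\<lambda>z. G (\<psi> z) * (u z * cnj (u z) * \<Omega> z))"
      by (rule ring_integral_cong) (simp add: u_def mult_ac)
    finally have eqA: "wint A (\<lambda>z. G z * (poly q z * cnj (poly q z))) = R N (\<lambda>z. G (\<psi> z) * (u z * cnj (u z) * \<Omega> z))" .
    have "R N (\<lambda>z. G (\<psi> z) * (u z * cnj (u z) * \<Omega> z)) - R N (\<lambda>z. G (\<psi> z) * YY N z)
       = R N (\<lambda>z. G (\<psi> z) * (u z * cnj (u z) * \<Omega> z) - G (\<psi> z) * YY N z)"
      by (rule ring_integral_diff[symmetric]) (intro continuous_on_mult continuous_on_cnj c)+
    also have "norm \<dots> \<le> B * (C / n * (2 * BY + C) * \<Omega>B)"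
    proof (rule ring_integral_bound)
      show "continuous_on ring (\<lambda>z. G (\<psi> z) * (u z * cnj (u z) * \<Omega> z) - G (\<psi> z) * YY N z)"
        by (intro continuous_on_diff continuous_on_mult continuous_on_cnj c)
      show "x0 \<le> 0" using x0 by simp
      fix z assume z: "z \<in> ring"
      define e where "e = u z - Yf N z"
      have e: "norm e \<le> C / n" unfolding e_def by (rule eb[OF z])
      have "C / n \<le> C" using divide_left_mono[OF n C] n by simp
      have "u z * cnj (u z) - Yf N z * cnj (Yf N z) = e * cnj (u z) + Yf N z * cnj e"
        by (simp add: e_def algebra_simps)
      also have "norm \<dots> \<le> norm e * norm (u z) + norm (Yf N z) * norm e"
        by (rule order_trans[OF norm_triangle_ineq]) (simp add: norm_mult)
      also have "\<dots> = norm e * (norm (u z) + norm (Yf N z))" by (simp add: algebra_simps)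
      also have "\<dots> \<le> C / n * (2 * BY + C)"
      proof (rule mult_mono[OF e])
        have "norm (u z) \<le> norm (Yf N z) + norm e"
          using norm_triangle_ineq[of "Yf N z" e] by (simp add: e_def)
        thus "norm (u z) + norm (Yf N z) \<le> 2 * BY + C" using BY(2)[OF N z] e \<open>C / n \<le> C\<close> by linarith
      qed (use C n in auto)
      finally have d: "norm (u z * cnj (u z) - Yf N z * cnj (Yf N z)) \<le> C / n * (2 * BY + C)" .
      have "G (\<psi> z) * (u z * cnj (u z) * \<Omega> z) - G (\<psi> z) * YY N z
         = G (\<psi> z) * ((u z * cnj (u z) - Yf N z * cnj (Yf N z)) * \<Omega> z)" by (simp add: algebra_simps)
      also have "norm \<dots> \<le> B * (C / n * (2 * BY + C) * \<Omega>B)"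
        unfolding norm_mult by (intro mult_mono GB[rule_format] d[unfolded norm_mult] norm_\<Omega>_le[OF z]) (use B C n BY(1) in auto)
      finally show "norm (G (\<psi> z) * (u z * cnj (u z) * \<Omega> z) - G (\<psi> z) * YY N z) \<le> B * (C / n * (2 * BY + C) * \<Omega>B)" .
    qed
    finally have a1: "norm (R N (\<lambda>z. G (\<psi> z) * (u z * cnj (u z) * \<Omega> z)) - R N (\<lambda>z. G (\<psi> z) * YY N z)) \<le> B * (C / n * (2 * BY + C) * \<Omega>B)" .
    have a2: "norm (wint (D - A) (\<lambda>z. G z * (poly q z * cnj (poly q z)))) \<le> B * (C\<^sup>2 / n) * Wtot"
    proof -
      have "norm (wint (D - A) (\<lambda>z. G z * (poly q z * cnj (poly q z)))) \<le> wint (D - A) (\<lambda>z. norm (G z * (poly q z * cnj (poly q z))))"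
        by (rule wd.wint_norm_le[OF DA_borel cG])
      also have "\<dots> \<le> B * (C\<^sup>2 / n) * Wtot"
      proof (rule wint_inner_bound)
        show "continuous_on UNIV (\<lambda>z. norm (G z * (poly q z * cnj (poly q z))))" by (rule continuous_on_norm[OF cG])
        show "0 \<le> B * (C\<^sup>2 / n)" using B n by simp
        fix z assume z: "z \<in> D - A"
        have "norm (G z * (poly q z * cnj (poly q z))) \<le> B * (C / n * (C / n))"
          unfolding norm_mult complex_mod_cnj by (intro mult_mono GB[rule_format] qb[OF z]) (use B C n in auto)
        also have "C / n * (C / n) = C\<^sup>2 / (n * n)" by (simp add: power2_eq_square)
        also have "C\<^sup>2 / (n * n) \<le> C\<^sup>2 / n" using n by (intro divide_left_mono) auto
        finally show "norm (G z * (poly q z * cnj (poly q z))) \<le> B * (C\<^sup>2 / n)" using B by (simp add: mult_left_mono)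
      qed
      finally show ?thesis .
    qed
    have "wint D (\<lambda>z. G z * (poly q z * cnj (poly q z))) - R N (\<lambda>z. G (\<psi> z) * YY N z)
       = (R N (\<lambda>z. G (\<psi> z) * (u z * cnj (u z) * \<Omega> z)) - R N (\<lambda>z. G (\<psi> z) * YY N z))
         + wint (D - A) (\<lambda>z. G z * (poly q z * cnj (poly q z)))"
      unfolding wd.wint_split[OF cG A_borel A_subset] eqA by simp
    also have "norm \<dots> \<le> B * (C / n * (2 * BY + C) * \<Omega>B) + B * (C\<^sup>2 / n) * Wtot"
      by (rule order_trans[OF norm_triangle_ineq add_mono[OF a1 a2]])
    also have "\<dots> = B * C2 / n" by (simp add: C2_def algebra_simps add_divide_distrib)
    finally show ?thesis by (simp only: n_def)
  qed
  moreover have "C2 \<ge> 0" using C BY(1) \<Omega>B(1) Wtot_nonneg by (simp add: C2_def)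
  ultimately show ?thesis by blast
qed

text \<open>Let \<open>p = P - d q\<close>, of degree below \<open>N\<close>. Since \<open>P\<close>
  is orthogonal to \<open>p\<close>, the squared norm of \<open>p\<close> is \<open>-d\<close> times
  the inner product of \<open>q\<close> and \<open>p\<close>, so the norm of \<open>p\<close> is at
  most \<open>d C1 / N^(\<kappa>+1)\<close>. As \<open>d^2\<close> times the squared norm of
  \<open>q\<close> is 1 plus that of \<open>p\<close>, and the norm of \<open>q\<close> is near 1,
  \<open>d\<close> is bounded; this bound is fed back into the errors.\<close>

lemma orthonormal_comparison:
  "\<exists>C N0. \<forall>N\<ge>N0. \<forall>P d. N \<ge> 1 \<longrightarrow> normalized_orthogonal_poly D \<omega> N P \<longrightarrow> d > 0 \<longrightarrow> lead_coeff P = of_real (d * lead N) \<longrightarrow>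
     d\<^sup>2 \<le> 4 \<and> (\<forall>G B. continuous_on UNIV G \<longrightarrow> (\<forall>z. norm (G z) \<le> B) \<longrightarrow>
        norm (wint D (\<lambda>z. G z * (poly P z * cnj (poly P z))) - of_real (d\<^sup>2) * R N (\<lambda>z. G (\<psi> z) * YY N z))
          \<le> B * C / real N ^ (\<kappa> + 1))"
proof -
  obtain C where C: "C \<ge> 0" "\<And>N. N \<ge> 1 \<Longrightarrow> \<exists>q. near_qp C N q"
    using quasi_polynomial_negligible by blast
  obtain C1 where C1: "C1 \<ge> 0" "\<And>N q p. N \<ge> 1 \<Longrightarrow> near_qp C N q \<Longrightarrow> degree p < N \<Longrightarrow>
     norm (wint D (\<lambda>z. poly q z * cnj (poly p z))) \<le> C1 / real N ^ (\<kappa> + 1) * sqrt (sq_norm p)"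
    using inner_product_small[OF C(1)] by blast
  obtain C2 where C2: "C2 \<ge> 0" "\<And>N q G B. N \<ge> 1 \<Longrightarrow> near_qp C N q \<Longrightarrow> continuous_on UNIV G \<Longrightarrow> (\<And>z. norm (G z) \<le> B) \<Longrightarrow>
     norm (wint D (\<lambda>z. G z * (poly q z * cnj (poly q z))) - R N (\<lambda>z. G (\<psi> z) * YY N z))
       \<le> B * C2 / real N ^ (\<kappa> + 1)"
    using quasi_polynomial_density[OF C(1)] by blast
  obtain C3 where C3: "\<And>N. N \<ge> 1 \<Longrightarrow> norm (R N (YY N) - 1) \<le> C3 / real N"
    using Yf_square_mean by blast
  define Cf where "Cf = 4 * C1 + 4 * C1\<^sup>2 + 4 * C2"
  \<comment> \<open>Large enough that the squared norm of \<open>q\<close> is at least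
    \<open>1/2\<close> and the norm of \<open>p\<close> at most \<open>d / 2\<close>. Together these
    give \<open>d^2 / 2 \<le> 1 + d^2 / 4\<close>, that is \<open>d^2 \<le> 4\<close>.\<close>
  define N0 where "N0 = nat \<lceil>2 * C2 + 2 * \<bar>C3\<bar> + 2 * C1 + 1\<rceil>"
  have "d\<^sup>2 \<le> 4 \<and> (\<forall>G B. continuous_on UNIV G \<longrightarrow> (\<forall>z. norm (G z) \<le> B) \<longrightarrow>
        norm (wint D (\<lambda>z. G z * (poly P z * cnj (poly P z))) - of_real (d\<^sup>2) * R N (\<lambda>z. G (\<psi> z) * YY N z))
          \<le> B * Cf / real N ^ (\<kappa> + 1))"
    if N0: "N \<ge> N0" and N: "N \<ge> 1" and P: "normalized_orthogonal_poly D \<omega> N P" and d: "d > 0" and lc: "lead_coeff P = of_real (d * lead N)" for N P d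
  proof -
    define n where "n = real N ^ (\<kappa> + 1)"
    have n1: "n \<ge> 1" unfolding n_def by (rule Npow[OF N])
    have nN: "n \<ge> real N" unfolding n_def using N by (simp add: self_le_power)
    have Nb: "real N \<ge> 2 * C2 + 2 * \<bar>C3\<bar> + 2 * C1 + 1" using N0 unfolding N0_def by linarith
    obtain q where q: "near_qp C N q" using C(2)[OF N] by blast
    have qd: "degree q \<le> N" "coeff q N = of_real (lead N)" using q by (auto simp: approx_poly_def)
    have Pd: "degree P = N" using P by (simp add: normalized_orthogonal_poly_def)
    define p where "p = P - smult (of_real d) q"
    have pdeg: "degree p < N"
    proof -
      have "degree p \<le> N" unfolding p_def using qd(1) Pd by (intro degree_diff_le) (auto intro: order_trans[OF degree_smult_le])
      moreover have "coeff p N = 0" using lc Pd qd(2) by (simp add: p_def)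
      ultimately show ?thesis
      proof (cases "degree p = N")
        case True
        hence "p = 0" using \<open>coeff p N = 0\<close> by (metis leading_coeff_0_iff)
        thus ?thesis using N by simp
      qed simp
    qed
    have Pp: "poly P z = of_real d * poly q z + poly p z" for z by (simp add: p_def)
    have orth: "wint D (\<lambda>z. poly P z * cnj (poly p z)) = 0"
      using P pdeg by (simp add: normalized_orthogonal_poly_def wd.area_integral_wint[symmetric])
    have unit: "wint D (\<lambda>z. poly P z * cnj (poly P z)) = 1"
    proof -
      have "wint D (\<lambda>z. poly P z * cnj (poly P z)) = area_integral D (\<lambda>z. complex_of_real ((norm (poly P z))\<^sup>2 * \<omega> z))"
        unfolding wd.area_integral_wint[symmetric] by (simp only: complex_norm_square of_real_mult)
      thus ?thesis using P by (simp add: normalized_orthogonal_poly_def)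
    qed
    define S where "S = sq_norm p"
    have cn: "continuous_on UNIV (\<lambda>z. (norm (poly r z))\<^sup>2)" for r :: "complex poly" by (intro continuous_intros)
    have S0: "S \<ge> 0" unfolding S_def by (rule wd.wint_nonneg[OF D_borel cn]) simp
    have sq: "wint D (\<lambda>z. poly r z * cnj (poly r z)) = of_real (sq_norm r)" for r
      using wd.wint_of_real[OF D_borel, of "\<lambda>z. (norm (poly r z))\<^sup>2"] by (simp only: complex_norm_square)
    have cc: "continuous_on UNIV (\<lambda>z. poly r z * cnj (poly r' z))" for r r' :: "complex poly" by (intro continuous_intros)
    have Sle: "sqrt S \<le> d * C1 / n"
    proof (cases "S = 0")
      case True thus ?thesis using d C1 n1 by simp
    next
      case False
      have "wint D (\<lambda>z. poly p z * cnj (poly p z)) = wint D (\<lambda>z. poly P z * cnj (poly p z) - of_real d * (poly q z * cnj (poly p z)))"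
        by (simp add: Pp algebra_simps)
      also have "\<dots> = - of_real d * wint D (\<lambda>z. poly q z * cnj (poly p z))"
        by (simp only: wd.wint_diff[OF D_borel cc continuous_on_mult[OF continuous_on_const cc]] orth wd.wint_cmult[OF D_borel]) simp
      finally have "of_real S = - of_real d * wint D (\<lambda>z. poly q z * cnj (poly p z))" by (simp only: sq S_def)
      hence "norm (complex_of_real S) = d * norm (wint D (\<lambda>z. poly q z * cnj (poly p z)))" using d by (simp only: norm_mult norm_minus_cancel norm_of_real abs_of_pos)
      also have "\<dots> \<le> d * (C1 / n * sqrt S)"
        unfolding n_def S_def by (rule mult_left_mono[OF C1(2)[OF N q pdeg] less_imp_le[OF d]])
      finally have "sqrt S * sqrt S \<le> (d * C1 / n) * sqrt S" using S0 by simp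
      thus ?thesis by (rule mult_right_le_imp_le) (use S0 False in simp)
    qed
    define Q where "Q = sq_norm q"
    have dQ: "d\<^sup>2 * Q = 1 + S"
    proof -
      have "wint D (\<lambda>z. of_real (d\<^sup>2) * (poly q z * cnj (poly q z)))
         = wint D (\<lambda>z. (poly P z * cnj (poly P z) - poly P z * cnj (poly p z)) - (cnj (poly P z * cnj (poly p z)) - poly p z * cnj (poly p z)))"
        by (simp add: Pp algebra_simps power2_eq_square)
      also have "\<dots> = (1 - 0) - (wint D (\<lambda>z. cnj (poly P z * cnj (poly p z))) - of_real S)"
      proof -
        have c1: "continuous_on UNIV (\<lambda>z. cnj (poly P z * cnj (poly p z)))" by (intro continuous_intros)
        show ?thesis
          by (simp only: wd.wint_diff[OF D_borel continuous_on_diff[OF cc cc] continuous_on_diff[OF c1 cc]]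
               wd.wint_diff[OF D_borel cc cc] wd.wint_diff[OF D_borel c1 cc] orth unit sq S_def)
      qed
      also have "wint D (\<lambda>z. cnj (poly P z * cnj (poly p z))) = cnj (wint D (\<lambda>z. poly P z * cnj (poly p z)))"
        by (rule wd.wint_cnj)
      also have "\<dots> = 0" by (simp only: orth complex_cnj_zero)
      finally have "of_real (d\<^sup>2 * Q) = complex_of_real (1 + S)" by (simp add: wd.wint_cmult[OF D_borel] sq Q_def)
      thus ?thesis by (simp only: of_real_eq_iff)
    qed
    have Qh: "Q \<ge> 1/2"
    proof -
      have "norm (of_real Q - R N (\<lambda>z. 1 * YY N z)) \<le> 1 * C2 / n"
        using C2(2)[OF N q, of "\<lambda>_. 1" 1] by (simp add: Q_def sq n_def continuous_on_const)
      moreover have "norm (R N (\<lambda>z. 1 * YY N z) - 1) \<le> C3 / real N" using C3[OF N] by simp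
      ultimately have "norm ((of_real Q - R N (\<lambda>z. 1 * YY N z)) + (R N (\<lambda>z. 1 * YY N z) - 1)) \<le> C2 / n + C3 / real N"
        by (intro order_trans[OF norm_triangle_ineq add_mono]) auto
      hence "norm (complex_of_real (Q - 1)) \<le> C2 / n + C3 / real N" by simp
      moreover have "C2 / n \<le> C2 / real N" using nN N C2(1) by (intro divide_left_mono) auto
      moreover have "C3 / real N \<le> \<bar>C3\<bar> / real N" using N by (intro divide_right_mono) auto
      moreover have "C2 / real N + \<bar>C3\<bar> / real N \<le> 1/2" using Nb N C1(1) by (simp add: add_divide_distrib[symmetric] divide_le_eq)
      ultimately have "\<bar>Q - 1\<bar> \<le> 1/2" by (simp only: norm_of_real)
      thus ?thesis by linarith
    qed
    have C1n: "C1 / n \<le> 1/2" using nN Nb n1 C2(1) C1(1) by (simp add: divide_le_eq)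
    have d4: "d\<^sup>2 \<le> 4"
    proof -
      have "d * C1 / n \<le> d * (1/2)" using mult_left_mono[OF C1n less_imp_le[OF d]] by (simp only: times_divide_eq_right)
      hence "sqrt S \<le> d * (1/2)" by (rule order_trans[OF Sle])
      hence "(sqrt S)\<^sup>2 \<le> (d * (1/2))\<^sup>2" using S0 by (intro power_mono) auto
      hence "S \<le> d\<^sup>2 / 4" using S0 by (simp add: power_mult_distrib power2_eq_square)
      moreover have "d\<^sup>2 * (1/2) \<le> d\<^sup>2 * Q" using Qh by (intro mult_left_mono) auto
      ultimately show ?thesis using dQ by linarith
    qed
    have d2: "d \<le> 2" by (rule power2_le_imp_le) (use d4 in auto)
    have main: "norm (wint D (\<lambda>z. G z * (poly P z * cnj (poly P z))) - of_real (d\<^sup>2) * R N (\<lambda>z. G (\<psi> z) * YY N z)) \<le> B * Cf / n"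
      if G: "continuous_on UNIV G" and GB: "\<And>z. norm (G z) \<le> B" for G B
    proof -
      have B: "B \<ge> 0" using GB norm_ge_zero order_trans by blast
      define w where "w = (\<lambda>r r'. wint D (\<lambda>z. G z * (poly r z * cnj (poly r' z))))"
      have cG: "continuous_on UNIV (\<lambda>z. G z * (poly r z * cnj (poly r' z)))" for r r' :: "complex poly" by (intro continuous_intros G)
      have wb: "norm (w r r') \<le> B * sqrt (sq_norm r) * sqrt (sq_norm r')" for r r'
      proof -
        have c1: "continuous_on UNIV (\<lambda>z. G z * poly r z)" by (intro continuous_intros G)
        have c2: "continuous_on UNIV (\<lambda>z. (norm (G z * poly r z))\<^sup>2)" by (intro continuous_intros c1)
        have "norm (w r r') = norm (wint D (\<lambda>z. (G z * poly r z) * cnj (poly r' z)))" by (simp only: w_def mult.assoc)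
        also have "\<dots> \<le> sqrt (wint D (\<lambda>z. (norm (G z * poly r z))\<^sup>2)) * sqrt (wint D (\<lambda>z. (norm (cnj (poly r' z)))\<^sup>2))"
          by (rule wd.wint_Cauchy_Schwarz[OF D_borel c1]) (intro continuous_on_cnj poly_cont)
        also have "\<dots> \<le> (B * sqrt (sq_norm r)) * sqrt (sq_norm r')"
        proof (rule mult_mono)
          have "wint D (\<lambda>z. (norm (G z * poly r z))\<^sup>2) \<le> wint D (\<lambda>z. B\<^sup>2 * (norm (poly r z))\<^sup>2)"
            by (rule wd.wint_mono[OF D_borel c2 continuous_on_mult[OF continuous_on_const cn]])
               (auto simp: norm_mult power_mult_distrib intro!: mult_right_mono power_mono GB)
          also have "\<dots> = B\<^sup>2 * sq_norm r" by (rule wd.wint_cmult_real[OF D_borel])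
          finally have "sqrt (wint D (\<lambda>z. (norm (G z * poly r z))\<^sup>2)) \<le> sqrt (B\<^sup>2 * sq_norm r)"
            by (rule real_sqrt_le_mono)
          thus "sqrt (wint D (\<lambda>z. (norm (G z * poly r z))\<^sup>2)) \<le> B * sqrt (sq_norm r)"
            using B by (simp add: real_sqrt_mult)
        qed (use B wd.wint_nonneg[OF D_borel cn] in auto)
        finally show ?thesis .
      qed
      \<comment> \<open>The mixed terms pair \<open>p\<close> with \<open>P\<close> rather than with
        \<open>q\<close>, because the norm of \<open>P\<close> is exactly 1.\<close>
      have "wint D (\<lambda>z. G z * (poly P z * cnj (poly P z)))
          = wint D (\<lambda>z. (of_real (d\<^sup>2) * (G z * (poly q z * cnj (poly q z))) + G z * (poly P z * cnj (poly p z)))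
              + (G z * (poly p z * cnj (poly P z)) - G z * (poly p z * cnj (poly p z))))"
        by (simp add: Pp algebra_simps power2_eq_square)
      also have "\<dots> = (of_real (d\<^sup>2) * w q q + w P p) + (w p P - w p p)"
      proof -
        have k: "continuous_on UNIV (\<lambda>z. of_real (d\<^sup>2) * (G z * (poly q z * cnj (poly q z))))"
          by (rule continuous_on_mult[OF continuous_on_const cG])
        show ?thesis unfolding w_def
          by (simp only: wd.wint_add[OF D_borel continuous_on_add[OF k cG] continuous_on_diff[OF cG cG]]
             wd.wint_add[OF D_borel k cG] wd.wint_diff[OF D_borel cG cG] wd.wint_cmult[OF D_borel])
      qed
      finally have eq: "wint D (\<lambda>z. G z * (poly P z * cnj (poly P z))) - of_real (d\<^sup>2) * R N (\<lambda>z. G (\<psi> z) * YY N z)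
         = of_real (d\<^sup>2) * (w q q - R N (\<lambda>z. G (\<psi> z) * YY N z)) + (w P p + (w p P - w p p))"
        by (simp add: algebra_simps)
      have uP: "sq_norm P = 1" using unit unfolding sq by (simp only: of_real_eq_1_iff)
      have "norm (w q q - R N (\<lambda>z. G (\<psi> z) * YY N z)) \<le> B * C2 / n"
        unfolding w_def n_def by (rule C2(2)[OF N q G GB])
      hence b1: "norm (of_real (d\<^sup>2) * (w q q - R N (\<lambda>z. G (\<psi> z) * YY N z))) \<le> 4 * (B * C2 / n)"
        unfolding norm_mult norm_of_real by (intro mult_mono) (use d4 in auto)
      have s2: "sqrt S \<le> 2 * C1 / n"
        by (rule order_trans[OF Sle]) (use d2 C1(1) n1 in \<open>auto intro!: divide_right_mono mult_right_mono\<close>)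
      have b2: "norm (w P p) \<le> B * (2 * C1 / n)" "norm (w p P) \<le> B * (2 * C1 / n)"
        using wb[of P p] wb[of p P] mult_left_mono[OF s2 B] by (simp_all add: uP S_def[symmetric])
      have b3: "norm (w p p) \<le> B * (4 * C1\<^sup>2 / n)"
      proof -
        have "norm (w p p) \<le> B * (sqrt S * sqrt S)" using wb[of p p] by (simp only: S_def mult.assoc)
        also have "\<dots> \<le> B * (2 * C1 / n * (2 * C1 / n))" using B S0 C1(1) n1 by (intro mult_left_mono mult_mono s2) auto
        also have "2 * C1 / n * (2 * C1 / n) = 4 * C1\<^sup>2 / (n * n)" by (simp add: power2_eq_square)
        also have "B * (4 * C1\<^sup>2 / (n * n)) \<le> B * (4 * C1\<^sup>2 / n)" using B n1 by (intro mult_left_mono divide_left_mono) auto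
        finally show ?thesis .
      qed
      have "norm (w P p + (w p P - w p p)) \<le> B * (2 * C1 / n) + (B * (2 * C1 / n) + B * (4 * C1\<^sup>2 / n))"
        by (rule order_trans[OF norm_triangle_ineq add_mono[OF b2(1) order_trans[OF norm_triangle_ineq4 add_mono[OF b2(2) b3]]]])
      hence "norm (wint D (\<lambda>z. G z * (poly P z * cnj (poly P z))) - of_real (d\<^sup>2) * R N (\<lambda>z. G (\<psi> z) * YY N z))
         \<le> 4 * (B * C2 / n) + (B * (2 * C1 / n) + (B * (2 * C1 / n) + B * (4 * C1\<^sup>2 / n)))"
        unfolding eq by (rule order_trans[OF norm_triangle_ineq add_mono[OF b1]])
      also have "\<dots> = B * Cf / n" by (simp add: Cf_def algebra_simps add_divide_distrib)
      finally show ?thesis .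
    qed
    show ?thesis using d4 main unfolding n_def by blast
  qed
  thus ?thesis by blast
qed

end

section \<open>Limits at infinity and assembly of the expansion\<close>

text \<open>Inversion and removal of a bounded singularity. It gives meaning to the limits of
  \<open>G_+\<close> and, through the conjugate, of \<open>G_-\<close>.\<close>

lemma bounded_holomorphic_tendsto_at_infinity:
  assumes f: "f holomorphic_on S" and S: "bounded (- S)" and b: "\<And>z. norm (f z) \<le> B"
  shows "\<exists>l. (f \<longlongrightarrow> l) at_infinity"
proof -
  obtain R where R: "R > 0" "\<And>z. z \<in> - S \<Longrightarrow> norm z \<le> R" using S unfolding bounded_pos by auto
  define s where "s = 1 / R"
  have s: "s > 0" using R(1) by (simp add: s_def)
  define f' where "f' = (\<lambda>w. f (inverse w))"
  have "f' holomorphic_on (ball 0 s - {0})"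
    unfolding f'_def
  proof (rule holomorphic_on_compose_gen[OF _ f, unfolded o_def])
    show "inverse holomorphic_on (ball 0 s - {0::complex})" by (intro holomorphic_intros) auto
    show "inverse ` (ball 0 s - {0}) \<subseteq> S"
    proof (rule image_subsetI, rule ccontr)
      fix w :: complex assume w: "w \<in> ball 0 s - {0}" and "inverse w \<notin> S"
      hence "norm (inverse w) \<le> R" using R(2) by simp
      hence le: "1 / norm w \<le> R" by (simp add: norm_inverse inverse_eq_divide norm_divide)
      have n: "norm w < 1 / R" "norm w > 0" using w by (auto simp: s_def)
      show False using le n(1) unfolding pos_divide_le_eq[OF n(2)] pos_less_divide_eq[OF R(1)] by (simp add: mult.commute)
    qed
  qed
  moreover have "f' \<in> O[at 0](\<lambda>_. 1)"
    by (rule bigoI[of _ B]) (simp add: f'_def b)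
  ultimately obtain g where g: "g holomorphic_on ball 0 s" "\<forall>z\<in>ball 0 s - {0}. g z = f' z"
    using removable_singularities[of "{0}" "ball 0 s" f'] s by auto
  have "isCont g 0"
    using holomorphic_on_imp_continuous_on[OF g(1)] s by (simp add: continuous_on_eq_continuous_at)
  hence "(g \<longlongrightarrow> g 0) (at 0)" by (simp add: isCont_def)
  moreover have "\<forall>\<^sub>F w in at 0. g w = f' w"
    unfolding eventually_at using s g(2) by (intro exI[of _ s]) (auto simp: dist_norm)
  ultimately have "(f' \<longlongrightarrow> g 0) (at 0)" by (rule Lim_transform_eventually)
  moreover have "filterlim inverse (at (0::complex)) at_infinity"
    by (simp add: filterlim_def at_to_infinity)
  ultimately have "((\<lambda>z. f' (inverse z)) \<longlongrightarrow> g 0) at_infinity" by (rule filterlim_compose)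
  thus ?thesis by (auto simp: f'_def)
qed

lemma exterior_param_mono:
  assumes "exterior_param \<psi> r \<gamma>" "r \<le> r'"
  shows "exterior_param \<psi> r' \<gamma>"
proof -
  interpret exterior_param \<psi> r \<gamma> by (rule assms(1))
  show ?thesis
    by standard (use r0 lim \<gamma> assms(2) in \<open>auto intro: holomorphic_on_subset[OF hol] inj_on_subset[OF inj]\<close>)
qed

context orth_setting
begin

text \<open>On the ring the function splits into \<open>gp - lp\<close>, \<open>gm - lm\<close>, the
  constant \<open>lp + lm\<close> and \<open>g0\<close>. The first two are negligible by holomorphy
  outside, and \<open>g0\<close> has the Laplace expansion. The constant multiplies
  \<open>d^2\<close> times the ring integral of \<open>y\<close>, which is 1 up to the
  error.\<close>

lemma density_expansion:
  assumes P: "\<And>N. N \<ge> 1 \<Longrightarrow> normalized_orthogonal_poly D \<omega> N (P N)" "\<And>N. N \<ge> 1 \<Longrightarrow> d N > 0"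
      "\<And>N. N \<ge> 1 \<Longrightarrow> lead_coeff (P N) = of_real (d N * lead N)"
    and G: "continuous_on UNIV G" "\<And>z. norm (G z) \<le> B"
    and gp: "log_smooth False r0 gp" "continuous_on {z. 1 \<le> norm z} gp" "gp holomorphic_on {z. 1 < norm z}" "(gp \<longlongrightarrow> lp) at_infinity"
    and gm: "log_smooth False r0 gm" "continuous_on {z. 1 \<le> norm z} gm" "(\<lambda>z. cnj (gm z)) holomorphic_on {z. 1 < norm z}" "(gm \<longlongrightarrow> lm) at_infinity"
    and g0: "log_smooth False r0 g0" "\<And>z. norm z = 1 \<Longrightarrow> g0 z = 0"
    and split: "\<And>z. z \<in> ring \<Longrightarrow> G (\<psi> z) = gp z + gm z + g0 z"
  shows "\<exists>C N0. \<forall>N\<ge>N0. norm (wint D (\<lambda>z. G z * (poly (P N) z * cnj (poly (P N) z)))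
     - (lp + lm + of_real ((d N)\<^sup>2) * expansion g0 N))
     \<le> C / real N ^ (\<kappa> + 1)"
proof -
  define S where "S N = expansion g0 N" for N
  define y where "y N z = Yf N z * cnj (Yf N z) * \<Omega> z" for N z
  obtain C N1 where C: "\<And>N Q e. N \<ge> N1 \<Longrightarrow> N \<ge> 1 \<Longrightarrow> normalized_orthogonal_poly D \<omega> N Q \<Longrightarrow> e > 0 \<Longrightarrow> lead_coeff Q = of_real (e * lead N) \<Longrightarrow>
     e\<^sup>2 \<le> 4 \<and> (\<forall>G B. continuous_on UNIV G \<longrightarrow> (\<forall>z. norm (G z) \<le> B) \<longrightarrow>
        norm (wint D (\<lambda>z. G z * (poly Q z * cnj (poly Q z))) - of_real (e\<^sup>2) * R N (\<lambda>z. G (\<psi> z) * y N z))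
          \<le> B * C / real N ^ (\<kappa> + 1))"
    using orthonormal_comparison unfolding y_def by blast
  define up where "up = (\<lambda>z. gp z - lp)"
  define um where "um = (\<lambda>z. cnj (gm z) - cnj lm)"
  have up: "log_smooth False r0 up" "continuous_on {z. 1 \<le> norm z} up" "up holomorphic_on {z. 1 < norm z}" "(up \<longlongrightarrow> 0) at_infinity"
    unfolding up_def using tendsto_diff[OF gp(4) tendsto_const, of lp]
    by (auto intro!: log_smooth_diff[OF r0] log_smooth_const r0 gp continuous_on_diff continuous_on_const holomorphic_on_diff holomorphic_on_const)
  have um: "log_smooth False r0 um" "continuous_on {z. 1 \<le> norm z} um" "um holomorphic_on {z. 1 < norm z}" "(um \<longlongrightarrow> 0) at_infinity"
    unfolding um_def using tendsto_diff[OF tendsto_cnj[OF gm(4)] tendsto_const, of "cnj lm"]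
    by (auto intro!: log_smooth_diff[OF r0] log_smooth_cnj log_smooth_const r0 gm continuous_on_diff continuous_on_cnj continuous_on_const holomorphic_on_diff holomorphic_on_const)
  obtain Ca where Ca: "\<And>N. N \<ge> 1 \<Longrightarrow> norm (R N (\<lambda>z. cnj (up z * Yf N z) * (Yf N z * \<Omega> z))) \<le> Ca / real N ^ (\<kappa> + 1)"
    using holomorphic_factor_negligible[OF up] by blast
  obtain Cb where Cb: "\<And>N. N \<ge> 1 \<Longrightarrow> norm (R N (\<lambda>z. cnj (um z * Yf N z) * (Yf N z * \<Omega> z))) \<le> Cb / real N ^ (\<kappa> + 1)"
    using holomorphic_factor_negligible[OF um] by blast
  obtain Cd where Cd: "\<And>N. N \<ge> 1 \<Longrightarrow> norm (R N (\<lambda>z. g0 z * y N z) - S N) \<le> Cd / real N ^ (\<kappa> + 1)"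
    using Laplace_expansion[OF g0] unfolding S_def y_def by blast
  define Ct where "Ct = B * C + 4 * (\<bar>Ca\<bar> + \<bar>Cb\<bar> + \<bar>Cd\<bar>) + norm (lp + lm) * C"
  have "norm (wint D (\<lambda>z. G z * (poly (P N) z * cnj (poly (P N) z))) - (lp + lm + of_real ((d N)\<^sup>2) * S N)) \<le> Ct / real N ^ (\<kappa> + 1)"
    if N: "N \<ge> max N1 1" for N
  proof -
    define n where "n = real N ^ (\<kappa> + 1)"
    have N1: "N \<ge> N1" "N \<ge> 1" using N by auto
    have n: "n > 0" using N1 by (simp add: n_def)
    define e where "e = (d N)\<^sup>2"
    note cmp = C[OF N1 P(1)[OF N1(2)] P(2)[OF N1(2)] P(3)[OF N1(2)]]
    have e4: "0 \<le> e" "e \<le> 4" using cmp by (auto simp: e_def)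
    have c: "continuous_on ring (y N)" "continuous_on ring up" "continuous_on ring gm"
      "continuous_on ring gp" "continuous_on ring g0"
    proof -
      have "log_smooth True r0 (y N)" unfolding y_def[abs_def] by (intro log_smooth_mult log_smooth_cnj r0 Yf_log_smooth \<Omega>)
      thus "continuous_on ring (y N)" by (rule cont_ring)
    qed (rule cont_ring[OF up(1)] cont_ring[OF gm(1)] cont_ring[OF gp(1)] cont_ring[OF g0(1)])+
    have E1: "norm (wint D (\<lambda>z. G z * (poly (P N) z * cnj (poly (P N) z))) - of_real e * R N (\<lambda>z. G (\<psi> z) * y N z)) \<le> B * C / n"
      using cmp G unfolding e_def n_def by blast
    \<comment> \<open>The comparison is reused with \<open>G = 1\<close>: the unit norm of
      \<open>P N\<close> evaluates \<open>d^2\<close> times the ring integral of \<open>y\<close>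
      without expanding either factor.\<close>
    have E3: "norm (1 - of_real e * R N (y N)) \<le> C / n"
    proof -
      have unit: "wint D (\<lambda>z. 1 * (poly (P N) z * cnj (poly (P N) z))) = 1"
      proof -
        have "wint D (\<lambda>z. 1 * (poly (P N) z * cnj (poly (P N) z))) = area_integral D (\<lambda>z. complex_of_real ((norm (poly (P N) z))\<^sup>2 * \<omega> z))"
          unfolding wd.area_integral_wint[symmetric] by (simp only: complex_norm_square of_real_mult mult_1)
        thus ?thesis using P(1)[OF N1(2)] by (simp add: normalized_orthogonal_poly_def)
      qed
      have "norm (wint D (\<lambda>z. 1 * (poly (P N) z * cnj (poly (P N) z))) - of_real e * R N (\<lambda>z. 1 * y N z)) \<le> 1 * C / n"
        using conjunct2[OF cmp, rule_format, of "\<lambda>_. 1" 1] unfolding e_def n_def by (simp only: continuous_on_const norm_one order_refl simp_thms)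
      thus ?thesis unfolding unit by (simp only: mult_1)
    qed
    \<comment> \<open>\<open>y\<close> is real-valued, so conjugating the integral moves the
      holomorphic factor into the conjugated slot expected by the negligibility estimate.\<close>
    have E2a: "norm (R N (\<lambda>z. up z * y N z)) \<le> \<bar>Ca\<bar> / n"
    proof -
      have "R N (\<lambda>z. cnj (up z * y N z)) = R N (\<lambda>z. cnj (up z * Yf N z) * (Yf N z * \<Omega> z))"
        by (rule ring_integral_cong) (simp add: y_def \<Omega>r(1) mult_ac)
      moreover have "R N (\<lambda>z. cnj (up z * y N z)) = cnj (R N (\<lambda>z. up z * y N z))"
        by (rule ring_integral_cnj[OF continuous_on_mult[OF c(2,1)]])
      ultimately have "norm (R N (\<lambda>z. up z * y N z)) \<le> Ca / n" using Ca[OF N1(2)] unfolding n_def by (metis complex_mod_cnj)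
      also have "\<dots> \<le> \<bar>Ca\<bar> / n" using n by (intro divide_right_mono) auto
      finally show ?thesis .
    qed
    have E2b: "norm (R N (\<lambda>z. (gm z - lm) * y N z)) \<le> \<bar>Cb\<bar> / n"
    proof -
      have "R N (\<lambda>z. (gm z - lm) * y N z) = R N (\<lambda>z. cnj (um z * Yf N z) * (Yf N z * \<Omega> z))"
        by (rule ring_integral_cong) (simp add: y_def um_def mult_ac)
      hence "norm (R N (\<lambda>z. (gm z - lm) * y N z)) \<le> Cb / n" using Cb[OF N1(2)] by (simp only: n_def)
      also have "\<dots> \<le> \<bar>Cb\<bar> / n" using n by (intro divide_right_mono) auto
      finally show ?thesis .
    qed
    have E4: "norm (R N (\<lambda>z. g0 z * y N z) - S N) \<le> \<bar>Cd\<bar> / n"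
    proof -
      have "norm (R N (\<lambda>z. g0 z * y N z) - S N) \<le> Cd / n" using Cd[OF N1(2)] by (simp only: n_def)
      also have "\<dots> \<le> \<bar>Cd\<bar> / n" using n by (intro divide_right_mono) auto
      finally show ?thesis .
    qed
    have dec: "R N (\<lambda>z. G (\<psi> z) * y N z) = (R N (\<lambda>z. up z * y N z) + R N (\<lambda>z. (gm z - lm) * y N z)) + ((lp + lm) * R N (y N) + R N (\<lambda>z. g0 z * y N z))"
    proof -
      have k: "continuous_on ring (\<lambda>z. up z * y N z)" "continuous_on ring (\<lambda>z. (gm z - lm) * y N z)"
        "continuous_on ring (\<lambda>z. (lp + lm) * y N z)" "continuous_on ring (\<lambda>z. g0 z * y N z)"
        by (intro continuous_intros c)+
      have "R N (\<lambda>z. G (\<psi> z) * y N z) = R N (\<lambda>z. (up z * y N z + (gm z - lm) * y N z) + ((lp + lm) * y N z + g0 z * y N z))"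
        by (rule ring_integral_cong) (simp add: split up_def algebra_simps)
      thus ?thesis
        by (simp only: ring_integral_add[OF continuous_on_add[OF k(1,2)] continuous_on_add[OF k(3,4)]] ring_integral_add[OF k(1,2)]
             ring_integral_add[OF k(3,4)] ring_integral_cmult)
    qed
    have alg: "w - (l + of_real e * s) = (w - of_real e * r) + (of_real e * ((a + b) + (x - s)) - l * (1 - of_real e * m))"
      if "r = (a + b) + (l * m + x)" for w l s r a b x m :: complex
      unfolding that by (simp add: algebra_simps)
    have eq: "wint D (\<lambda>z. G z * (poly (P N) z * cnj (poly (P N) z))) - (lp + lm + of_real ((d N)\<^sup>2) * S N)
       = (wint D (\<lambda>z. G z * (poly (P N) z * cnj (poly (P N) z))) - of_real e * R N (\<lambda>z. G (\<psi> z) * y N z))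
         + (of_real e * ((R N (\<lambda>z. up z * y N z) + R N (\<lambda>z. (gm z - lm) * y N z)) + (R N (\<lambda>z. g0 z * y N z) - S N))
            - (lp + lm) * (1 - of_real e * R N (y N)))"
      unfolding e_def[symmetric] by (rule alg[OF dec])
    have b2: "norm (of_real e * ((R N (\<lambda>z. up z * y N z) + R N (\<lambda>z. (gm z - lm) * y N z)) + (R N (\<lambda>z. g0 z * y N z) - S N)))
        \<le> 4 * ((\<bar>Ca\<bar> / n + \<bar>Cb\<bar> / n) + \<bar>Cd\<bar> / n)"
    proof -
      have "norm ((R N (\<lambda>z. up z * y N z) + R N (\<lambda>z. (gm z - lm) * y N z)) + (R N (\<lambda>z. g0 z * y N z) - S N)) \<le> (\<bar>Ca\<bar> / n + \<bar>Cb\<bar> / n) + \<bar>Cd\<bar> / n"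
        by (rule order_trans[OF norm_triangle_ineq add_mono[OF order_trans[OF norm_triangle_ineq add_mono[OF E2a E2b]] E4]])
      thus ?thesis unfolding norm_mult by (rule mult_mono[rotated]) (use e4 n in auto)
    qed
    have b3: "norm ((lp + lm) * (1 - of_real e * R N (y N))) \<le> norm (lp + lm) * (C / n)"
      unfolding norm_mult by (rule mult_left_mono[OF E3 norm_ge_zero])
    have "norm (wint D (\<lambda>z. G z * (poly (P N) z * cnj (poly (P N) z))) - (lp + lm + of_real ((d N)\<^sup>2) * S N))
      \<le> B * C / n + (4 * ((\<bar>Ca\<bar> / n + \<bar>Cb\<bar> / n) + \<bar>Cd\<bar> / n) + norm (lp + lm) * (C / n))"
      unfolding eq by (rule order_trans[OF norm_triangle_ineq add_mono[OF E1 order_trans[OF norm_triangle_ineq4 add_mono[OF b2 b3]]]])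
    also have "\<dots> = Ct / n" by (simp add: Ct_def add_divide_distrib algebra_simps)
    finally show ?thesis by (simp only: n_def)
  qed
  thus ?thesis unfolding S_def by blast
qed

end

theorem theorem2p1p1:
  fixes D W :: "complex set" and \<omega> :: "complex \<Rightarrow> real"
    and \<phi> V G Gp Gm G0 \<psi> \<Omega> :: "complex \<Rightarrow> complex"
    and P :: "nat \<Rightarrow> complex poly" and \<kappa> :: nat
  assumes "analytic_jordan_domain D"
    and "admissible_weight D \<omega>"
    and "exterior_conformal_map D W \<phi>"
    and "szego_function D \<omega> V"
    and "\<And>N. normalized_orthogonal_poly D \<omega> N (P N)"
    and "smooth_fun G" and "bounded (range G)"
    and "smooth_fun Gp" and "bounded (range Gp)"
    and "smooth_fun Gm" and "bounded (range Gm)"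
    and "smooth_fun G0" and "bounded (range G0)"
    and "\<And>z. G z = Gp z + Gm z + G0 z"
    and "Gp holomorphic_on (- closure D)"
    and "(\<lambda>z. cnj (Gm z)) holomorphic_on (- closure D)"
    and "\<And>z. z \<in> frontier D \<Longrightarrow> G0 z = 0"
    and "1 \<le> \<kappa>"
  defines "\<psi> \<equiv> the_inv_into W \<phi>"
  defines "\<Omega> \<equiv> modified_weight \<omega> V \<psi>"
  shows "(\<lambda>N. area_integral D (\<lambda>z. G z * complex_of_real ((norm (poly (P N) z))\<^sup>2 * \<omega> z))
            - (Lim at_infinity Gp + Lim at_infinity Gm
               + complex_of_real ((D_const \<phi> V N (P N))\<^sup>2) *
                 (\<Sum>(\<nu>, j, k)\<in>I_set \<kappa>. 1 / of_nat N ^ (\<nu> + j + k) *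
                    circle_mean (\<lambda>z.
                      ((\<lambda>h w. - (1/2) * r_dr h w) ^^ \<nu>) (G0 \<circ> \<psi>) z *
                      W_op \<Omega> N \<nu> \<kappa> (\<lambda>w. X_fun \<Omega> j w * cnj (X_fun \<Omega> k w)) z))))
         \<in> O(\<lambda>N. 1 / of_nat N ^ (\<kappa> + 1))"
proof -
  note top = analytic_jordan_domain_topology[OF assms(1)]
  obtain r c where r: "0 < r" "r < 1" and c: "0 < c" "deriv_at_infinity \<phi> = c"
    and \<phi>: "\<And>z. r < norm z \<Longrightarrow> \<phi> (\<psi> z) = z" "\<phi> holomorphic_on \<psi> ` {z. r < norm z}"
    and ext: "exterior_param \<psi> r (inverse (of_real c))" and \<phi>_inf: "filterlim \<phi> at_infinity at_infinity"
    and im: "\<psi> ` {z. 1 < norm z} = - closure D" "\<psi> ` {z. 1 \<le> norm z} = - D" "\<psi> ` sphere 0 1 = frontier D"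
    and "((\<lambda>z. deriv \<phi> z) \<longlongrightarrow> of_real c) at_infinity" "((\<lambda>z. \<phi> z / z) \<longlongrightarrow> of_real c) at_infinity"
    by (rule exterior_map_properties[OF top assms(3), folded \<psi>_def]) (rule that[rotated 3])
  interpret e: exterior_param \<psi> r "inverse (of_real c)" by (rule ext)
  have \<psi>c: "continuous_on {z. r < norm z} \<psi>" by (rule holomorphic_on_imp_continuous_on[OF e.hol])
  obtain U where U: "open U" "frontier D \<subseteq> U" "\<And>z. z \<in> U \<Longrightarrow> 0 < \<omega> z \<and> real_analytic2_at (\<lambda>w. ln (\<omega> w)) z"
    using assms(2) unfolding admissible_weight_def by blast
  obtain v where V: "V analytic_on (- D)" "\<And>z. z \<in> frontier D \<Longrightarrow> 2 * Re (V z) = - ln (\<omega> z)" "(V \<longlongrightarrow> complex_of_real v) at_infinity"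
    using assms(4) unfolding szego_function_def by blast
  obtain T where T: "open T" "- D \<subseteq> T" "V holomorphic_on T" using V(1) unfolding analytic_on_holomorphic by blast
  have sr: "{z::complex. 1 \<le> norm z} \<subseteq> {z. r < norm z}" "sphere (0::complex) 1 \<subseteq> {z. r < norm z}" using r by auto
  \<comment> \<open>The neighbourhoods for \<open>V\<close> and for \<open>\<omega>\<close> are
    pulled back to the coordinate \<open>z\<close>. For \<open>V\<close> this yields a full exterior
    domain; for \<open>\<omega>\<close> only an annulus, since its regularity is given near the
    boundary alone.\<close>
  have "open ({z. r < norm z} \<inter> \<psi> -` T)" by (rule continuous_open_preimage[OF \<psi>c open_norm_gt T(1)])
  moreover have "{z. 1 \<le> norm z} \<subseteq> {z. r < norm z} \<inter> \<psi> -` T" using sr(1) im(2) T(2) by blast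
  ultimately obtain r1 where r1: "0 < r1" "r1 < 1" "{z. r1 < norm z} \<subseteq> {z. r < norm z} \<inter> \<psi> -` T"
    by (rule open_contains_exterior)
  have "open ({z. r < norm z} \<inter> \<psi> -` U)" by (rule continuous_open_preimage[OF \<psi>c open_norm_gt U(1)])
  moreover have "sphere 0 1 \<subseteq> {z. r < norm z} \<inter> \<psi> -` U" using sr(2) im(3) U(2) by blast
  ultimately obtain r2 where r2: "0 < r2" "r2 < 1" "annulus r2 \<subseteq> {z. r < norm z} \<inter> \<psi> -` U"
    by (rule open_contains_annulus)
  define \<rho>0 where "\<rho>0 = max r (max r1 r2)"
  have \<rho>0: "0 < \<rho>0" "\<rho>0 < 1" "r \<le> \<rho>0" "r1 \<le> \<rho>0" "r2 \<le> \<rho>0" using r r1 r2 by (auto simp: \<rho>0_def)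
  have VT: "(\<lambda>z. V (\<psi> z)) holomorphic_on {z. r1 < norm z}"
    by (rule holomorphic_on_compose_gen[OF holomorphic_on_subset[OF e.hol] T(3), unfolded o_def]) (use r1(3) in auto)
  have ann: "annulus \<rho>0 \<subseteq> {z. r < norm z}" "annulus \<rho>0 \<subseteq> {z. r1 < norm z}" "annulus \<rho>0 \<subseteq> annulus r2"
    using \<rho>0 annulus_mono[OF r2(1), of \<rho>0] by (auto simp: annulus_def)
  have \<psi>U: "\<psi> ` annulus \<rho>0 \<subseteq> U" using ann(3) r2(3) by blast
  have bdry: "2 * Re (V (\<psi> z)) = - ln (\<omega> (\<psi> z))" if "norm z = 1" for z
    by (rule V(2)) (use that in \<open>auto simp: im(3)[symmetric]\<close>)
  note w0 = modified_weight_log_smooth[OF \<rho>0(1,2) holomorphic_on_subset[OF e.hol ann(1)] \<psi>U U(1) _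
      holomorphic_on_subset[OF VT ann(2)], where \<omega> = \<omega>]
  have w: "log_smooth True \<rho>0 \<Omega>" "log_smooth True \<rho>0 (\<lambda>z. inverse (\<Omega> z))"
    unfolding \<Omega>_def by (rule w0(1) w0(2); (rule U(3) bdry; assumption))+
  have w1: "\<Omega> z = 1" if "norm z = 1" for z
    unfolding \<Omega>_def by (rule w0(3)[OF _ _ that]) (rule U(3) bdry; assumption)+
  obtain r0 where r0: "\<rho>0 \<le> r0" "r0 < 1"
    and Z: "\<And>j. j \<le> \<kappa> \<Longrightarrow> log_smooth True r0 (Z_fun \<Omega> j)" "\<And>j k. j \<le> \<kappa> \<Longrightarrow> k \<in> H2_minus0 \<Longrightarrow> circle_inner (Z_fun \<Omega> j) k = 0"
    and X: "\<And>j. j < \<kappa> \<Longrightarrow> X_fun \<Omega> (Suc j) holomorphic_on {z. r0 < norm z}" "\<And>j. j < \<kappa> \<Longrightarrow> (X_fun \<Omega> (Suc j) \<longlongrightarrow> 0) at_infinity"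
    using XZ_family[OF \<rho>0(1,2) w(1,2), of \<kappa>] by blast
  have r00: "0 < r0" using \<rho>0 r0 by simp
  \<comment> \<open>The inner radius of the ring, and \<open>\<rho>1\<close> between it and
    \<open>r0\<close>; any numbers with \<open>r0 < \<rho>1 < s < 1\<close> would serve.\<close>
  define s where "s = (1 + r0) / 2"
  have s: "r0 < s" "s < 1" "0 < s" using r0 r00 by (auto simp: s_def)
  define x0 where "x0 = ln s"
  have x0: "exp x0 = s" using s by (simp add: x0_def)
  define \<rho>1 where "\<rho>1 = (r0 + s) / 2"
  have \<rho>1: "r0 < \<rho>1" "\<rho>1 < s" using s by (auto simp: \<rho>1_def)
  have dsub: "{z::complex. r0 < norm z} \<subseteq> {z. r < norm z}" "{z::complex. r0 < norm z} \<subseteq> {z. r1 < norm z}" using \<rho>0 r0 by auto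
  have asub: "annulus r0 \<subseteq> annulus \<rho>0" by (rule annulus_mono[OF \<rho>0(1) r0(1)])
  have \<Omega>of: "\<Omega> z = of_real (exp (2 * Re (V (\<psi> z))) * \<omega> (\<psi> z))" for z by (simp add: \<Omega>_def modified_weight_def)
  interpret wdom: weighted_domain D \<omega> by (rule admissible_weight_domain[OF top(1,2) assms(2)])
  interpret ep0: exterior_param \<psi> r0 "inverse (of_real c)" by (rule exterior_param_mono[OF ext]) (use \<rho>0 r0 in simp)
  interpret os: orth_setting r0 x0 \<Omega> "\<lambda>z. exp (2 * Re (V (\<psi> z))) * \<omega> (\<psi> z)" \<kappa> \<psi> "inverse (of_real c)" D \<omega> V \<phi> c v \<rho>1
  proof unfold_locales
    show "0 < r0" "r0 < 1" by (rule r00 r0(2))+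
    show "ln r0 < x0" "x0 < 0" using s r00 by (auto simp: x0_def)
    show "log_smooth True r0 \<Omega>" "log_smooth True r0 (\<lambda>z. inverse (\<Omega> z))"
      by (rule log_smooth_mono[OF \<rho>0(1) r0(1) w(1)] log_smooth_mono[OF \<rho>0(1) r0(1) w(2)])+
    show "\<Omega> z = of_real (exp (2 * Re (V (\<psi> z))) * \<omega> (\<psi> z))" for z by (rule \<Omega>of)
    show "0 < exp (2 * Re (V (\<psi> z))) * \<omega> (\<psi> z)" if "z \<in> annulus r0" for z
    proof -
      have "\<psi> z \<in> U" using \<psi>U asub that by blast
      thus ?thesis using U(3) by simp
    qed
    show "\<Omega> z = 1" if "norm z = 1" for z by (rule w1[OF that])
    show "log_smooth True r0 (Z_fun \<Omega> j)" if "j \<le> \<kappa>" for j by (rule Z(1)[OF that])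
    show "circle_inner (Z_fun \<Omega> j) k = 0" if "j \<le> \<kappa>" "k \<in> H2_minus0" for j k by (rule Z(2)[OF that])
    show "X_fun \<Omega> (Suc j) holomorphic_on {z. r0 < norm z}" if "j < \<kappa>" for j by (rule X(1)[OF that])
    show "(X_fun \<Omega> (Suc j) \<longlongrightarrow> 0) at_infinity" if "j < \<kappa>" for j by (rule X(2)[OF that])
    show "exp (2 * Re (V (\<psi> z))) * \<omega> (\<psi> z) = exp (2 * Re (V (\<psi> z))) * \<omega> (\<psi> z)" for z ..
    show "\<phi> holomorphic_on \<psi> ` {z. r0 < norm z}" by (rule holomorphic_on_subset[OF \<phi>(2) image_mono[OF dsub(1)]])
    show "\<phi> (\<psi> z) = z" if "r0 < norm z" for z by (rule \<phi>(1)) (use that dsub in auto)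
    show "filterlim \<phi> at_infinity at_infinity" by (rule \<phi>_inf)
    show "\<psi> ` {z. 1 \<le> norm z} = - D" by (rule im(2))
    show "(\<lambda>z. V (\<psi> z)) holomorphic_on {z. r0 < norm z}" by (rule holomorphic_on_subset[OF VT dsub(2)])
    show "((\<lambda>z. V (\<psi> z)) \<longlongrightarrow> of_real v) at_infinity" by (rule filterlim_compose[OF V(3) e.tendsto_infinity])
    show "0 < c" by (rule c(1))
    show "inverse (of_real c) = inverse (complex_of_real c)" ..
    show "r0 < \<rho>1" "\<rho>1 < exp x0" using \<rho>1 x0 by auto
  qed
  have r0': "0 < r0" "r0 < 1" by (rule r00 r0(2))+
  have cont: "continuous_on UNIV f" if "smooth_fun f" for f :: "complex \<Rightarrow> complex"
    using that unfolding smooth_fun_def by (metis times_differentiable.simps(1))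
  obtain B where B: "\<And>z. norm (G z) \<le> B" using assms(7) unfolding bounded_iff by auto
  obtain Bp where Bp: "\<And>z. norm (Gp z) \<le> Bp" using assms(9) unfolding bounded_iff by auto
  obtain Bm where Bm: "\<And>z. norm (cnj (Gm z)) \<le> Bm" using assms(11) unfolding bounded_iff by auto
  have bdc: "bounded (- (- closure D))" using bounded_closure[OF top(2)] by simp
  \<comment> \<open>Boundedness and holomorphy outside \<open>D\<close> force a limit at infinity,
    so \<open>Lim\<close> in the claim denotes an actual limit.\<close>
  obtain lp where lp: "(Gp \<longlongrightarrow> lp) at_infinity"
    using bounded_holomorphic_tendsto_at_infinity[OF assms(15) bdc Bp] by blast
  obtain lm' where lm': "((\<lambda>z. cnj (Gm z)) \<longlongrightarrow> lm') at_infinity"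
    using bounded_holomorphic_tendsto_at_infinity[OF assms(16) bdc Bm] by blast
  have lm: "(Gm \<longlongrightarrow> cnj lm') at_infinity" using tendsto_cnj[OF lm'] by simp
  have Lims: "Lim at_infinity Gp = lp" "Lim at_infinity Gm = cnj lm'" "Lim at_infinity V = of_real v"
    by (rule tendsto_Lim[OF trivial_limit_at_infinity lp] tendsto_Lim[OF trivial_limit_at_infinity lm] tendsto_Lim[OF trivial_limit_at_infinity V(3)])+
  have annd: "annulus r0 \<subseteq> {z. r0 < norm z}" by (auto simp: annulus_def)
  have ls: "log_smooth False r0 (\<lambda>z. f (\<psi> z))" if "smooth_fun f" for f
    by (rule log_smooth_smooth_fun[OF r0' holomorphic_on_subset[OF ep0.hol annd] that])
  have c1: "continuous_on {z. 1 \<le> norm z} (\<lambda>z. f (\<psi> z))" if "smooth_fun f" for f :: "complex \<Rightarrow> complex"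
    by (rule continuous_on_compose2[OF cont[OF that] continuous_on_subset[OF \<psi>c sr(1)]]) simp
  have h1: "(\<lambda>z. f (\<psi> z)) holomorphic_on {z. 1 < norm z}" if "f holomorphic_on (- closure D)" for f
    by (rule holomorphic_on_compose_gen[OF holomorphic_on_subset[OF e.hol] that, unfolded o_def]) (use im(1) r in auto)
  \<comment> \<open>At \<open>N = 0\<close> the division by \<open>sqrt N\<close> gives the value 0,
    so positivity and the relation with the leading coefficient start at
    \<open>N = 1\<close>.\<close>
  have dN: "D_const \<phi> V N (P N) > 0" "lead_coeff (P N) = of_real (D_const \<phi> V N (P N) * os.lead N)" if N: "N \<ge> 1" for N
  proof -
    obtain l where l: "l > 0" "lead_coeff (P N) = complex_of_real l" using assms(5)[of N] unfolding normalized_orthogonal_poly_def by blast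
    have Dc: "D_const \<phi> V N (P N) = l * (exp (- v) / c ^ (N + 1)) / sqrt (real N)"
      unfolding D_const_def C_const_def Lims c(2) l(2) by simp
    show "D_const \<phi> V N (P N) > 0" unfolding Dc using l c N by simp
    have "D_const \<phi> V N (P N) * os.lead N = l"
      unfolding Dc os.lead_def using c(1) N by (simp add: exp_minus)
    thus "lead_coeff (P N) = of_real (D_const \<phi> V N (P N) * os.lead N)" using l(2) by simp
  qed
  have g0: "G0 (\<psi> z) = 0" if "norm z = 1" for z
    by (rule assms(17)) (use that in \<open>auto simp: im(3)[symmetric]\<close>)
  obtain C N0 where main: "\<And>N. N \<ge> N0 \<Longrightarrow> norm (wdom.wint D (\<lambda>z. G z * (poly (P N) z * cnj (poly (P N) z)))
     - (lp + cnj lm' + of_real ((D_const \<phi> V N (P N))\<^sup>2) * os.expansion (\<lambda>z. G0 (\<psi> z)) N))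
     \<le> C / real N ^ (\<kappa> + 1)"
    using os.density_expansion[OF assms(5) dN cont[OF assms(6)] B
       ls[OF assms(8)] c1[OF assms(8)] h1[OF assms(15)] filterlim_compose[OF lp e.tendsto_infinity]
       ls[OF assms(10)] c1[OF assms(10)] h1[OF assms(16)] filterlim_compose[OF lm e.tendsto_infinity]
       ls[OF assms(12)] g0 assms(14)] by blast
  have ai: "area_integral D (\<lambda>z. G z * complex_of_real ((norm (poly (P N) z))\<^sup>2 * \<omega> z))
     = wdom.wint D (\<lambda>z. G z * (poly (P N) z * cnj (poly (P N) z)))" for N
    unfolding wdom.area_integral_wint[symmetric] by (simp only: complex_norm_square of_real_mult mult.assoc)
  show ?thesis
    unfolding ai Lims o_def
  proof (rule bigoI[of _ C], rule eventually_sequentiallyI[of N0])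
    fix N assume "N0 \<le> N"
    from main[OF this] show "norm (wdom.wint D (\<lambda>z. G z * (poly (P N) z * cnj (poly (P N) z)))
     - (lp + cnj lm' + of_real ((D_const \<phi> V N (P N))\<^sup>2) * os.expansion (\<lambda>z. G0 (\<psi> z)) N))
     \<le> C * norm (1 / of_nat N ^ (\<kappa> + 1) :: complex)"
      by (simp add: norm_divide norm_power norm_mult)
  qed
qed

end
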